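(* Let $m\ge1$ and let $G=F^\times\times\mathrm{GL}_{2m}(F)$, $H=F^\times\times\mathrm{GL}_m(F)\times\mathrm{GL}_m(F)$, with $\widetilde G$, $\widetilde\iota$, $U$, $\widetilde K$, $\widetilde L$, $\widetilde{\mathfrak H}_c$ as in the context, let $M_{H,\mathcal O}$ be the trivial functor and $x_U=1_{\mathcal O}\in M_{H,\mathcal O}(U)=\mathcal O$. Then there exists a zeta element for $(x_U,\widetilde{\mathfrak H}_c,\widetilde L)$ for all $c\in\mathbb Z\setminus2\mathbb Z$.
   Context: $F$ is a local field of characteristic zero (non-archimedean) with ring of integers $\mathscr O_F$, uniformizer $\varpi$, residue cardinality $q$. $\mathcal O$ is an integral domain containing $\mathbb Z[q^{-1}]$; $\Phi$ is a field containing $\mathcal O$. **Groups.** $n=2m$; $G=F^\times\times\mathrm{GL}_n(F)$, $K=\mathscr O_F^\times\times\mathrm{GL}_n(\mathscr O_F)$. $\iota:H=F^\times\times\mathrm{GL}_m(F)\times\mathrm{GL}_m(F)\hookrightarrow G$ is the block diagonal embedding and $U=H\cap K$. $T=F^\times$, $C=\mathscr O_F^\times$, $D=1+\varpi\mathscr O_F$, $\nu:H\to T$, $(c_0,h_1,h_2)\mapsto\det h_2/\det h_1$. $\widetilde G=G\times T$, $\widetilde\iota=\iota\times\nu:H\to\widetilde G$ (through which $H$ is a subgroup of $\widetilde G$), $\widetilde K=K\times C$, $\widetilde L=K\times D$. **Hecke polynomial.** Let $\Lambda=\mathbb Z f_0\oplus\cdots\oplus\mathbb Zf_n$; for $\lambda=\sum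 a_if_i$ put $\varpi^\lambda=(\varpi^{a_0},\mathrm{diag}(\varpi^{a_1},\dots,\varpi^{a_n}))\in G$, $\langle\lambda,\delta\rangle=\frac12\sum_{k=1}^n(n-2k+1)a_k$, and $e^\lambda\in\mathcal R[\Lambda]$ the corresponding group-algebra element, $\mathcal R=\mathbb Z[q^{\pm1/2}]$, $y_i=e^{f_i}$. Let $\mathcal N$ be the group of upper triangular unipotent matrices in $\mathrm{GL}_n(F)$. The Satake transform $\mathscr S:\mathcal H_{\mathcal R}(K\backslash G/K)\to\mathcal R[\Lambda]^{S_n}$ ($S_n$ permuting $f_1,\dots,f_n$; Haar measure with $K$ of volume 1) is the $\mathcal R$-algebra isomorphism sending $\mathrm{ch}(K\sigma K)$ to $\sum q^{-\langle\lambda,\delta\rangle}e^\lambda$, the sum over left cosets $\varpi^\lambda uK\subset K\sigma K$ ($\lambda\in\Lambda$, $u\in\mathcal N$). $\mathfrak H_{\mathrm{std},c}(X)$ is the polynomial over $\mathcal H_{\mathcal R}(K\backslash G/K)$ with $\mathscr S(\mathfrak H_{\mathrm{std},c}(X))=\prod_{i=1}^n(1-y_0y_iq^{-c/2}X)$; for $c$ odd its coefficients lie in $\mathcal H_{\mathbb Z[q^{-1}]}(K\backslash G/K)$. $\widetilde{\mathfrak H}_c=\mathfrak H_{\mathrm{std},c}(\mathrm{Frob})$ with $\mathrm{Frob}=\mathrm{ch}(\varpi^{-1}C)$, i.e. each term $\mathrm{ch}(K\sigma K)X^k$ is replaced by the function $\mathrm{ch}(K\sigma K\times\varpi^{-k}C)$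 on $\widetilde G$. **Zeta elements (trivial functor).** The trivial functor assigns $M_{H,\mathcal O}(V)=\mathcal O$ to every compact open $V\subset H$, with restriction and conjugation maps the identity and the pushforward $V\subset W$ equal to multiplication by $[W:V]$; its inductive completion over $\Phi$ is $\Phi$ with trivial $H$-action. For compact open $V_1,V_2\subset H$ put $[V_1:V_2]=\mu_H(V_1)/\mu_H(V_2)$ for a Haar measure $\mu_H$. Let $\mathcal C(\widetilde G/\widetilde K,\Phi)$ be the space of right $\widetilde K$-invariant compactly supported functions $\xi:\widetilde G\to\Phi$, with $H$-action $(h\xi)(g)=\xi(h^{-1}g)$. A zeta element for $(x_U,\widetilde{\mathfrak H}_c,\widetilde L)$ is a $\zeta\in\mathcal C(\widetilde G/\widetilde K,\Phi)$ such that (i) for each $g\in\widetilde G$, $\zeta(g)$ is a finite sum $\sum_i[U:V_i]\,x_i$ with $V_i\subset H\cap g\widetilde Lg^{-1}$ compact open in $H$ and $x_i\in\mathcal O$; (ii) $\zeta$ and the function $x_U\otimes\widetilde{\mathfrak H}_c:g\mapsto\widetilde{\mathfrak H}_c(g)\,x_U$ have the same image in the $H$-coinvariants $\mathcal C(\widetilde G/\widetilde K,\Phi)_H$. *)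

theory Defs
  imports
    "HOL-Analysis.Product_Topology"
    "HOL-Analysis.Measure_Space"
    "HOL-Library.Poly_Mapping"
    "HOL-Library.Function_Algebras"
    "HOL-Computational_Algebra.Polynomial"
    "HOL-Algebra.Coset"
    "Jordan_Normal_Form.Determinant"
begin

section \<open>Local fields\<close>

text \<open>A valuation is an integer-valued function \<open>v\<close> whose value at \<open>0\<close> is irrelevant: the
  convention \<open>v 0 = \<infinity>\<close> is built into the fractional ideals below.\<close>

definition frac_ideal :: "('f::field \<Rightarrow> int) \<Rightarrow> int \<Rightarrow> 'f set" where
  "frac_ideal v k = {x. x = 0 \<or> k \<le> v x}"

abbreviation int_ring :: "('f::field \<Rightarrow> int) \<Rightarrow> 'f set" where
  "int_ring v \<equiv> frac_ideal v 0"

definition residue_field :: "('f::field \<Rightarrow> int) \<Rightarrow> 'f set set" where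
  "residue_field v =
     int_ring v // {(x, y). x \<in> int_ring v \<and> y \<in> int_ring v \<and> x - y \<in> frac_ideal v 1}"

definition residue_card :: "('f::field \<Rightarrow> int) \<Rightarrow> nat" where
  "residue_card v = card (residue_field v)"

text \<open>Non-archimedean local fields of characteristic zero, presented by their normalized
  discrete valuation.\<close>

locale local_field =
  fixes v :: "'f::field_char_0 \<Rightarrow> int"
  assumes val_mult: "x \<noteq> 0 \<Longrightarrow> y \<noteq> 0 \<Longrightarrow> v (x * y) = v x + v y"
    and val_add: "x \<noteq> 0 \<Longrightarrow> y \<noteq> 0 \<Longrightarrow> x + y \<noteq> 0 \<Longrightarrow> min (v x) (v y) \<le> v (x + y)"
    and val_normalized: "\<exists>x. x \<noteq> 0 \<and> v x = 1"
    and finite_residue_field: "finite (residue_field v)"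
    and complete:
      "(\<And>k. \<exists>N. \<forall>i\<ge>N. \<forall>j\<ge>N. s i - s j \<in> frac_ideal v k) \<Longrightarrow>
       \<exists>l. \<forall>k. \<exists>N. \<forall>i\<ge>N. s (i::nat) - l \<in> frac_ideal v k"

definition uniformizer :: "('f::field \<Rightarrow> int) \<Rightarrow> 'f \<Rightarrow> bool" where
  "uniformizer v w \<longleftrightarrow> w \<noteq> 0 \<and> v w = 1"

definition field_topology :: "('f::field \<Rightarrow> int) \<Rightarrow> 'f topology" where
  "field_topology v = topology (\<lambda>S. \<forall>x\<in>S. \<exists>k. \<forall>y. y - x \<in> frac_ideal v k \<longrightarrow> y \<in> S)"

lemma openin_field_topology:
  "openin (field_topology v) S \<longleftrightarrow> (\<forall>x\<in>S. \<exists>k. \<forall>y. y - x \<in> frac_ideal v k \<longrightarrow> y \<in> S)"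
proof -
  have "istopology (\<lambda>S. \<forall>x\<in>S. \<exists>k. \<forall>y. y - x \<in> frac_ideal v k \<longrightarrow> y \<in> S)"
    unfolding istopology_def
  proof (intro conjI allI impI ballI)
    fix S T x
    assume S: "\<forall>x\<in>S. \<exists>k. \<forall>y. y - x \<in> frac_ideal v k \<longrightarrow> y \<in> S"
      and T: "\<forall>x\<in>T. \<exists>k. \<forall>y. y - x \<in> frac_ideal v k \<longrightarrow> y \<in> T"
      and x: "x \<in> S \<inter> T"
    from S x obtain k where k: "\<forall>y. y - x \<in> frac_ideal v k \<longrightarrow> y \<in> S" by blast
    from T x obtain l where l: "\<forall>y. y - x \<in> frac_ideal v l \<longrightarrow> y \<in> T" by blast
    have "frac_ideal v (max k l) \<subseteq> frac_ideal v k \<inter> frac_ideal v l"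
      by (auto simp: frac_ideal_def)
    with k l show "\<exists>k. \<forall>y. y - x \<in> frac_ideal v k \<longrightarrow> y \<in> S \<inter> T"
      by blast
  next
    fix \<K> x
    assume "\<forall>S\<in>\<K>. \<forall>x\<in>S. \<exists>k. \<forall>y. y - x \<in> frac_ideal v k \<longrightarrow> y \<in> S" and "x \<in> \<Union>\<K>"
    then show "\<exists>k. \<forall>y. y - x \<in> frac_ideal v k \<longrightarrow> y \<in> \<Union>\<K>"
      by (metis Union_iff)
  qed
  then show ?thesis
    by (simp add: field_topology_def)
qed

lemma topspace_field_topology [simp]: "topspace (field_topology v) = UNIV"
  by (metis UNIV_I openin_field_topology openin_subset top.extremum_unique)


section \<open>Groups\<close>

definition mult_group :: "'f::field monoid" where
  "mult_group = \<lparr>carrier = UNIV - {0}, monoid.mult = (*), one = 1\<rparr>"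

definition GL :: "nat \<Rightarrow> 'f::field mat monoid" where
  "GL n = units_of (ring_mat TYPE('f) n ())"

definition grp_G :: "nat \<Rightarrow> ('f::field \<times> 'f mat) monoid" where
  "grp_G m = mult_group \<times>\<times> GL (2 * m)"

definition grp_H :: "nat \<Rightarrow> ('f::field \<times> 'f mat \<times> 'f mat) monoid" where
  "grp_H m = mult_group \<times>\<times> (GL m \<times>\<times> GL m)"

definition grp_Gt :: "nat \<Rightarrow> (('f::field \<times> 'f mat) \<times> 'f) monoid" where
  "grp_Gt m = grp_G m \<times>\<times> mult_group"

lemma group_mult_group: "group (mult_group :: 'f::field monoid)"
proof (rule groupI)
  fix x :: 'f
  assume "x \<in> carrier mult_group"
  then show "\<exists>y\<in>carrier mult_group. y \<otimes>\<^bsub>mult_group\<^esub> x = \<one>\<^bsub>mult_group\<^esub>"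
    by (intro bexI[of _ "inverse x"]) (auto simp: mult_group_def)
qed (auto simp: mult_group_def)

lemma group_GL: "group (GL n :: 'f::field mat monoid)"
proof -
  interpret ring "ring_mat TYPE('f) n ()"
    by (rule ring_mat)
  show ?thesis
    unfolding GL_def by (rule units_group)
qed

lemma group_grp_G: "group (grp_G m)"
  unfolding grp_G_def by (intro DirProd_group group_mult_group group_GL)

lemma group_grp_H: "group (grp_H m)"
  unfolding grp_H_def by (intro DirProd_group group_mult_group group_GL)

lemma group_grp_Gt: "group (grp_Gt m)"
  unfolding grp_Gt_def by (intro DirProd_group group_mult_group group_grp_G)

definition mult_topology :: "('f::field \<Rightarrow> int) \<Rightarrow> 'f topology" where
  "mult_topology v = subtopology (field_topology v) (UNIV - {0})"

text \<open>The subspace topology from \<open>F\<^bsup>n\<times>n\<^esup>\<close>; inversion is automatically continuous for it.\<close>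

definition GL_topology :: "('f::field \<Rightarrow> int) \<Rightarrow> nat \<Rightarrow> 'f mat topology" where
  "GL_topology v n =
     pullback_topology (carrier (GL n)) (\<lambda>A. \<lambda>ij\<in>{..<n} \<times> {..<n}. A $$ ij)
       (product_topology (\<lambda>_. field_topology v) ({..<n} \<times> {..<n}))"

definition top_G :: "('f::field \<Rightarrow> int) \<Rightarrow> nat \<Rightarrow> ('f \<times> 'f mat) topology" where
  "top_G v m = prod_topology (mult_topology v) (GL_topology v (2 * m))"

definition top_H :: "('f::field \<Rightarrow> int) \<Rightarrow> nat \<Rightarrow> ('f \<times> 'f mat \<times> 'f mat) topology" where
  "top_H v m =
     prod_topology (mult_topology v) (prod_topology (GL_topology v m) (GL_topology v m))"

definition top_Gt :: "('f::field \<Rightarrow> int) \<Rightarrow> nat \<Rightarrow> (('f \<times> 'f mat) \<times> 'f) topology" where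
  "top_Gt v m = prod_topology (top_G v m) (mult_topology v)"

lemma topspace_mult_topology: "topspace (mult_topology v) = carrier mult_group"
  by (simp add: mult_topology_def mult_group_def)

lemma topspace_GL_topology: "topspace (GL_topology v n) = carrier (GL n)"
  by (auto simp: GL_topology_def topspace_pullback_topology)

lemma topspace_top_G: "topspace (top_G v m) = carrier (grp_G m)"
  by (simp add: top_G_def grp_G_def topspace_mult_topology topspace_GL_topology)

lemma topspace_top_H: "topspace (top_H v m) = carrier (grp_H m)"
  by (simp add: top_H_def grp_H_def topspace_mult_topology topspace_GL_topology)

lemma topspace_top_Gt: "topspace (top_Gt v m) = carrier (grp_Gt m)"
  by (simp add: top_Gt_def grp_Gt_def topspace_mult_topology topspace_top_G)

definition iota :: "nat \<Rightarrow> 'f::field \<times> 'f mat \<times> 'f mat \<Rightarrow> 'f \<times> 'f mat" where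
  "iota m = (\<lambda>(c, h1, h2). (c, four_block_mat h1 (0\<^sub>m m m) (0\<^sub>m m m) h2))"

definition nu :: "'f::field \<times> 'f mat \<times> 'f mat \<Rightarrow> 'f" where
  "nu = (\<lambda>(c, h1, h2). det h2 / det h1)"

definition iota_t :: "nat \<Rightarrow> 'f::field \<times> 'f mat \<times> 'f mat \<Rightarrow> ('f \<times> 'f mat) \<times> 'f" where
  "iota_t m h = (iota m h, nu h)"

definition int_units :: "('f::field \<Rightarrow> int) \<Rightarrow> 'f set" where
  "int_units v = {x. x \<noteq> 0 \<and> x \<in> int_ring v \<and> inverse x \<in> int_ring v}"

definition GL_int :: "('f::field \<Rightarrow> int) \<Rightarrow> nat \<Rightarrow> 'f mat set" where
  "GL_int v n = {A \<in> carrier (GL n). \<forall>i<n. \<forall>j<n.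
     A $$ (i, j) \<in> int_ring v \<and> (inv\<^bsub>GL n\<^esub> A) $$ (i, j) \<in> int_ring v}"

definition sub_K :: "('f::field \<Rightarrow> int) \<Rightarrow> nat \<Rightarrow> ('f \<times> 'f mat) set" where
  "sub_K v m = int_units v \<times> GL_int v (2 * m)"

definition sub_U :: "('f::field \<Rightarrow> int) \<Rightarrow> nat \<Rightarrow> ('f \<times> 'f mat \<times> 'f mat) set" where
  "sub_U v m = {h \<in> carrier (grp_H m). iota m h \<in> sub_K v m}"

definition sub_D :: "('f::field \<Rightarrow> int) \<Rightarrow> 'f \<Rightarrow> 'f set" where
  "sub_D v w = (\<lambda>x. 1 + w * x) ` int_ring v"

definition sub_Kt :: "('f::field \<Rightarrow> int) \<Rightarrow> nat \<Rightarrow> (('f \<times> 'f mat) \<times> 'f) set" where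
  "sub_Kt v m = sub_K v m \<times> int_units v"

definition sub_Lt :: "('f::field \<Rightarrow> int) \<Rightarrow> 'f \<Rightarrow> nat \<Rightarrow> (('f \<times> 'f mat) \<times> 'f) set" where
  "sub_Lt v w m = sub_K v m \<times> sub_D v w"


section \<open>Coefficients\<close>

definition is_subring :: "'a::ring_1 set \<Rightarrow> bool" where
  "is_subring R \<longleftrightarrow> 1 \<in> R \<and> (\<forall>x\<in>R. \<forall>y\<in>R. x - y \<in> R \<and> x * y \<in> R)"

definition subring_gen :: "'a::ring_1 set \<Rightarrow> 'a set" where
  "subring_gen S = \<Inter>{R. is_subring R \<and> S \<subseteq> R}"

definition Z_q_inv :: "('f::field \<Rightarrow> int) \<Rightarrow> 'p::field_char_0 set" where
  "Z_q_inv v = subring_gen {inverse (of_nat (residue_card v))}"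

text \<open>\<open>\<int>[q\<^bsup>\<plusminus>1/2\<^esup>]\<close>, with \<open>q\<^bsup>1/2\<^esup>\<close> the positive real square root.\<close>

definition Z_q_half :: "('f::field \<Rightarrow> int) \<Rightarrow> real set" where
  "Z_q_half v = subring_gen {sqrt (residue_card v), inverse (sqrt (residue_card v))}"

text \<open>The identification of \<open>\<rat> \<subseteq> \<real>\<close> with the prime field of a field of characteristic
  zero. It is used only for elements of \<open>\<int>[q\<^sup>-\<^sup>1]\<close> and for indices of compact open subgroups.\<close>

definition rat_transfer :: "real \<Rightarrow> 'p::field_char_0" where
  "rat_transfer x = of_rat (the_inv (of_rat :: rat \<Rightarrow> real) x)"


section \<open>Satake transform and Hecke polynomial\<close>

definition compactly_supported :: "'g topology \<Rightarrow> ('g \<Rightarrow> 'a::zero) \<Rightarrow> bool" where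
  "compactly_supported X \<phi> \<longleftrightarrow> compactin X (Abstract_Topology.closure_of X {g \<in> topspace X. \<phi> g \<noteq> 0})"

text \<open>Functions on a group are extended by \<open>0\<close> outside the carrier.\<close>

definition hecke_space :: "('f::field \<Rightarrow> int) \<Rightarrow> nat \<Rightarrow> real set \<Rightarrow> ('f \<times> 'f mat \<Rightarrow> real) set" where
  "hecke_space v m R = {\<phi>.
     (\<forall>g. g \<notin> carrier (grp_G m) \<longrightarrow> \<phi> g = 0) \<and>
     (\<forall>g\<in>carrier (grp_G m). \<phi> g \<in> R) \<and>
     (\<forall>g\<in>carrier (grp_G m). \<forall>k\<in>sub_K v m.
        \<phi> (k \<otimes>\<^bsub>grp_G m\<^esub> g) = \<phi> g \<and> \<phi> (g \<otimes>\<^bsub>grp_G m\<^esub> k) = \<phi> g) \<and>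
     compactly_supported (top_G v m) \<phi>}"

text \<open>\<open>\<Lambda> = \<int>f\<^sub>0 \<oplus> \<dots> \<oplus> \<int>f\<^sub>n\<close> is the set of finitely supported functions \<open>nat \<Rightarrow>\<^sub>0 int\<close> with
  support in \<open>{0..n}\<close>, and \<open>\<R>[\<Lambda>]\<close> is contained in the convolution algebra
  \<open>(nat \<Rightarrow>\<^sub>0 int) \<Rightarrow>\<^sub>0 real\<close>, where \<open>e\<^sup>\<lambda>\<close> is \<open>single \<lambda> 1\<close>.\<close>

type_synonym weight = "nat \<Rightarrow>\<^sub>0 int"

definition weights :: "nat \<Rightarrow> weight set" where
  "weights n = {l. Poly_Mapping.keys l \<subseteq> {0..n}}"

text \<open>Matrix rows and columns are numbered from \<open>0\<close>, hence the shift.\<close>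

definition varpi_pow :: "'f::field \<Rightarrow> nat \<Rightarrow> weight \<Rightarrow> 'f \<times> 'f mat" where
  "varpi_pow w n l =
     (w powi Poly_Mapping.lookup l 0,
      mat n n (\<lambda>(i, j). if i = j then w powi Poly_Mapping.lookup l (i + 1) else 0))"

definition delta_pairing :: "nat \<Rightarrow> weight \<Rightarrow> real" where
  "delta_pairing n l =
     (\<Sum>k = 1..n. (real n - 2 * real k + 1) * real_of_int (Poly_Mapping.lookup l k)) / 2"

definition unipotent :: "nat \<Rightarrow> 'f::field mat set" where
  "unipotent n = {u \<in> carrier_mat n n. upper_triangular u \<and> (\<forall>i<n. u $$ (i, i) = 1)}"

definition double_coset :: "('f::field \<Rightarrow> int) \<Rightarrow> nat \<Rightarrow> 'f \<times> 'f mat \<Rightarrow> ('f \<times> 'f mat) set" where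
  "double_coset v m \<sigma> = sub_K v m <#>\<^bsub>grp_G m\<^esub> (\<sigma> <#\<^bsub>grp_G m\<^esub> sub_K v m)"

text \<open>The transform of the characteristic function of the double coset \<open>D\<close>. A left coset
  \<open>\<varpi>\<^sup>\<lambda>uK\<close> determines \<open>\<lambda>\<close>, so summing over pairs \<open>(\<lambda>, \<varpi>\<^sup>\<lambda>uK)\<close> is summing over left cosets.\<close>

definition satake_ch ::
  "('f::field \<Rightarrow> int) \<Rightarrow> 'f \<Rightarrow> nat \<Rightarrow> ('f \<times> 'f mat) set \<Rightarrow> (weight \<Rightarrow>\<^sub>0 real)" where
  "satake_ch v w m D =
     (\<Sum>(l, B) \<in> {(l, B). l \<in> weights (2 * m) \<and> B \<subseteq> D \<and>
          (\<exists>u\<in>unipotent (2 * m).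
             B = (varpi_pow w (2 * m) l \<otimes>\<^bsub>grp_G m\<^esub> (1, u)) <#\<^bsub>grp_G m\<^esub> sub_K v m)}.
        Poly_Mapping.single l (real (residue_card v) powr (- delta_pairing (2 * m) l)))"

text \<open>Linear extension: \<open>\<phi>\<close> is constant on each double coset \<open>D\<close>, with value \<open>the_elem (\<phi> ` D)\<close>,
  and nonzero on finitely many of them.\<close>

definition satake ::
  "('f::field \<Rightarrow> int) \<Rightarrow> 'f \<Rightarrow> nat \<Rightarrow> ('f \<times> 'f mat \<Rightarrow> real) \<Rightarrow> (weight \<Rightarrow>\<^sub>0 real)" where
  "satake v w m \<phi> =
     (\<Sum>D \<in> {D \<in> double_coset v m ` carrier (grp_G m). \<phi> ` D \<noteq> {0}}.
        Poly_Mapping.single 0 (the_elem (\<phi> ` D)) * satake_ch v w m D)"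

definition y_var :: "nat \<Rightarrow> (weight \<Rightarrow>\<^sub>0 real)" where
  "y_var i = Poly_Mapping.single (Poly_Mapping.single i 1) 1"

definition satake_poly :: "('f::field \<Rightarrow> int) \<Rightarrow> nat \<Rightarrow> int \<Rightarrow> (weight \<Rightarrow>\<^sub>0 real) poly" where
  "satake_poly v m c =
     (\<Prod>i = 1..2 * m.
        [:1, - (y_var 0 * y_var i *
               Poly_Mapping.single 0 (real (residue_card v) powr (- real_of_int c / 2))):])"

text \<open>The coefficient of \<open>X\<^sup>k\<close> in the Hecke polynomial; unique because the Satake transform is an
  isomorphism.\<close>

definition hecke_std_coeff ::
  "('f::field \<Rightarrow> int) \<Rightarrow> 'f \<Rightarrow> nat \<Rightarrow> int \<Rightarrow> nat \<Rightarrow> 'f \<times> 'f mat \<Rightarrow> real" where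
  "hecke_std_coeff v w m c k =
     (THE \<phi>. \<phi> \<in> hecke_space v m (Z_q_half v) \<and>
             satake v w m \<phi> = Polynomial.coeff (satake_poly v m c) k)"

definition hecke_tilde ::
  "('f::field \<Rightarrow> int) \<Rightarrow> 'f \<Rightarrow> nat \<Rightarrow> int \<Rightarrow> ('f \<times> 'f mat) \<times> 'f \<Rightarrow> 'p::field_char_0" where
  "hecke_tilde v w m c = (\<lambda>(g, t).
     \<Sum>k \<le> 2 * m. rat_transfer (hecke_std_coeff v w m c k g) *
       (if t \<in> (w powi (- int k)) <#\<^bsub>mult_group\<^esub> int_units v then 1 else 0))"


section \<open>Zeta elements for the trivial functor\<close>

definition haar_measure :: "'g monoid \<Rightarrow> 'g topology \<Rightarrow> 'g measure \<Rightarrow> bool" where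
  "haar_measure G X \<mu> \<longleftrightarrow>
     space \<mu> = carrier G \<and>
     sets \<mu> = sigma_sets (carrier G) {S. openin X S} \<and>
     (\<forall>g\<in>carrier G. \<forall>S\<in>sets \<mu>. emeasure \<mu> (g <#\<^bsub>G\<^esub> S) = emeasure \<mu> S) \<and>
     (\<forall>S. compactin X S \<longrightarrow> emeasure \<mu> S < \<infinity>) \<and>
     (\<forall>S. openin X S \<and> S \<noteq> {} \<longrightarrow> 0 < emeasure \<mu> S)"

definition gen_index :: "'g measure \<Rightarrow> 'g set \<Rightarrow> 'g set \<Rightarrow> 'p::field_char_0" where
  "gen_index \<mu> V1 V2 = rat_transfer (measure \<mu> V1 / measure \<mu> V2)"

definition compact_open_subgroup :: "'g monoid \<Rightarrow> 'g topology \<Rightarrow> 'g set \<Rightarrow> bool" where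
  "compact_open_subgroup G X V \<longleftrightarrow> subgroup V G \<and> compactin X V \<and> openin X V"

definition test_functions ::
  "('f::field \<Rightarrow> int) \<Rightarrow> nat \<Rightarrow> (('f \<times> 'f mat) \<times> 'f \<Rightarrow> 'p::field_char_0) set" where
  "test_functions v m = {\<xi>.
     (\<forall>g. g \<notin> carrier (grp_Gt m) \<longrightarrow> \<xi> g = 0) \<and>
     (\<forall>g\<in>carrier (grp_Gt m). \<forall>k\<in>sub_Kt v m. \<xi> (g \<otimes>\<^bsub>grp_Gt m\<^esub> k) = \<xi> g) \<and>
     compactly_supported (top_Gt v m) \<xi>}"

definition H_act ::
  "nat \<Rightarrow> 'f::field \<times> 'f mat \<times> 'f mat \<Rightarrow> (('f \<times> 'f mat) \<times> 'f \<Rightarrow> 'p::field_char_0) \<Rightarrow>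
   ('f \<times> 'f mat) \<times> 'f \<Rightarrow> 'p" where
  "H_act m h \<xi> = (\<lambda>g. if g \<in> carrier (grp_Gt m)
     then \<xi> (inv\<^bsub>grp_Gt m\<^esub> (iota_t m h) \<otimes>\<^bsub>grp_Gt m\<^esub> g) else 0)"

abbreviation (input) fun_scale :: "'p \<Rightarrow> ('g \<Rightarrow> 'p) \<Rightarrow> 'g \<Rightarrow> 'p::field_char_0" where
  "fun_scale \<equiv> (\<lambda>a \<xi> g. a * \<xi> g)"

lemma vector_space_fun_scale: "vector_space fun_scale"
  by unfold_locales (auto simp: fun_eq_iff algebra_simps)

definition coinvariant_kernel ::
  "('f::field \<Rightarrow> int) \<Rightarrow> nat \<Rightarrow> (('f \<times> 'f mat) \<times> 'f \<Rightarrow> 'p::field_char_0) set" where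
  "coinvariant_kernel v m =
     module.span fun_scale
       {H_act m h \<xi> - \<xi> | h \<xi>. h \<in> carrier (grp_H m) \<and> \<xi> \<in> test_functions v m}"

text \<open>The class of \<open>\<xi>\<close> in the coinvariants, as a coset of the kernel.\<close>

definition coinvariant_class ::
  "('f::field \<Rightarrow> int) \<Rightarrow> nat \<Rightarrow> (('f \<times> 'f mat) \<times> 'f \<Rightarrow> 'p::field_char_0) \<Rightarrow>
   (('f \<times> 'f mat) \<times> 'f \<Rightarrow> 'p) set" where
  "coinvariant_class v m \<xi> = {\<eta> \<in> test_functions v m. \<eta> - \<xi> \<in> coinvariant_kernel v m}"

text \<open>For the trivial functor all restrictions and conjugations are identities and \<open>H\<close> acts
  trivially on the completion, so that a zeta element takes scalar values: \<open>x\<^sub>U\<close> and the \<open>x i\<close> are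
  elements of \<open>R\<close>, and \<open>hk g * x\<^sub>U\<close> is the value of \<open>x\<^sub>U \<otimes> hk\<close> at \<open>g\<close>. The group \<open>V i\<close> is
  a subgroup of \<open>H \<inter> g L g\<^sup>-\<^sup>1\<close>, with \<open>H\<close> embedded by \<open>iota_t\<close>.\<close>

definition zeta_element ::
  "('f::field \<Rightarrow> int) \<Rightarrow> nat \<Rightarrow> ('f \<times> 'f mat \<times> 'f mat) measure \<Rightarrow> 'p::field_char_0 set \<Rightarrow>
   'p \<Rightarrow> (('f \<times> 'f mat) \<times> 'f \<Rightarrow> 'p) \<Rightarrow> (('f \<times> 'f mat) \<times> 'f) set \<Rightarrow>
   (('f \<times> 'f mat) \<times> 'f \<Rightarrow> 'p) \<Rightarrow> bool" where
  "zeta_element v m \<mu> R x\<^sub>U hk L \<zeta> \<longleftrightarrow>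
     \<zeta> \<in> test_functions v m \<and>
     (\<forall>g\<in>carrier (grp_Gt m). \<exists>r V x.
        (\<forall>i<r::nat. compact_open_subgroup (grp_H m) (top_H v m) (V i) \<and>
           iota_t m ` V i \<subseteq> g <#\<^bsub>grp_Gt m\<^esub> (L #>\<^bsub>grp_Gt m\<^esub> inv\<^bsub>grp_Gt m\<^esub> g) \<and>
           x i \<in> R) \<and>
        \<zeta> g = (\<Sum>i<r. gen_index \<mu> (sub_U v m) (V i) * x i)) \<and>
     coinvariant_class v m \<zeta> = coinvariant_class v m (\<lambda>g. hk g * x\<^sub>U)"

end

theory Submission
  imports Defs
begin

text \<open>The coefficient of \<open>X\<^sup>k\<close> in the Hecke polynomial is \<open>(-1)\<^sup>k\<close> times \<open>q\<close> to the power \<open>- k (c + 2 m - k) / 2\<close> times the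
  characteristic function of a minuscule double coset, so the Hecke operator is a finite sum of
  indicator functions of left cosets of \<open>K \<times> C\<close>. By the Iwasawa and Cartan decompositions every
  \<open>H\<close>-orbit of such cosets contains one of the form \<open>y K\<close> with \<open>y\<close> a block unipotent matrix
  with upper right block \<open>X = diag(x\<^sub>i)\<close>, where each \<open>x\<^sub>i\<close> is zero or not integral. Moving every
  coset to such a base point does not change the class in the coinvariants, and the value at \<open>y\<close>
  becomes \<open>\<mu>(U) / \<mu>(H\<^sub>0)\<close> times \<open>\<Sum>\<^sub>k \<alpha>\<^sub>k N\<^sub>k\<close>, where \<open>H\<^sub>0\<close> is the stabilizer of \<open>y K\<close>, \<open>\<alpha>\<^sub>k\<close> are the
  coefficients above and \<open>N\<^sub>k\<close> counts cosets \<open>U h\<close>; this uses that \<open>H\<close> is unimodular.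
  If no \<open>x\<^sub>i\<close> vanishes, then \<open>\<nu>(H\<^sub>0)\<close> is contained in \<open>D\<close> and \<open>V = H\<^sub>0\<close> is admissible. Otherwise
  \<open>V = H\<^sub>0 \<inter> \<nu>\<^sup>-\<^sup>1(D)\<close> has index \<open>q - 1\<close> in \<open>H\<^sub>0\<close>, and \<open>q - 1\<close> divides the sum, because
  \<open>\<alpha>\<^sub>k\<close> is congruent to \<open>(-1)\<^sup>k\<close> and the one-dimensional torus stabilizing \<open>y K\<close> acts on the cosets
  \<open>U h\<close> with orbits of length \<open>q - 1\<close> and with fixed points whose alternating count is zero.\<close>

text \<open>The obstacle is integrality. The value at a base point is the sum of
  \<open>\<alpha>\<^sub>k M\<^sub>k\<close>, where \<open>M\<^sub>k\<close> counts the left cosets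
  of \<open>H\<^sub>0\<close> in the set \<open>A k\<close> of all h carrying y into the k-th part
  of the support. Condition (i) wants this to be [U:V] times an element of \<open>\<O>\<close> with
  V inside a conjugate of the group with D, and that can force V to be smaller than
  \<open>H\<^sub>0\<close> by the factor q - 1. But \<open>A k\<close> is also left invariant under
  U; computing its Haar measure in both ways gives
  \<open>M\<^sub>k \<mu>(H\<^sub>0) = N\<^sub>k \<mu>(U)\<close>, and on the cosets
  \<open>U h\<close> the torus inside \<open>H\<^sub>0\<close> acts from the right. The parity of c
  enters through the Hecke coefficients: it makes their exponents of q integers. As q and its
  inverse are both congruent to 1 modulo q - 1 in \<open>\<O>\<close>, the values of these exponents
  do not matter. The cancellation of fixed cosets has a simple source: one column of
  \<open>h\<^sub>1\<close> is either divisible by w or not, and dividing it by w lowers k by one,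
  hence changes the sign.\<close>

lemma frac_ideal_zero [simp]: "0 \<in> frac_ideal v k"
  by (simp add: frac_ideal_def)

lemma frac_ideal_mono: "k \<le> l \<Longrightarrow> x \<in> frac_ideal v l \<Longrightarrow> x \<in> frac_ideal v k"
  by (auto simp: frac_ideal_def)

section \<open>Arithmetic of the valuation and of fractional ideals\<close>

locale local_field_unif = local_field v for v :: "'f::field_char_0 \<Rightarrow> int" +
  fixes w :: 'f
  assumes unif: "uniformizer v w"
begin

abbreviation I :: "int \<Rightarrow> 'f set" where "I \<equiv> frac_ideal v"

abbreviation q :: nat where "q \<equiv> residue_card v"

lemma w_nonzero [simp]: "w \<noteq> 0" and val_w [simp]: "v w = 1"
  using unif by (auto simp: uniformizer_def)

lemma val_one [simp]: "v 1 = 0"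
  using val_mult[of 1 1] by simp

lemma val_inverse: "x \<noteq> 0 \<Longrightarrow> v (inverse x) = - v x"
  using val_mult[of x "inverse x"] by simp

lemma val_divide: "x \<noteq> 0 \<Longrightarrow> y \<noteq> 0 \<Longrightarrow> v (x / y) = v x - v y"
  by (simp add: divide_inverse val_mult val_inverse)

lemma val_minus [simp]: "v (- x) = v x"
proof (cases "x = 0")
  case False
  have "v (-1) = 0"
    using val_mult[of "-1" "-1"] by simp
  then show ?thesis
    using val_mult[of "-1" x] False by simp
qed simp

lemma val_power: "x \<noteq> 0 \<Longrightarrow> v (x ^ n) = int n * v x"
  by (induction n) (auto simp: val_mult algebra_simps)

lemma val_powi: "x \<noteq> 0 \<Longrightarrow> v (x powi k) = k * v x"
  by (auto simp: power_int_def val_power val_inverse)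

lemma val_w_powi [simp]: "v (w powi k) = k"
  by (simp add: val_powi)

lemma I_minus [simp]: "- x \<in> I k \<longleftrightarrow> x \<in> I k"
  by (auto simp: frac_ideal_def)

lemma I_add [intro]: "x \<in> I k \<Longrightarrow> y \<in> I k \<Longrightarrow> x + y \<in> I k"
proof (cases "x = 0 \<or> y = 0 \<or> x + y = 0")
  case False
  assume "x \<in> I k" "y \<in> I k"
  then show ?thesis
    using val_add[of x y] False by (auto simp: frac_ideal_def)
qed (auto simp: frac_ideal_def)

lemma I_diff [intro]: "x \<in> I k \<Longrightarrow> y \<in> I k \<Longrightarrow> x - y \<in> I k"
  using I_add[of x k "- y"] by simp

lemma I_diff_commute: "x - y \<in> I k \<longleftrightarrow> y - x \<in> I k"
  using I_minus[of "x - y" k] by simp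

lemma I_diff_trans: "x - y \<in> I k \<Longrightarrow> y - z \<in> I k \<Longrightarrow> x - z \<in> I k"
  using I_add[of "x - y" k "y - z"] by simp

lemma I_sum: "(\<And>i. i \<in> A \<Longrightarrow> f i \<in> I k) \<Longrightarrow> sum f A \<in> I k"
  by (induction A rule: infinite_finite_induct) auto

lemma I_mult: "x \<in> I k \<Longrightarrow> y \<in> I l \<Longrightarrow> x * y \<in> I (k + l)"
  by (cases "x = 0 \<or> y = 0") (auto simp: frac_ideal_def val_mult)

lemma I_mult0 [intro]: "x \<in> I 0 \<Longrightarrow> y \<in> I k \<Longrightarrow> x * y \<in> I k"
    "x \<in> I k \<Longrightarrow> y \<in> I 0 \<Longrightarrow> x * y \<in> I k"
  using I_mult[of x 0 y k] I_mult[of x k y 0] by auto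

lemma I_one [simp]: "1 \<in> I k \<longleftrightarrow> k \<le> 0"
  by (auto simp: frac_ideal_def)

lemma I_prod: "(\<And>i. i \<in> A \<Longrightarrow> f i \<in> I 0) \<Longrightarrow> prod f A \<in> I 0"
  by (induction A rule: infinite_finite_induct) auto

lemma I_power: "x \<in> I 0 \<Longrightarrow> x ^ n \<in> I 0"
  by (induction n) auto

lemma I_scale: "x \<noteq> 0 \<Longrightarrow> x * y \<in> I k \<longleftrightarrow> y \<in> I (k - v x)"
  by (cases "y = 0") (auto simp: frac_ideal_def val_mult)

lemma I_w_scale: "w powi l * y \<in> I k \<longleftrightarrow> y \<in> I (k - l)"
  by (simp add: I_scale)

lemma I_iff_val: "x \<noteq> 0 \<Longrightarrow> x \<in> I k \<longleftrightarrow> k \<le> v x"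
  by (simp add: frac_ideal_def)

lemma val_add_small:
  assumes "x \<noteq> 0" "y \<in> I (v x + 1)"
  shows "x + y \<noteq> 0" "v (x + y) = v x"
proof -
  show ne: "x + y \<noteq> 0"
  proof
    assume "x + y = 0"
    then have "y = - x" by (simp add: add_eq_0_iff)
    with assms show False by (auto simp: frac_ideal_def)
  qed
  have "x + y \<in> I (v x)"
    using assms by (intro I_add) (auto simp: frac_ideal_def)
  then have 1: "v x \<le> v (x + y)"
    using ne by (simp add: I_iff_val)
  show "v (x + y) = v x"
  proof (rule ccontr)
    assume "v (x + y) \<noteq> v x"
    with 1 have "x + y \<in> I (v x + 1)"
      using ne by (simp add: I_iff_val)
    then have "(x + y) - y \<in> I (v x + 1)"
      using assms by blast
    then show False
      using assms by (simp add: I_iff_val)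
  qed
qed

lemma int_units_iff: "x \<in> int_units v \<longleftrightarrow> x \<noteq> 0 \<and> v x = 0"
  by (auto simp: int_units_def frac_ideal_def val_inverse)

lemma I0_not_unit: "x \<in> I 0 \<Longrightarrow> x \<notin> int_units v \<Longrightarrow> x \<in> I 1"
  by (auto simp: int_units_iff frac_ideal_def)

lemma unit_congruent: "x \<in> int_units v \<Longrightarrow> y - x \<in> I 1 \<Longrightarrow> y \<in> int_units v"
  using val_add_small[of x "y - x"] by (simp add: int_units_iff)

lemma unit_not_I1: "x \<in> int_units v \<Longrightarrow> x \<notin> I 1"
  by (auto simp: int_units_iff frac_ideal_def)

lemma sub_D_iff: "x \<in> sub_D v w \<longleftrightarrow> x - 1 \<in> I 1"
proof
  assume "x - 1 \<in> I 1"
  then have "(x - 1) / w \<in> I 0"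
    using I_scale[of w "(x - 1) / w" 1] by simp
  then show "x \<in> sub_D v w"
    by (auto simp: sub_D_def intro!: image_eqI[of _ _ "(x - 1) / w"])
next
  assume "x \<in> sub_D v w"
  then show "x - 1 \<in> I 1"
    by (auto simp: sub_D_def I_scale)
qed

text \<open>A fixed set of q digits. They serve as centres of sub-balls in the compactness proof, as
  free entries of Hermite normal forms and, restricted to units, as labels of torus cosets.\<close>

definition res_reps :: "'f set" where
  "res_reps = (SOME R. R \<subseteq> I 0 \<and> (\<forall>x\<in>I 0. \<exists>!r. r \<in> R \<and> x - r \<in> I 1) \<and> finite R \<and> card R = q)"

lemma res_reps_exists:
  "\<exists>R. R \<subseteq> I 0 \<and> (\<forall>x\<in>I 0. \<exists>!r. r \<in> R \<and> x - r \<in> I 1) \<and> finite R \<and> card R = q"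
proof -
  let ?r = "{(x, y). x \<in> I 0 \<and> y \<in> I 0 \<and> x - y \<in> I 1}"
  have eq: "equiv (I 0) ?r"
    unfolding equiv_def refl_on_def sym_def trans_def
    using I_diff_commute I_diff_trans by auto
  define f where "f = (\<lambda>C::'f set. SOME x. x \<in> C)"
  have f: "f C \<in> C" if "C \<in> residue_field v" for C
  proof -
    have "C \<noteq> {}"
      using in_quotient_imp_non_empty[OF eq] that by (auto simp: residue_field_def)
    then show ?thesis
      unfolding f_def by (simp add: some_in_eq)
  qed
  have sub: "C \<subseteq> I 0" if "C \<in> residue_field v" for C
    using in_quotient_imp_subset[OF eq] that by (auto simp: residue_field_def)
  have same: "C = D" if "C \<in> residue_field v" "D \<in> residue_field v" "x \<in> C" "y \<in> D" "x - y \<in> I 1" for C D x y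
  proof -
    have "(x, y) \<in> ?r"
      using that sub by blast
    then show ?thesis
      using quotient_eq_iff[OF eq, of C D x y] that unfolding residue_field_def by blast
  qed
  have inj: "inj_on f (residue_field v)"
    by (rule inj_onI) (metis f same cancel_comm_monoid_add_class.diff_cancel frac_ideal_zero)
  show ?thesis
  proof (intro exI[of _ "f ` residue_field v"] conjI ballI)
    show "f ` residue_field v \<subseteq> I 0"
      using f sub by blast
    show "finite (f ` residue_field v)"
      using finite_residue_field by simp
    show "card (f ` residue_field v) = q"
      using card_image[OF inj] by (simp add: residue_card_def)
    fix x assume x: "x \<in> I 0"
    define C where "C = ?r `` {x}"
    have C: "C \<in> residue_field v" "x \<in> C"
      using x by (auto simp: residue_field_def C_def quotient_def)
    show "\<exists>!r. r \<in> f ` residue_field v \<and> x - r \<in> I 1"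
    proof (rule ex1I[of _ "f C"])
      show "f C \<in> f ` residue_field v \<and> x - f C \<in> I 1"
        using f[OF C(1)] C by (auto simp: C_def)
      fix r assume "r \<in> f ` residue_field v \<and> x - r \<in> I 1"
      then obtain D where D: "D \<in> residue_field v" "r = f D" "x - f D \<in> I 1" by auto
      have "C = D"
        by (rule same[OF C(1) D(1) C(2) f[OF D(1)] D(3)])
      with D show "r = f C" by simp
    qed
  qed
qed

lemma res_reps: "res_reps \<subseteq> I 0" "x \<in> I 0 \<Longrightarrow> \<exists>!r. r \<in> res_reps \<and> x - r \<in> I 1"
    "finite res_reps" "card res_reps = q"
  using someI_ex[OF res_reps_exists] unfolding res_reps_def by blast+

lemma res_reps_eq: "r \<in> res_reps \<Longrightarrow> s \<in> res_reps \<Longrightarrow> r - s \<in> I 1 \<Longrightarrow> r = s"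
  using res_reps(2)[of r] res_reps(1) by (metis cancel_comm_monoid_add_class.diff_cancel frac_ideal_zero subsetD)

definition res_unit_reps :: "'f set" where
  "res_unit_reps = res_reps \<inter> int_units v"

text \<open>Exactly one digit, \<open>z\<close>, represents the class of 0, and every other digit is
  a unit; hence the count \<open>q - 1\<close>.\<close>

lemma res_unit_reps:
  "finite res_unit_reps" "card res_unit_reps = q - 1" "res_unit_reps \<subseteq> int_units v"
  "x \<in> int_units v \<Longrightarrow> \<exists>r\<in>res_unit_reps. x - r \<in> I 1"
proof -
  obtain z where z: "z \<in> res_reps" "0 - z \<in> I 1"
    using res_reps(2)[of 0] by auto
  have "res_unit_reps = res_reps - {z}"
  proof (intro equalityI subsetI)
    fix x assume x: "x \<in> res_unit_reps"
    then have "x \<noteq> z"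
      using z unit_not_I1[of x] by (auto simp: res_unit_reps_def)
    with x show "x \<in> res_reps - {z}" by (simp add: res_unit_reps_def)
  next
    fix x assume x: "x \<in> res_reps - {z}"
    have "x \<notin> I 1"
    proof
      assume "x \<in> I 1"
      then have "x - z \<in> I 1" using z I_add[of x 1 "- z"] by simp
      with x z show False using res_reps_eq by auto
    qed
    with x show "x \<in> res_unit_reps"
      using I0_not_unit res_reps(1) by (auto simp: res_unit_reps_def)
  qed
  then show "card res_unit_reps = q - 1" "finite res_unit_reps"
    using z res_reps(3,4) by auto
  show "res_unit_reps \<subseteq> int_units v"
    by (auto simp: res_unit_reps_def)
  assume x: "x \<in> int_units v"
  then have "x \<in> I 0" by (simp add: int_units_def)
  then obtain r where r: "r \<in> res_reps" "x - r \<in> I 1"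
    using res_reps(2) by blast
  then have "r \<in> int_units v"
    using unit_congruent[OF x, of r] I_diff_commute by blast
  with r show "\<exists>r\<in>res_unit_reps. x - r \<in> I 1"
    by (auto simp: res_unit_reps_def)
qed

text \<open>The class of 1 is nonzero. Positivity of \<open>q - 1\<close> is what permits cancelling
  this factor in the orbit sums.\<close>

lemma q_ge_2: "q \<ge> 2"
proof -
  have "1 \<in> int_units v" by (simp add: int_units_iff)
  then have "res_unit_reps \<noteq> {}" using res_unit_reps(4) by blast
  then have "q - 1 > 0"
    using res_unit_reps(1,2) by (metis card_gt_0_iff)
  then show ?thesis by simp
qed

end

section \<open>Matrices with entries in a fractional ideal\<close>

definition frac_mat :: "('f::field \<Rightarrow> int) \<Rightarrow> int \<Rightarrow> nat \<Rightarrow> nat \<Rightarrow> 'f mat set" where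
  "frac_mat v k nr nc = {A \<in> carrier_mat nr nc. \<forall>i<nr. \<forall>j<nc. A $$ (i, j) \<in> frac_ideal v k}"

text \<open>The adjugate formula shows the entries of the inverse as minors divided by the
  determinant, which is the form in which integrality can be read off.\<close>

definition minv :: "'f::field mat \<Rightarrow> 'f mat" where
  "minv A = inverse (det A) \<cdot>\<^sub>m adj_mat A"

lemma carrier_GL: "A \<in> carrier (GL n) \<longleftrightarrow> A \<in> carrier_mat n n \<and> det A \<noteq> 0"
  using unit_imp_det_non_zero[of A n "()"] det_non_zero_imp_unit[of A n "()"]
  by (auto simp: GL_def units_of_def Units_def ring_mat_def)

lemma mult_GL [simp]: "A \<otimes>\<^bsub>GL n\<^esub> B = A * B"
  and one_GL [simp]: "\<one>\<^bsub>GL n\<^esub> = 1\<^sub>m n"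
  by (simp_all add: GL_def units_of_def ring_mat_def)

lemma minv:
  fixes A :: "'f::field mat"
  assumes "A \<in> carrier_mat n n" "det A \<noteq> 0"
  shows "minv A \<in> carrier_mat n n" "A * minv A = 1\<^sub>m n" "minv A * A = 1\<^sub>m n"
    "det (minv A) = inverse (det A)"
proof -
  note adj = adj_mat[OF assms(1)]
  show c: "minv A \<in> carrier_mat n n"
    using adj by (simp add: minv_def)
  show 1: "A * minv A = 1\<^sub>m n"
    using adj assms by (auto simp: minv_def mult_smult_distrib[OF assms(1) adj(1)] intro!: eq_matI)
  show "minv A * A = 1\<^sub>m n"
    using mat_mult_left_right_inverse[OF assms(1) c 1] .
  have "det A * det (minv A) = 1"
    using det_mult[OF assms(1) c] 1 by simp
  then show "det (minv A) = inverse (det A)"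
    by (simp add: inverse_unique)
qed

lemma right_inverse_unique:
  fixes A :: "'f::field mat"
  assumes "A \<in> carrier_mat n n" "B \<in> carrier_mat n n" "A * B = 1\<^sub>m n"
  shows "det A \<noteq> 0" "B = minv A" "det B \<noteq> 0" "A = minv B"
proof -
  have "det A * det B = 1"
    using det_mult[OF assms(1,2)] assms(3) by simp
  then show d: "det A \<noteq> 0" "det B \<noteq> 0" by auto
  note m = minv[OF assms(1) d(1)]
  have "minv A * (A * B) = minv A * A * B"
    using assms m by (intro assoc_mult_mat[symmetric]) auto
  then show "B = minv A"
    unfolding m(3) assms(3) using right_mult_one_mat[OF m(1)] left_mult_one_mat[OF assms(2)] by simp
  note m' = minv[OF assms(2) d(2)]
  have "A * B * minv B = A * (B * minv B)"
    using assms m' by (intro assoc_mult_mat) auto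
  then show "A = minv B"
    unfolding m'(2) assms(3) using left_mult_one_mat[OF m'(1)] right_mult_one_mat[OF assms(1)] by simp
qed

lemma inv_GL: "A \<in> carrier (GL n) \<Longrightarrow> inv\<^bsub>GL n\<^esub> A = minv A"
  using minv[of A n] group.inv_equality[OF group_GL[of n], of "minv A" A]
  by (auto simp: carrier_GL)

lemma minv_minv: "A \<in> carrier_mat n n \<Longrightarrow> det A \<noteq> 0 \<Longrightarrow> minv (minv A) = (A :: 'f::field mat)"
  using minv[of A n] right_inverse_unique(2)[of "minv A" n A] by simp

lemma minv_mult:
  fixes A B :: "'f::field mat"
  assumes "A \<in> carrier_mat n n" "det A \<noteq> 0" "B \<in> carrier_mat n n" "det B \<noteq> 0"
  shows "minv (A * B) = minv B * minv A"
proof -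
  note a = minv[OF assms(1,2)] and b = minv[OF assms(3,4)]
  have "(A * B) * (minv B * minv A) = A * (B * (minv B * minv A))"
    using assms a b by (intro assoc_mult_mat) auto
  also have "B * (minv B * minv A) = B * minv B * minv A"
    using assms a b by (intro assoc_mult_mat[symmetric]) auto
  also have "\<dots> = minv A"
    using a b by simp
  finally have "(A * B) * (minv B * minv A) = 1\<^sub>m n"
    using a by simp
  then show ?thesis
    using right_inverse_unique(2)[of "A * B" n "minv B * minv A"] assms a b by simp
qed

lemma minv_one [simp]: "minv (1\<^sub>m n) = (1\<^sub>m n :: 'f::field mat)"
  using right_inverse_unique(2)[of "1\<^sub>m n :: 'f mat" n "1\<^sub>m n"] by simp

lemma mult_GL_carrier: "A \<in> carrier (GL n) \<Longrightarrow> B \<in> carrier (GL n) \<Longrightarrow> A * B \<in> carrier (GL n)"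
  by (auto simp: carrier_GL det_mult[of _ n])

lemma minv_GL_carrier: "A \<in> carrier (GL n) \<Longrightarrow> minv A \<in> carrier (GL n)"
  using minv[of A n] by (auto simp: carrier_GL)

lemma mat_cancel_left:
  fixes A :: "'f::field mat"
  assumes "A \<in> carrier_mat n n" "det A \<noteq> 0" "B \<in> carrier_mat n k"
  shows "minv A * (A * B) = B" "A * (minv A * B) = B"
  using minv[OF assms(1,2)] assms by (simp_all add: assoc_mult_mat[symmetric, of _ n n _ n _ k])

lemma mat_cancel_right:
  fixes A :: "'f::field mat"
  assumes "A \<in> carrier_mat n n" "det A \<noteq> 0" "B \<in> carrier_mat k n"
  shows "B * A * minv A = B" "B * minv A * A = B"
  using minv[OF assms(1,2)] assms by (simp_all add: assoc_mult_mat[of _ k n _ n _ n])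

context local_field_unif
begin

abbreviation M :: "int \<Rightarrow> nat \<Rightarrow> nat \<Rightarrow> 'f mat set" where "M \<equiv> frac_mat v"

lemma M_carrier: "A \<in> M k n m \<Longrightarrow> A \<in> carrier_mat n m"
  by (simp add: frac_mat_def)

lemma M_entry: "A \<in> M k n m \<Longrightarrow> i < n \<Longrightarrow> j < m \<Longrightarrow> A $$ (i, j) \<in> I k"
  by (simp add: frac_mat_def)

lemma MI: "A \<in> carrier_mat n m \<Longrightarrow> (\<And>i j. i < n \<Longrightarrow> j < m \<Longrightarrow> A $$ (i, j) \<in> I k) \<Longrightarrow> A \<in> M k n m"
  by (simp add: frac_mat_def)

lemma M_mono: "k \<le> l \<Longrightarrow> A \<in> M l n m \<Longrightarrow> A \<in> M k n m"
  by (auto simp: frac_mat_def intro: frac_ideal_mono)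

lemma M_add: "A \<in> M k n m \<Longrightarrow> B \<in> M k n m \<Longrightarrow> A + B \<in> M k n m"
  using M_carrier[of A k n m] M_carrier[of B k n m] M_entry[of A k n m] M_entry[of B k n m]
  by (intro MI) (auto intro!: I_add)

lemma M_diff: "A \<in> M k n m \<Longrightarrow> B \<in> M k n m \<Longrightarrow> A - B \<in> M k n m"
  using M_carrier[of A k n m] M_carrier[of B k n m] M_entry[of A k n m] M_entry[of B k n m]
  by (intro MI) (auto intro!: I_diff)

lemma M_uminus: "A \<in> M k n m \<Longrightarrow> - A \<in> M k n m"
  by (auto simp: frac_mat_def)

lemma M_mult: "A \<in> M k n m \<Longrightarrow> B \<in> M l m p \<Longrightarrow> A * B \<in> M (k + l) n p"
  by (auto simp: frac_mat_def scalar_prod_def intro!: I_sum I_mult)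

lemma M_mult0: "A \<in> M 0 n m \<Longrightarrow> B \<in> M k m p \<Longrightarrow> A * B \<in> M k n p"
    "A \<in> M k n m \<Longrightarrow> B \<in> M 0 m p \<Longrightarrow> A * B \<in> M k n p"
  using M_mult[of A 0 n m B k p] M_mult[of A k n m B 0 p] by auto

lemma M_smult: "A \<in> M k n m \<Longrightarrow> c \<in> I l \<Longrightarrow> c \<cdot>\<^sub>m A \<in> M (l + k) n m"
  by (auto simp: frac_mat_def intro!: I_mult)

lemma M_smult_iff:
  assumes c: "c \<noteq> 0"
  shows "c \<cdot>\<^sub>m A \<in> M k n m \<longleftrightarrow> A \<in> M (k - v c) n m"
proof
  assume A: "A \<in> M (k - v c) n m"
  have "c \<in> I (v c)" using c by (simp add: I_iff_val)
  from M_smult[OF A this] show "c \<cdot>\<^sub>m A \<in> M k n m" by simp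
next
  assume A: "c \<cdot>\<^sub>m A \<in> M k n m"
  have "inverse c \<in> I (- v c)" using c by (simp add: I_iff_val val_inverse)
  moreover have "inverse c \<cdot>\<^sub>m (c \<cdot>\<^sub>m A) = A"
    using c by (intro eq_matI) auto
  ultimately show "A \<in> M (k - v c) n m"
    using M_smult[OF A, of "inverse c" "- v c"] by simp
qed

lemma M_one: "1\<^sub>m n \<in> M 0 n n"
  by (auto simp: frac_mat_def)

lemma M_zero: "0\<^sub>m n m \<in> M k n m"
  by (auto simp: frac_mat_def)

lemma I_signof: "signof p \<in> I 0"
  by (simp add: sign_def)

lemma det_M0: "A \<in> M 0 n n \<Longrightarrow> det A \<in> I 0"
  by (subst det_def'[of _ n])
    (auto simp: M_carrier intro!: I_sum I_mult0 I_prod I_signof M_entry[of A 0 n n] simp flip: atLeast0LessThan dest: permutes_in_image)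

lemma det_M: "A \<in> M k n n \<Longrightarrow> det A \<in> I (int n * k)"
proof -
  assume A: "A \<in> M k n n"
  \<comment> \<open>The determinant is homogeneous of degree n, so scaling by a power of w reduces
    to integral matrices.\<close>
  have "(w powi (- k)) \<cdot>\<^sub>m A \<in> M 0 n n"
    using A by (subst M_smult_iff) auto
  from det_M0[OF this] have "(w powi (- k)) ^ n * det A \<in> I 0"
    using M_carrier[OF A] by (simp add: carrier_matD)
  then show ?thesis
    by (subst (asm) I_scale) (auto simp: val_power)
qed

lemma adj_M0: "A \<in> M 0 n n \<Longrightarrow> adj_mat A \<in> M 0 n n"
proof -
  assume A: "A \<in> M 0 n n"
  note c = M_carrier[OF A]
  show ?thesis
  proof (rule MI)
    show "adj_mat A \<in> carrier_mat n n" using adj_mat[OF c] by simp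
    fix i j assume ij: "i < n" "j < n"
    have d: "mat_delete A j i \<in> M 0 (n - 1) (n - 1)"
    proof (rule MI)
      show "mat_delete A j i \<in> carrier_mat (n - 1) (n - 1)"
        using c by (rule mat_delete_carrier)
      fix a b assume "a < n - 1" "b < n - 1"
      then show "mat_delete A j i $$ (a, b) \<in> I 0"
        using c ij by (auto simp: mat_delete_def intro!: M_entry[OF A])
    qed
    show "adj_mat A $$ (i, j) \<in> I 0"
      using ij c det_M0[OF d] by (auto simp: adj_mat_def cofactor_def intro!: I_mult0 I_power)
  qed
qed

lemma minv_M0: "A \<in> M 0 n n \<Longrightarrow> det A \<in> int_units v \<Longrightarrow> minv A \<in> M 0 n n"
  using M_smult[of "adj_mat A" 0 n n "inverse (det A)" 0] adj_M0[of A n]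
  by (auto simp: minv_def int_units_def)

text \<open>An integral inverse makes the determinant and its inverse integral; conversely, a unit
  determinant makes the adjugate formula integral.\<close>

lemma GL_int_iff: "A \<in> GL_int v n \<longleftrightarrow> A \<in> M 0 n n \<and> det A \<in> int_units v"
proof
  assume "A \<in> GL_int v n"
  then have A: "A \<in> carrier (GL n)" "A \<in> M 0 n n" "minv A \<in> M 0 n n"
    using minv(1)[of A n] by (auto simp: GL_int_def frac_mat_def inv_GL carrier_GL)
  have "det A \<in> I 0" "det (minv A) \<in> I 0"
    using A det_M0 by auto
  then show "A \<in> M 0 n n \<and> det A \<in> int_units v"
    using A minv(4)[of A n] by (auto simp: carrier_GL int_units_def)
next
  assume A: "A \<in> M 0 n n \<and> det A \<in> int_units v"
  then have c: "A \<in> carrier (GL n)"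
    by (auto simp: carrier_GL M_carrier int_units_def)
  show "A \<in> GL_int v n"
    using A c minv_M0[of A n] M_entry[of A 0 n n] M_entry[of "minv A" 0 n n]
    by (auto simp: GL_int_def inv_GL)
qed

lemma GL_int_iff_inv: "A \<in> GL_int v n \<longleftrightarrow> A \<in> carrier (GL n) \<and> A \<in> M 0 n n \<and> minv A \<in> M 0 n n"
proof
  assume A: "A \<in> GL_int v n"
  then show "A \<in> carrier (GL n) \<and> A \<in> M 0 n n \<and> minv A \<in> M 0 n n"
    using minv_M0[of A n] by (auto simp: GL_int_iff carrier_GL M_carrier int_units_def)
next
  assume A: "A \<in> carrier (GL n) \<and> A \<in> M 0 n n \<and> minv A \<in> M 0 n n"
  then show "A \<in> GL_int v n"
    using M_entry[of A 0 n n] M_entry[of "minv A" 0 n n] by (auto simp: GL_int_def inv_GL)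
qed

lemma GL_int_D:
  assumes "A \<in> GL_int v n"
  shows "A \<in> carrier_mat n n" "det A \<noteq> 0" "A \<in> M 0 n n" "minv A \<in> M 0 n n" "minv A \<in> carrier_mat n n"
    "v (det A) = 0" "A \<in> carrier (GL n)"
  using assms GL_int_iff[of A n] GL_int_iff_inv[of A n] M_carrier int_units_iff by (auto simp: carrier_GL)

lemma GL_int_mult:
  assumes "A \<in> GL_int v n" "B \<in> GL_int v n"
  shows "A * B \<in> GL_int v n"
proof -
  note a = GL_int_D[OF assms(1)] and b = GL_int_D[OF assms(2)]
  have "A * B \<in> M 0 n n"
    using M_mult0(1)[OF a(3) b(3)] .
  moreover have "det (A * B) = det A * det B"
    using det_mult[OF a(1) b(1)] .
  ultimately show ?thesis
    using a(2,6) b(2,6) by (simp add: GL_int_iff int_units_iff val_mult)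
qed

lemma GL_int_minv:
  assumes "A \<in> GL_int v n"
  shows "minv A \<in> GL_int v n"
proof -
  note a = GL_int_D[OF assms]
  show ?thesis
    unfolding GL_int_iff_inv minv_minv[OF a(1,2)] using a minv_GL_carrier[OF a(7)] by simp
qed

lemma GL_int_one: "1\<^sub>m n \<in> GL_int v n"
  by (auto simp: GL_int_iff M_one int_units_iff)

lemma M_GL_int_left:
  assumes P: "P \<in> GL_int v n" and A: "A \<in> carrier_mat n m"
  shows "P * A \<in> M k n m \<longleftrightarrow> A \<in> M k n m"
proof
  note p = GL_int_D[OF P]
  show "A \<in> M k n m" if "P * A \<in> M k n m"
    using M_mult0(1)[OF p(4) that] mat_cancel_left(1)[OF p(1,2) A] by simp
  show "P * A \<in> M k n m" if "A \<in> M k n m"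
    using M_mult0(1)[OF p(3) that] .
qed

lemma M_GL_int_right:
  assumes P: "P \<in> GL_int v n" and A: "A \<in> carrier_mat m n"
  shows "A * P \<in> M k m n \<longleftrightarrow> A \<in> M k m n"
proof
  note p = GL_int_D[OF P]
  show "A \<in> M k m n" if "A * P \<in> M k m n"
    using M_mult0(2)[OF that p(4)] mat_cancel_right(1)[OF p(1,2) A] by simp
  show "A * P \<in> M k m n" if "A \<in> M k m n"
    using M_mult0(2)[OF that p(3)] .
qed

lemma prod_congruent:
  assumes "\<And>i. i \<in> A \<Longrightarrow> f i \<in> I 0" "\<And>i. i \<in> A \<Longrightarrow> f i - g i \<in> I k" "k \<ge> 0"
  shows "prod f A - prod g A \<in> I k"
  using assms
proof (induction A rule: infinite_finite_induct)
  case (insert a A)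
  have g: "g i \<in> I 0" if "i \<in> insert a A" for i
  proof -
    have "f i - g i \<in> I 0" using insert.prems that frac_ideal_mono by blast
    then have "f i - (f i - g i) \<in> I 0" using insert.prems(1)[OF that] by blast
    then show ?thesis by simp
  qed
  have "prod f (insert a A) - prod g (insert a A) = f a * (prod f A - prod g A) + (f a - g a) * prod g A"
    using insert.hyps by (simp add: algebra_simps)
  moreover have "prod g A \<in> I 0" using g by (intro I_prod) auto
  moreover have "prod f A - prod g A \<in> I k" using insert by auto
  ultimately show ?case
    using insert.prems by (metis I_add I_mult0 insertI1)
qed auto

text \<open>Term by term comparison in the Leibniz formula. It is the source of all statements that
  \<open>nu\<close> is congruent to 1 modulo w.\<close>

lemma det_congruent:
  assumes "A \<in> M 0 n n" "A - B \<in> M k n n" "B \<in> carrier_mat n n" "k \<ge> 0"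
  shows "det A - det B \<in> I k"
proof -
  have "det A - det B = (\<Sum>p | p permutes {0..<n}. signof p * ((\<Prod>i = 0..<n. A $$ (i, p i)) - (\<Prod>i = 0..<n. B $$ (i, p i))))"
    using assms M_carrier[OF assms(1)] by (simp add: det_def'[of _ n] sum_subtractf right_diff_distrib)
  also have "\<dots> \<in> I k"
  proof (intro I_sum I_mult0(1) prod_congruent)
    fix p i assume p: "p \<in> {p. p permutes {0..<n}}"
    show "signof p \<in> I 0" by (rule I_signof)
    assume "i \<in> {0..<n}"
    then have i: "i < n" "p i < n"
      using p permutes_in_image[of p "{0..<n}" i] by auto
    show "A $$ (i, p i) \<in> I 0" using M_entry[OF assms(1)] i by simp
    show "A $$ (i, p i) - B $$ (i, p i) \<in> I k" using M_entry[OF assms(2) i] i assms(3) M_carrier[OF assms(1)] by simp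
  qed (use assms in auto)
  finally show ?thesis .
qed

lemma GL_int_congruent:
  assumes "A - 1\<^sub>m n \<in> M 1 n n" "A \<in> carrier_mat n n"
  shows "A \<in> GL_int v n"
proof -
  have "A = (A - 1\<^sub>m n) + 1\<^sub>m n"
    using assms by auto
  then have A: "A \<in> M 0 n n"
    using M_add[OF M_mono[of 0 1, OF _ assms(1)] M_one] by auto
  have "det A - 1 \<in> I 1"
    using det_congruent[OF A assms(1)] by simp
  then show ?thesis
    using A unit_congruent[of 1 "det A"] by (simp add: GL_int_iff int_units_iff)
qed

end

section \<open>Iwasawa and Cartan decompositions\<close>

definition perm_mat :: "nat \<Rightarrow> (nat \<Rightarrow> nat) \<Rightarrow> 'f::field mat" where
  "perm_mat n p = mat n n (\<lambda>(i, j). if i = p j then 1 else 0)"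

text \<open>An elementary matrix: multiplying by it on the right adds \<open>c j\<close> times the
  last column to column j. Only column operations are set up; row operations are obtained from them
  by transposing.\<close>

definition add_last_col :: "nat \<Rightarrow> (nat \<Rightarrow> 'f::field) \<Rightarrow> 'f mat" where
  "add_last_col n c = mat (Suc n) (Suc n) (\<lambda>(k, j). (if k = j then 1 else 0) + (if k = n then c j else 0))"

definition corner_ext :: "nat \<Rightarrow> 'f::field mat \<Rightarrow> 'f \<Rightarrow> 'f mat" where
  "corner_ext n A u = mat (Suc n) (Suc n)
     (\<lambda>(i, j). if i < n \<and> j < n then A $$ (i, j) else if i = n \<and> j = n then u else 0)"

definition corner :: "nat \<Rightarrow> 'f mat \<Rightarrow> 'f mat" where
  "corner n C = mat n n (\<lambda>(i, j). C $$ (i, j))"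

lemma perm_mat_carrier [simp]: "perm_mat n p \<in> carrier_mat n n"
  and add_last_col_carrier [simp]: "add_last_col n c \<in> carrier_mat (Suc n) (Suc n)"
  and corner_ext_carrier [simp]: "corner_ext n A u \<in> carrier_mat (Suc n) (Suc n)"
  and corner_carrier [simp]: "corner n C \<in> carrier_mat n n"
  by (simp_all add: perm_mat_def add_last_col_def corner_ext_def corner_def)

lemma perm_mat_dims [simp]: "dim_row (perm_mat n p) = n" "dim_col (perm_mat n p) = n"
  and add_last_col_dims [simp]: "dim_row (add_last_col n c) = Suc n" "dim_col (add_last_col n c) = Suc n"
  and corner_ext_dims [simp]: "dim_row (corner_ext n A u) = Suc n" "dim_col (corner_ext n A u) = Suc n"
  and corner_dims [simp]: "dim_row (corner n C) = n" "dim_col (corner n C) = n"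
  and mat_diag_dims [simp]: "dim_row (mat_diag n d) = n" "dim_col (mat_diag n d) = n"
  by (simp_all add: perm_mat_def add_last_col_def corner_ext_def corner_def mat_diag_def)

lemma square_mult_carrier [simp]:
  "A \<in> carrier_mat n n \<Longrightarrow> B \<in> carrier_mat n n \<Longrightarrow> A * B \<in> carrier_mat n n"
  by (rule mult_carrier_mat)

lemma mult_mat_entry:
  "A \<in> carrier_mat a b \<Longrightarrow> B \<in> carrier_mat b c \<Longrightarrow> i < a \<Longrightarrow> j < c \<Longrightarrow>
    (A * B) $$ (i, j) = (\<Sum>k<b. A $$ (i, k) * B $$ (k, j))"
  by (auto simp: scalar_prod_def atLeast0LessThan intro!: sum.cong)

declare index_mult_mat(1) [simp del]

lemma mult_perm_mat:
  assumes "A \<in> carrier_mat r n" "i < r" "j < n" "p j < n"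
  shows "(A * perm_mat n p) $$ (i, j) = A $$ (i, p j)"
proof -
  have "(A * perm_mat n p) $$ (i, j) = (\<Sum>k<n. A $$ (i, k) * (if k = p j then 1 else 0))"
    using assms by (subst mult_mat_entry[of _ r n _ n]) (auto simp: perm_mat_def intro!: sum.cong)
  also have "\<dots> = A $$ (i, p j)"
    using assms by (simp add: if_distrib[of "(*) _"] cong: if_cong)
  finally show ?thesis .
qed

lemma mult_add_last_col:
  assumes "A \<in> carrier_mat r (Suc n)" "i < r" "j < Suc n"
  shows "(A * add_last_col n c) $$ (i, j) = A $$ (i, j) + A $$ (i, n) * c j"
proof -
  have "(A * add_last_col n c) $$ (i, j) =
      (\<Sum>k<Suc n. A $$ (i, k) * (if k = j then 1 else 0) + A $$ (i, k) * (if k = n then c j else 0))"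
    using assms by (subst mult_mat_entry[of _ r "Suc n" _ "Suc n"])
      (auto simp: add_last_col_def algebra_simps simp del: sum.lessThan_Suc intro!: sum.cong)
  also have "\<dots> = A $$ (i, j) + A $$ (i, n) * c j"
    unfolding sum.distrib using assms
    by (simp add: if_distrib[of "(*) _"] del: sum.lessThan_Suc cong: if_cong)
  finally show ?thesis .
qed

lemma mult_corner_ext:
  assumes "C \<in> carrier_mat (Suc n) (Suc n)" "A \<in> carrier_mat n n"
  shows "i < n \<Longrightarrow> j < n \<Longrightarrow> (C * corner_ext n A u) $$ (i, j) = (corner n C * A) $$ (i, j)"
    "j < n \<Longrightarrow> (\<And>k. k < n \<Longrightarrow> C $$ (n, k) = 0) \<Longrightarrow> (C * corner_ext n A u) $$ (n, j) = 0"
    "i < Suc n \<Longrightarrow> (C * corner_ext n A u) $$ (i, n) = C $$ (i, n) * u"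
proof -
  have *: "(C * corner_ext n A u) $$ (i, j) = (\<Sum>k<n. C $$ (i, k) * corner_ext n A u $$ (k, j)) +
      C $$ (i, n) * corner_ext n A u $$ (n, j)" if "i < Suc n" "j < Suc n" for i j
    using assms that by (subst mult_mat_entry[of _ "Suc n" "Suc n" _ "Suc n"]) auto
  show "i < n \<Longrightarrow> j < n \<Longrightarrow> (C * corner_ext n A u) $$ (i, j) = (corner n C * A) $$ (i, j)"
    using assms by (subst *, simp, simp, subst mult_mat_entry[of _ n n _ n])
      (auto simp: corner_ext_def corner_def intro!: sum.cong)
  show "j < n \<Longrightarrow> (\<And>k. k < n \<Longrightarrow> C $$ (n, k) = 0) \<Longrightarrow> (C * corner_ext n A u) $$ (n, j) = 0"
    by (subst *) (auto simp: corner_ext_def)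
  show "i < Suc n \<Longrightarrow> (C * corner_ext n A u) $$ (i, n) = C $$ (i, n) * u"
    by (subst *) (auto simp: corner_ext_def)
qed

lemma corner_ext_mult:
  assumes "A \<in> carrier_mat n n" "B \<in> carrier_mat n n"
  shows "corner_ext n A u * corner_ext n B x = corner_ext n (A * B) (u * x)"
proof (rule eq_matI)
  fix i j assume "i < dim_row (corner_ext n (A * B) (u * x))" "j < dim_col (corner_ext n (A * B) (u * x))"
  then have ij: "i < Suc n" "j < Suc n" by (auto simp: corner_ext_def)
  have c: "corner n (corner_ext n A u) = A"
    using assms by (intro eq_matI) (auto simp: corner_def corner_ext_def)
  consider "i < n" "j < n" | "i = n" "j < n" | "j = n" using ij by linarith
  then show "(corner_ext n A u * corner_ext n B x) $$ (i, j) = corner_ext n (A * B) (u * x) $$ (i, j)"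
  proof cases
    case 1
    then show ?thesis
      using mult_corner_ext(1)[OF corner_ext_carrier assms(2), of i j A u x] ij c by (simp add: corner_ext_def[of n "A * B"])
  next
    case 2
    then show ?thesis
      using mult_corner_ext(2)[OF corner_ext_carrier assms(2), of j A u x] ij
      by (simp add: corner_ext_def[of n "A * B"]) (simp add: corner_ext_def)
  next
    case 3
    then show ?thesis
      using mult_corner_ext(3)[OF corner_ext_carrier assms(2), of i A u x] ij
      by (simp add: corner_ext_def[of n "A * B"]) (simp add: corner_ext_def)
  qed
qed (auto simp: corner_ext_def)

lemma corner_ext_one: "corner_ext n (1\<^sub>m n) 1 = 1\<^sub>m (Suc n)"
  by (intro eq_matI) (auto simp: corner_ext_def)

lemma corner_ext_diag: "corner_ext n (mat_diag n d) u = mat_diag (Suc n) (d(n := u))"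
  by (intro eq_matI) (auto simp: corner_ext_def mat_diag_def)

lemma det_mat_diag: "det (mat_diag n d) = (\<Prod>i<n. d i :: 'f::field)"
proof -
  have "upper_triangular (mat_diag n d)"
    by (auto simp: mat_diag_def)
  then show ?thesis
    by (subst det_upper_triangular[of _ n])
      (auto simp: diag_mat_def mat_diag_def atLeast0LessThan prod.list_conv_set_nth intro!: prod.cong)
qed

lemma minv_mat_diag:
  assumes "\<And>i. i < n \<Longrightarrow> d i \<noteq> (0 :: 'f::field)"
  shows "minv (mat_diag n d) = mat_diag n (\<lambda>i. inverse (d i))"
proof (rule right_inverse_unique(2)[symmetric])
  show "mat_diag n d * mat_diag n (\<lambda>i. inverse (d i)) = 1\<^sub>m n"
    unfolding mat_diag_diag using assms by (auto simp: mat_diag_def intro!: eq_matI)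
qed auto

context local_field_unif
begin

lemma GL_intI:
  assumes "A \<in> M 0 n n" "B \<in> M 0 n n" "A * B = 1\<^sub>m n"
  shows "A \<in> GL_int v n"
proof -
  note u = right_inverse_unique[OF M_carrier[OF assms(1)] M_carrier[OF assms(2)] assms(3)]
  have "A \<in> carrier (GL n)"
    using u(1) M_carrier[OF assms(1)] by (simp add: carrier_GL)
  then show ?thesis
    using assms u(2) by (simp add: GL_int_iff_inv)
qed

lemma GL_int_perm_mat:
  assumes p: "p permutes {..<n}"
  shows "perm_mat n p \<in> GL_int v n"
proof (rule GL_intI)
  show "perm_mat n p \<in> M 0 n n" "perm_mat n (inv_into UNIV p) \<in> M 0 n n"
    by (auto intro!: MI simp: perm_mat_def)
  show "perm_mat n p * perm_mat n (inv_into UNIV p) = 1\<^sub>m n"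
  proof (rule eq_matI)
    fix i j assume ij: "i < dim_row (1\<^sub>m n)" "j < dim_col (1\<^sub>m n)"
    have j: "inv_into UNIV p j < n"
      using permutes_in_image[OF permutes_inv[OF p], of j] ij by simp
    have "p (inv_into UNIV p j) = j"
      using p by (rule permutes_inverses)
    then show "(perm_mat n p * perm_mat n (inv_into UNIV p)) $$ (i, j) = 1\<^sub>m n $$ (i, j)"
      using ij j by (subst mult_perm_mat[of _ n]) (auto simp: perm_mat_def)
  qed (auto simp: perm_mat_def)
qed

lemma GL_int_add_last_col:
  assumes "c n = 0" "\<And>j. j < n \<Longrightarrow> c j \<in> I 0"
  shows "add_last_col n c \<in> GL_int v (Suc n)"
proof (rule GL_intI)
  have M: "add_last_col n c \<in> M 0 (Suc n) (Suc n)" if "c n = 0" "\<And>j. j < n \<Longrightarrow> c j \<in> I 0" for c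
  proof (rule MI)
    fix i j assume "i < Suc n" "j < Suc n"
    then show "add_last_col n c $$ (i, j) \<in> I 0"
      using that by (cases "j = n") (auto simp: add_last_col_def)
  qed simp
  show "add_last_col n c \<in> M 0 (Suc n) (Suc n)" "add_last_col n (\<lambda>j. - c j) \<in> M 0 (Suc n) (Suc n)"
    using assms by (auto intro!: M)
  show "add_last_col n c * add_last_col n (\<lambda>j. - c j) = 1\<^sub>m (Suc n)"
  proof (rule eq_matI)
    fix i j assume "i < dim_row (1\<^sub>m (Suc n))" "j < dim_col (1\<^sub>m (Suc n))"
    then have ij: "i < Suc n" "j < Suc n" by auto
    then show "(add_last_col n c * add_last_col n (\<lambda>j. - c j)) $$ (i, j) = 1\<^sub>m (Suc n) $$ (i, j)"
      unfolding mult_add_last_col[OF add_last_col_carrier ij] using assms(1) by (simp add: add_last_col_def)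
  qed auto
qed

lemma GL_int_corner_ext:
  assumes "A \<in> GL_int v n" "u \<in> int_units v"
  shows "corner_ext n A u \<in> GL_int v (Suc n)"
proof (rule GL_intI)
  note a = GL_int_D[OF assms(1)]
  show "corner_ext n A u \<in> M 0 (Suc n) (Suc n)" "corner_ext n (minv A) (inverse u) \<in> M 0 (Suc n) (Suc n)"
    using M_entry[OF a(3)] M_entry[OF a(4)] assms(2) by (auto intro!: MI simp: corner_ext_def int_units_def)
  show "corner_ext n A u * corner_ext n (minv A) (inverse u) = 1\<^sub>m (Suc n)"
    using corner_ext_mult[OF a(1,5), of u "inverse u"] minv(2)[OF a(1,2)] assms(2) corner_ext_one
    by (simp add: int_units_def)
qed

lemma GL_int_transpose: "A \<in> GL_int v n \<Longrightarrow> transpose_mat A \<in> GL_int v n"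
  using GL_int_D(1)[of A n] by (auto simp: GL_int_iff det_transpose frac_mat_def)

text \<open>The pivot has minimal valuation in its row, so the quotients by it are integral and the
  column operations stay inside the integral general linear group.\<close>

lemma clear_last_row:
  assumes A: "A \<in> carrier_mat (Suc n) (Suc n)" and ne: "A $$ (n, n) \<noteq> 0"
    and min: "\<And>j. j < n \<Longrightarrow> A $$ (n, j) \<in> I (v (A $$ (n, n)))"
  obtains E where "E \<in> GL_int v (Suc n)" "\<And>j. j < n \<Longrightarrow> (A * E) $$ (n, j) = 0"
    "\<And>i. i < Suc n \<Longrightarrow> (A * E) $$ (i, n) = A $$ (i, n)"
proof
  define c where "c j = (if j = n then 0 else - (A $$ (n, j) / A $$ (n, n)))" for j
  have c: "c n = 0" "c j \<in> I 0" if "j < n" for j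
    using min[OF that] ne I_scale[OF ne, of "A $$ (n, j) / A $$ (n, n)" "v (A $$ (n, n))"] by (auto simp: c_def)
  show "add_last_col n c \<in> GL_int v (Suc n)"
    using c by (intro GL_int_add_last_col) (auto simp: c_def)
  show "(A * add_last_col n c) $$ (n, j) = 0" if "j < n" for j
    using that ne by (simp add: mult_add_last_col[OF A] c_def)
  show "(A * add_last_col n c) $$ (i, n) = A $$ (i, n)" if "i < Suc n" for i
    using that by (simp add: mult_add_last_col[OF A] c_def)
qed

lemma swap_permutes: "i < n \<Longrightarrow> j < n \<Longrightarrow> Transposition.transpose i j permutes {..<n}"
  by (rule permutes_swap_id) auto

lemma ex_min_val:
  assumes "finite S" "x \<in> S" "f x \<noteq> 0"
  obtains y where "y \<in> S" "f y \<noteq> 0" "\<And>z. z \<in> S \<Longrightarrow> f z \<in> I (v (f y))"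
proof -
  define T where "T = {y \<in> S. f y \<noteq> 0}"
  have T: "finite T" "T \<noteq> {}"
    using assms by (auto simp: T_def)
  define y where "y = arg_min_on (\<lambda>y. v (f y)) T"
  have "y \<in> T"
    unfolding y_def by (rule arg_min_if_finite[OF T])
  moreover have "v (f y) \<le> v (f z)" if "z \<in> T" for z
    using arg_min_least[OF T that, of "\<lambda>y. v (f y)"] by (simp add: y_def)
  ultimately show ?thesis
    by (intro that[of y]) (auto simp: T_def frac_ideal_def)
qed

text \<open>An entry of minimal valuation in the last row is swapped to the corner and clears the
  rest of that row; the remaining upper left block is still invertible, and induction applies to
  it.\<close>

theorem iwasawa:
  "A \<in> carrier (GL n) \<Longrightarrow> \<exists>k\<in>GL_int v n. upper_triangular (A * k)"
proof (induction n arbitrary: A)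
  case 0
  then show ?case
    using GL_int_one[of 0] by (intro bexI[of _ "1\<^sub>m 0"]) (auto simp: carrier_GL)
next
  case (Suc n)
  have A: "A \<in> carrier_mat (Suc n) (Suc n)" "det A \<noteq> 0"
    using Suc.prems by (auto simp: carrier_GL)
  have "\<exists>j<Suc n. A $$ (n, j) \<noteq> 0"
  proof (rule ccontr)
    assume z: "\<not> ?thesis"
    have "(A * minv A) $$ (n, n) = (\<Sum>k<Suc n. A $$ (n, k) * minv A $$ (k, n))"
      using A minv(1)[OF A] by (intro mult_mat_entry) auto
    also have "\<dots> = 0"
      using z by (intro sum.neutral) auto
    finally show False
      using minv(2)[OF A] by simp
  qed
  then obtain j0 where j0: "j0 < Suc n" "A $$ (n, j0) \<noteq> 0" by auto
  obtain j where j: "j \<in> {..<Suc n}" "A $$ (n, j) \<noteq> 0" "\<And>z. z \<in> {..<Suc n} \<Longrightarrow> A $$ (n, z) \<in> I (v (A $$ (n, j)))"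
    using ex_min_val[of "{..<Suc n}" j0 "\<lambda>j. A $$ (n, j)"] j0 by auto
  define p where "p = Transposition.transpose j n"
  have p: "p permutes {..<Suc n}"
    using j unfolding p_def by (intro swap_permutes) auto
  define B where "B = A * perm_mat (Suc n) p"
  note k1 = GL_int_perm_mat[OF p]
  have pj: "p z < Suc n" if "z < Suc n" for z
    using permutes_in_image[OF p, of z] that by simp
  have B: "B \<in> carrier_mat (Suc n) (Suc n)" "B $$ (n, z) = A $$ (n, p z)" if "z < Suc n" for z
    using A that pj by (auto simp: B_def mult_perm_mat[OF A(1)])
  have "B $$ (n, n) = A $$ (n, j)"
    using B(2)[of n] by (simp add: p_def)
  then obtain E where E: "E \<in> GL_int v (Suc n)" "\<And>j. j < n \<Longrightarrow> (B * E) $$ (n, j) = 0"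
    using clear_last_row[of B n] B(1)[of 0] B(2) j pj by (metis less_SucI lessThan_iff zero_less_Suc)
  define C where "C = B * E"
  note E' = GL_int_D[OF E(1)] and k1' = GL_int_D[OF k1]
  have C: "C \<in> carrier_mat (Suc n) (Suc n)"
    using B(1)[of 0] E' by (simp add: C_def)
  have "det C = det A * det (perm_mat (Suc n) p :: 'f mat) * det E"
    unfolding C_def B_def using A E' k1' by (simp add: det_mult[of _ "Suc n"])
  then have dC: "det C \<noteq> 0"
    using A E' k1' by simp
  have "C = four_block_mat (corner n C) (mat n 1 (\<lambda>(i,j). C $$ (i, n))) (0\<^sub>m 1 n) (mat 1 1 (\<lambda>_. C $$ (n, n)))"
    using C E(2) by (intro eq_matI) (auto simp: corner_def C_def less_Suc_eq)
  then have "det C = det (corner n C) * det (mat 1 1 (\<lambda>_. C $$ (n, n)))"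
    using det_four_block_mat_lower_left_zero[of "corner n C" n "mat n 1 (\<lambda>(i,j). C $$ (i, n))" 1 "0\<^sub>m 1 n"
        "mat 1 1 (\<lambda>_. C $$ (n, n))"] by simp
  with dC have "corner n C \<in> carrier (GL n)"
    by (simp add: carrier_GL)
  from Suc.IH[OF this] obtain k where k: "k \<in> GL_int v n" "upper_triangular (corner n C * k)" by auto
  note k' = GL_int_D[OF k(1)]
  have up: "upper_triangular (C * corner_ext n k 1)"
  proof (rule upper_triangularI)
    fix i j assume ij: "j < i" "i < dim_row (C * corner_ext n k 1)"
    then have ij': "j < i" "i < Suc n" using C by auto
    show "(C * corner_ext n k 1) $$ (i, j) = 0"
    proof (cases "i = n")
      case True
      then show ?thesis using mult_corner_ext(2)[OF C k'(1), of j] ij' E(2) by (simp add: C_def)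
    next
      case False
      then have "(C * corner_ext n k 1) $$ (i, j) = (corner n C * k) $$ (i, j)"
        using mult_corner_ext(1)[OF C k'(1), of i j] ij' by simp
      also have "\<dots> = 0"
        using False ij' k'(1) by (intro upper_triangularD[OF k(2)]) (auto simp: corner_def)
      finally show ?thesis .
    qed
  qed
  have "C * corner_ext n k 1 = A * (perm_mat (Suc n) p * (E * corner_ext n k 1))"
    unfolding C_def B_def using A(1) E'(1) by (simp add: assoc_mult_mat[of _ "Suc n" "Suc n" _ "Suc n" _ "Suc n"])
  moreover have "perm_mat (Suc n) p * (E * corner_ext n k 1) \<in> GL_int v (Suc n)"
    using k1 E(1) k(1) by (intro GL_int_mult GL_int_corner_ext) (auto simp: int_units_iff)
  ultimately show ?case
    using up by metis
qed

text \<open>The pivot is an entry of minimal valuation in the whole matrix. Every later operation is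
  integral, so all entries stay in \<open>M e\<close> and the pivot keeps dividing both its row and
  its column.\<close>

lemma cartan_step:
  assumes A: "A \<in> carrier_mat (Suc n) (Suc n)" and ne: "A \<noteq> 0\<^sub>m (Suc n) (Suc n)"
  obtains P Q B e where "P \<in> GL_int v (Suc n)" "Q \<in> GL_int v (Suc n)" "B \<in> M e n n"
    "P * A * Q = corner_ext n B (w powi e)" "A \<in> M e (Suc n) (Suc n)"
proof -
  let ?N = "Suc n" and ?S = "{..<Suc n} \<times> {..<Suc n}"
  have "\<exists>x\<in>?S. A $$ x \<noteq> 0"
  proof (rule ccontr)
    assume "\<not> ?thesis"
    then have "A = 0\<^sub>m ?N ?N" using A by (intro eq_matI) auto
    with ne show False by simp
  qed
  then obtain x0 where x0: "x0 \<in> ?S" "A $$ x0 \<noteq> 0" by auto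
  obtain x where x: "x \<in> ?S" "A $$ x \<noteq> 0" "\<And>z. z \<in> ?S \<Longrightarrow> A $$ z \<in> I (v (A $$ x))"
    using ex_min_val[of ?S x0 "\<lambda>x. A $$ x"] x0 by (metis finite_SigmaI finite_lessThan)
  obtain i j where ij: "x = (i, j)" "i < ?N" "j < ?N" using x(1) by auto
  define e where "e = v (A $$ x)"
  have Ae: "A \<in> M e ?N ?N"
    using x(3) A by (intro MI) (auto simp: e_def)
  define p r where "p = Transposition.transpose j n" and "r = Transposition.transpose i n"
  have p: "p permutes {..<?N}" and r: "r permutes {..<?N}"
    using ij unfolding p_def r_def by (auto intro!: swap_permutes)
  note Q1 = GL_int_perm_mat[OF p] and R1 = GL_int_transpose[OF GL_int_perm_mat[OF r]]
  let ?Q1 = "perm_mat ?N p :: 'f mat" and ?R1 = "perm_mat ?N r :: 'f mat"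
  \<comment> \<open>Permuting columns of the transpose permutes rows; together the two permutations
    move the pivot to the lower right corner.\<close>
  define A1 where "A1 = transpose_mat (transpose_mat (A * ?Q1) * ?R1)"
  have A1c: "A1 \<in> carrier_mat ?N ?N" using A by (simp add: A1_def)
  have A1eq: "A1 = transpose_mat ?R1 * (A * ?Q1)"
    unfolding A1_def using A by (subst transpose_mult[of _ ?N ?N _ ?N]) auto
  have A1nn: "A1 $$ (n, n) = A $$ x"
  proof -
    have "A1 $$ (n, n) = (transpose_mat (A * ?Q1) * ?R1) $$ (n, n)"
      unfolding A1_def using A by auto
    also have "\<dots> = transpose_mat (A * ?Q1) $$ (n, i)"
      using A ij by (subst mult_perm_mat[of _ ?N]) (auto simp: r_def)
    also have "\<dots> = (A * ?Q1) $$ (i, n)"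
      using A ij by auto
    also have "\<dots> = A $$ (i, j)"
      using A ij by (subst mult_perm_mat[of _ ?N]) (auto simp: p_def)
    finally show ?thesis by (simp add: ij)
  qed
  have "A * ?Q1 \<in> M e ?N ?N"
    using M_GL_int_right[OF Q1 A] Ae by simp
  then have A1e: "A1 \<in> M e ?N ?N"
    unfolding A1eq using M_GL_int_left[OF R1, of "A * ?Q1" ?N] A by simp
  obtain E where E: "E \<in> GL_int v ?N" "\<And>j. j < n \<Longrightarrow> (A1 * E) $$ (n, j) = 0"
      "\<And>i. i < ?N \<Longrightarrow> (A1 * E) $$ (i, n) = A1 $$ (i, n)"
    using clear_last_row[of A1 n] A1c A1nn x(2) M_entry[OF A1e] by (metis e_def less_SucI lessI)
  note E' = GL_int_D[OF E(1)]
  define A2 where "A2 = transpose_mat (A1 * E)"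
  have A2c: "A2 \<in> carrier_mat ?N ?N" using A1c E' by (simp add: A2_def)
  have A1Ee: "A1 * E \<in> M e ?N ?N" using M_GL_int_right[OF E(1) A1c] A1e by simp
  have A2e: "A2 \<in> M e ?N ?N"
    using M_entry[OF A1Ee] A1c E' by (intro MI) (auto simp: A2_def)
  have A2i: "A2 $$ (a, b) = (A1 * E) $$ (b, a)" if "a < ?N" "b < ?N" for a b
    using that A1c E' by (simp add: A2_def)
  have A2nn: "A2 $$ (n, n) = A $$ x"
    using A2i[of n n] E(3)[of n] A1nn by simp
  obtain G where G: "G \<in> GL_int v ?N" "\<And>j. j < n \<Longrightarrow> (A2 * G) $$ (n, j) = 0"
      "\<And>i. i < ?N \<Longrightarrow> (A2 * G) $$ (i, n) = A2 $$ (i, n)"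
    using clear_last_row[of A2 n] A2c A2nn x(2) M_entry[OF A2e] by (metis e_def less_SucI lessI)
  note G' = GL_int_D[OF G(1)]
  define A3 where "A3 = transpose_mat (A2 * G)"
  have A3c: "A3 \<in> carrier_mat ?N ?N" using A2c G' by (simp add: A3_def)
  have A3i: "A3 $$ (a, b) = (A2 * G) $$ (b, a)" if "a < ?N" "b < ?N" for a b
    using that A2c G' by (simp add: A3_def)
  have "A2 * G \<in> M e ?N ?N" using M_GL_int_right[OF G(1) A2c] A2e by simp
  then have A3e: "A3 \<in> M e ?N ?N"
    using M_entry[of "A2 * G" e ?N ?N] A2c G' by (intro MI) (auto simp: A3_def)
  have A3n: "A3 $$ (a, n) = 0" if "a < n" for a
    using A3i[of a n] G(2)[OF that] that by simp
  have A3n': "A3 $$ (n, a) = (if a = n then A $$ x else 0)" if "a < ?N" for a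
    using A3i[of n a] G(3)[OF that] that A2i[of a n] E(2)[of a] A2nn by auto
  have A3eq: "A3 = corner_ext n (corner n A3) (A $$ x)"
    using A3c A3n A3n' by (intro eq_matI) (auto simp: corner_ext_def corner_def less_Suc_eq)
  \<comment> \<open>The pivot equals \<open>w powi e\<close> up to a unit; this unit is absorbed
    into the right factor.\<close>
  define u where "u = w powi e / A $$ x"
  have u: "u \<in> int_units v"
    using x(2) by (simp add: u_def int_units_iff val_divide e_def)
  define S where "S = corner_ext n (1\<^sub>m n) u"
  have S: "S \<in> GL_int v ?N"
    unfolding S_def using GL_int_one u by (rule GL_int_corner_ext)
  have A3S: "A3 * S = corner_ext n (corner n A3) (w powi e)"
    unfolding S_def by (subst A3eq, subst corner_ext_mult)
      (use x(2) right_mult_one_mat[OF corner_carrier, of n A3] in \<open>auto simp: u_def\<close>)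
  have GT: "transpose_mat G \<in> GL_int v ?N" using G(1) by (rule GL_int_transpose)
  have A3': "A3 = transpose_mat G * (A1 * E)"
    unfolding A3_def using transpose_mult[OF A2c G'(1)] A1c E' by (simp add: A2_def)
  have c: "?Q1 \<in> carrier_mat ?N ?N" "transpose_mat ?R1 \<in> carrier_mat ?N ?N" "E \<in> carrier_mat ?N ?N"
      "transpose_mat G \<in> carrier_mat ?N ?N" "S \<in> carrier_mat ?N ?N"
    using E' G' S GL_int_D(1) by auto
  note as = assoc_mult_mat[of _ ?N ?N _ ?N _ ?N]
  have "A3 * S = transpose_mat G * transpose_mat ?R1 * A * (?Q1 * E * S)"
    unfolding A3' A1eq using A c by (simp add: as)
  then have "transpose_mat G * transpose_mat ?R1 * A * (?Q1 * E * S) = corner_ext n (corner n A3) (w powi e)"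
    using A3S by simp
  moreover have "corner n A3 \<in> M e n n"
    using M_entry[OF A3e] by (intro MI) (auto simp: corner_def)
  moreover have "transpose_mat G * transpose_mat ?R1 \<in> GL_int v ?N" "?Q1 * E * S \<in> GL_int v ?N"
    using GT R1 Q1 E(1) S by (auto intro!: GL_int_mult)
  ultimately show ?thesis
    using that Ae by blast
qed

text \<open>Valuations decrease along the diagonal, so the last entry divides all the others. Zero
  counts as infinite valuation, whence the clause that puts zeros first.\<close>

definition elementary_divisors :: "nat \<Rightarrow> (nat \<Rightarrow> 'f) \<Rightarrow> bool" where
  "elementary_divisors n d \<longleftrightarrow>
     (\<forall>i<n. d i = 0 \<or> (\<exists>e. d i = w powi e)) \<and>
     (\<forall>i<n. \<forall>j<n. i \<le> j \<longrightarrow> d j \<noteq> 0 \<longrightarrow> d i \<in> I (v (d j))) \<and>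
     (\<forall>i<n. \<forall>j<n. i \<le> j \<longrightarrow> d j = 0 \<longrightarrow> d i = 0)"

text \<open>Singular matrices are included on purpose: base points arise by diagonalizing an upper
  right block, which may be singular. Induction works because the corner split off by
  \<open>cartan_step\<close> divides the entire remaining block.\<close>

theorem cartan:
  "A \<in> carrier_mat n n \<Longrightarrow> \<exists>P\<in>GL_int v n. \<exists>Q\<in>GL_int v n. \<exists>d. P * A * Q = mat_diag n d \<and>
     elementary_divisors n d"
proof (induction n arbitrary: A)
  case 0
  then show ?case
    using GL_int_one[of 0] by (intro bexI[of _ "1\<^sub>m 0"] exI[of _ "\<lambda>_. 0"]) (auto simp: elementary_divisors_def)
next
  case (Suc n)
  let ?N = "Suc n"
  show ?case
  proof (cases "A = 0\<^sub>m ?N ?N")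
    case True
    have "1\<^sub>m ?N * A * 1\<^sub>m ?N = mat_diag ?N (\<lambda>_. 0)"
      using True by (auto simp: mat_diag_def intro!: eq_matI)
    then show ?thesis
      using GL_int_one[of ?N] by (intro bexI[of _ "1\<^sub>m ?N"] exI[of _ "\<lambda>_. 0"]) (auto simp: elementary_divisors_def)
  next
    case False
    obtain P Q B e where *: "P \<in> GL_int v ?N" "Q \<in> GL_int v ?N" "B \<in> M e n n"
      "P * A * Q = corner_ext n B (w powi e)" "A \<in> M e ?N ?N"
      using cartan_step[OF Suc.prems False] by blast
    note B = M_carrier[OF *(3)]
    from Suc.IH[OF B] obtain P' Q' d where
      P': "P' \<in> GL_int v n" and Q': "Q' \<in> GL_int v n" and eq: "P' * B * Q' = mat_diag n d" and
      ed: "elementary_divisors n d" by blast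
    have d: "\<forall>i<n. d i = 0 \<or> (\<exists>e. d i = w powi e)"
        "\<forall>i<n. \<forall>j<n. i \<le> j \<longrightarrow> d j \<noteq> 0 \<longrightarrow> d i \<in> I (v (d j))"
        "\<forall>i<n. \<forall>j<n. i \<le> j \<longrightarrow> d j = 0 \<longrightarrow> d i = 0"
      using ed by (simp_all add: elementary_divisors_def)
    note p' = GL_int_D[OF P'] and q' = GL_int_D[OF Q'] and p = GL_int_D[OF *(1)] and q = GL_int_D[OF *(2)]
    have "P' * B * Q' \<in> M e n n"
      using M_mult0(2)[OF M_mult0(1)[OF p'(3) *(3)] q'(3)] .
    then have dI: "d i \<in> I e" if "i < n" for i
      using M_entry[of "mat_diag n d" e n n i i] that by (simp add: eq mat_diag_def)
    let ?d = "d(n := w powi e)"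
    have "corner_ext n P' 1 * P * A * (Q * corner_ext n Q' 1) = corner_ext n P' 1 * (P * A * Q) * corner_ext n Q' 1"
      using p q Suc.prems by (simp add: assoc_mult_mat[of _ ?N ?N _ ?N _ ?N])
    also have "\<dots> = mat_diag ?N ?d"
      unfolding *(4) using p' q' B by (simp add: corner_ext_mult corner_ext_diag eq)
    finally have 1: "corner_ext n P' 1 * P * A * (Q * corner_ext n Q' 1) = mat_diag ?N ?d" .
    have 2: "corner_ext n P' 1 * P \<in> GL_int v ?N" "Q * corner_ext n Q' 1 \<in> GL_int v ?N"
      using P' Q' * by (auto intro!: GL_int_mult GL_int_corner_ext simp: int_units_iff)
    have 3: "\<forall>i<?N. ?d i = 0 \<or> (\<exists>e. ?d i = w powi e)"
      using d by auto
    have 4: "\<forall>i<?N. \<forall>j<?N. i \<le> j \<longrightarrow> ?d j \<noteq> 0 \<longrightarrow> ?d i \<in> I (v (?d j))"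
    proof (intro allI impI)
      fix i j assume "i < ?N" "j < ?N" "i \<le> j" "?d j \<noteq> 0"
      then show "?d i \<in> I (v (?d j))"
        using d(2) dI by (cases "j = n"; cases "i = n") (auto simp: I_iff_val)
    qed
    have 5: "\<forall>i<?N. \<forall>j<?N. i \<le> j \<longrightarrow> ?d j = 0 \<longrightarrow> ?d i = 0"
      using d(3) by (auto simp: less_Suc_eq)
    show ?thesis
      using 3 4 5 by (intro bexI[OF _ 2(1)] bexI[OF _ 2(2)] exI[of _ ?d] conjI 1)
        (simp add: elementary_divisors_def)
  qed
qed

corollary cartan_GL:
  assumes A: "A \<in> carrier (GL n)"
  obtains P Q e where "P \<in> GL_int v n" "Q \<in> GL_int v n" "P * A * Q = mat_diag n (\<lambda>i. w powi e i)"
    "\<And>i j. i \<le> j \<Longrightarrow> j < n \<Longrightarrow> e j \<le> e i"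
proof -
  obtain P Q d where *: "P \<in> GL_int v n" "Q \<in> GL_int v n" "P * A * Q = mat_diag n d"
     "elementary_divisors n d"
    using cartan[of A n] A[unfolded carrier_GL] by auto
  have ed1: "d i = 0 \<or> (\<exists>e. d i = w powi e)" if "i < n" for i
    using *(4) that unfolding elementary_divisors_def by blast
  have ed2: "d i \<in> I (v (d j))" if "j < n" "i \<le> j" "d j \<noteq> 0" for i j
    using *(4) that unfolding elementary_divisors_def by (meson le_less_trans)
  note p = GL_int_D[OF *(1)] and q = GL_int_D[OF *(2)]
  have "det (mat_diag n d) = det P * det A * det Q"
    unfolding *(3)[symmetric] using A p q by (simp add: det_mult[of _ n] carrier_GL)
  then have "(\<Prod>i<n. d i) \<noteq> 0"
    using A p q by (simp add: det_mat_diag carrier_GL)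
  then have nz: "d i \<noteq> 0" if "i < n" for i
    using that by auto
  have d: "d i = w powi v (d i)" if i: "i < n" for i
  proof -
    obtain e where "d i = w powi e" using ed1[OF i] nz[OF i] by blast
    then show ?thesis by simp
  qed
  have "P * A * Q = mat_diag n (\<lambda>i. w powi v (d i))"
    unfolding *(3) by (intro eq_matI) (auto simp: mat_diag_def intro: d)
  moreover have "v (d j) \<le> v (d i)" if "i \<le> j" "j < n" for i j
    using ed2[OF that(2,1) nz[OF that(2)]] nz[of i] that by (simp add: I_iff_val)
  ultimately show ?thesis
    using that[of P Q "\<lambda>i. v (d i)"] *(1,2) by blast
qed

end

section \<open>Totally disconnected locally compact groups\<close>

text \<open>The left cosets of the subgroups \<open>U N\<close> form a basis of the topology and the
  sets \<open>B N\<close> are a compact exhaustion starting with a subgroup. In the applications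
  \<open>U N\<close> are congruence subgroups and \<open>B 0\<close> is the group of integral
  points, that is, K, U or their analogues.\<close>

locale td_group = group G for G :: "'a monoid" (structure) +
  fixes X :: "'a topology" and U B :: "nat \<Rightarrow> 'a set"
  assumes U_subgroup: "subgroup (U N) G"
    and U_antimono: "U (Suc N) \<subseteq> U N"
    and openin_iff: "openin X S \<longleftrightarrow> S \<subseteq> carrier G \<and> (\<forall>g\<in>S. \<exists>N. \<forall>u\<in>U N. g \<otimes> u \<in> S)"
    and U_conj: "g \<in> carrier G \<Longrightarrow> \<exists>M. \<forall>u\<in>U M. g \<otimes> u \<otimes> inv g \<in> U N"
    and B_subgroup: "subgroup (B 0) G"
    and U_le_B: "U 0 \<subseteq> B 0"
    and B_compact: "compactin X (B N)"
    and B_mono: "B N \<subseteq> B (Suc N)"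
    and B_cover: "g \<in> carrier G \<Longrightarrow> \<exists>N. g \<in> B N"
    and B_mult: "\<exists>L. \<forall>a\<in>B M. \<forall>b\<in>B N. a \<otimes> b \<in> B L"
begin

text \<open>A combinatorial form of "compact and open". Uniform right invariance under one
  \<open>U N\<close> makes the set and its complement open; containment in one \<open>B N\<close>
  then gives compactness.\<close>

definition nice :: "'a set \<Rightarrow> bool" where
  "nice S \<longleftrightarrow> S \<subseteq> carrier G \<and> (\<exists>N. \<forall>g\<in>S. \<forall>u\<in>U N. g \<otimes> u \<in> S) \<and> (\<exists>N. S \<subseteq> B N)"

lemma niceI:
  "S \<subseteq> carrier G \<Longrightarrow> (\<And>g u. g \<in> S \<Longrightarrow> u \<in> U N \<Longrightarrow> g \<otimes> u \<in> S) \<Longrightarrow> S \<subseteq> B L \<Longrightarrow> nice S"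
  unfolding nice_def by blast

lemma topspace_X: "topspace X = carrier G"
proof -
  have "openin X (carrier G)"
    unfolding openin_iff using subgroup.subset[OF U_subgroup] by blast
  moreover have "topspace X \<subseteq> carrier G"
    using openin_topspace[of X] unfolding openin_iff by blast
  ultimately show ?thesis
    using openin_subset by blast
qed

lemma U_le: "M \<le> N \<Longrightarrow> U N \<subseteq> U M"
  by (rule lift_Suc_antimono_le[of U]) (use U_antimono in auto)

lemma B_le: "M \<le> N \<Longrightarrow> B M \<subseteq> B N"
  by (rule lift_Suc_mono_le[of B]) (use B_mono in auto)

lemma B_carrier: "B N \<subseteq> carrier G"
  using compactin_subset_topspace[OF B_compact] topspace_X by blast

lemma U_carrier: "U N \<subseteq> carrier G"
  using subgroup.subset[OF U_subgroup] .

lemma nice_carrier: "nice S \<Longrightarrow> S \<subseteq> carrier G"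
  by (simp add: nice_def)

lemma nice_open: "nice S \<Longrightarrow> openin X S"
  unfolding nice_def openin_iff by blast

lemma nice_closed:
  assumes "nice S"
  shows "closedin X S"
proof -
  from assms obtain N L where S: "S \<subseteq> carrier G" "\<forall>g\<in>S. \<forall>u\<in>U N. g \<otimes> u \<in> S" "S \<subseteq> B L"
    by (auto simp: nice_def)
  have "openin X (carrier G - S)"
    unfolding openin_iff
  proof (intro conjI ballI exI[of _ N])
    fix g u assume g: "g \<in> carrier G - S" and u: "u \<in> U N"
    have uc: "u \<in> carrier G" using u U_carrier by blast
    have "g \<otimes> u \<notin> S"
    proof
      assume "g \<otimes> u \<in> S"
      then have "g \<otimes> u \<otimes> inv u \<in> S"
        using S(2) subgroup.m_inv_closed[OF U_subgroup u] by blast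
      then show False
        using g uc by (simp add: m_assoc)
    qed
    then show "g \<otimes> u \<in> carrier G - S" using g uc by simp
  qed auto
  then show "closedin X S"
    using S(1) unfolding closedin_def topspace_X by blast
qed

lemma nice_compact:
  assumes "nice S"
  shows "compactin X S"
proof -
  obtain L where L: "S \<subseteq> B L" using assms by (auto simp: nice_def)
  show ?thesis by (rule closed_compactin[OF B_compact L nice_closed[OF assms]])
qed

lemma nice_compactly_supported:
  assumes "nice S" "\<And>g. g \<in> carrier G \<Longrightarrow> f g \<noteq> 0 \<longleftrightarrow> g \<in> S"
  shows "compactly_supported X f"
proof -
  have "{g \<in> topspace X. f g \<noteq> 0} = S"
    using assms nice_carrier[OF assms(1)] by (auto simp: topspace_X)
  then show ?thesis
    using nice_closed[OF assms(1)] nice_compact[OF assms(1)]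
    by (simp add: compactly_supported_def closure_of_closedin)
qed

lemma nice_B0: "nice (B 0)"
  using B_carrier subgroup.m_closed[OF B_subgroup] U_le_B by (intro niceI[of _ 0 0]) blast+

lemma nice_l_coset:
  assumes "nice S" "g \<in> carrier G"
  shows "nice (g <#\<^bsub>G\<^esub> S)"
proof -
  from assms obtain N L where S: "S \<subseteq> carrier G" "\<forall>g\<in>S. \<forall>u\<in>U N. g \<otimes> u \<in> S" "S \<subseteq> B L"
    by (auto simp: nice_def)
  obtain K where K: "g \<in> B K" using B_cover assms by blast
  obtain R where R: "\<forall>a\<in>B K. \<forall>b\<in>B L. a \<otimes> b \<in> B R" using B_mult by blast
  show ?thesis
  proof (rule niceI[of _ N R])
    show "g <#\<^bsub>G\<^esub> S \<subseteq> carrier G" using assms S(1) by (auto simp: l_coset_def)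
    show "g <#\<^bsub>G\<^esub> S \<subseteq> B R" using R K S(3) by (auto simp: l_coset_def)
    fix x u assume x: "x \<in> g <#\<^bsub>G\<^esub> S" and u: "u \<in> U N"
    then obtain s where s: "s \<in> S" "x = g \<otimes> s" by (auto simp: l_coset_def)
    have "x \<otimes> u = g \<otimes> (s \<otimes> u)"
      using s S(1) assms u U_carrier by (auto simp: m_assoc subset_iff)
    then show "x \<otimes> u \<in> g <#\<^bsub>G\<^esub> S" using s u S(2) by (auto simp: l_coset_def)
  qed
qed

text \<open>Right translation by g conjugates the subgroup of right invariance;
  \<open>U_conj\<close> supplies a smaller \<open>U M\<close> whose conjugate by g lies in the given
  one.\<close>

lemma nice_r_coset:
  assumes "nice S" "g \<in> carrier G"
  shows "nice (S #> g)"
proof -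
  from assms obtain N L where S: "S \<subseteq> carrier G" "\<forall>g\<in>S. \<forall>u\<in>U N. g \<otimes> u \<in> S" "S \<subseteq> B L"
    by (auto simp: nice_def)
  obtain K where K: "g \<in> B K" using B_cover assms by blast
  obtain R where R: "\<forall>a\<in>B L. \<forall>b\<in>B K. a \<otimes> b \<in> B R" using B_mult by blast
  obtain M where M: "\<forall>u\<in>U M. g \<otimes> u \<otimes> inv g \<in> U N" using U_conj assms by blast
  show ?thesis
  proof (rule niceI[of _ M R])
    show "S #> g \<subseteq> carrier G" using assms S(1) by (auto simp: r_coset_def)
    show "S #> g \<subseteq> B R" using R K S(3) by (auto simp: r_coset_def)
    fix x u assume x: "x \<in> S #> g" and u: "u \<in> U M"
    then obtain s where s: "s \<in> S" "x = s \<otimes> g" by (auto simp: r_coset_def)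
    have c: "s \<in> carrier G" "u \<in> carrier G" using s S(1) u U_carrier by auto
    have "s \<otimes> (g \<otimes> u \<otimes> inv g) \<in> S" using s u S(2) M by blast
    moreover have "x \<otimes> u = s \<otimes> (g \<otimes> u \<otimes> inv g) \<otimes> g"
      using s c assms by (simp add: m_assoc)
    ultimately show "x \<otimes> u \<in> S #> g" by (auto simp: r_coset_def)
  qed
qed

lemma nice_Int:
  assumes "nice S" "nice T"
  shows "nice (S \<inter> T)"
proof -
  from assms obtain N L M where S: "S \<subseteq> carrier G" "\<forall>g\<in>S. \<forall>u\<in>U N. g \<otimes> u \<in> S" "S \<subseteq> B L"
    "\<forall>g\<in>T. \<forall>u\<in>U M. g \<otimes> u \<in> T"
    by (auto simp: nice_def)
  moreover have "U (max M N) \<subseteq> U M \<inter> U N" using U_le by simp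
  ultimately show ?thesis
    by (intro niceI[of _ "max M N" L]) blast+
qed

text \<open>A nice set containing the identity contains some \<open>U N\<close>, so right invariance
  under it is uniform invariance in the sense of \<open>nice\<close>.\<close>

lemma nice_invariantI:
  assumes W: "nice W" "\<one> \<in> W" and S: "S \<subseteq> carrier G" "S \<subseteq> B L"
    and inv: "\<And>g h. g \<in> S \<Longrightarrow> h \<in> W \<Longrightarrow> g \<otimes> h \<in> S"
  shows "nice S"
proof -
  from W obtain N where N: "\<forall>g\<in>W. \<forall>u\<in>U N. g \<otimes> u \<in> W"
    by (auto simp: nice_def)
  have "U N \<subseteq> W"
  proof
    fix u assume u: "u \<in> U N"
    then have "\<one> \<otimes> u \<in> W" using N W(2) by blast
    then show "u \<in> W" using u U_carrier[of N] by auto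
  qed
  then show ?thesis
    unfolding nice_def using S inv by blast
qed

lemma nice_subset:
  assumes "nice T" "S \<subseteq> T" "nice W" "\<one> \<in> W" "\<And>g h. g \<in> S \<Longrightarrow> h \<in> W \<Longrightarrow> g \<otimes> h \<in> S"
  shows "nice S"
proof -
  obtain L where "T \<subseteq> B L" "T \<subseteq> carrier G" using assms(1) by (auto simp: nice_def)
  then show ?thesis
    using assms by (intro nice_invariantI[of W S L]) auto
qed

lemma compact_open_nice: "nice S \<Longrightarrow> subgroup S G \<Longrightarrow> compact_open_subgroup G X S"
  using nice_open nice_compact by (simp add: compact_open_subgroup_def)

lemma l_coset_memI: "a \<in> S \<Longrightarrow> g \<otimes> a \<in> g <#\<^bsub>G\<^esub> S"
  by (auto simp: l_coset_def)

lemma r_coset_memI: "a \<in> S \<Longrightarrow> a \<otimes> g \<in> S #> g"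
  by (auto simp: r_coset_def)

lemma l_coset_self: "subgroup W G \<Longrightarrow> g \<in> carrier G \<Longrightarrow> g \<in> g <#\<^bsub>G\<^esub> W"
  using l_coset_memI[of "\<one>" W g] subgroup.one_closed by fastforce

lemma l_coset_eq_iff:
  assumes "subgroup W G" "g \<in> carrier G" "h \<in> carrier G"
  shows "g <#\<^bsub>G\<^esub> W = h <#\<^bsub>G\<^esub> W \<longleftrightarrow> h \<in> g <#\<^bsub>G\<^esub> W"
  using l_repr_independence[of h g W] l_coset_self[of W h] assms by auto

lemma l_coset_mem_iff:
  assumes "subgroup W G" "g \<in> carrier G" "h \<in> carrier G"
  shows "h \<in> g <#\<^bsub>G\<^esub> W \<longleftrightarrow> inv g \<otimes> h \<in> W"
proof
  assume "h \<in> g <#\<^bsub>G\<^esub> W"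
  then obtain x where "x \<in> W" "h = g \<otimes> x" by (auto simp: l_coset_def)
  then show "inv g \<otimes> h \<in> W"
    using assms subgroup.subset[OF assms(1)] by (auto simp: m_assoc[symmetric] subset_iff)
next
  assume "inv g \<otimes> h \<in> W"
  then have "g \<otimes> (inv g \<otimes> h) \<in> g <#\<^bsub>G\<^esub> W" by (rule l_coset_memI)
  then show "h \<in> g <#\<^bsub>G\<^esub> W" using assms by (simp add: m_assoc[symmetric])
qed

text \<open>The cosets meeting a compact set form a disjoint open cover of it.\<close>

lemma finite_cosets_compact:
  assumes C: "compactin X C" and W: "subgroup W G" "nice W"
  shows "finite ((\<lambda>g. g <#\<^bsub>G\<^esub> W) ` C)"
proof -
  have Cc: "C \<subseteq> carrier G" using compactin_subset_topspace[OF C] topspace_X by simp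
  let ?F = "(\<lambda>g. g <#\<^bsub>G\<^esub> W) ` C"
  have cov: "C \<subseteq> \<Union>?F"
  proof
    fix x assume "x \<in> C"
    then show "x \<in> \<Union>?F" using l_coset_self[OF W(1), of x] Cc by (intro UnionI[of "x <#\<^bsub>G\<^esub> W"]) auto
  qed
  have op: "openin X T" if "T \<in> ?F" for T
  proof -
    from that obtain g where g: "g \<in> C" "T = g <#\<^bsub>G\<^esub> W" by (elim imageE)
    then show ?thesis using nice_open[OF nice_l_coset[OF W(2), of g]] Cc by auto
  qed
  obtain F where F: "finite F" "F \<subseteq> ?F" "C \<subseteq> \<Union>F"
    using C[unfolded compactin_def, THEN conjunct2, rule_format, OF conjI[OF _ cov]] op by metis
  have "?F \<subseteq> F"
  proof
    fix T assume "T \<in> ?F"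
    then obtain g where g: "g \<in> C" "T = g <#\<^bsub>G\<^esub> W" by (elim imageE)
    then obtain Z where Z: "Z \<in> F" "g \<in> Z" using F(3) by (meson UnionE subsetD)
    with F(2) obtain h where h: "h \<in> C" "Z = h <#\<^bsub>G\<^esub> W" by (meson imageE subsetD)
    have "h <#\<^bsub>G\<^esub> W = g <#\<^bsub>G\<^esub> W"
      using l_coset_eq_iff[OF W(1), of h g] g h Z Cc by (simp add: subset_iff)
    with g h Z show "T \<in> F" by simp
  qed
  then show ?thesis using F(1) finite_subset by blast
qed

end

text \<open>The groups G, H and G x T are iterated products of the unit group of F and of general
  linear groups, so the structure has to be checked for these two factors alone.\<close>

lemma td_group_DirProd:
  assumes "td_group G X U B" "td_group H Y V C"
  shows "td_group (G \<times>\<times> H) (prod_topology X Y) (\<lambda>N. U N \<times> V N) (\<lambda>N. B N \<times> C N)"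
proof -
  interpret G: td_group G X U B by fact
  interpret H: td_group H Y V C by fact
  interpret GH: group "G \<times>\<times> H" by (intro DirProd_group) unfold_locales
  show ?thesis
  proof (intro td_group.intro td_group_axioms.intro GH.is_group)
    show "subgroup (U N \<times> V N) (G \<times>\<times> H)" for N
      by (rule DirProd_subgroups) (use G.U_subgroup H.U_subgroup G.is_group H.is_group in auto)
    show "subgroup (B 0 \<times> C 0) (G \<times>\<times> H)"
      by (rule DirProd_subgroups) (use G.B_subgroup H.B_subgroup G.is_group H.is_group in auto)
    show "U (Suc N) \<times> V (Suc N) \<subseteq> U N \<times> V N" for N
      using G.U_antimono H.U_antimono by blast
    show "B N \<times> C N \<subseteq> B (Suc N) \<times> C (Suc N)" for N
      using G.B_mono H.B_mono by blast
    show "U 0 \<times> V 0 \<subseteq> B 0 \<times> C 0"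
      using G.U_le_B H.U_le_B by blast
    show "compactin (prod_topology X Y) (B N \<times> C N)" for N
      using G.B_compact H.B_compact by (simp add: compactin_Times)
    show "\<exists>M. \<forall>u\<in>U M \<times> V M. g \<otimes>\<^bsub>G \<times>\<times> H\<^esub> u \<otimes>\<^bsub>G \<times>\<times> H\<^esub> inv\<^bsub>G \<times>\<times> H\<^esub> g \<in> U N \<times> V N"
      if gc: "g \<in> carrier (G \<times>\<times> H)" for g N
    proof -
      obtain a b where g: "g = (a, b)" "a \<in> carrier G" "b \<in> carrier H" using gc by (cases g) (auto simp: DirProd_def)
      obtain M1 where M1: "\<forall>u\<in>U M1. a \<otimes>\<^bsub>G\<^esub> u \<otimes>\<^bsub>G\<^esub> inv\<^bsub>G\<^esub> a \<in> U N" using G.U_conj g by blast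
      obtain M2 where M2: "\<forall>u\<in>V M2. b \<otimes>\<^bsub>H\<^esub> u \<otimes>\<^bsub>H\<^esub> inv\<^bsub>H\<^esub> b \<in> V N" using H.U_conj g by blast
      show ?thesis
        using M1 M2 G.U_le[of M1 "max M1 M2"] H.U_le[of M2 "max M1 M2"] g
        by (intro exI[of _ "max M1 M2"]) (auto simp: inv_DirProd[OF G.is_group H.is_group])
    qed
    show "\<exists>N. g \<in> B N \<times> C N" if gc: "g \<in> carrier (G \<times>\<times> H)" for g
    proof -
      obtain a b where g: "g = (a, b)" "a \<in> carrier G" "b \<in> carrier H" using gc by (cases g) (auto simp: DirProd_def)
      obtain M1 where M1: "a \<in> B M1" using G.B_cover g by blast
      obtain M2 where M2: "b \<in> C M2" using H.B_cover g by blast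
      show ?thesis
        using M1 M2 G.B_le[of M1 "max M1 M2"] H.B_le[of M2 "max M1 M2"] g
        by (intro exI[of _ "max M1 M2"]) auto
    qed
    show "\<exists>L. \<forall>a\<in>B M \<times> C M. \<forall>b\<in>B N \<times> C N. a \<otimes>\<^bsub>G \<times>\<times> H\<^esub> b \<in> B L \<times> C L" for M N
    proof -
      obtain L1 where L1: "\<forall>a\<in>B M. \<forall>b\<in>B N. a \<otimes>\<^bsub>G\<^esub> b \<in> B L1" using G.B_mult by blast
      obtain L2 where L2: "\<forall>a\<in>C M. \<forall>b\<in>C N. a \<otimes>\<^bsub>H\<^esub> b \<in> C L2" using H.B_mult by blast
      show ?thesis
        using L1 L2 G.B_le[of L1 "max L1 L2"] H.B_le[of L2 "max L1 L2"]
        by (intro exI[of _ "max L1 L2"]) auto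
    qed
    show "openin (prod_topology X Y) S \<longleftrightarrow> S \<subseteq> carrier (G \<times>\<times> H) \<and>
        (\<forall>g\<in>S. \<exists>N. \<forall>u\<in>U N \<times> V N. g \<otimes>\<^bsub>G \<times>\<times> H\<^esub> u \<in> S)" for S
    proof (intro iffI conjI ballI)
      assume o: "openin (prod_topology X Y) S"
      then show "S \<subseteq> carrier (G \<times>\<times> H)"
        using openin_subset[OF o] by (simp add: G.topspace_X H.topspace_X)
      fix g assume g: "g \<in> S"
      obtain a b where ab: "g = (a, b)" by (cases g)
      obtain S1 S2 where S: "openin X S1" "openin Y S2" "a \<in> S1" "b \<in> S2" "S1 \<times> S2 \<subseteq> S"
        using o[unfolded openin_prod_topology_alt, rule_format, of a b] g ab by auto
      obtain M1 where M1: "\<forall>u\<in>U M1. a \<otimes>\<^bsub>G\<^esub> u \<in> S1" using S(1,3) unfolding G.openin_iff by blast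
      obtain M2 where M2: "\<forall>u\<in>V M2. b \<otimes>\<^bsub>H\<^esub> u \<in> S2" using S(2,4) unfolding H.openin_iff by blast
      show "\<exists>N. \<forall>u\<in>U N \<times> V N. g \<otimes>\<^bsub>G \<times>\<times> H\<^esub> u \<in> S"
        using M1 M2 G.U_le[of M1 "max M1 M2"] H.U_le[of M2 "max M1 M2"] ab
        by (intro exI[of _ "max M1 M2"]) (auto intro!: subsetD[OF S(5)])
    next
      assume S: "S \<subseteq> carrier (G \<times>\<times> H) \<and> (\<forall>g\<in>S. \<exists>N. \<forall>u\<in>U N \<times> V N. g \<otimes>\<^bsub>G \<times>\<times> H\<^esub> u \<in> S)"
      show "openin (prod_topology X Y) S"
        unfolding openin_prod_topology_alt
      proof (intro allI impI)
        fix a b assume ab: "(a, b) \<in> S"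
        then obtain N where N: "\<forall>u\<in>U N \<times> V N. (a, b) \<otimes>\<^bsub>G \<times>\<times> H\<^esub> u \<in> S" using S by blast
        have c: "a \<in> carrier G" "b \<in> carrier H" using S ab by auto
        have op: "openin X (a <#\<^bsub>G\<^esub> U N)" "openin Y (b <#\<^bsub>H\<^esub> V N)"
        proof -
          have "a <#\<^bsub>G\<^esub> U N \<subseteq> carrier G" using c G.U_carrier by (auto simp: l_coset_def)
          moreover have "x \<otimes>\<^bsub>G\<^esub> u \<in> a <#\<^bsub>G\<^esub> U N" if "x \<in> a <#\<^bsub>G\<^esub> U N" "u \<in> U N" for x u
          proof -
            obtain y where y: "y \<in> U N" "x = a \<otimes>\<^bsub>G\<^esub> y" using \<open>x \<in> a <#\<^bsub>G\<^esub> U N\<close> by (auto simp: l_coset_def)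
            then have "x \<otimes>\<^bsub>G\<^esub> u = a \<otimes>\<^bsub>G\<^esub> (y \<otimes>\<^bsub>G\<^esub> u)" using c that G.U_carrier[of N] by (auto simp: G.m_assoc subset_iff)
            then show ?thesis using G.l_coset_memI[OF subgroup.m_closed[OF G.U_subgroup y(1) that(2)]] by simp
          qed
          ultimately show "openin X (a <#\<^bsub>G\<^esub> U N)" unfolding G.openin_iff by blast
          have "b <#\<^bsub>H\<^esub> V N \<subseteq> carrier H" using c H.U_carrier by (auto simp: l_coset_def)
          moreover have "x \<otimes>\<^bsub>H\<^esub> u \<in> b <#\<^bsub>H\<^esub> V N" if "x \<in> b <#\<^bsub>H\<^esub> V N" "u \<in> V N" for x u
          proof -
            obtain y where y: "y \<in> V N" "x = b \<otimes>\<^bsub>H\<^esub> y" using \<open>x \<in> b <#\<^bsub>H\<^esub> V N\<close> by (auto simp: l_coset_def)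
            then have "x \<otimes>\<^bsub>H\<^esub> u = b \<otimes>\<^bsub>H\<^esub> (y \<otimes>\<^bsub>H\<^esub> u)" using c that H.U_carrier[of N] by (auto simp: H.m_assoc subset_iff)
            then show ?thesis using H.l_coset_memI[OF subgroup.m_closed[OF H.U_subgroup y(1) that(2)]] by simp
          qed
          ultimately show "openin Y (b <#\<^bsub>H\<^esub> V N)" unfolding H.openin_iff by blast
        qed
        have "(a <#\<^bsub>G\<^esub> U N) \<times> (b <#\<^bsub>H\<^esub> V N) \<subseteq> S"
          using N by (auto simp: l_coset_def)
        then show "\<exists>U V. openin X U \<and> openin Y V \<and> a \<in> U \<and> b \<in> V \<and> U \<times> V \<subseteq> S"
          by (intro exI[of _ "a <#\<^bsub>G\<^esub> U N"] exI[of _ "b <#\<^bsub>H\<^esub> V N"] conjI op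
              G.l_coset_self[OF G.U_subgroup c(1)] H.l_coset_self[OF H.U_subgroup c(2)])
      qed
    qed
  qed
qed

section \<open>Topology of the field, of its unit group and of the general linear groups\<close>

context local_field_unif
begin

text \<open>A ball of level j is the union of the q balls of level j + 1 around its digits: the
  branching step of the compactness argument.\<close>

lemma ball_split:
  assumes "y - x \<in> I j"
  shows "\<exists>r\<in>res_reps. y - (x + w powi j * r) \<in> I (j + 1)"
proof -
  have "w powi (- j) * (y - x) \<in> I 0"
    using assms by (simp only: I_w_scale) simp
  then obtain r where r: "r \<in> res_reps" "w powi (- j) * (y - x) - r \<in> I 1"
    using res_reps(2) by blast
  have "w powi j * (w powi (- j) * (y - x) - r) \<in> I (j + 1)"
    using r(2) by (simp only: I_w_scale) simp
  moreover have "w powi j * (w powi (- j) * (y - x) - r) = y - (x + w powi j * r)"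
    by (simp add: algebra_simps power_int_minus)
  ultimately show ?thesis using r by auto
qed

text \<open>Nested balls: a ball that is not finitely covered contains, since there are finitely
  many digits, a ball of the next level with the same defect. The centres form a Cauchy sequence,
  completeness gives a limit, and one open set around the limit swallows a late ball.\<close>

lemma compactin_frac_ideal: "compactin (field_topology v) (I k)"
  unfolding compactin_def
proof (intro conjI allI impI)
  fix \<U> assume U: "(\<forall>T\<in>\<U>. openin (field_topology v) T) \<and> I k \<subseteq> \<Union>\<U>"
  have op: "openin (field_topology v) T" if "T \<in> \<U>" for T
    using that U by auto
  have cov: "I k \<subseteq> \<Union>\<U>"
    using U by auto
  define bad where "bad x j \<longleftrightarrow> \<not> (\<exists>F. finite F \<and> F \<subseteq> \<U> \<and> {y. y - x \<in> I j} \<subseteq> \<Union>F)" for x j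
  have step: "\<exists>y. y - x \<in> I j \<and> bad y (j + 1)" if b: "bad x j" for x j
  proof (rule ccontr)
    assume no: "\<not> ?thesis"
    have "\<exists>F. finite F \<and> F \<subseteq> \<U> \<and> {y. y - (x + w powi j * r) \<in> I (j + 1)} \<subseteq> \<Union>F" if "r \<in> res_reps" for r
    proof -
      have "(x + w powi j * r) - x \<in> I j"
        using that res_reps(1) by (auto simp: I_w_scale)
      then have "\<not> bad (x + w powi j * r) (j + 1)" using no by blast
      then show ?thesis unfolding bad_def by (simp only: not_not)
    qed
    then obtain F where F: "\<And>r. r \<in> res_reps \<Longrightarrow> finite (F r) \<and> F r \<subseteq> \<U> \<and>
        {y. y - (x + w powi j * r) \<in> I (j + 1)} \<subseteq> \<Union>(F r)"
      by metis
    have "finite (\<Union>r\<in>res_reps. F r)" "(\<Union>r\<in>res_reps. F r) \<subseteq> \<U>"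
      using F res_reps(3) by auto
    moreover have "{y. y - x \<in> I j} \<subseteq> \<Union>(\<Union>r\<in>res_reps. F r)"
    proof
      fix y assume "y \<in> {y. y - x \<in> I j}"
      then obtain r where r: "r \<in> res_reps" "y - (x + w powi j * r) \<in> I (j + 1)"
        using ball_split by blast
      have "y \<in> {y. y - (x + w powi j * r) \<in> I (j + 1)}" using r(2) by (rule CollectI)
      then have "y \<in> \<Union>(F r)" using F[OF r(1)] by (meson subsetD)
      then show "y \<in> \<Union>(\<Union>r\<in>res_reps. F r)" using r(1) by blast
    qed
    ultimately show False using b unfolding bad_def by (metis (no_types, lifting))
  qed
  show "\<exists>F. finite F \<and> F \<subseteq> \<U> \<and> I k \<subseteq> \<Union>F"
  proof (rule ccontr)
    assume "\<not> ?thesis"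
    then have b0: "bad 0 k" by (simp add: bad_def)
    have "\<exists>s. \<forall>n. (bad (s n) (k + int n) \<and> s n \<in> I k) \<and> s (Suc n) - s n \<in> I (k + int n)"
    proof (rule dependent_nat_choice)
      show "\<exists>x. bad x (k + int 0) \<and> x \<in> I k" using b0 by (intro exI[of _ 0]) auto
      fix x n assume x: "bad x (k + int n) \<and> x \<in> I k"
      then obtain y where y: "y - x \<in> I (k + int n)" "bad y (k + int n + 1)"
        using step[of x "k + int n"] by blast
      have "y - x \<in> I k" using y(1) by (rule frac_ideal_mono[rotated]) simp
      then have "(y - x) + x \<in> I k" using x by (intro I_add) auto
      then show "\<exists>y. (bad y (k + int (Suc n)) \<and> y \<in> I k) \<and> y - x \<in> I (k + int n)"
        using y by (intro exI[of _ y]) (simp add: ac_simps)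
    qed
    then obtain s where s: "\<And>n. bad (s n) (k + int n)" "\<And>n. s (Suc n) - s n \<in> I (k + int n)"
        "\<And>n. s n \<in> I k" by blast
    have near: "s (n + d) - s n \<in> I (k + int n)" for n d
    proof (induction d)
      case (Suc d)
      have "s (Suc (n + d)) - s (n + d) \<in> I (k + int n)"
        using s(2)[of "n + d"] frac_ideal_mono[of "k + int n" "k + int (n + d)"] by auto
      then show ?case using Suc I_diff_trans by fastforce
    qed simp
    have near': "s m - s n \<in> I (k + int n)" if "m \<ge> n" for m n
      using near[of n "m - n"] that by simp
    have cauchy: "\<exists>N. \<forall>i\<ge>N. \<forall>j\<ge>N. s i - s j \<in> I l" for l
    proof (intro exI[of _ "nat (l - k)"] allI impI)
      fix i j assume ij: "nat (l - k) \<le> i" "nat (l - k) \<le> j"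
      have 1: "s a - s (nat (l - k)) \<in> I l" if "nat (l - k) \<le> a" for a
        using near'[OF that] by (rule frac_ideal_mono[rotated]) simp
      have "s i - s (nat (l - k)) - (s j - s (nat (l - k))) \<in> I l"
        using I_diff[OF 1[OF ij(1)] 1[OF ij(2)]] .
      then show "s i - s j \<in> I l" by simp
    qed
    from complete[OF cauchy] obtain l where l: "\<And>j. \<exists>N. \<forall>i\<ge>N. s i - l \<in> I j" by blast
    have sl: "\<exists>N. s N - l \<in> I j \<and> N \<ge> K" for j K
      using l[of j] by (metis linear)
    obtain N0 where "s N0 - l \<in> I k" using sl by blast
    from I_diff[OF s(3)[of N0] this] have "l \<in> I k" by simp
    then have "l \<in> \<Union>\<U>" using cov by blast
    then obtain T where T: "T \<in> \<U>" "l \<in> T" by blast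
    obtain j where j: "\<forall>y. y - l \<in> I j \<longrightarrow> y \<in> T"
      using op[OF T(1)] T(2) unfolding openin_field_topology by blast
    \<comment> \<open>Both conditions are required: \<open>s N\<close> is close to the limit, and
      the ball of level \<open>k + int N\<close> around it is small enough to lie in the ball of
      level j around the limit, hence in \<open>T\<close>.\<close>
    obtain N where N: "s N - l \<in> I j" "N \<ge> nat (j - k)" using sl by blast
    have "y \<in> T" if "y - s N \<in> I (k + int N)" for y
    proof -
      have "y - s N \<in> I j" using that by (rule frac_ideal_mono[rotated]) (use N(2) in linarith)
      then show ?thesis using j I_diff_trans[OF _ N(1)] by blast
    qed
    then have "\<not> bad (s N) (k + int N)"
      unfolding bad_def using T(1) by (intro notI) (auto dest!: spec[of _ "{T}"])
    then show False using s(1) by blast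
  qed
qed simp

text \<open>The shift by one makes the whole filtration start inside the units, so that
  \<open>mult_U 0\<close> is already a subgroup of \<open>mult_B 0\<close>. The same shift occurs in
  \<open>GL_U\<close>.\<close>

definition mult_U :: "nat \<Rightarrow> 'f set" where "mult_U N = {x. x - 1 \<in> I (int N + 1)}"

definition mult_B :: "nat \<Rightarrow> 'f set" where "mult_B N = {x. x \<noteq> 0 \<and> \<bar>v x\<bar> \<le> int N}"

definition GL_U :: "nat \<Rightarrow> nat \<Rightarrow> 'f mat set" where
  "GL_U n N = {A \<in> carrier_mat n n. A - 1\<^sub>m n \<in> M (int N + 1) n n}"

text \<open>Bounding the inverse together with the matrix keeps the determinant away from 0; this
  makes the set closed in the space of all matrices, and therefore compact.\<close>

definition GL_B :: "nat \<Rightarrow> nat \<Rightarrow> 'f mat set" where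
  "GL_B n N = {A \<in> carrier (GL n). A \<in> M (- int N) n n \<and> minv A \<in> M (- int N) n n}"

lemma mult_U_unit: "x \<in> mult_U N \<Longrightarrow> x \<noteq> 0 \<and> v x = 0"
  using unit_congruent[of 1 x] frac_ideal_mono[of 1 "int N + 1" "x - 1" v]
  by (auto simp: mult_U_def int_units_iff)

lemma mult_B0: "mult_B 0 = int_units v"
  by (auto simp: mult_B_def int_units_iff)

lemma carrier_mult_group: "carrier mult_group = UNIV - {0}"
  and mult_mult_group [simp]: "x \<otimes>\<^bsub>mult_group\<^esub> y = x * y"
  and one_mult_group [simp]: "\<one>\<^bsub>mult_group\<^esub> = 1"
  by (simp_all add: mult_group_def)

lemma inv_mult_group: "x \<noteq> 0 \<Longrightarrow> inv\<^bsub>mult_group\<^esub> x = inverse x"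
  by (rule group.inv_equality[OF group_mult_group]) (auto simp: carrier_mult_group)

lemma subgroup_mult_U: "subgroup (mult_U N) mult_group"
proof (rule group.subgroupI[OF group_mult_group])
  show "mult_U N \<subseteq> carrier mult_group"
    using mult_U_unit by (auto simp: carrier_mult_group)
  show "mult_U N \<noteq> {}"
    by (auto simp: mult_U_def intro!: exI[of _ 1])
  fix x y assume x: "x \<in> mult_U N" and y: "y \<in> mult_U N"
  note u = mult_U_unit[OF x] mult_U_unit[OF y]
  have "x * (y - 1) \<in> I (int N + 1)"
    using u y by (simp add: I_scale mult_U_def)
  then have "x * (y - 1) + (x - 1) \<in> I (int N + 1)"
    using x by (intro I_add) (simp_all add: mult_U_def)
  then show "x \<otimes>\<^bsub>mult_group\<^esub> y \<in> mult_U N"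
    by (simp add: mult_U_def algebra_simps)
next
  fix x assume x: "x \<in> mult_U N"
  note u = mult_U_unit[OF x]
  have "inverse x * (x - 1) \<in> I (int N + 1)"
    using u x by (simp add: I_scale mult_U_def val_inverse)
  then have "- (inverse x * (x - 1)) \<in> I (int N + 1)" by (simp only: I_minus)
  then show "inv\<^bsub>mult_group\<^esub> x \<in> mult_U N"
    using u by (simp add: inv_mult_group mult_U_def algebra_simps)
qed

text \<open>Around a nonzero x the additive ball of level N + 1 + v x is the multiplicative
  translate of \<open>mult_U N\<close> by x, so both families generate the same open sets.\<close>

lemma openin_mult_topology:
  "openin (mult_topology v) S \<longleftrightarrow> S \<subseteq> carrier mult_group \<and>
     (\<forall>g\<in>S. \<exists>N. \<forall>u\<in>mult_U N. g \<otimes>\<^bsub>mult_group\<^esub> u \<in> S)"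
proof -
  have op0: "openin (field_topology v) (UNIV - {0})"
    unfolding openin_field_topology
  proof
    fix x :: 'f assume "x \<in> UNIV - {0}"
    then show "\<exists>k. \<forall>y. y - x \<in> I k \<longrightarrow> y \<in> UNIV - {0}"
      using val_add_small(1)[of x "- x"] by (intro exI[of _ "v x + 1"]) (auto simp: I_iff_val)
  qed
  have "openin (mult_topology v) S \<longleftrightarrow> S \<subseteq> carrier mult_group \<and> openin (field_topology v) S"
    unfolding mult_topology_def openin_open_subtopology[OF op0] by (auto simp: carrier_mult_group)
  moreover have "(\<exists>k. \<forall>y. y - x \<in> I k \<longrightarrow> y \<in> S) \<longleftrightarrow> (\<exists>N. \<forall>u\<in>mult_U N. x * u \<in> S)" if x: "x \<noteq> 0" for x
  proof
    assume "\<exists>k. \<forall>y. y - x \<in> I k \<longrightarrow> y \<in> S"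
    then obtain k where k: "\<forall>y. y - x \<in> I k \<longrightarrow> y \<in> S" by blast
    have "x * u \<in> S" if "u \<in> mult_U (nat (k - v x))" for u
    proof -
      have "u - 1 \<in> I (k - v x)"
        using that unfolding mult_U_def by (auto intro: frac_ideal_mono[rotated])
      then have "x * (u - 1) \<in> I k" using x by (simp add: I_scale)
      then have "x * u - x \<in> I k" by (simp add: algebra_simps)
      then show ?thesis using k by blast
    qed
    then show "\<exists>N. \<forall>u\<in>mult_U N. x * u \<in> S" by blast
  next
    assume "\<exists>N. \<forall>u\<in>mult_U N. x * u \<in> S"
    then obtain N where N: "\<forall>u\<in>mult_U N. x * u \<in> S" by blast
    have "y \<in> S" if y: "y - x \<in> I (int N + 1 + v x)" for y
    proof -
      have "x * (y / x - 1) \<in> I (int N + 1 + v x)" using y x by (simp add: algebra_simps)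
      then have "y / x \<in> mult_U N" using x by (simp add: I_scale mult_U_def)
      then have "x * (y / x) \<in> S" using N by blast
      then show ?thesis using x by simp
    qed
    then show "\<exists>k. \<forall>y. y - x \<in> I k \<longrightarrow> y \<in> S" by blast
  qed
  ultimately show ?thesis
    unfolding openin_field_topology mult_mult_group by (auto simp: carrier_mult_group subset_iff)
qed

lemma compactin_mult_B: "compactin (mult_topology v) (mult_B N)"
proof -
  have "openin (field_topology v) (UNIV - mult_B N)"
    unfolding openin_field_topology
  proof
    fix x assume x: "x \<in> UNIV - mult_B N"
    have "y \<notin> mult_B N" if "y - x \<in> I (int N + 1)" for y
    proof
      assume y: "y \<in> mult_B N"
      then have "- (y - x) \<in> I (v y + 1)"
        using that by (intro frac_ideal_mono[of "v y + 1" "int N + 1"]) (auto simp: mult_B_def simp del: minus_diff_eq)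
      from val_add_small[OF _ this] y have "x \<noteq> 0 \<and> v x = v y" by (simp add: mult_B_def)
      with x y show False by (simp add: mult_B_def)
    qed
    then show "\<exists>k. \<forall>y. y - x \<in> I k \<longrightarrow> y \<in> UNIV - mult_B N" by blast
  qed
  then have "closedin (field_topology v) (mult_B N)"
    unfolding closedin_def by simp
  moreover have "mult_B N \<subseteq> I (- int N)"
    by (auto simp: mult_B_def I_iff_val)
  ultimately have "compactin (field_topology v) (mult_B N)"
    using closed_compactin[OF compactin_frac_ideal] by blast
  then show ?thesis
    unfolding mult_topology_def compactin_subtopology by (auto simp: mult_B_def)
qed

lemma td_group_mult: "td_group mult_group (mult_topology v) mult_U mult_B"
proof (intro td_group.intro td_group_axioms.intro group_mult_group subgroup_mult_U openin_mult_topology compactin_mult_B)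
  show "mult_U (Suc N) \<subseteq> mult_U N" for N
    by (auto simp: mult_U_def intro: frac_ideal_mono[rotated])
  show "mult_B N \<subseteq> mult_B (Suc N)" for N
    by (auto simp: mult_B_def)
  show "mult_U 0 \<subseteq> mult_B 0"
    using mult_U_unit by (auto simp: mult_B_def)
  show "subgroup (mult_B 0) mult_group"
    by (rule group.subgroupI[OF group_mult_group])
      (auto simp: mult_B_def carrier_mult_group inv_mult_group val_mult val_inverse intro!: exI[of _ 1])
  show "\<exists>M. \<forall>u\<in>mult_U M. g \<otimes>\<^bsub>mult_group\<^esub> u \<otimes>\<^bsub>mult_group\<^esub> inv\<^bsub>mult_group\<^esub> g \<in> mult_U N"
    if "g \<in> carrier mult_group" for g N
  proof -
    have *: "g * u * inverse g = u" for u
      using that by (simp add: carrier_mult_group)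
    show ?thesis
      using that by (intro exI[of _ N]) (simp add: carrier_mult_group inv_mult_group *)
  qed
  show "\<exists>N. g \<in> mult_B N" if "g \<in> carrier mult_group" for g
    using that by (intro exI[of _ "nat \<bar>v g\<bar>"]) (auto simp: carrier_mult_group mult_B_def)
  show "\<exists>L. \<forall>a\<in>mult_B M. \<forall>b\<in>mult_B N. a \<otimes>\<^bsub>mult_group\<^esub> b \<in> mult_B L" for M N
    by (intro exI[of _ "M + N"]) (auto simp: mult_B_def val_mult)
qed

lemma GL_B0: "GL_B n 0 = GL_int v n"
  by (auto simp: GL_B_def GL_int_iff_inv)

lemma GL_U_int: "A \<in> GL_U n N \<Longrightarrow> A \<in> GL_int v n"
  using GL_int_congruent[of A n] M_mono[of 1 "int N + 1"] by (auto simp: GL_U_def)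

lemma mult_minus_one:
  "A \<in> carrier_mat n n \<Longrightarrow> B \<in> carrier_mat n n \<Longrightarrow> A * (B - 1\<^sub>m n) = A * B - (A :: 'f mat)"
  by (simp add: mult_minus_distrib_mat[of _ n n _ n])

lemma subgroup_GL_U: "subgroup (GL_U n N) (GL n)"
proof (rule group.subgroupI[OF group_GL])
  show "GL_U n N \<subseteq> carrier (GL n)"
    using GL_U_int GL_int_D(7) by blast
  have "1\<^sub>m n - 1\<^sub>m n = (0\<^sub>m n n :: 'f mat)" by auto
  then show "GL_U n N \<noteq> {}"
    using M_zero[of n n "int N + 1"] unfolding GL_U_def ex_in_conv[symmetric]
    by (intro exI[of _ "1\<^sub>m n"]) (metis (mono_tags, lifting) mem_Collect_eq one_carrier_mat)
  fix x y assume x: "x \<in> GL_U n N" and y: "y \<in> GL_U n N"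
  note u = GL_int_D[OF GL_U_int[OF x]] GL_int_D[OF GL_U_int[OF y]]
  have "x * (y - 1\<^sub>m n) \<in> M (int N + 1) n n"
    using M_mult0(1)[OF u(3)] y by (simp add: GL_U_def)
  then have "(x * y - x) + (x - 1\<^sub>m n) \<in> M (int N + 1) n n"
    using x mult_minus_one[of x n y] u by (intro M_add) (simp_all add: GL_U_def)
  moreover have "(x * y - x) + (x - 1\<^sub>m n) = x * y - 1\<^sub>m n"
    using u by (intro eq_matI) auto
  ultimately show "x \<otimes>\<^bsub>GL n\<^esub> y \<in> GL_U n N"
    using u by (simp add: GL_U_def)
next
  fix x assume x: "x \<in> GL_U n N"
  note u = GL_int_D[OF GL_U_int[OF x]]
  have "minv x * (x - 1\<^sub>m n) \<in> M (int N + 1) n n"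
    using M_mult0(1)[OF u(4)] x by (simp add: GL_U_def)
  then have "- (1\<^sub>m n - minv x) \<in> M (int N + 1) n n"
    using mult_minus_one[of "minv x" n x] u minv(3)[OF u(1,2)] by (intro M_uminus) simp
  moreover have "- (1\<^sub>m n - minv x) = minv x - 1\<^sub>m n"
    using u by (intro eq_matI) auto
  ultimately show "inv\<^bsub>GL n\<^esub> x \<in> GL_U n N"
    using u by (simp add: GL_U_def inv_GL)
qed

lemma GL_B_mult: "A \<in> GL_B n M' \<Longrightarrow> B \<in> GL_B n N \<Longrightarrow> A * B \<in> GL_B n (M' + N)"
proof -
  assume A: "A \<in> GL_B n M'" and B: "B \<in> GL_B n N"
  have "A * B \<in> M (- int M' + - int N) n n" "minv B * minv A \<in> M (- int N + - int M') n n"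
    using A B M_mult[of A "- int M'" n n B "- int N" n] M_mult[of "minv B" "- int N" n n "minv A" "- int M'" n]
    unfolding GL_B_def by blast+
  moreover have "minv (A * B) = minv B * minv A"
    using A B by (intro minv_mult[of _ n]) (auto simp: GL_B_def carrier_GL)
  ultimately show ?thesis
    using A B mult_GL_carrier[of A n B] by (simp add: GL_B_def algebra_simps)
qed

lemma GL_B_le: "M' \<le> N \<Longrightarrow> GL_B n M' \<subseteq> GL_B n N"
  using M_mono[of "- int N" "- int M'"] by (auto simp: GL_B_def)

lemma ex_M: "A \<in> carrier_mat n m \<Longrightarrow> \<exists>N. A \<in> M (- int N) n m"
proof -
  assume A: "A \<in> carrier_mat n m"
  define S where "S = insert 0 ((\<lambda>ij. \<bar>v (A $$ ij)\<bar>) ` ({..<n} \<times> {..<m}))"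
  have S: "finite S" by (simp add: S_def)
  have "A \<in> M (- int (nat (Max S))) n m"
  proof (rule MI[OF A])
    fix i j assume "i < n" "j < m"
    then have "\<bar>v (A $$ (i, j))\<bar> \<in> S" by (auto simp: S_def)
    then have "\<bar>v (A $$ (i, j))\<bar> \<le> Max S" using S by simp
    then show "A $$ (i, j) \<in> I (- int (nat (Max S)))" by (auto simp: frac_ideal_def)
  qed
  then show ?thesis by blast
qed

lemma GL_B_cover: "A \<in> carrier (GL n) \<Longrightarrow> \<exists>N. A \<in> GL_B n N"
proof -
  assume A: "A \<in> carrier (GL n)"
  obtain N1 where N1: "A \<in> M (- int N1) n n" using ex_M[of A n n] A by (auto simp: carrier_GL)
  obtain N2 where N2: "minv A \<in> M (- int N2) n n" using ex_M[of "minv A" n n] A minv(1)[of A n] by (auto simp: carrier_GL)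
  have "A \<in> GL_B n (max N1 N2)"
    using A M_mono[OF _ N1, of "- int (max N1 N2)"] M_mono[OF _ N2, of "- int (max N1 N2)"] by (simp add: GL_B_def)
  then show ?thesis by blast
qed

text \<open>Passes from additive to multiplicative nearness: multiplying the difference by the
  inverse of g loses at most a levels. In particular a matrix close enough to g is automatically
  invertible.\<close>

lemma GL_U_near:
  assumes g: "g \<in> GL_B n a" and h: "h \<in> carrier_mat n n" "h - g \<in> M (int (N + a) + 1) n n"
  shows "minv g * h \<in> GL_U n N" "g * (minv g * h) = h" "h \<in> carrier (GL n)"
proof -
  have G: "g \<in> carrier_mat n n" "det g \<noteq> 0" "minv g \<in> M (- int a) n n" using g by (auto simp: GL_B_def carrier_GL)
  note i = minv[OF G(1,2)]
  have "minv g * (h - g) \<in> M (- int a + (int (N + a) + 1)) n n"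
    by (rule M_mult[OF G(3) h(2)])
  moreover have "minv g * (h - g) = minv g * h - 1\<^sub>m n"
    using i G h by (simp add: mult_minus_distrib_mat[of _ n n _ n])
  ultimately show U: "minv g * h \<in> GL_U n N" using i h by (simp add: GL_U_def algebra_simps)
  show e: "g * (minv g * h) = h" using mat_cancel_left[OF G(1,2) h(1)] by simp
  have "g * (minv g * h) \<in> carrier (GL n)"
    using mult_GL_carrier[OF _ GL_int_D(7)[OF GL_U_int[OF U]]] g by (simp add: GL_B_def)
  then show "h \<in> carrier (GL n)" by (simp only: e)
qed

abbreviation GL_idx :: "nat \<Rightarrow> (nat \<times> nat) set" where "GL_idx n \<equiv> {..<n} \<times> {..<n}"

definition mat_fun :: "nat \<Rightarrow> 'f mat \<Rightarrow> nat \<times> nat \<Rightarrow> 'f" where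
  "mat_fun n A = (\<lambda>ij\<in>GL_idx n. A $$ ij)"

abbreviation P_top :: "nat \<Rightarrow> (nat \<times> nat \<Rightarrow> 'f) topology" where
  "P_top n \<equiv> product_topology (\<lambda>_. field_topology v) (GL_idx n)"

lemma mat_fun_extensional: "mat_fun n A \<in> extensional (GL_idx n)"
  by (simp add: mat_fun_def)

lemma GL_topology_alt: "GL_topology v n = pullback_topology (carrier (GL n)) (mat_fun n) (P_top n)"
  by (simp add: GL_topology_def mat_fun_def[abs_def])

definition box :: "nat \<Rightarrow> int \<Rightarrow> (nat \<times> nat \<Rightarrow> 'f) \<Rightarrow> (nat \<times> nat \<Rightarrow> 'f) set" where
  "box n k x = (\<Pi>\<^sub>E ij\<in>GL_idx n. {y. y - x ij \<in> I k})"

lemma openin_ball: "openin (field_topology v) {y. y - x \<in> I k}"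
  unfolding openin_field_topology using I_diff_trans by blast

lemma openin_box: "openin (P_top n) (box n k x)"
  unfolding box_def by (subst openin_PiE_gen) (auto simp: openin_ball)

lemma box_mat_fun:
  assumes "A \<in> carrier_mat n n" "B \<in> carrier_mat n n"
  shows "mat_fun n A \<in> box n k (mat_fun n B) \<longleftrightarrow> A - B \<in> M k n n"
  using assms by (auto simp: box_def mat_fun_def frac_mat_def PiE_iff)

text \<open>There are finitely many coordinates, so the maximum of the levels found for them works
  for all at once.\<close>

lemma openin_P_top_imp_box:
  assumes "openin (P_top n) T" "x \<in> T"
  shows "\<exists>k. box n k x \<subseteq> T"
proof -
  obtain Z where Z: "\<forall>i\<in>GL_idx n. openin (field_topology v) (Z i)" "x \<in> Pi\<^sub>E (GL_idx n) Z" "Pi\<^sub>E (GL_idx n) Z \<subseteq> T"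
    using assms(1)[unfolded openin_product_topology_alt, rule_format, OF assms(2)] by (elim exE conjE)
  have "\<forall>ij\<in>GL_idx n. \<exists>k. \<forall>y. y - x ij \<in> I k \<longrightarrow> y \<in> Z ij"
  proof
    fix ij assume ij: "ij \<in> GL_idx n"
    have "openin (field_topology v) (Z ij)" "x ij \<in> Z ij"
      using Z(1) PiE_mem[OF Z(2) ij] ij by blast+
    then show "\<exists>k. \<forall>y. y - x ij \<in> I k \<longrightarrow> y \<in> Z ij"
      unfolding openin_field_topology by blast
  qed
  then obtain k where k: "\<And>ij. ij \<in> GL_idx n \<Longrightarrow> \<forall>y. y - x ij \<in> I (k ij) \<longrightarrow> y \<in> Z ij" by metis
  define K where "K = Max (insert 0 (k ` GL_idx n))"
  have K: "k ij \<le> K" if "ij \<in> GL_idx n" for ij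
    unfolding K_def using that by (intro Max_ge) auto
  have "box n K x \<subseteq> Pi\<^sub>E (GL_idx n) Z"
    unfolding box_def
  proof (rule PiE_mono)
    fix ij assume ij: "ij \<in> GL_idx n"
    show "{y. y - x ij \<in> I K} \<subseteq> Z ij"
      using k[OF ij] frac_ideal_mono[OF K[OF ij]] by blast
  qed
  then show ?thesis using Z(3) by blast
qed

lemma openin_GL_topology:
  "openin (GL_topology v n) S \<longleftrightarrow> S \<subseteq> carrier (GL n) \<and>
     (\<forall>g\<in>S. \<exists>N. \<forall>u\<in>GL_U n N. g \<otimes>\<^bsub>GL n\<^esub> u \<in> S)"
proof (intro iffI conjI ballI)
  assume "openin (GL_topology v n) S"
  then obtain T where T: "openin (P_top n) T" "S = mat_fun n -` T \<inter> carrier (GL n)"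
    unfolding GL_topology_alt openin_pullback_topology by blast
  then show "S \<subseteq> carrier (GL n)" by blast
  fix g assume g: "g \<in> S"
  then obtain k where k: "box n k (mat_fun n g) \<subseteq> T"
    using openin_P_top_imp_box[OF T(1), of "mat_fun n g"] T(2) by blast
  have gc: "g \<in> carrier (GL n)" using g T(2) by blast
  obtain a where a: "g \<in> GL_B n a" using GL_B_cover[OF gc] by blast
  have "g * u \<in> S" if u: "u \<in> GL_U n (nat (k + int a))" for u
  proof -
    note u' = GL_int_D[OF GL_U_int[OF u]]
    have "g * (u - 1\<^sub>m n) \<in> M (- int a + (int (nat (k + int a)) + 1)) n n"
      using a u by (intro M_mult) (auto simp: GL_B_def GL_U_def)
    then have "g * u - g \<in> M k n n"
      using mult_minus_one[of g n u] gc u' by (auto simp: carrier_GL intro: M_mono[rotated])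
    then have "mat_fun n (g * u) \<in> box n k (mat_fun n g)"
      using gc u' by (subst box_mat_fun) (auto simp: carrier_GL)
    then show ?thesis using k T(2) mult_GL_carrier[OF gc u'(7)] by auto
  qed
  then show "\<exists>N. \<forall>u\<in>GL_U n N. g \<otimes>\<^bsub>GL n\<^esub> u \<in> S" by auto
next
  assume S: "S \<subseteq> carrier (GL n) \<and> (\<forall>g\<in>S. \<exists>N. \<forall>u\<in>GL_U n N. g \<otimes>\<^bsub>GL n\<^esub> u \<in> S)"
  have "\<exists>k. \<forall>h\<in>carrier_mat n n. h - g \<in> M k n n \<longrightarrow> h \<in> S" if g: "g \<in> S" for g
  proof -
    obtain a where a: "g \<in> GL_B n a" using GL_B_cover S g by blast
    obtain N where N: "\<forall>u\<in>GL_U n N. g * u \<in> S" using S g by auto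
    show ?thesis
      using GL_U_near[OF a] N by (intro exI[of _ "int (N + a) + 1"]) metis
  qed
  then obtain k where k: "\<And>g h. g \<in> S \<Longrightarrow> h \<in> carrier_mat n n \<Longrightarrow> h - g \<in> M (k g) n n \<Longrightarrow> h \<in> S" by metis
  define T where "T = (\<Union>g\<in>S. box n (k g) (mat_fun n g))"
  have c: "g \<in> carrier_mat n n" if "g \<in> S" for g using that S by (auto simp: carrier_GL)
  have "mat_fun n h \<in> T \<longleftrightarrow> h \<in> S" if h: "h \<in> carrier (GL n)" for h
  proof
    assume "mat_fun n h \<in> T"
    then obtain g where g: "g \<in> S" "mat_fun n h \<in> box n (k g) (mat_fun n g)" by (auto simp: T_def)
    then have "h - g \<in> M (k g) n n" using box_mat_fun[of h n g] h c by (auto simp: carrier_GL)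
    then show "h \<in> S" using k[OF g(1)] h by (auto simp: carrier_GL)
  next
    assume hS: "h \<in> S"
    have "h - h = 0\<^sub>m n n" using c[OF hS] by auto
    then have "mat_fun n h \<in> box n (k h) (mat_fun n h)"
      using c[OF hS] by (subst box_mat_fun) (auto simp: M_zero)
    then show "mat_fun n h \<in> T" using hS by (auto simp: T_def)
  qed
  then have "S = mat_fun n -` T \<inter> carrier (GL n)" using S by blast
  moreover have "openin (P_top n) T"
    unfolding T_def using openin_box by (intro openin_Union) auto
  ultimately show "openin (GL_topology v n) S"
    unfolding GL_topology_alt openin_pullback_topology by blast
qed

lemma compactin_pullback:
  assumes "compactin T (f ` S)" "S \<subseteq> A"
  shows "compactin (pullback_topology A f T) S"
  unfolding compactin_def
proof (intro conjI allI impI)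
  have "f ` S \<subseteq> topspace T" using assms(1) by (rule compactin_subset_topspace)
  then show "S \<subseteq> topspace (pullback_topology A f T)"
    using assms(2) by (auto simp: topspace_pullback_topology)
  fix \<U> assume U: "(\<forall>V\<in>\<U>. openin (pullback_topology A f T) V) \<and> S \<subseteq> \<Union>\<U>"
  then have "\<forall>V\<in>\<U>. \<exists>W. openin T W \<and> V = f -` W \<inter> A"
    unfolding openin_pullback_topology by blast
  then obtain W where W: "\<And>V. V \<in> \<U> \<Longrightarrow> openin T (W V)" "\<And>V. V \<in> \<U> \<Longrightarrow> V = f -` W V \<inter> A" by metis
  have cov: "f ` S \<subseteq> \<Union>(W ` \<U>)"
  proof
    fix y assume "y \<in> f ` S"
    then obtain x where x: "x \<in> S" "y = f x" by blast
    then obtain V where "V \<in> \<U>" "x \<in> V" using U by blast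
    then show "y \<in> \<Union>(W ` \<U>)" using W(2)[of V] x by blast
  qed
  obtain F where F: "finite F" "F \<subseteq> W ` \<U>" "f ` S \<subseteq> \<Union>F"
    using assms(1)[unfolded compactin_def, THEN conjunct2, rule_format, OF conjI[OF _ cov]] W(1) by auto
  from finite_subset_image[OF F(1,2)] obtain C where C: "C \<subseteq> \<U>" "finite C" "F = W ` C" by blast
  have "S \<subseteq> \<Union>C"
  proof
    fix x assume x: "x \<in> S"
    then obtain V where "V \<in> C" "f x \<in> W V" using F(3) C(3) by blast
    then show "x \<in> \<Union>C" using W(2)[of V] C(1) x assms(2) by blast
  qed
  then show "\<exists>F. finite F \<and> F \<subseteq> \<U> \<and> S \<subseteq> \<Union>F" using C by blast
qed

text \<open>A matrix A near some g in \<open>GL_B n N\<close> is g times an integral invertible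
  matrix, hence lies in \<open>GL_B n N\<close> again. So the image is closed in the product of
  copies of a compact fractional ideal.\<close>

lemma compactin_GL_B: "compactin (GL_topology v n) (GL_B n N)"
  unfolding GL_topology_alt
proof (rule compactin_pullback)
  show "GL_B n N \<subseteq> carrier (GL n)" by (auto simp: GL_B_def)
  let ?K = "\<Pi>\<^sub>E ij\<in>GL_idx n. I (- int N)"
  have K: "compactin (P_top n) ?K"
    by (subst compactin_PiE) (auto simp: compactin_frac_ideal)
  have sub: "mat_fun n ` GL_B n N \<subseteq> ?K"
  proof
    fix x assume "x \<in> mat_fun n ` GL_B n N"
    then obtain A where A: "x = mat_fun n A" "A \<in> M (- int N) n n" by (auto simp: GL_B_def)
    show "x \<in> ?K"
      unfolding PiE_iff A(1) using mat_fun_extensional M_entry[OF A(2)] by (auto simp: mat_fun_def)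
  qed
  have "openin (P_top n) (topspace (P_top n) - mat_fun n ` GL_B n N)"
  proof (subst openin_subopen, intro ballI)
    fix x assume x: "x \<in> topspace (P_top n) - mat_fun n ` GL_B n N"
    define A where "A = mat n n x"
    have fA: "mat_fun n A = x"
      using x by (intro ext) (auto simp: A_def mat_fun_def PiE_iff extensional_def)
    have Ac: "A \<in> carrier_mat n n" by (simp add: A_def)
    have "box n (int (0 + N) + 1) x \<inter> mat_fun n ` GL_B n N = {}"
    proof (rule ccontr)
      assume "\<not> ?thesis"
      then obtain g where g: "g \<in> GL_B n N" "mat_fun n g \<in> box n (int (0 + N) + 1) x"
        by (auto simp only: disjoint_iff image_iff)
      have gc: "g \<in> carrier_mat n n" using g by (auto simp: GL_B_def carrier_GL)
      have "g - A \<in> M (int (0 + N) + 1) n n"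
        using g(2) unfolding fA[symmetric] by (subst (asm) box_mat_fun[OF gc Ac])
      then have "- (g - A) \<in> M (int (0 + N) + 1) n n" by (rule M_uminus)
      moreover have "- (g - A) = A - g" using gc Ac by auto
      ultimately have "A - g \<in> M (int (0 + N) + 1) n n" by simp
      note near = GL_U_near[OF g(1) Ac this]
      have "g * (minv g * A) \<in> GL_B n (N + 0)"
        using g(1) GL_U_int[OF near(1)] by (intro GL_B_mult) (simp_all add: GL_B0)
      then have "A \<in> GL_B n N" using near(2) by simp
      then show False using x fA by blast
    qed
    moreover have "x \<in> box n (int (0 + N) + 1) x"
      using x unfolding box_def Diff_iff topspace_product_topology PiE_iff by simp
    moreover have "box n (int (0 + N) + 1) x \<subseteq> topspace (P_top n)"
      using openin_subset[OF openin_box] .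
    ultimately show "\<exists>T. openin (P_top n) T \<and> x \<in> T \<and> T \<subseteq> topspace (P_top n) - mat_fun n ` GL_B n N"
      by (intro exI[of _ "box n (int (0 + N) + 1) x"] conjI openin_box) (simp_all only: Diff_eq Int_subset_iff disjoint_eq_subset_Compl not_False_eq_True)
  qed
  moreover have "mat_fun n ` GL_B n N \<subseteq> topspace (P_top n)"
  proof
    fix x assume "x \<in> mat_fun n ` GL_B n N"
    then obtain A where A: "x = mat_fun n A" by auto
    show "x \<in> topspace (P_top n)"
      unfolding topspace_product_topology PiE_iff A(1) using mat_fun_extensional by simp
  qed
  ultimately have "closedin (P_top n) (mat_fun n ` GL_B n N)"
    unfolding closedin_def by (intro conjI)
  then show "compactin (P_top n) (mat_fun n ` GL_B n N)"
    by (rule closed_compactin[OF K sub])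
qed

lemma subgroup_GL_int: "subgroup (GL_int v n) (GL n)"
  by (rule group.subgroupI[OF group_GL])
    (auto simp: GL_int_D(7) GL_int_mult inv_GL GL_int_minv intro: GL_int_one)

lemma td_group_GL: "td_group (GL n) (GL_topology v n) (GL_U n) (GL_B n)"
proof (intro td_group.intro td_group_axioms.intro group_GL subgroup_GL_U openin_GL_topology compactin_GL_B GL_B_cover)
  show "GL_U n (Suc N) \<subseteq> GL_U n N" for N
    by (auto simp: GL_U_def intro: M_mono[rotated])
  show "GL_B n N \<subseteq> GL_B n (Suc N)" for N
    by (rule GL_B_le) simp
  show "GL_U n 0 \<subseteq> GL_B n 0"
    using GL_U_int by (auto simp: GL_B0)
  show "subgroup (GL_B n 0) (GL n)"
    by (simp add: GL_B0 subgroup_GL_int)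
  show "\<exists>L. \<forall>a\<in>GL_B n M'. \<forall>b\<in>GL_B n N. a \<otimes>\<^bsub>GL n\<^esub> b \<in> GL_B n L" for M' N
    using GL_B_mult by (intro exI[of _ "M' + N"]) simp
  show "\<exists>M'. \<forall>u\<in>GL_U n M'. g \<otimes>\<^bsub>GL n\<^esub> u \<otimes>\<^bsub>GL n\<^esub> inv\<^bsub>GL n\<^esub> g \<in> GL_U n N"
    if g: "g \<in> carrier (GL n)" for g N
  proof -
    obtain a where a: "g \<in> GL_B n a" using GL_B_cover[OF g] by blast
    have G: "g \<in> carrier_mat n n" "det g \<noteq> 0" using g by (auto simp: carrier_GL)
    note i = minv[OF G]
    \<comment> \<open>Conjugation loses a levels at g and another a at its inverse, hence the level
      \<open>N + 2 * a\<close>.\<close>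
    have "g * u * minv g \<in> GL_U n N" if u: "u \<in> GL_U n (N + 2 * a)" for u
    proof -
      have uc: "u \<in> carrier_mat n n" using u by (simp add: GL_U_def)
      have "g * (u - 1\<^sub>m n) * minv g \<in> M (- int a + (int (N + 2 * a) + 1) + - int a) n n"
        using a u by (intro M_mult) (auto simp: GL_B_def GL_U_def)
      moreover have "g * (u - 1\<^sub>m n) * minv g = g * u * minv g - 1\<^sub>m n"
        unfolding mult_minus_one[OF G(1) uc] using G i uc by (simp add: minus_mult_distrib_mat[of _ n n])
      ultimately show ?thesis using G i uc by (simp add: GL_U_def)
    qed
    then show ?thesis using g by (auto simp: inv_GL)
  qed
qed

lemma td_group_G:
  "td_group (grp_G m) (top_G v m) (\<lambda>N. mult_U N \<times> GL_U (2 * m) N) (\<lambda>N. mult_B N \<times> GL_B (2 * m) N)"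
  unfolding grp_G_def top_G_def by (intro td_group_DirProd td_group_mult td_group_GL)

lemma td_group_H:
  "td_group (grp_H m) (top_H v m) (\<lambda>N. mult_U N \<times> (GL_U m N \<times> GL_U m N)) (\<lambda>N. mult_B N \<times> (GL_B m N \<times> GL_B m N))"
  unfolding grp_H_def top_H_def by (intro td_group_DirProd td_group_mult td_group_GL)

lemma td_group_Gt:
  "td_group (grp_Gt m) (top_Gt v m) (\<lambda>N. (mult_U N \<times> GL_U (2 * m) N) \<times> mult_U N)
     (\<lambda>N. (mult_B N \<times> GL_B (2 * m) N) \<times> mult_B N)"
  unfolding grp_Gt_def top_Gt_def by (intro td_group_DirProd td_group_mult td_group_G)

end

section \<open>Haar measure and unimodularity\<close>

locale haar_td_group = td_group +
  fixes \<mu> :: "'a measure"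
  assumes haar: "haar_measure G X \<mu>"
begin

lemma nice_sets: "nice S \<Longrightarrow> S \<in> sets \<mu>"
  using haar nice_open by (auto simp: haar_measure_def)

lemma nice_emeasure: "nice S \<Longrightarrow> emeasure \<mu> S \<noteq> \<infinity>"
  using haar nice_compact unfolding haar_measure_def by fastforce

lemma nice_measure_pos: "nice S \<Longrightarrow> S \<noteq> {} \<Longrightarrow> measure \<mu> S > 0"
  using haar nice_open[of S] nice_emeasure[of S]
  by (simp add: haar_measure_def measure_def enn2real_positive_iff less_top)

lemma measure_l_coset: "nice S \<Longrightarrow> g \<in> carrier G \<Longrightarrow> measure \<mu> (g <#\<^bsub>G\<^esub> S) = measure \<mu> S"
  using haar nice_sets[of S] by (simp add: haar_measure_def measure_def)

text \<open>A cover by disjoint nonempty open sets has no proper subcover, so compactness makes it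
  finite and the measure adds up. All index computations below are instances.\<close>

lemma measure_blocks:
  assumes S: "nice S" "\<Union>\<C> = S"
    and nice: "\<And>T. T \<in> \<C> \<Longrightarrow> nice T" and ne: "\<And>T. T \<in> \<C> \<Longrightarrow> T \<noteq> {}"
    and disj: "\<And>T T'. T \<in> \<C> \<Longrightarrow> T' \<in> \<C> \<Longrightarrow> T \<inter> T' \<noteq> {} \<Longrightarrow> T = T'"
    and c: "\<And>T. T \<in> \<C> \<Longrightarrow> measure \<mu> T = c"
  shows "finite \<C>" "measure \<mu> S = of_nat (card \<C>) * c"
proof -
  have cov: "S \<subseteq> \<Union>\<C>" using S(2) by simp
  have op: "\<forall>T\<in>\<C>. openin X T" using nice nice_open by blast
  obtain F where F: "finite F" "F \<subseteq> \<C>" "S \<subseteq> \<Union>F"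
    using nice_compact[OF S(1), unfolded compactin_def, THEN conjunct2, rule_format, OF conjI[OF _ cov]] op
    by auto
  have "\<C> \<subseteq> F"
  proof
    fix T assume T: "T \<in> \<C>"
    then obtain x where x: "x \<in> T" using ne by blast
    then have "x \<in> \<Union>F" using S(2) F(3) T by blast
    then obtain T' where T': "T' \<in> F" "x \<in> T'" by blast
    then have "T = T'" using disj[OF T, of T'] F(2) x by blast
    then show "T \<in> F" using T' by simp
  qed
  then show fin: "finite \<C>" using F(1) finite_subset by blast
  have "disjoint_family_on (\<lambda>T. T) \<C>"
    unfolding disjoint_family_on_def using disj by blast
  then have "measure \<mu> (\<Union>T\<in>\<C>. T) = (\<Sum>T\<in>\<C>. measure \<mu> T)"
    using fin nice nice_sets nice_emeasure by (intro measure_finite_Union) auto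
  also have "\<dots> = of_nat (card \<C>) * c" using c by simp
  finally show "measure \<mu> S = of_nat (card \<C>) * c" using S(2) by simp
qed

lemma l_cosets_disjoint:
  assumes "subgroup W G" "g \<in> carrier G" "h \<in> carrier G" "(g <#\<^bsub>G\<^esub> W) \<inter> (h <#\<^bsub>G\<^esub> W) \<noteq> {}"
  shows "g <#\<^bsub>G\<^esub> W = h <#\<^bsub>G\<^esub> W"
proof -
  obtain x where x: "x \<in> g <#\<^bsub>G\<^esub> W" "x \<in> h <#\<^bsub>G\<^esub> W" using assms(4) by blast
  have xc: "x \<in> carrier G"
    using x(1) assms(2) subgroup.subset[OF assms(1)] by (auto simp: l_coset_def)
  show ?thesis
    using l_coset_eq_iff[OF assms(1) assms(2) xc] l_coset_eq_iff[OF assms(1) assms(3) xc] x by simp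
qed

lemma r_cosets_disjoint:
  assumes "subgroup W G" "g \<in> carrier G" "h \<in> carrier G" "(W #> g) \<inter> (W #> h) \<noteq> {}"
  shows "W #> g = W #> h"
proof -
  obtain x where x: "x \<in> W #> g" "x \<in> W #> h" using assms(4) by blast
  then show ?thesis
    using repr_independence[of x W g] repr_independence[of x W h] assms by simp
qed

lemma r_coset_self: "subgroup W G \<Longrightarrow> g \<in> carrier G \<Longrightarrow> g \<in> W #> g"
  using r_coset_memI[of "\<one>" W g] subgroup.one_closed[of W G] by simp

lemma measure_l_cosets:
  assumes W: "subgroup W G" "nice W" and S: "nice S" "\<And>g h. g \<in> S \<Longrightarrow> h \<in> W \<Longrightarrow> g \<otimes> h \<in> S"
  shows "finite ((\<lambda>g. g <#\<^bsub>G\<^esub> W) ` S)"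
    "measure \<mu> S = of_nat (card ((\<lambda>g. g <#\<^bsub>G\<^esub> W) ` S)) * measure \<mu> W"
proof -
  note Sc = nice_carrier[OF S(1)]
  have U: "\<Union>((\<lambda>g. g <#\<^bsub>G\<^esub> W) ` S) = S"
  proof
    show "\<Union>((\<lambda>g. g <#\<^bsub>G\<^esub> W) ` S) \<subseteq> S" using S(2) by (auto simp: l_coset_def)
    show "S \<subseteq> \<Union>((\<lambda>g. g <#\<^bsub>G\<^esub> W) ` S)" using l_coset_self[OF W(1)] Sc by auto
  qed
  have n: "nice T" "T \<noteq> {}" "measure \<mu> T = measure \<mu> W" if T: "T \<in> (\<lambda>g. g <#\<^bsub>G\<^esub> W) ` S" for T
  proof -
    obtain g where g: "g \<in> S" "T = g <#\<^bsub>G\<^esub> W" using T by (elim imageE)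
    then have gc: "g \<in> carrier G" using Sc by blast
    show "nice T" "T \<noteq> {}" "measure \<mu> T = measure \<mu> W"
      using g nice_l_coset[OF W(2) gc] l_coset_self[OF W(1) gc] measure_l_coset[OF W(2) gc] by auto
  qed
  have d: "T = T'" if T: "T \<in> (\<lambda>g. g <#\<^bsub>G\<^esub> W) ` S" and T': "T' \<in> (\<lambda>g. g <#\<^bsub>G\<^esub> W) ` S" and ne: "T \<inter> T' \<noteq> {}" for T T'
  proof -
    obtain g where g: "g \<in> S" "T = g <#\<^bsub>G\<^esub> W" using T by (rule imageE)
    obtain h where h: "h \<in> S" "T' = h <#\<^bsub>G\<^esub> W" using T' by (rule imageE)
    show ?thesis
      using l_cosets_disjoint[OF W(1), of g h] g h ne Sc by auto
  qed
  show "finite ((\<lambda>g. g <#\<^bsub>G\<^esub> W) ` S)"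
    by (rule measure_blocks(1)[OF S(1) U n(1,2) d n(3)])
  show "measure \<mu> S = of_nat (card ((\<lambda>g. g <#\<^bsub>G\<^esub> W) ` S)) * measure \<mu> W"
    by (rule measure_blocks(2)[OF S(1) U n(1,2) d n(3)])
qed

lemma l_r_coset_assoc:
  assumes "W \<subseteq> carrier G" "g \<in> carrier G" "h \<in> carrier G"
  shows "(g <#\<^bsub>G\<^esub> W) #> h = g <#\<^bsub>G\<^esub> (W #> h)"
  using coset_assoc[OF assms(2,3,1)] by simp

lemma r_coset_inj: "S \<subseteq> carrier G \<Longrightarrow> T \<subseteq> carrier G \<Longrightarrow> h \<in> carrier G \<Longrightarrow> S #> h = T #> h \<Longrightarrow> S = T"
proof -
  assume a: "S \<subseteq> carrier G" "T \<subseteq> carrier G" "h \<in> carrier G" "S #> h = T #> h"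
  have "(Z #> h) #> inv h = Z" if "Z \<subseteq> carrier G" for Z
    using that a(3) by (simp add: coset_mult_assoc)
  then show "S = T" using a by metis
qed

text \<open>S is a disjoint union of left cosets g W, so S h is the disjoint union of the sets g (W
  h), which by left invariance all have the measure of W h. Both quotients are therefore the same
  number of cosets.\<close>

lemma measure_r_coset_ratio:
  assumes W: "subgroup W G" "nice W" and S: "nice S" "\<And>g h. g \<in> S \<Longrightarrow> h \<in> W \<Longrightarrow> g \<otimes> h \<in> S"
    and h: "h \<in> carrier G"
  shows "measure \<mu> (S #> h) * measure \<mu> W = measure \<mu> S * measure \<mu> (W #> h)"
proof -
  note Sc = nice_carrier[OF S(1)] and Wc = subgroup.subset[OF W(1)]
  let ?C = "(\<lambda>g. g <#\<^bsub>G\<^esub> W) ` S"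
  let ?D = "(\<lambda>T. T #> h) ` ?C"
  note 1 = measure_l_cosets[OF W S]
  have Tc: "T \<subseteq> carrier G" if "T \<in> ?C" for T
    using that Sc Wc by (auto simp: l_coset_def)
  have inj: "inj_on (\<lambda>T. T #> h) ?C"
    using r_coset_inj[OF Tc Tc h] by (intro inj_onI)
  have US: "\<Union>?C = S"
  proof
    show "\<Union>?C \<subseteq> S" using S(2) by (auto simp: l_coset_def)
    show "S \<subseteq> \<Union>?C" using l_coset_self[OF W(1)] Sc by auto
  qed
  have U: "\<Union>?D = S #> h"
    by (subst US[symmetric]) (auto simp: r_coset_def)
  have n: "nice T" "T \<noteq> {}" "measure \<mu> T = measure \<mu> (W #> h)" if T: "T \<in> ?D" for T
  proof -
    obtain Z where Z: "Z \<in> ?C" "T = Z #> h" using T by (rule imageE)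
    obtain g where g: "g \<in> S" "Z = g <#\<^bsub>G\<^esub> W" using Z(1) by (rule imageE)
    have gc: "g \<in> carrier G" using g Sc by blast
    have Teq: "T = g <#\<^bsub>G\<^esub> (W #> h)" using Z g l_r_coset_assoc[OF Wc gc h] by simp
    note nW = nice_r_coset[OF W(2) h]
    show "nice T" "measure \<mu> T = measure \<mu> (W #> h)"
      unfolding Teq using nice_l_coset[OF nW gc] measure_l_coset[OF nW gc] by auto
    show "T \<noteq> {}"
      unfolding Teq using l_coset_memI[OF r_coset_self[OF W(1) h], of g] by blast
  qed
  have d: "T = T'" if T: "T \<in> ?D" and T': "T' \<in> ?D" and ne: "T \<inter> T' \<noteq> {}" for T T'
  proof -
    obtain Z where Z: "Z \<in> ?C" "T = Z #> h" using T by (rule imageE)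
    obtain g where g: "g \<in> S" "Z = g <#\<^bsub>G\<^esub> W" using Z(1) by (rule imageE)
    obtain Z' where Z': "Z' \<in> ?C" "T' = Z' #> h" using T' by (rule imageE)
    obtain g' where g': "g' \<in> S" "Z' = g' <#\<^bsub>G\<^esub> W" using Z'(1) by (rule imageE)
    obtain x where x: "x \<in> T" "x \<in> T'" using ne by blast
    obtain z where z: "z \<in> Z" "x = z \<otimes> h" using x(1) Z(2) by (auto simp: r_coset_def)
    obtain z' where z': "z' \<in> Z'" "x = z' \<otimes> h" using x(2) Z'(2) by (auto simp: r_coset_def)
    have "z \<in> carrier G" "z' \<in> carrier G" using z(1) z'(1) Tc[OF Z(1)] Tc[OF Z'(1)] by auto
    then have "z = z'" using z(2) z'(2) h right_cancel by simp
    then have "Z \<inter> Z' \<noteq> {}" using z z' by blast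
    then have "Z = Z'" using l_cosets_disjoint[OF W(1), of g g'] g g' Sc by auto
    then show ?thesis using Z Z' by simp
  qed
  have "measure \<mu> (S #> h) = of_nat (card ?D) * measure \<mu> (W #> h)"
    by (rule measure_blocks(2)[OF nice_r_coset[OF S(1) h] U n(1,2) d n(3)])
  also have "card ?D = card ?C" by (rule card_image[OF inj])
  finally show ?thesis using 1(2) by simp
qed

text \<open>The modular character, read off from the set \<open>B 0\<close>;
  \<open>measure_r_coset\<close> shows that every nice set gives the same factor.\<close>

definition modular :: "'a \<Rightarrow> real" where
  "modular h = measure \<mu> (B 0 #> h) / measure \<mu> (B 0)"

lemma subgroup_ne: "subgroup W G \<Longrightarrow> W \<noteq> {}"
  using subgroup.one_closed by blast

lemma measure_B0_pos: "measure \<mu> (B 0) > 0"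
  using nice_measure_pos[OF nice_B0 subgroup_ne[OF B_subgroup]] .

text \<open>\<open>B 0\<close> and W are both unions of left cosets of their intersection, so
  \<open>measure_r_coset_ratio\<close> compares each of them with it.\<close>

lemma modular_subgroup:
  assumes W: "subgroup W G" "nice W" and h: "h \<in> carrier G"
  shows "measure \<mu> (W #> h) = modular h * measure \<mu> W"
proof -
  let ?V = "B 0 \<inter> W"
  have V: "subgroup ?V G" "nice ?V"
    using subgroups_Inter_pair[OF B_subgroup W(1)] nice_Int[OF nice_B0 W(2)] by auto
  have p: "measure \<mu> ?V > 0" using nice_measure_pos[OF V(2) subgroup_ne[OF V(1)]] .
  have 1: "measure \<mu> (B 0 #> h) * measure \<mu> ?V = measure \<mu> (B 0) * measure \<mu> (?V #> h)"
    using subgroup.m_closed[OF B_subgroup] by (intro measure_r_coset_ratio[OF V nice_B0 _ h]) auto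
  have 2: "measure \<mu> (W #> h) * measure \<mu> ?V = measure \<mu> W * measure \<mu> (?V #> h)"
    using subgroup.m_closed[OF W(1)] by (intro measure_r_coset_ratio[OF V W(2) _ h]) auto
  have "measure \<mu> (?V #> h) = modular h * measure \<mu> ?V"
    using 1 measure_B0_pos by (simp add: modular_def field_simps)
  then show ?thesis using 2 p by simp
qed

lemma nice_U: "nice (U N)"
proof -
  have "U N \<subseteq> B 0" using U_le[of 0 N] U_le_B by simp
  then show ?thesis
    using U_carrier subgroup.m_closed[OF U_subgroup] by (intro niceI[of _ N 0]) auto
qed

lemma measure_r_coset:
  assumes S: "nice S" and h: "h \<in> carrier G"
  shows "measure \<mu> (S #> h) = modular h * measure \<mu> S"
proof -
  obtain N where N: "\<And>g u. g \<in> S \<Longrightarrow> u \<in> U N \<Longrightarrow> g \<otimes> u \<in> S" using S by (auto simp: nice_def)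
  have p: "measure \<mu> (U N) > 0" using nice_measure_pos[OF nice_U subgroup_ne[OF U_subgroup]] .
  show ?thesis
    using measure_r_coset_ratio[OF U_subgroup[of N] nice_U S N h] modular_subgroup[OF U_subgroup[of N] nice_U h] p by simp
qed

lemma modular_pos: "h \<in> carrier G \<Longrightarrow> modular h > 0"
  using nice_measure_pos[OF nice_r_coset[OF nice_B0]] measure_B0_pos r_coset_self[OF B_subgroup]
  by (force simp: modular_def)

lemma modular_mult:
  assumes "g \<in> carrier G" "h \<in> carrier G"
  shows "modular (g \<otimes> h) = modular g * modular h"
proof -
  have "B 0 #> (g \<otimes> h) = (B 0 #> g) #> h"
    using assms B_carrier by (simp add: coset_mult_assoc)
  then have "measure \<mu> (B 0 #> (g \<otimes> h)) = modular h * (modular g * measure \<mu> (B 0))"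
    using measure_r_coset[OF nice_r_coset[OF nice_B0 assms(1)] assms(2)] measure_r_coset[OF nice_B0 assms(1)] by simp
  then show ?thesis using measure_B0_pos by (simp add: modular_def[of "g \<otimes> h"])
qed

lemma modular_B0: "h \<in> B 0 \<Longrightarrow> modular h = 1"
  using subgroup.rcos_const[OF B_subgroup is_group] measure_B0_pos by (simp add: modular_def)

lemma modular_central:
  assumes "z \<in> carrier G" "\<And>g. g \<in> carrier G \<Longrightarrow> g \<otimes> z = z \<otimes> g"
  shows "modular z = 1"
proof -
  have "B 0 #> z = z <#\<^bsub>G\<^esub> B 0"
    unfolding r_coset_def l_coset_def using assms(2) B_carrier[of 0] by (intro SUP_cong) auto
  then show ?thesis
    using measure_l_coset[OF nice_B0 assms(1)] measure_B0_pos by (simp add: modular_def)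
qed

end

section \<open>Unimodularity of H\<close>

context local_field_unif
begin

text \<open>By the Cartan decomposition only diagonal matrices matter. Permutation matrices show
  that \<open>D i x\<close> has the same value for every i, and the product of the
  \<open>D i x\<close> over i is scalar; so this value is a positive real number with n-th power
  1.\<close>

lemma GL_hom_trivial:
  fixes \<psi> :: "'f mat \<Rightarrow> real"
  assumes mult: "\<And>A B. A \<in> carrier (GL n) \<Longrightarrow> B \<in> carrier (GL n) \<Longrightarrow> \<psi> (A * B) = \<psi> A * \<psi> B"
    and pos: "\<And>A. A \<in> carrier (GL n) \<Longrightarrow> \<psi> A > 0"
    and int: "\<And>A. A \<in> GL_int v n \<Longrightarrow> \<psi> A = 1"
    and scalar: "\<And>x. x \<noteq> 0 \<Longrightarrow> \<psi> (mat_diag n (\<lambda>_. x)) = 1"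
    and A: "A \<in> carrier (GL n)"
  shows "\<psi> A = 1"
proof -
  have diag: "mat_diag n d \<in> carrier (GL n)" if "\<And>i. i < n \<Longrightarrow> d i \<noteq> 0" for d :: "nat \<Rightarrow> 'f"
    using that by (simp add: carrier_GL det_mat_diag)
  define D where "D i x = mat_diag n (\<lambda>j. if j = i then x else 1)" for i and x :: 'f
  have DG: "D i x \<in> carrier (GL n)" if "x \<noteq> 0" for i x
    unfolding D_def using that by (intro diag) auto
  have partial: "\<psi> (mat_diag n (\<lambda>j. if j < k then d j else 1)) = (\<Prod>j<k. \<psi> (D j (d j)))"
    if "\<And>i. d i \<noteq> 0" for d k
  proof (induction k)
    case 0
    then show ?case using int[OF GL_int_one] by simp
  next
    case (Suc k)
    have "mat_diag n (\<lambda>j. if j < Suc k then d j else 1) = mat_diag n (\<lambda>j. if j < k then d j else 1) * D k (d k)"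
      unfolding D_def mat_diag_diag by (rule arg_cong[of _ _ "mat_diag n"]) (auto simp: less_Suc_eq)
    also have "\<psi> \<dots> = \<psi> (mat_diag n (\<lambda>j. if j < k then d j else 1)) * \<psi> (D k (d k))"
      using that by (intro mult DG diag) auto
    finally show ?case using Suc by simp
  qed
  have full: "\<psi> (mat_diag n d) = (\<Prod>j<n. \<psi> (D j (d j)))" if "\<And>i. d i \<noteq> 0" for d
  proof -
    have "mat_diag n d = mat_diag n (\<lambda>j. if j < n then d j else 1)"
      by (intro eq_matI) (auto simp: mat_diag_def)
    then show ?thesis using partial[of d n, OF that] by simp
  qed
  have conj: "\<psi> (D i x) = \<psi> (D j x)" if "i < n" "j < n" "x \<noteq> 0" for i j x
  proof -
    define p where "p = Transposition.transpose i j"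
    have p: "p permutes {..<n}" using that unfolding p_def by (intro swap_permutes)
    note P = GL_int_perm_mat[OF p]
    have pb: "p b < n" if "b < n" for b using permutes_in_image[OF p, of b] that by simp
    have "perm_mat n p * D i x = D j x * perm_mat n p"
      unfolding D_def mat_diag_mult_left[OF perm_mat_carrier] mat_diag_mult_right[OF perm_mat_carrier]
      by (intro eq_matI) (auto simp: perm_mat_def p_def Transposition.transpose_def)
    then have "\<psi> (perm_mat n p) * \<psi> (D i x) = \<psi> (D j x) * \<psi> (perm_mat n p)"
      using mult[OF GL_int_D(7)[OF P] DG[OF that(3), of i]] mult[OF DG[OF that(3), of j] GL_int_D(7)[OF P]]
      by metis
    then show ?thesis using int[OF P] by simp
  qed
  have D1: "\<psi> (D i x) = 1" if "i < n" "x \<noteq> 0" for i x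
  proof -
    have "1 = (\<Prod>j<n. \<psi> (D j x))" using full[of "\<lambda>_. x"] scalar[of x] that by simp
    also have "\<dots> = (\<Prod>j<n. \<psi> (D i x))" by (rule prod.cong[OF refl], rule conj) (use that in auto)
    finally have "\<psi> (D i x) ^ n = 1" by simp
    then show ?thesis
      using pos[OF DG[OF that(2)], of i] that(1) power_eq_imp_eq_base[of "\<psi> (D i x)" n 1] by simp
  qed
  obtain P Q e where PQ: "P \<in> GL_int v n" "Q \<in> GL_int v n" "P * A * Q = mat_diag n (\<lambda>i. w powi e i)"
    using cartan_GL[OF A] by metis
  have "\<psi> (P * A * Q) = 1"
    unfolding PQ(3) using full[of "\<lambda>i. w powi e i"] prod.neutral[of "{..<n}" "\<lambda>j. \<psi> (D j (w powi e j))"] D1 by simp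
  moreover have "\<psi> (P * A * Q) = \<psi> P * \<psi> A * \<psi> Q"
    using mult[OF GL_int_D(7)[OF PQ(1)] A] mult[OF mult_GL_carrier[OF GL_int_D(7)[OF PQ(1)] A] GL_int_D(7)[OF PQ(2)]]
    by simp
  ultimately show ?thesis using int PQ by simp
qed

lemma carrier_grp_H: "(c, h1, h2) \<in> carrier (grp_H m) \<longleftrightarrow> c \<noteq> 0 \<and> h1 \<in> carrier (GL m) \<and> h2 \<in> carrier (GL m)"
  by (simp add: grp_H_def carrier_mult_group)

lemma mult_grp_H [simp]: "(c, h1, h2) \<otimes>\<^bsub>grp_H m\<^esub> (c', h1', h2') = (c * c', h1 * h1', h2 * h2')"
  by (simp add: grp_H_def)

text \<open>The modular character is positive, trivial on \<open>B 0\<close> and trivial on the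
  centre. This is exactly the input of \<open>GL_hom_trivial\<close> for each general linear factor,
  and the remaining factor is central.\<close>

lemma modular_H_trivial:
  assumes "haar_measure (grp_H m) (top_H v m) \<mu>" "h \<in> carrier (grp_H m)"
  shows "haar_td_group.modular (grp_H m) (\<lambda>N. mult_B N \<times> (GL_B m N \<times> GL_B m N)) \<mu> h = 1"
proof -
  interpret td_group "grp_H m" "top_H v m" "\<lambda>N. mult_U N \<times> (GL_U m N \<times> GL_U m N)" "\<lambda>N. mult_B N \<times> (GL_B m N \<times> GL_B m N)"
    by (rule td_group_H)
  interpret haar_td_group "grp_H m" "top_H v m" "\<lambda>N. mult_U N \<times> (GL_U m N \<times> GL_U m N)"
      "\<lambda>N. mult_B N \<times> (GL_B m N \<times> GL_B m N)" \<mu>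
    by unfold_locales (rule assms)
  obtain c h1 h2 where h: "h = (c, h1, h2)" "c \<noteq> 0" "h1 \<in> carrier (GL m)" "h2 \<in> carrier (GL m)"
    using assms(2) by (cases h) (auto simp: carrier_grp_H)
  have one: "1\<^sub>m m \<in> carrier (GL m)" by (simp add: carrier_GL)
  have c: "modular (x, mat_diag m (\<lambda>_. y), mat_diag m (\<lambda>_. z)) = 1" if "x \<noteq> 0" "y \<noteq> 0" "z \<noteq> 0" for x y z
  proof (rule modular_central)
    show "(x, mat_diag m (\<lambda>_. y), mat_diag m (\<lambda>_. z)) \<in> carrier (grp_H m)"
      using that by (simp add: carrier_grp_H carrier_GL det_mat_diag)
    have comm: "A * mat_diag m (\<lambda>_. y) = mat_diag m (\<lambda>_. y) * A" if "A \<in> carrier_mat m m" for A and y :: 'f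
      unfolding mat_diag_mult_left[OF that] mat_diag_mult_right[OF that] by (intro eq_matI) auto
    fix g :: "'f \<times> 'f mat \<times> 'f mat" assume "g \<in> carrier (grp_H m)"
    then show "g \<otimes>\<^bsub>grp_H m\<^esub> (x, mat_diag m (\<lambda>_. y), mat_diag m (\<lambda>_. z)) =
        (x, mat_diag m (\<lambda>_. y), mat_diag m (\<lambda>_. z)) \<otimes>\<^bsub>grp_H m\<^esub> g"
      using comm by (cases g) (auto simp: carrier_grp_H carrier_GL)
  qed
  have e: "mat_diag m (\<lambda>_. 1) = (1\<^sub>m m :: 'f mat)" by simp
  have 1: "modular (1, A, 1\<^sub>m m) = 1" if "A \<in> carrier (GL m)" for A
  proof (rule GL_hom_trivial[where \<psi> = "\<lambda>A. modular (1, A, 1\<^sub>m m)", OF _ _ _ _ that])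
    show "modular (1, A * B, 1\<^sub>m m) = modular (1, A, 1\<^sub>m m) * modular (1, B, 1\<^sub>m m)"
      if "A \<in> carrier (GL m)" "B \<in> carrier (GL m)" for A B
      using modular_mult[of "(1, A, 1\<^sub>m m)" "(1, B, 1\<^sub>m m)"] that one by (simp add: carrier_grp_H)
    show "modular (1, A, 1\<^sub>m m) > 0" if "A \<in> carrier (GL m)" for A
      using that one by (intro modular_pos) (simp add: carrier_grp_H)
    show "modular (1, A, 1\<^sub>m m) = 1" if "A \<in> GL_int v m" for A
      using that GL_int_one by (intro modular_B0) (simp add: GL_B0 mult_B_def)
    show "modular (1, mat_diag m (\<lambda>_. x), 1\<^sub>m m) = 1" if "x \<noteq> 0" for x
      using c[of 1 x 1] that by simp
  qed
  have 2: "modular (1, 1\<^sub>m m, A) = 1" if "A \<in> carrier (GL m)" for A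
  proof (rule GL_hom_trivial[where \<psi> = "\<lambda>A. modular (1, 1\<^sub>m m, A)", OF _ _ _ _ that])
    show "modular (1, 1\<^sub>m m, A * B) = modular (1, 1\<^sub>m m, A) * modular (1, 1\<^sub>m m, B)"
      if "A \<in> carrier (GL m)" "B \<in> carrier (GL m)" for A B
      using modular_mult[of "(1, 1\<^sub>m m, A)" "(1, 1\<^sub>m m, B)"] that one by (simp add: carrier_grp_H)
    show "modular (1, 1\<^sub>m m, A) > 0" if "A \<in> carrier (GL m)" for A
      using that one by (intro modular_pos) (simp add: carrier_grp_H)
    show "modular (1, 1\<^sub>m m, A) = 1" if "A \<in> GL_int v m" for A
      using that GL_int_one by (intro modular_B0) (simp add: GL_B0 mult_B_def)
    show "modular (1, 1\<^sub>m m, mat_diag m (\<lambda>_. x)) = 1" if "x \<noteq> 0" for x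
      using c[of 1 1 x] that by simp
  qed
  have m12: "modular (1, h1, h2) = modular (1, h1, 1\<^sub>m m) * modular (1, 1\<^sub>m m, h2)"
    using modular_mult[of "(1, h1, 1\<^sub>m m)" "(1, 1\<^sub>m m, h2)"] h(3,4) one right_mult_one_mat[of h1 m m]
      left_mult_one_mat[of h2 m m] by (simp add: carrier_grp_H carrier_GL)
  have "modular h = modular (c, 1\<^sub>m m, 1\<^sub>m m) * modular (1, h1, h2)"
    using modular_mult[of "(c, 1\<^sub>m m, 1\<^sub>m m)" "(1, h1, h2)"] h one left_mult_one_mat[of h1 m m]
      left_mult_one_mat[of h2 m m] by (simp add: carrier_grp_H carrier_GL)
  then show ?thesis
    using 1[OF h(3)] 2[OF h(4)] c[OF h(2), of 1 1] m12 by simp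
qed

end

section \<open>Injectivity of the Satake transform\<close>

text \<open>Back substitution from the last row upwards, which is the induction on
  \<open>n - i\<close>.\<close>

lemma upper_triangular_right_factor:
  fixes b :: "'f::field mat"
  assumes b: "b \<in> carrier_mat n n" "upper_triangular b" "\<And>i. i < n \<Longrightarrow> b $$ (i, i) \<noteq> 0"
    and A: "A \<in> carrier_mat n n" "upper_triangular (b * A)"
  shows "i < n \<Longrightarrow> j < i \<Longrightarrow> A $$ (i, j) = 0"
    "i < n \<Longrightarrow> (b * A) $$ (i, i) = b $$ (i, i) * A $$ (i, i)"
proof -
  have split: "(b * A) $$ (i, j) = b $$ (i, i) * A $$ (i, j) + (\<Sum>k\<in>{i<..<n}. b $$ (i, k) * A $$ (k, j))"
    if "i < n" "j < n" for i j
  proof -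
    have "(b * A) $$ (i, j) = (\<Sum>k<n. b $$ (i, k) * A $$ (k, j))"
      using b A that by (intro mult_mat_entry) auto
    also have "\<dots> = (\<Sum>k\<in>{i..<n}. b $$ (i, k) * A $$ (k, j))"
      using b that by (intro sum.mono_neutral_right) (auto simp: upper_triangularD not_le)
    also have "{i..<n} = insert i {i<..<n}" using that by auto
    finally show ?thesis by simp
  qed
  have low: "i < n \<Longrightarrow> j < i \<Longrightarrow> A $$ (i, j) = 0" for i j
  proof (induction "n - i" arbitrary: i rule: less_induct)
    case less
    have "(\<Sum>k\<in>{i<..<n}. b $$ (i, k) * A $$ (k, j)) = 0"
      using less by (intro sum.neutral) auto
    moreover have "(b * A) $$ (i, j) = 0"
      using less.prems b A by (intro upper_triangularD[OF A(2)]) auto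
    ultimately show ?case
      using split[of i j] less.prems b(3)[of i] by simp
  qed
  then show "i < n \<Longrightarrow> j < i \<Longrightarrow> A $$ (i, j) = 0" .
  have "(\<Sum>k\<in>{i<..<n}. b $$ (i, k) * A $$ (k, i)) = 0" using low by (intro sum.neutral) auto
  then show "i < n \<Longrightarrow> (b * A) $$ (i, i) = b $$ (i, i) * A $$ (i, i)"
    using split[of i i] by simp
qed

lemma det_upper_triangular_prod:
  "b \<in> carrier_mat n n \<Longrightarrow> upper_triangular b \<Longrightarrow> det b = (\<Prod>i<n. b $$ (i, i))"
  by (subst det_upper_triangular)
    (auto simp: diag_mat_def atLeast0LessThan prod.list_conv_set_nth intro!: prod.cong)

text \<open>In a decreasing sequence the positions with value at least k form an initial segment,
  which is known from its length.\<close>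

lemma sorted_ge_iff:
  fixes e :: "nat \<Rightarrow> int"
  assumes s: "\<And>i j. i \<le> j \<Longrightarrow> j < n \<Longrightarrow> e j \<le> e i" and i: "i < n"
  shows "k \<le> e i \<longleftrightarrow> i < card {i. i < n \<and> k \<le> e i}"
proof
  assume "k \<le> e i"
  then have "{..i} \<subseteq> {i. i < n \<and> k \<le> e i}"
    using order_trans[OF _ s[OF _ i]] i by auto
  from card_mono[OF _ this] show "i < card {i. i < n \<and> k \<le> e i}" by simp
next
  assume c: "i < card {i. i < n \<and> k \<le> e i}"
  show "k \<le> e i"
  proof (rule ccontr)
    assume "\<not> k \<le> e i"
    then have "j < i" if "j < n" "k \<le> e j" for j
      using s[of i j] that by (cases "i \<le> j") auto
    then have "{i. i < n \<and> k \<le> e i} \<subseteq> {..<i}" by auto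
    from card_mono[OF _ this] c show False by simp
  qed
qed

text \<open>The increment of the truncated sum from k - 1 to k is the number of entries that are at
  least k. Truncated sums are thus a complete invariant of a decreasing sequence, and they will
  order the double cosets.\<close>

lemma sorted_eqI:
  fixes e e' :: "nat \<Rightarrow> int"
  assumes "\<And>i j. i \<le> j \<Longrightarrow> j < n \<Longrightarrow> e j \<le> e i" "\<And>i j. i \<le> j \<Longrightarrow> j < n \<Longrightarrow> e' j \<le> e' i"
    and T: "\<And>k. (\<Sum>i<n. min k (e i)) = (\<Sum>i<n. min k (e' i))"
    and i: "i < n"
  shows "e i = e' i"
proof -
  have card: "int (card {i. i < n \<and> k \<le> e i}) = (\<Sum>i<n. min k (e i)) - (\<Sum>i<n. min (k - 1) (e i))" for k and e :: "nat \<Rightarrow> int"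
  proof -
    have "(\<Sum>i<n. min k (e i)) - (\<Sum>i<n. min (k - 1) (e i)) = (\<Sum>i<n. if k \<le> e i then 1 else 0)"
      unfolding sum_subtractf[symmetric] by (intro sum.cong) auto
    also have "\<dots> = int (card ({..<n} \<inter> {i. k \<le> e i}))" by (simp add: sum.If_cases)
    also have "{..<n} \<inter> {i. k \<le> e i} = {i. i < n \<and> k \<le> e i}" by auto
    finally show ?thesis by simp
  qed
  have "k \<le> e i \<longleftrightarrow> k \<le> e' i" for k
  proof -
    have "card {i. i < n \<and> k \<le> e i} = card {i. i < n \<and> k \<le> e' i}"
      using card[of k e] card[of k e'] T by simp
    moreover have "(k \<le> e i) = (i < card {i. i < n \<and> k \<le> e i})" by (rule sorted_ge_iff[OF assms(1) i])
    moreover have "(k \<le> e' i) = (i < card {i. i < n \<and> k \<le> e' i})" by (rule sorted_ge_iff[OF assms(2) i])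
    ultimately show ?thesis by (simp only:)
  qed
  then show ?thesis by (meson order_antisym order_refl)
qed

lemma (in group) double_coset_eq:
  assumes K: "subgroup K G" and g: "g \<in> carrier G" "h \<in> K <#> (g <#\<^bsub>G\<^esub> K)"
  shows "K <#> (h <#\<^bsub>G\<^esub> K) = K <#> (g <#\<^bsub>G\<^esub> K)"
proof -
  have c: "x \<in> carrier G" if "x \<in> K" for x using that subgroup.subset[OF K] by blast
  have mem: "x \<in> K <#> (a <#\<^bsub>G\<^esub> K) \<longleftrightarrow> (\<exists>k\<in>K. \<exists>l\<in>K. x = k \<otimes> (a \<otimes> l))" for a x
    unfolding set_mult_def l_coset_def by blast
  obtain k l where kl: "k \<in> K" "l \<in> K" "h = k \<otimes> (g \<otimes> l)" using g(2) unfolding mem by blast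
  have kc: "k \<in> carrier G" and lc: "l \<in> carrier G" using kl c by blast+
  have hc: "h \<in> carrier G" unfolding kl(3) using kc lc g(1) by simp
  have "inv k \<otimes> (k \<otimes> (g \<otimes> l) \<otimes> inv l) = (inv k \<otimes> k) \<otimes> (g \<otimes> (l \<otimes> inv l))"
    by (simp only: m_assoc inv_closed m_closed kc lc g(1))
  then have g': "inv k \<otimes> (h \<otimes> inv l) = g"
    unfolding kl(3) using kc lc g(1) by simp
  note mc = subgroup.m_closed[OF K] and ic = subgroup.m_inv_closed[OF K]
  show ?thesis
  proof (intro equalityI subsetI)
    fix x assume "x \<in> K <#> (h <#\<^bsub>G\<^esub> K)"
    then obtain k' l' where x: "k' \<in> K" "l' \<in> K" "x = k' \<otimes> (h \<otimes> l')" unfolding mem by blast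
    have "x = (k' \<otimes> k) \<otimes> (g \<otimes> (l \<otimes> l'))"
      unfolding x(3) kl(3) by (simp only: m_assoc m_closed kc lc g(1) c[OF x(1)] c[OF x(2)])
    then show "x \<in> K <#> (g <#\<^bsub>G\<^esub> K)"
      unfolding mem using mc[OF x(1) kl(1)] mc[OF kl(2) x(2)] by blast
  next
    fix x assume "x \<in> K <#> (g <#\<^bsub>G\<^esub> K)"
    then obtain k' l' where x: "k' \<in> K" "l' \<in> K" "x = k' \<otimes> (g \<otimes> l')" unfolding mem by blast
    have "x = (k' \<otimes> inv k) \<otimes> (h \<otimes> (inv l \<otimes> l'))"
      unfolding x(3) g'[symmetric]
      by (simp only: m_assoc m_closed inv_closed kc lc hc c[OF x(1)] c[OF x(2)])
    then show "x \<in> K <#> (h <#\<^bsub>G\<^esub> K)"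
      unfolding mem using mc[OF x(1) ic[OF kl(1)]] mc[OF ic[OF kl(2)] x(2)] by blast
  qed
qed

lemma lookup_single0_mult:
  "Poly_Mapping.lookup (Poly_Mapping.single 0 a * p) l = a * Poly_Mapping.lookup (p :: weight \<Rightarrow>\<^sub>0 real) l"
  unfolding mult_map_scale_conv_mult[symmetric] by (simp add: map.rep_eq when_def)

definition weight_of :: "nat \<Rightarrow> (nat \<Rightarrow> int) \<Rightarrow> weight" where
  "weight_of n f = Abs_poly_mapping (\<lambda>i. if i \<le> n then f i else 0)"

lemma lookup_weight_of: "Poly_Mapping.lookup (weight_of n f) i = (if i \<le> n then f i else 0)"
proof -
  have "finite {i. (if i \<le> n then f i else 0) \<noteq> 0}"
    by (rule finite_subset[of _ "{..n}"]) auto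
  then show ?thesis
    unfolding weight_of_def by (simp add: lookup_Abs_poly_mapping)
qed

lemma weight_of_weights: "weight_of n f \<in> weights n"
  by (auto simp: weights_def in_keys_iff lookup_weight_of split: if_splits)

lemma weights_lookup_zero: "l \<in> weights n \<Longrightarrow> i > n \<Longrightarrow> Poly_Mapping.lookup l i = 0"
  by (force simp: weights_def in_keys_iff)

lemma weights_eqI:
  "l \<in> weights n \<Longrightarrow> l' \<in> weights n \<Longrightarrow> (\<And>i. i \<le> n \<Longrightarrow> Poly_Mapping.lookup l i = Poly_Mapping.lookup l' i) \<Longrightarrow> l = l'"
  by (rule poly_mapping_eqI) (metis weights_lookup_zero not_le)

lemma finite_weights_bounded: "finite {l \<in> weights n. \<forall>i\<le>n. \<bar>Poly_Mapping.lookup l i\<bar> \<le> N}"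
proof (rule inj_on_finite)
  show "inj_on (\<lambda>l. restrict (Poly_Mapping.lookup l) {..n}) {l \<in> weights n. \<forall>i\<le>n. \<bar>Poly_Mapping.lookup l i\<bar> \<le> N}"
  proof (rule inj_onI)
    fix l l'
    assume l: "l \<in> {l \<in> weights n. \<forall>i\<le>n. \<bar>Poly_Mapping.lookup l i\<bar> \<le> N}"
      "l' \<in> {l \<in> weights n. \<forall>i\<le>n. \<bar>Poly_Mapping.lookup l i\<bar> \<le> N}"
      and eq: "restrict (Poly_Mapping.lookup l) {..n} = restrict (Poly_Mapping.lookup l') {..n}"
    have "Poly_Mapping.lookup l i = Poly_Mapping.lookup l' i" if "i \<le> n" for i
      using fun_cong[OF eq, of i] that by simp
    then show "l = l'" using l by (intro weights_eqI) auto
  qed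
  show "(\<lambda>l. restrict (Poly_Mapping.lookup l) {..n}) ` {l \<in> weights n. \<forall>i\<le>n. \<bar>Poly_Mapping.lookup l i\<bar> \<le> N}
      \<subseteq> (\<Pi>\<^sub>E i\<in>{..n}. {- N..N})"
    by (intro image_subsetI) (auto simp only: restrict_PiE_iff, auto simp: abs_le_iff)
qed (auto intro: finite_PiE)

abbreviation wcoord :: "weight \<Rightarrow> nat \<Rightarrow> int" where
  "wcoord l i \<equiv> Poly_Mapping.lookup l (Suc i)"

lemma varpi_pow_alt: "varpi_pow w n l = (w powi Poly_Mapping.lookup l 0, mat_diag n (\<lambda>i. w powi wcoord l i))"
  by (auto simp: varpi_pow_def mat_diag_def intro!: eq_matI)

context local_field_unif
begin

lemma val_prod: "(\<And>i. i < n \<Longrightarrow> f i \<noteq> 0) \<Longrightarrow> v (\<Prod>i<n. f i) = (\<Sum>i<(n::nat). v (f i))"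
proof (induction n)
  case (Suc n)
  then have "(\<Prod>i<n. f i) \<noteq> 0" by auto
  then show ?case using Suc by (simp add: val_mult)
qed simp

text \<open>Let g be the matrix in \<open>eq\<close>. The lattice spanned by the columns of g and of
  \<open>w powi k\<close> times the identity has the basis \<open>P * ?T\<close>, so its determinant
  has the left-hand sum as valuation. In an upper triangular basis b of this lattice, the i-th
  diagonal entry divides both \<open>w powi a i\<close> and \<open>w powi k\<close>, which bounds
  the same valuation by the right-hand sum.\<close>

lemma dominance:
  assumes P: "P \<in> GL_int v n" and Q: "Q \<in> GL_int v n" and u: "u \<in> unipotent n"
    and eq: "mat_diag n (\<lambda>i. w powi a i) * u = P * (mat_diag n (\<lambda>i. w powi e i) * Q)"
  shows "(\<Sum>i<n. min k (e i)) \<le> (\<Sum>i<n. min k (a i))"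
proof -
  note p = GL_int_D[OF P] and q = GL_int_D[OF Q]
  define t where "t i = min k (e i)" for i
  let ?T = "mat_diag n (\<lambda>i. w powi t i)"
  have Td: "det ?T \<noteq> 0" by (simp add: det_mat_diag)
  have Ti: "minv ?T = mat_diag n (\<lambda>i. inverse (w powi t i))" by (rule minv_mat_diag) simp
  \<comment> \<open>Basis of the lattice just described; the Iwasawa decomposition replaces it by
    the triangular basis \<open>b\<close> without changing the lattice.\<close>
  define h where "h = P * ?T"
  have hd: "h \<in> carrier (GL n)" using p Td by (simp add: h_def carrier_GL det_mult[of _ n])
  then have hc: "h \<in> carrier_mat n n" "det h \<noteq> 0" by (auto simp: carrier_GL)
  obtain \<kappa> where \<kappa>: "\<kappa> \<in> GL_int v n" "upper_triangular (h * \<kappa>)" using iwasawa[OF hd] by blast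
  note k = GL_int_D[OF \<kappa>(1)]
  define b where "b = h * \<kappa>"
  have b: "b \<in> carrier_mat n n" "upper_triangular b" "det b \<noteq> 0"
    using hc k \<kappa>(2) by (auto simp: b_def det_mult[of _ n])
  then have bii: "b $$ (i, i) \<noteq> 0" if "i < n" for i
    using that det_upper_triangular_prod[OF b(1,2)] by auto
  have bi: "minv b = minv \<kappa> * minv h" unfolding b_def using hc k by (intro minv_mult) auto
  have hi: "minv h = minv ?T * minv P" unfolding h_def using p Td by (intro minv_mult) auto
  note pi = minv[OF p(1,2)]
  define g where "g = mat_diag n (\<lambda>i. w powi a i) * u"
  have uc: "u \<in> carrier_mat n n" "upper_triangular u" "\<And>i. i < n \<Longrightarrow> u $$ (i, i) = 1"
    using u by (auto simp: unipotent_def)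
  have gc: "g \<in> carrier_mat n n" using uc by (simp add: g_def)
  have gij: "g $$ (i, j) = w powi a i * u $$ (i, j)" if "i < n" "j < n" for i j
    unfolding g_def mat_diag_mult_left[OF uc(1)] using that by simp
  have gu: "upper_triangular g" using gij uc gc by (auto simp: upper_triangularD)
  \<comment> \<open>\<open>A\<close> and \<open>C\<close> are the coordinates of g and of
    \<open>w powi k\<close> times the identity in the basis b. Both turn out integral, and since all
    matrices involved are triangular the diagonal entries multiply.\<close>
  define A where "A = minv b * g"
  define C where "C = minv b * (w powi k \<cdot>\<^sub>m 1\<^sub>m n)"
  have Tic: "minv ?T \<in> carrier_mat n n" by (simp add: Ti)
  have bic: "minv b \<in> carrier_mat n n" using minv(1)[OF b(1,3)] .
  have bA: "b * A = g" unfolding A_def using mat_cancel_left[OF b(1,3) gc] by simp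
  have bC: "b * C = w powi k \<cdot>\<^sub>m 1\<^sub>m n" unfolding C_def using mat_cancel_left[OF b(1,3), of "w powi k \<cdot>\<^sub>m 1\<^sub>m n" n] by simp
  have "A = minv \<kappa> * (minv ?T * (minv P * g))"
    unfolding A_def bi hi using k(5) Tic pi(1) gc by (simp add: assoc_mult_mat[of _ n n _ n _ n])
  also have "minv P * g = mat_diag n (\<lambda>i. w powi e i) * Q"
    unfolding g_def eq using mat_cancel_left[OF p(1,2), of "mat_diag n (\<lambda>i. w powi e i) * Q" n] q by simp
  also have "minv ?T * (mat_diag n (\<lambda>i. w powi e i) * Q) = mat_diag n (\<lambda>i. w powi (e i - t i)) * Q"
    unfolding Ti using q(1)
    by (simp add: assoc_mult_mat[symmetric, of _ n n _ n _ n] power_int_diff field_simps)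
  finally have Aeq: "A = minv \<kappa> * (mat_diag n (\<lambda>i. w powi (e i - t i)) * Q)" .
  have dM: "mat_diag n (\<lambda>i. w powi f i) \<in> M 0 n n" if "\<And>i. i < n \<Longrightarrow> f i \<ge> 0" for f
    using that by (intro MI) (auto simp: mat_diag_def I_iff_val)
  have AM: "A \<in> M 0 n n"
    unfolding Aeq by (rule M_mult0(1)[OF k(4) M_mult0(1)[OF dM q(3)]]) (auto simp: t_def)
  have "C = w powi k \<cdot>\<^sub>m minv b"
    unfolding C_def mult_smult_distrib[OF bic one_carrier_mat] right_mult_one_mat[OF bic] ..
  also have "\<dots> = minv \<kappa> * (w powi k \<cdot>\<^sub>m minv ?T * minv P)"
    unfolding bi hi using k(5) Tic pi(1)
    by (simp add: mult_smult_distrib[of _ n n _ n] mult_smult_assoc_mat[of _ n n _ n])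
  also have "w powi k \<cdot>\<^sub>m minv ?T = mat_diag n (\<lambda>i. w powi (k - t i))"
    unfolding Ti by (intro eq_matI) (auto simp: mat_diag_def power_int_diff field_simps)
  finally have Ceq: "C = minv \<kappa> * (mat_diag n (\<lambda>i. w powi (k - t i)) * minv P)" .
  have CM: "C \<in> M 0 n n"
    unfolding Ceq by (rule M_mult0(1)[OF k(4) M_mult0(1)[OF dM p(4)]]) (auto simp: t_def)
  have uA: "upper_triangular (b * A)" unfolding bA by (rule gu)
  have uC: "upper_triangular (b * C)" unfolding bC by auto
  have le: "v (b $$ (i, i)) \<le> min k (a i)" if i: "i < n" for i
  proof -
    have "w powi a i = b $$ (i, i) * A $$ (i, i)"
      using upper_triangular_right_factor(2)[OF b(1,2) bii M_carrier[OF AM] uA i] gij[OF i i] uc(3)[OF i] by (simp add: bA)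
    moreover have "A $$ (i, i) \<noteq> 0" using calculation by (metis mult_zero_right power_int_eq_0_iff w_nonzero)
    ultimately have 1: "a i = v (b $$ (i, i)) + v (A $$ (i, i))" "v (A $$ (i, i)) \<ge> 0"
      using bii[OF i] M_entry[OF AM i i] by (metis val_mult val_w_powi, simp add: I_iff_val)
    have "w powi k = b $$ (i, i) * C $$ (i, i)"
      using upper_triangular_right_factor(2)[OF b(1,2) bii M_carrier[OF CM] uC i] i by (simp add: bC)
    moreover have "C $$ (i, i) \<noteq> 0" using calculation by (metis mult_zero_right power_int_eq_0_iff w_nonzero)
    ultimately have 2: "k = v (b $$ (i, i)) + v (C $$ (i, i))" "v (C $$ (i, i)) \<ge> 0"
      using bii[OF i] M_entry[OF CM i i] by (metis val_mult val_w_powi, simp add: I_iff_val)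
    from 1 2 show ?thesis by linarith
  qed
  have "(\<Sum>i<n. t i) = v (det ?T)" by (simp add: det_mat_diag val_prod)
  also have "\<dots> = v (det b)"
    unfolding b_def h_def using p(1,2,6) k(1,2,6) Td by (simp add: det_mult[of _ n] val_mult)
  also have "\<dots> = (\<Sum>i<n. v (b $$ (i, i)))"
    using det_upper_triangular_prod[OF b(1,2)] val_prod[of n "\<lambda>i. b $$ (i, i)"] bii by simp
  also have "\<dots> \<le> (\<Sum>i<n. min k (a i))" using le by (intro sum_mono) auto
  finally show ?thesis by (simp add: t_def)
qed

section \<open>Double cosets and the left cosets in the Satake sum\<close>

lemma carrier_grp_G: "(c, g) \<in> carrier (grp_G m) \<longleftrightarrow> c \<noteq> 0 \<and> g \<in> carrier (GL (2 * m))"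
  by (simp add: grp_G_def carrier_mult_group)

lemma mult_grp_G [simp]: "(c, g) \<otimes>\<^bsub>grp_G m\<^esub> (c', g') = (c * c', g * g')"
  by (simp add: grp_G_def)

lemma inv_grp_G: "c \<noteq> 0 \<Longrightarrow> g \<in> carrier (GL (2 * m)) \<Longrightarrow> inv\<^bsub>grp_G m\<^esub> (c, g) = (inverse c, minv g)"
  by (simp add: grp_G_def inv_DirProd[OF group_mult_group group_GL] carrier_mult_group inv_mult_group inv_GL)

lemma sub_K_alt: "sub_K v m = mult_B 0 \<times> GL_B (2 * m) 0"
  by (simp add: sub_K_def mult_B0 GL_B0)

lemma sub_K_iff: "(c, g) \<in> sub_K v m \<longleftrightarrow> c \<in> int_units v \<and> g \<in> GL_int v (2 * m)"
  by (simp add: sub_K_def)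

lemma double_coset_iff: "(c, g) \<in> double_coset v m (c0, g0) \<longleftrightarrow>
    (\<exists>a\<in>int_units v. \<exists>b\<in>int_units v. c = a * (c0 * b)) \<and>
    (\<exists>P\<in>GL_int v (2 * m). \<exists>Q\<in>GL_int v (2 * m). g = P * (g0 * Q))"
proof -
  have "(c, g) \<in> double_coset v m (c0, g0) \<longleftrightarrow>
      (\<exists>k\<in>sub_K v m. \<exists>l\<in>sub_K v m. (c, g) = k \<otimes>\<^bsub>grp_G m\<^esub> ((c0, g0) \<otimes>\<^bsub>grp_G m\<^esub> l))"
    unfolding double_coset_def set_mult_def l_coset_def by blast
  then show ?thesis
    unfolding sub_K_def split_paired_Bex_Sigma mult_grp_G by simp
qed

lemma varpi_pow_carrier: "varpi_pow w (2 * m) l \<in> carrier (grp_G m)"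
  by (simp add: varpi_pow_alt carrier_grp_G carrier_GL det_mat_diag)

lemma unipotent_det: "u \<in> unipotent n \<Longrightarrow> det u = (1 :: 'f)"
  using det_upper_triangular_prod[of u n] by (auto simp: unipotent_def)

lemma one_unipotent: "1\<^sub>m n \<in> unipotent n"
  by (auto simp: unipotent_def)

definition sorted_weight :: "nat \<Rightarrow> weight \<Rightarrow> bool" where
  "sorted_weight n l \<longleftrightarrow> l \<in> weights n \<and> (\<forall>i j. i \<le> j \<longrightarrow> j < n \<longrightarrow> wcoord l j \<le> wcoord l i)"

lemma double_coset_sorted:
  assumes "x \<in> carrier (grp_G m)"
  obtains l where "sorted_weight (2 * m) l" "double_coset v m x = double_coset v m (varpi_pow w (2 * m) l)"
proof -
  obtain c g where x: "x = (c, g)" "c \<noteq> 0" "g \<in> carrier (GL (2 * m))"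
    using assms by (cases x) (auto simp: carrier_grp_G)
  obtain P Q e where PQ: "P \<in> GL_int v (2 * m)" "Q \<in> GL_int v (2 * m)" "P * g * Q = mat_diag (2 * m) (\<lambda>i. w powi e i)"
    "\<And>i j. i \<le> j \<Longrightarrow> j < 2 * m \<Longrightarrow> e j \<le> e i"
    using cartan_GL[OF x(3)] by metis
  define l where "l = weight_of (2 * m) (\<lambda>i. if i = 0 then v c else e (i - 1))"
  have l: "Poly_Mapping.lookup l 0 = v c" "\<And>i. i < 2 * m \<Longrightarrow> wcoord l i = e i"
    by (auto simp: l_def lookup_weight_of)
  have s: "sorted_weight (2 * m) l"
    using PQ(4) l(2) by (auto simp: sorted_weight_def l_def weight_of_weights)
  have vp: "varpi_pow w (2 * m) l = (w powi v c, mat_diag (2 * m) (\<lambda>i. w powi e i))"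
    unfolding varpi_pow_alt using l by (auto simp: mat_diag_def intro!: eq_matI)
  have g2: "mat_diag (2 * m) (\<lambda>i. w powi e i) = P * (g * Q)"
    unfolding PQ(3)[symmetric] using GL_int_D(1)[OF PQ(1)] GL_int_D(1)[OF PQ(2)] x(3)
    by (intro assoc_mult_mat[of _ "2*m" "2*m" _ "2*m" _ "2*m"]) (auto simp: carrier_GL)
  have u: "w powi v c / c \<in> int_units v" "1 \<in> int_units v"
    using x(2) by (simp_all add: int_units_iff val_divide)
  have "varpi_pow w (2 * m) l \<in> double_coset v m x"
    unfolding vp x(1) double_coset_iff
    using PQ(1,2) g2 u x(2) by (intro conjI bexI[OF _ u(1)] bexI[OF _ u(2)] bexI[OF _ PQ(1)] bexI[OF _ PQ(2)]) auto
  then have "double_coset v m (varpi_pow w (2 * m) l) = double_coset v m x"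
    unfolding double_coset_def
    by (intro group.double_coset_eq[OF group_grp_G _ assms])
      (use td_group.B_subgroup[OF td_group_G] in \<open>auto simp: sub_K_alt\<close>)
  then show ?thesis using that s by metis
qed

definition satake_pairs :: "nat \<Rightarrow> ('f \<times> 'f mat) set \<Rightarrow> (weight \<times> ('f \<times> 'f mat) set) set" where
  "satake_pairs m D = {(l, B). l \<in> weights (2 * m) \<and> B \<subseteq> D \<and>
      (\<exists>u\<in>unipotent (2 * m). B = (varpi_pow w (2 * m) l \<otimes>\<^bsub>grp_G m\<^esub> (1, u)) <#\<^bsub>grp_G m\<^esub> sub_K v m)}"

lemma satake_ch_alt:
  "satake_ch v w m D = (\<Sum>(l, B)\<in>satake_pairs m D. Poly_Mapping.single l (real q powr (- delta_pairing (2 * m) l)))"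
  by (simp add: satake_ch_def satake_pairs_def)

lemma varpi_unip_carrier: "u \<in> unipotent (2 * m) \<Longrightarrow> varpi_pow w (2 * m) l \<otimes>\<^bsub>grp_G m\<^esub> (1, u) \<in> carrier (grp_G m)"
  using unipotent_det[of u "2 * m"] by (auto simp: varpi_pow_alt carrier_grp_G carrier_GL det_mult[of _ "2*m"] det_mat_diag unipotent_def)

lemma subgroup_sub_K: "subgroup (sub_K v m) (grp_G m)"
  using td_group.B_subgroup[OF td_group_G] by (simp add: sub_K_alt)

text \<open>A sum over an infinite set is 0 by convention, so \<open>satake_ch\<close> has its
  intended value only once this set is known to be finite. The cosets are finite in number by
  compactness; the weights are bounded below by the denominators of the representative and above
  through its determinant.\<close>

lemma finite_satake_pairs:
  assumes D: "td_group.nice (grp_G m) (\<lambda>N. mult_U N \<times> GL_U (2 * m) N) (\<lambda>N. mult_B N \<times> GL_B (2 * m) N) D"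
  shows "finite (satake_pairs m D)"
proof -
  let ?n = "2 * m"
  interpret td_group "grp_G m" "top_G v m" "\<lambda>N. mult_U N \<times> GL_U (2 * m) N" "\<lambda>N. mult_B N \<times> GL_B (2 * m) N"
    by (rule td_group_G)
  note Dc = nice_carrier[OF D]
  obtain L where L: "D \<subseteq> mult_B L \<times> GL_B (2 * m) L" using D by (auto simp: nice_def)
  have fin: "finite ((\<lambda>g. g <#\<^bsub>grp_G m\<^esub> sub_K v m) ` D)"
    using finite_cosets_compact[OF nice_compact[OF D] subgroup_sub_K] nice_B0 by (simp add: sub_K_alt)
  \<comment> \<open>Every coordinate is at least - L and the sum is at most n L, so a single
    coordinate is at most 2 n L; the additional L keeps \<open>int L \<le> N\<close> even for n =
    0.\<close>
  define N where "N = int (Suc (2 * ?n)) * int L"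
  have "satake_pairs m D \<subseteq> {l \<in> weights ?n. \<forall>i\<le>?n. \<bar>Poly_Mapping.lookup l i\<bar> \<le> N} \<times> (\<lambda>g. g <#\<^bsub>grp_G m\<^esub> sub_K v m) ` D"
  proof
    fix x assume "x \<in> satake_pairs m D"
    then obtain l B u where x: "x = (l, B)" "l \<in> weights ?n" "B \<subseteq> D" "u \<in> unipotent ?n"
      "B = (varpi_pow w ?n l \<otimes>\<^bsub>grp_G m\<^esub> (1, u)) <#\<^bsub>grp_G m\<^esub> sub_K v m"
      unfolding satake_pairs_def by blast
    define h where "h = varpi_pow w ?n l \<otimes>\<^bsub>grp_G m\<^esub> (1, u)"
    have hD: "h \<in> D"
      using l_coset_self[OF subgroup_sub_K varpi_unip_carrier[OF x(4), of l]] x(3,5) by (auto simp: h_def)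
    let ?g = "mat_diag ?n (\<lambda>i. w powi wcoord l i) * u"
    have h: "h = (w powi Poly_Mapping.lookup l 0, ?g)" by (simp add: h_def varpi_pow_alt)
    have hL: "w powi Poly_Mapping.lookup l 0 \<in> mult_B L" "?g \<in> GL_B ?n L" using hD L h by auto
    have uc: "u \<in> carrier_mat ?n ?n" "\<And>i. i < ?n \<Longrightarrow> u $$ (i, i) = 1" using x(4) by (auto simp: unipotent_def)
    have gM: "?g \<in> M (- int L) ?n ?n" "minv ?g \<in> M (- int L) ?n ?n" "det ?g \<noteq> 0" "?g \<in> carrier_mat ?n ?n"
      using hL by (auto simp: GL_B_def carrier_GL)
    have lo: "wcoord l i \<ge> - int L" if i: "i < ?n" for i
    proof -
      have "?g $$ (i, i) = w powi wcoord l i"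
        unfolding mat_diag_mult_left[OF uc(1)] using i uc(2) by simp
      then show ?thesis using M_entry[OF gM(1) i i] by (simp add: I_iff_val)
    qed
    have "det ?g = (\<Prod>i<?n. w powi wcoord l i)"
      using unipotent_det[OF x(4)] uc by (simp add: det_mult[of _ ?n] det_mat_diag)
    then have vd: "v (det ?g) = (\<Sum>i<?n. wcoord l i)" by (simp add: val_prod)
    have "det (minv ?g) \<in> I (int ?n * (- int L))" by (rule det_M[OF gM(2)])
    then have vd2: "v (det ?g) \<le> int ?n * int L"
      using minv(4)[OF gM(4,3)] gM(3) by (simp add: I_iff_val val_inverse)
    have hi: "wcoord l i \<le> N" if i: "i < ?n" for i
    proof -
      have "(\<Sum>i<?n. wcoord l i) = wcoord l i + (\<Sum>j\<in>{..<?n} - {i}. wcoord l j)"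
        using i by (intro sum.remove) auto
      moreover have "(\<Sum>j\<in>{..<?n} - {i}. - int L) \<le> (\<Sum>j\<in>{..<?n} - {i}. wcoord l j)"
        using lo by (intro sum_mono) auto
      moreover have "(\<Sum>j\<in>{..<?n} - {i}. - int L) \<ge> - int ?n * int L"
        using i by (simp add: algebra_simps of_nat_diff)
      ultimately show ?thesis using vd vd2 unfolding N_def by (simp add: algebra_simps)
    qed
    have LN: "int L \<le> N" by (simp add: N_def algebra_simps)
    have "\<bar>Poly_Mapping.lookup l i\<bar> \<le> N" if i: "i \<le> ?n" for i
    proof (cases i)
      case 0
      then show ?thesis using hL(1) LN by (simp add: mult_B_def)
    next
      case (Suc j)
      then have "wcoord l j \<le> N" "- int L \<le> wcoord l j" using hi lo i by auto
      then show ?thesis using Suc LN by simp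
    qed
    then show "x \<in> {l \<in> weights ?n. \<forall>i\<le>?n. \<bar>Poly_Mapping.lookup l i\<bar> \<le> N} \<times> (\<lambda>g. g <#\<^bsub>grp_G m\<^esub> sub_K v m) ` D"
      using x hD by (auto simp: h_def)
  qed
  then show ?thesis
    using finite_weights_bounded[of ?n N] fin finite_subset by blast
qed

lemma nice_double_coset:
  assumes "x \<in> carrier (grp_G m)"
  shows "td_group.nice (grp_G m) (\<lambda>N. mult_U N \<times> GL_U (2 * m) N) (\<lambda>N. mult_B N \<times> GL_B (2 * m) N) (double_coset v m x)"
proof -
  interpret td_group "grp_G m" "top_G v m" "\<lambda>N. mult_U N \<times> GL_U (2 * m) N" "\<lambda>N. mult_B N \<times> GL_B (2 * m) N"
    by (rule td_group_G)
  have nK: "nice (sub_K v m)" using nice_B0 by (simp add: sub_K_alt)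
  note sK = subgroup_sub_K[of m]
  have n1: "nice (x <#\<^bsub>grp_G m\<^esub> sub_K v m)" by (rule nice_l_coset[OF nK assms])
  obtain L where L: "x <#\<^bsub>grp_G m\<^esub> sub_K v m \<subseteq> mult_B L \<times> GL_B (2 * m) L" using n1 by (auto simp: nice_def)
  obtain R where R: "\<forall>a\<in>mult_B 0 \<times> GL_B (2 * m) 0. \<forall>b\<in>mult_B L \<times> GL_B (2 * m) L. a \<otimes>\<^bsub>grp_G m\<^esub> b \<in> mult_B R \<times> GL_B (2 * m) R"
    using B_mult[of 0 L] by blast
  show ?thesis
  proof (rule nice_invariantI[OF nK subgroup.one_closed[OF sK]])
    show "double_coset v m x \<subseteq> carrier (grp_G m)"
      unfolding double_coset_def by (intro set_mult_closed nice_carrier[OF nK] nice_carrier[OF n1])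
    show "double_coset v m x \<subseteq> mult_B R \<times> GL_B (2 * m) R"
    proof
      fix z assume "z \<in> double_coset v m x"
      then obtain k y where "k \<in> sub_K v m" "y \<in> x <#\<^bsub>grp_G m\<^esub> sub_K v m" "z = k \<otimes>\<^bsub>grp_G m\<^esub> y"
        unfolding double_coset_def set_mult_def by blast
      then show "z \<in> mult_B R \<times> GL_B (2 * m) R" using R L by (auto simp: sub_K_alt)
    qed
    fix g h assume g: "g \<in> double_coset v m x" and h: "h \<in> sub_K v m"
    obtain k l where kl: "k \<in> sub_K v m" "l \<in> sub_K v m" "g = k \<otimes>\<^bsub>grp_G m\<^esub> (x \<otimes>\<^bsub>grp_G m\<^esub> l)"
      using g unfolding double_coset_def set_mult_def l_coset_def by blast
    have c: "k \<in> carrier (grp_G m)" "l \<in> carrier (grp_G m)" "h \<in> carrier (grp_G m)"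
      using kl h nice_carrier[OF nK] by auto
    have "g \<otimes>\<^bsub>grp_G m\<^esub> h = k \<otimes>\<^bsub>grp_G m\<^esub> (x \<otimes>\<^bsub>grp_G m\<^esub> (l \<otimes>\<^bsub>grp_G m\<^esub> h))"
      using kl(3) c assms by (simp add: m_assoc)
    then show "g \<otimes>\<^bsub>grp_G m\<^esub> h \<in> double_coset v m x"
      using kl(1) subgroup.m_closed[OF sK kl(2) h] unfolding double_coset_def set_mult_def l_coset_def by blast
  qed
qed

lemma lookup_satake_ch:
  assumes "finite (satake_pairs m D)"
  shows "Poly_Mapping.lookup (satake_ch v w m D) l =
    real (card {B. (l, B) \<in> satake_pairs m D}) * real q powr (- delta_pairing (2 * m) l)"
proof -
  have "Poly_Mapping.lookup (satake_ch v w m D) l =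
      (\<Sum>p\<in>satake_pairs m D. if fst p = l then real q powr (- delta_pairing (2 * m) l) else 0)"
    unfolding satake_ch_alt lookup_sum by (intro sum.cong) (auto simp: lookup_single when_def)
  also have "\<dots> = (\<Sum>p\<in>{p \<in> satake_pairs m D. fst p = l}. real q powr (- delta_pairing (2 * m) l))"
    using assms by (intro sum.inter_filter[symmetric])
  also have "\<dots> = real (card {p \<in> satake_pairs m D. fst p = l}) * real q powr (- delta_pairing (2 * m) l)"
    by simp
  also have "card {p \<in> satake_pairs m D. fst p = l} = card {B. (l, B) \<in> satake_pairs m D}"
    by (rule bij_betw_same_card[of snd]) (force simp: bij_betw_def inj_on_def)
  finally show ?thesis .
qed

abbreviation double_cosets :: "nat \<Rightarrow> ('f \<times> 'f mat) set set" where
  "double_cosets m \<equiv> double_coset v m ` carrier (grp_G m)"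

lemma double_coset_self:
  assumes "x \<in> carrier (grp_G m)"
  shows "x \<in> double_coset v m x"
proof -
  obtain c g where x: "x = (c, g)" "c \<noteq> 0" "g \<in> carrier (GL (2 * m))"
    using assms by (cases x) (auto simp: carrier_grp_G)
  show ?thesis
    unfolding x(1) double_coset_iff
    using x GL_int_one[of "2 * m"] left_mult_one_mat[of g "2*m" "2*m"] right_mult_one_mat[of g "2*m" "2*m"]
    by (intro conjI bexI[of _ 1] bexI[of _ "1\<^sub>m (2 * m)"]) (auto simp: carrier_GL int_units_iff)
qed

lemma hecke_const_on_double_coset:
  assumes "\<phi> \<in> hecke_space v m R" "x \<in> carrier (grp_G m)" "y \<in> double_coset v m x"
  shows "\<phi> y = \<phi> x"
proof -
  interpret group "grp_G m" by (rule group_grp_G)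
  obtain k l where kl: "k \<in> sub_K v m" "l \<in> sub_K v m" "y = k \<otimes>\<^bsub>grp_G m\<^esub> (x \<otimes>\<^bsub>grp_G m\<^esub> l)"
    using assms(3) unfolding double_coset_def set_mult_def l_coset_def by blast
  have "l \<in> carrier (grp_G m)" using kl subgroup.subset[OF subgroup_sub_K] by blast
  then have "\<phi> y = \<phi> (x \<otimes>\<^bsub>grp_G m\<^esub> l)" "\<phi> (x \<otimes>\<^bsub>grp_G m\<^esub> l) = \<phi> x"
    using assms(1,2) kl unfolding hecke_space_def by auto
  then show ?thesis by simp
qed

lemma hecke_image_double_coset:
  assumes "\<phi> \<in> hecke_space v m R" "x \<in> carrier (grp_G m)"
  shows "\<phi> ` double_coset v m x = {\<phi> x}"
  using hecke_const_on_double_coset[OF assms] double_coset_self[OF assms(2)] by blast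

lemma finite_hecke_support:
  assumes "\<phi> \<in> hecke_space v m R"
  shows "finite {D \<in> double_cosets m. \<phi> ` D \<noteq> {0}}"
proof -
  interpret td_group "grp_G m" "top_G v m" "\<lambda>N. mult_U N \<times> GL_U (2 * m) N" "\<lambda>N. mult_B N \<times> GL_B (2 * m) N"
    by (rule td_group_G)
  let ?S = "{g \<in> topspace (top_G v m). \<phi> g \<noteq> 0}"
  let ?C = "top_G v m closure_of ?S"
  have C: "compactin (top_G v m) ?C"
    using assms by (simp add: hecke_space_def compactly_supported_def)
  have fin: "finite ((\<lambda>g. g <#\<^bsub>grp_G m\<^esub> sub_K v m) ` ?C)"
    using finite_cosets_compact[OF C subgroup_sub_K] nice_B0 by (simp add: sub_K_alt)
  have "{D \<in> double_cosets m. \<phi> ` D \<noteq> {0}} \<subseteq> (\<lambda>T. sub_K v m <#>\<^bsub>grp_G m\<^esub> T) ` (\<lambda>g. g <#\<^bsub>grp_G m\<^esub> sub_K v m) ` ?C"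
  proof
    fix D assume "D \<in> {D \<in> double_cosets m. \<phi> ` D \<noteq> {0}}"
    then obtain x where x: "x \<in> carrier (grp_G m)" "D = double_coset v m x" "\<phi> ` D \<noteq> {0}" by auto
    then have "\<phi> x \<noteq> 0" using hecke_image_double_coset[OF assms x(1)] by simp
    then have "x \<in> ?S" using x(1) by (simp add: topspace_X)
    moreover have "?S \<subseteq> ?C" by (rule closure_of_subset) blast
    ultimately show "D \<in> (\<lambda>T. sub_K v m <#>\<^bsub>grp_G m\<^esub> T) ` (\<lambda>g. g <#\<^bsub>grp_G m\<^esub> sub_K v m) ` ?C"
      using x(2) by (auto simp: double_coset_def)
  qed
  then show ?thesis using fin finite_subset by blast
qed

lemma lookup_satake:
  assumes \<phi>: "\<phi> \<in> hecke_space v m R" and F: "finite F" "F \<subseteq> double_cosets m"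
    "{D \<in> double_cosets m. \<phi> ` D \<noteq> {0}} \<subseteq> F"
  shows "Poly_Mapping.lookup (satake v w m \<phi>) l = (\<Sum>D\<in>F. the_elem (\<phi> ` D) * Poly_Mapping.lookup (satake_ch v w m D) l)"
proof -
  have "Poly_Mapping.lookup (satake v w m \<phi>) l =
      (\<Sum>D\<in>{D \<in> double_cosets m. \<phi> ` D \<noteq> {0}}. the_elem (\<phi> ` D) * Poly_Mapping.lookup (satake_ch v w m D) l)"
    unfolding satake_def lookup_sum lookup_single0_mult ..
  also have "\<dots> = (\<Sum>D\<in>F. the_elem (\<phi> ` D) * Poly_Mapping.lookup (satake_ch v w m D) l)"
    using F by (intro sum.mono_neutral_left) auto
  finally show ?thesis .
qed

text \<open>This makes the Satake transform triangular: the transform of the double coset of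
  \<open>l'\<close> involves only weights whose truncated sums are at least those of
  \<open>l'\<close>, with the same coordinate at 0.\<close>

lemma satake_pairs_dominance:
  assumes "(l, B) \<in> satake_pairs m (double_coset v m (varpi_pow w (2 * m) l'))"
  shows "(\<Sum>i<2*m. min k (wcoord l' i)) \<le> (\<Sum>i<2*m. min k (wcoord l i))"
    "Poly_Mapping.lookup l 0 = Poly_Mapping.lookup l' 0"
proof -
  interpret td_group "grp_G m" "top_G v m" "\<lambda>N. mult_U N \<times> GL_U (2 * m) N" "\<lambda>N. mult_B N \<times> GL_B (2 * m) N"
    by (rule td_group_G)
  obtain u where u: "u \<in> unipotent (2 * m)" "B = (varpi_pow w (2 * m) l \<otimes>\<^bsub>grp_G m\<^esub> (1, u)) <#\<^bsub>grp_G m\<^esub> sub_K v m"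
    "B \<subseteq> double_coset v m (varpi_pow w (2 * m) l')"
    using assms unfolding satake_pairs_def by blast
  have "varpi_pow w (2 * m) l \<otimes>\<^bsub>grp_G m\<^esub> (1, u) \<in> double_coset v m (varpi_pow w (2 * m) l')"
    using l_coset_self[OF subgroup_sub_K varpi_unip_carrier[OF u(1), of l]] u(2,3) by blast
  then have "(w powi Poly_Mapping.lookup l 0, mat_diag (2 * m) (\<lambda>i. w powi wcoord l i) * u) \<in>
      double_coset v m (w powi Poly_Mapping.lookup l' 0, mat_diag (2 * m) (\<lambda>i. w powi wcoord l' i))"
    by (simp add: varpi_pow_alt)
  then obtain a b P Q where *: "a \<in> int_units v" "b \<in> int_units v"
      "w powi Poly_Mapping.lookup l 0 = a * (w powi Poly_Mapping.lookup l' 0 * b)"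
      "P \<in> GL_int v (2*m)" "Q \<in> GL_int v (2*m)"
      "mat_diag (2 * m) (\<lambda>i. w powi wcoord l i) * u = P * (mat_diag (2 * m) (\<lambda>i. w powi wcoord l' i) * Q)"
    unfolding double_coset_iff by blast
  show "(\<Sum>i<2*m. min k (wcoord l' i)) \<le> (\<Sum>i<2*m. min k (wcoord l i))"
    by (rule dominance[OF *(4,5) u(1) *(6)])
  have "v (w powi Poly_Mapping.lookup l 0) = v (w powi Poly_Mapping.lookup l' 0)"
    unfolding *(3) using *(1,2) by (simp add: int_units_iff val_mult)
  then show "Poly_Mapping.lookup l 0 = Poly_Mapping.lookup l' 0" by simp
qed

text \<open>Among the double cosets on which the two functions differ, take one with minimal
  truncated sums. By triangularity no other differing double coset contributes to the coefficient at
  its weight, while its own contribution is a positive count times a power of q. The coefficients of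
  the Hecke polynomial are defined by a unique description, and this theorem supplies the
  uniqueness.\<close>

theorem satake_inj:
  assumes \<phi>: "\<phi> \<in> hecke_space v m R" and \<psi>: "\<psi> \<in> hecke_space v m R'"
    and eq: "satake v w m \<phi> = satake v w m \<psi>"
  shows "\<phi> = \<psi>"
proof (rule ccontr)
  assume ne: "\<phi> \<noteq> \<psi>"
  let ?n = "2 * m"
  define F where "F = {D \<in> double_cosets m. \<phi> ` D \<noteq> {0}} \<union> {D \<in> double_cosets m. \<psi> ` D \<noteq> {0}}"
  have F: "finite F" "F \<subseteq> double_cosets m" using finite_hecke_support \<phi> \<psi> by (auto simp: F_def)
  define N where "N = {D \<in> double_cosets m. the_elem (\<phi> ` D) \<noteq> the_elem (\<psi> ` D)}"
  have NF: "N \<subseteq> F"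
  proof
    fix D assume D: "D \<in> N"
    then obtain x where x: "x \<in> carrier (grp_G m)" "D = double_coset v m x" by (auto simp: N_def)
    have "\<phi> x \<noteq> \<psi> x"
      using D hecke_image_double_coset[OF \<phi> x(1)] hecke_image_double_coset[OF \<psi> x(1)] x(2) by (simp add: N_def)
    then show "D \<in> F"
      using x hecke_image_double_coset[OF \<phi> x(1)] hecke_image_double_coset[OF \<psi> x(1)] by (auto simp: F_def)
  qed
  have "N \<noteq> {}"
  proof -
    obtain x where x: "\<phi> x \<noteq> \<psi> x" using ne by blast
    have xc: "x \<in> carrier (grp_G m)"
    proof (rule ccontr)
      assume "x \<notin> carrier (grp_G m)"
      then have "\<phi> x = 0" "\<psi> x = 0" using \<phi> \<psi> unfolding hecke_space_def by blast+
      with x show False by simp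
    qed
    have "double_coset v m x \<in> N"
      using x xc hecke_image_double_coset[OF \<phi> xc] hecke_image_double_coset[OF \<psi> xc] by (auto simp: N_def)
    then show ?thesis by blast
  qed
  define rep where "rep D = (SOME l. sorted_weight ?n l \<and> D = double_coset v m (varpi_pow w ?n l))" for D
  have rep: "sorted_weight ?n (rep D)" "D = double_coset v m (varpi_pow w ?n (rep D))" if Dc: "D \<in> double_cosets m" for D
  proof -
    obtain x where x: "x \<in> carrier (grp_G m)" "D = double_coset v m x" using Dc by blast
    obtain l where "sorted_weight ?n l" "D = double_coset v m (varpi_pow w ?n l)"
      using double_coset_sorted[OF x(1)] x(2) by metis
    then have "\<exists>l. sorted_weight ?n l \<and> D = double_coset v m (varpi_pow w ?n l)" by blast
    from someI_ex[OF this] show "sorted_weight ?n (rep D)" "D = double_coset v m (varpi_pow w ?n (rep D))"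
      unfolding rep_def by blast+
  qed
  define T where "T D = (\<lambda>k. \<Sum>i<?n. min k (wcoord (rep D) i))" for D
  have "finite (T ` N)" "T ` N \<noteq> {}" using NF F(1) finite_subset \<open>N \<noteq> {}\<close> by auto
  \<comment> \<open>The pointwise order on truncated sums is only partial, so a minimal element
    replaces a least one. Equal truncated sums later force equal sorted weights.\<close>
  from finite_has_minimal[OF this] obtain t where t: "t \<in> T ` N" "\<forall>b\<in>T ` N. b \<le> t \<longrightarrow> t = b" by blast
  obtain D0 where D0: "D0 \<in> N" "t = T D0" using t(1) by blast
  have D0c: "D0 \<in> double_cosets m" using D0 by (simp add: N_def)
  let ?l = "rep D0"
  have other: "Poly_Mapping.lookup (satake_ch v w m D) ?l = 0" if D: "D \<in> N" "D \<noteq> D0" for D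
  proof (rule ccontr)
    assume nz: "Poly_Mapping.lookup (satake_ch v w m D) ?l \<noteq> 0"
    have Dc: "D \<in> double_cosets m" using D by (simp add: N_def)
    have "finite (satake_pairs m D)"
      using finite_satake_pairs nice_double_coset Dc by auto
    from lookup_satake_ch[OF this] nz have "card {B. (?l, B) \<in> satake_pairs m D} \<noteq> 0" by auto
    then obtain B where "(?l, B) \<in> satake_pairs m D" by (auto dest!: card_ge_0_finite[OF neq0_conv[THEN iffD1]] simp: card_eq_0_iff)
    then have B: "(?l, B) \<in> satake_pairs m (double_coset v m (varpi_pow w ?n (rep D)))" using rep(2)[OF Dc] by simp
    have "T D \<le> T D0"
      using satake_pairs_dominance(1)[OF B] by (simp add: T_def le_fun_def)
    then have TT: "T D0 = T D" using t(2) D0 D(1) by blast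
    have "?l = rep D"
    proof (rule weights_eqI)
      show "?l \<in> weights ?n" "rep D \<in> weights ?n" using rep(1)[OF D0c] rep(1)[OF Dc] by (auto simp: sorted_weight_def)
      fix i assume i: "i \<le> ?n"
      show "Poly_Mapping.lookup ?l i = Poly_Mapping.lookup (rep D) i"
      proof (cases i)
        case 0
        then show ?thesis using satake_pairs_dominance(2)[OF B] by simp
      next
        case (Suc j)
        have "wcoord ?l j = wcoord (rep D) j"
        proof (rule sorted_eqI[of ?n "wcoord ?l" "wcoord (rep D)" j])
          show "(\<Sum>i<2*m. min k (wcoord (rep D0) i)) = (\<Sum>i<2*m. min k (wcoord (rep D) i))" for k
            using fun_cong[OF TT, of k] by (simp add: T_def)
        qed (use rep(1)[OF D0c] rep(1)[OF Dc] i Suc in \<open>auto simp: sorted_weight_def\<close>)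
        then show ?thesis using Suc by simp
      qed
    qed
    then have "D = D0" using rep(2)[OF Dc] rep(2)[OF D0c] by simp
    with D(2) show False by simp
  qed
  have "(\<Sum>D\<in>F. the_elem (\<phi> ` D) * Poly_Mapping.lookup (satake_ch v w m D) ?l) =
      (\<Sum>D\<in>F. the_elem (\<psi> ` D) * Poly_Mapping.lookup (satake_ch v w m D) ?l)"
    using lookup_satake[OF \<phi> F] lookup_satake[OF \<psi> F] eq by (simp add: F_def)
  then have "0 = (\<Sum>D\<in>F. (the_elem (\<phi> ` D) - the_elem (\<psi> ` D)) * Poly_Mapping.lookup (satake_ch v w m D) ?l)"
    by (simp add: left_diff_distrib sum_subtractf)
  also have "\<dots> = (\<Sum>D\<in>{D0}. (the_elem (\<phi> ` D) - the_elem (\<psi> ` D)) * Poly_Mapping.lookup (satake_ch v w m D) ?l)"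
  proof (rule sum.mono_neutral_right[OF F(1)])
    show "{D0} \<subseteq> F" using D0(1) NF by blast
    show "\<forall>D\<in>F - {D0}. (the_elem (\<phi> ` D) - the_elem (\<psi> ` D)) * Poly_Mapping.lookup (satake_ch v w m D) ?l = 0"
    proof
      fix D assume D: "D \<in> F - {D0}"
      show "(the_elem (\<phi> ` D) - the_elem (\<psi> ` D)) * Poly_Mapping.lookup (satake_ch v w m D) ?l = 0"
      proof (cases "D \<in> N")
        case True
        then show ?thesis using other D by simp
      next
        case False
        then show ?thesis using D F(2) by (auto simp: N_def)
      qed
    qed
  qed
  finally have z: "Poly_Mapping.lookup (satake_ch v w m D0) ?l = 0" using D0(1) by (simp add: N_def)
  have fin: "finite (satake_pairs m D0)" using finite_satake_pairs nice_double_coset D0c by auto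
  let ?B = "(varpi_pow w ?n ?l \<otimes>\<^bsub>grp_G m\<^esub> (1, 1\<^sub>m ?n)) <#\<^bsub>grp_G m\<^esub> sub_K v m"
  have vp1: "varpi_pow w ?n ?l \<otimes>\<^bsub>grp_G m\<^esub> (1, 1\<^sub>m ?n) = varpi_pow w ?n ?l" by (simp add: varpi_pow_alt)
  have "varpi_pow w ?n ?l <#\<^bsub>grp_G m\<^esub> sub_K v m \<subseteq> D0"
  proof
    fix z assume z: "z \<in> varpi_pow w ?n ?l <#\<^bsub>grp_G m\<^esub> sub_K v m"
    interpret group "grp_G m" by (rule group_grp_G)
    have "z \<in> carrier (grp_G m)"
      using z varpi_pow_carrier subgroup.subset[OF subgroup_sub_K[of m]] by (auto simp: l_coset_def)
    then have "z = \<one>\<^bsub>grp_G m\<^esub> \<otimes>\<^bsub>grp_G m\<^esub> z" by simp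
    then have "z \<in> double_coset v m (varpi_pow w ?n ?l)"
      using z subgroup.one_closed[OF subgroup_sub_K] unfolding double_coset_def set_mult_def by blast
    then show "z \<in> D0" using rep(2)[OF D0c] by simp
  qed
  then have "(?l, ?B) \<in> satake_pairs m D0"
    using rep(1)[OF D0c] one_unipotent[of ?n] unfolding satake_pairs_def sorted_weight_def
    by (auto simp: vp1 intro!: bexI[of _ "1\<^sub>m ?n"])
  then have "?B \<in> {B. (?l, B) \<in> satake_pairs m D0}" by simp
  moreover have "finite {B. (?l, B) \<in> satake_pairs m D0}"
    by (rule finite_subset[OF _ finite_imageI[OF fin, of snd]]) force
  ultimately have "card {B. (?l, B) \<in> satake_pairs m D0} > 0" by (auto simp: card_gt_0_iff)
  then have "Poly_Mapping.lookup (satake_ch v w m D0) ?l > 0"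
    using lookup_satake_ch[OF fin, of ?l] q_ge_2 by simp
  with z show False by simp
qed

end

section \<open>The Hecke polynomial\<close>

text \<open>The exponent of the product of y_0 y_(i+1) over i in S. The set S is numbered from 0
  like matrix rows, hence the shift; coordinate 0 is \<open>card S\<close> because every linear
  factor brings one y_0.\<close>

definition minuscule :: "nat \<Rightarrow> nat set \<Rightarrow> weight" where
  "minuscule n S = weight_of n (\<lambda>i. if i = 0 then int (card S) else if i - 1 \<in> S then 1 else 0)"

lemma lookup_minuscule:
  "Poly_Mapping.lookup (minuscule n S) 0 = int (card S)"
  "i < n \<Longrightarrow> wcoord (minuscule n S) i = (if i \<in> S then 1 else 0)"
  by (simp_all add: minuscule_def lookup_weight_of)

lemma minuscule_weights: "minuscule n S \<in> weights n"
  by (simp add: minuscule_def weight_of_weights)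

lemma minuscule_inj: "S \<subseteq> {..<n} \<Longrightarrow> {i. i < n \<and> wcoord (minuscule n S) i = 1} = S"
  by (auto simp: lookup_minuscule split: if_splits)

text \<open>The positions of the free digits in a Hermite normal form with pivot set S; their number
  is the dimension of the corresponding Schubert cell.\<close>

definition inversions :: "nat \<Rightarrow> nat set \<Rightarrow> (nat \<times> nat) set" where
  "inversions n S = {(i, j). i < j \<and> j < n \<and> i \<in> S \<and> j \<notin> S}"

lemma finite_inversions [simp]: "finite (inversions n S)"
  by (rule finite_subset[of _ "{..<n} \<times> {..<n}"]) (auto simp: inversions_def)

text \<open>By induction on n: a new index outside S is inverted with every element of S, a new
  index inside S with none. The point is that the number of inversions and the pairing with delta
  differ by a quantity that depends on \<open>card S\<close> and n alone.\<close>

lemma card_inversions: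
  "S \<subseteq> {..<n} \<Longrightarrow> real (card (inversions n S)) =
     (\<Sum>i\<in>S. (real n - 1 - 2 * real i)) / 2 + real (card S) * (real n - real (card S)) / 2"
proof (induction n arbitrary: S)
  case 0
  then show ?case by (simp add: inversions_def)
next
  case (Suc n)
  show ?case
  proof (cases "n \<in> S")
    case False
    then have S: "S \<subseteq> {..<n}" using Suc.prems by (auto simp: less_Suc_eq subset_iff)
    have fS: "finite S" using S finite_subset by blast
    have "inversions (Suc n) S = inversions n S \<union> (\<lambda>i. (i, n)) ` S"
      using S False by (auto simp: inversions_def less_Suc_eq)
    moreover have "inversions n S \<inter> (\<lambda>i. (i, n)) ` S = {}" by (auto simp: inversions_def)
    ultimately have "card (inversions (Suc n) S) = card (inversions n S) + card S"
      using fS by (simp add: card_Un_disjoint card_image inj_on_def)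
    moreover have "(\<Sum>i\<in>S. (real (Suc n) - 1 - 2 * real i)) = (\<Sum>i\<in>S. (real n - 1 - 2 * real i)) + real (card S)"
      using sum.distrib[of "\<lambda>i. real n - 1 - 2 * real i" "\<lambda>_. 1" S] by (simp add: algebra_simps)
    ultimately show ?thesis using Suc.IH[OF S] by (simp add: field_simps)
  next
    case True
    define S' where "S' = S - {n}"
    have S': "S' \<subseteq> {..<n}" "S = insert n S'" "n \<notin> S'" using Suc.prems True by (auto simp: S'_def)
    have fS: "finite S'" using S'(1) finite_subset by blast
    have "inversions (Suc n) S = inversions n S'"
      using S' by (auto simp: inversions_def less_Suc_eq)
    moreover have "(\<Sum>i\<in>S'. (real (Suc n) - 1 - 2 * real i)) = (\<Sum>i\<in>S'. (real n - 1 - 2 * real i)) + real (card S')"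
      using sum.distrib[of "\<lambda>i. real n - 1 - 2 * real i" "\<lambda>_. 1" S'] by (simp add: algebra_simps)
    ultimately show ?thesis using Suc.IH[OF S'(1)] S'(2,3) fS by (simp add: field_simps)
  qed
qed

lemma delta_pairing_minuscule:
  assumes "S \<subseteq> {..<n}"
  shows "delta_pairing n (minuscule n S) = (\<Sum>i\<in>S. (real n - 1 - 2 * real i)) / 2"
proof -
  have "(\<Sum>k = 1..n. (real n - 2 * real k + 1) * real_of_int (Poly_Mapping.lookup (minuscule n S) k)) =
      (\<Sum>i<n. if i \<in> S then real n - 1 - 2 * real i else 0)"
    by (simp add: sum.atLeast1_atMost_eq lookup_minuscule algebra_simps cong: sum.cong)
      (intro sum.cong, auto simp: lookup_minuscule)
  also have "\<dots> = (\<Sum>i\<in>{..<n} \<inter> S. real n - 1 - 2 * real i)"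
    by (simp add: sum.If_cases Int_def)
  also have "{..<n} \<inter> S = S" using assms by blast
  finally show ?thesis by (simp add: delta_pairing_def)
qed

section \<open>Minuscule double cosets\<close>

context local_field_unif
begin

lemma val_w_power [simp]: "v (w ^ k) = int k"
  by (simp add: val_power)

text \<open>A minuscule double coset: that of the diagonal matrix with \<open>k\<close> entries \<open>w\<close> followed by ones.\<close>

definition supp_GL :: "nat \<Rightarrow> nat \<Rightarrow> 'f mat set" where
  "supp_GL n k = {g \<in> carrier (GL n). g \<in> M 0 n n \<and> minv g \<in> M (-1) n n \<and> v (det g) = int k}"

definition supp_G :: "nat \<Rightarrow> nat \<Rightarrow> ('f \<times> 'f mat) set" where
  "supp_G m k = {(c, g). c \<noteq> 0 \<and> v c = int k \<and> g \<in> supp_GL (2 * m) k}"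

lemma supp_GL_biinvariant:
  assumes P: "P \<in> GL_int v n" and Q: "Q \<in> GL_int v n" and g: "g \<in> supp_GL n k"
  shows "P * (g * Q) \<in> supp_GL n k"
proof -
  note p = GL_int_D[OF P] and q = GL_int_D[OF Q]
  have g': "g \<in> carrier_mat n n" "det g \<noteq> 0" "g \<in> M 0 n n" "minv g \<in> M (-1) n n" "v (det g) = int k"
    using g by (auto simp: supp_GL_def carrier_GL)
  have d: "det (P * (g * Q)) = det P * (det g * det Q)"
    using p q g' by (simp add: det_mult[of _ n])
  have i: "minv (P * (g * Q)) = minv Q * minv g * minv P"
    using minv_mult[OF p(1,2), of "g * Q"] minv_mult[OF g'(1,2) q(1,2)] p q g' by (simp add: det_mult[of _ n])
  have "P * (g * Q) \<in> M 0 n n" by (rule M_mult0(1)[OF p(3) M_mult0(1)[OF g'(3) q(3)]])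
  moreover have "minv (P * (g * Q)) \<in> M (-1) n n"
    unfolding i by (rule M_mult0(2)[OF M_mult0(1)[OF q(4) g'(4)] p(4)])
  ultimately show ?thesis
    using d p q g' by (simp add: supp_GL_def carrier_GL val_mult)
qed

lemma supp_GL_D:
  assumes "g \<in> supp_GL n k"
  shows "g \<in> carrier_mat n n" "det g \<noteq> 0" "g \<in> M 0 n n" "minv g \<in> M (-1) n n" "v (det g) = int k" "g \<in> carrier (GL n)"
  using assms by (auto simp: supp_GL_def carrier_GL)

lemma supp_GL_diag:
  assumes "k \<le> n"
  shows "mat_diag n (\<lambda>i. if i < k then w else 1) \<in> supp_GL n k"
proof -
  let ?d = "\<lambda>i. if i < k then w else 1"
  have "v (det (mat_diag n ?d)) = (\<Sum>i<n. v (?d i))" by (simp add: det_mat_diag val_prod)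
  also have "\<dots> = (\<Sum>i<n. if i < k then 1 else 0)" by (intro sum.cong) auto
  also have "\<dots> = int (card ({..<n} \<inter> {..<k}))" by (simp add: sum.If_cases lessThan_def)
  also have "{..<n} \<inter> {..<k} = {..<k}" using assms by auto
  finally have "v (det (mat_diag n ?d)) = int k" by simp
  moreover have "mat_diag n ?d \<in> M 0 n n" by (intro MI) (auto simp: mat_diag_def I_iff_val)
  moreover have "minv (mat_diag n ?d) \<in> M (-1) n n"
    by (subst minv_mat_diag) (auto simp: mat_diag_def I_iff_val val_inverse intro!: MI)
  ultimately show ?thesis by (simp add: supp_GL_def carrier_GL det_mat_diag)
qed

text \<open>Integrality of g and of w times its inverse forces each elementary divisor exponent to
  be 0 or 1, and the determinant says how many are 1; sorting puts these first.\<close>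

lemma supp_GL_cartan:
  assumes g: "g \<in> supp_GL n k"
  shows "k \<le> n" "\<exists>P\<in>GL_int v n. \<exists>Q\<in>GL_int v n. g = P * (mat_diag n (\<lambda>i. if i < k then w else 1) * Q)"
proof -
  note G = supp_GL_D[OF g]
  obtain P Q e where PQ: "P \<in> GL_int v n" "Q \<in> GL_int v n" "P * g * Q = mat_diag n (\<lambda>i. w powi e i)"
    and s: "\<And>i j. i \<le> j \<Longrightarrow> j < n \<Longrightarrow> e j \<le> e i"
    using cartan_GL[OF G(6)] by metis
  note p = GL_int_D[OF PQ(1)] and q = GL_int_D[OF PQ(2)]
  have "P * (g * Q) \<in> supp_GL n k" by (rule supp_GL_biinvariant[OF PQ(1,2) g])
  then have D: "mat_diag n (\<lambda>i. w powi e i) \<in> supp_GL n k"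
    using PQ(3) p q G by (simp add: assoc_mult_mat[of _ n n _ n _ n])
  note D' = supp_GL_D[OF D]
  have Di: "minv (mat_diag n (\<lambda>i. w powi e i)) = mat_diag n (\<lambda>i. inverse (w powi e i))"
    by (rule minv_mat_diag) simp
  have e01: "0 \<le> e i" "e i \<le> 1" if "i < n" for i
    using M_entry[OF D'(3) that that] M_entry[OF D'(4)[unfolded Di] that that] that
    by (auto simp: mat_diag_def I_iff_val val_inverse)
  have "int k = (\<Sum>i<n. e i)" using D'(5) by (simp add: det_mat_diag val_prod)
  also have "\<dots> = (\<Sum>i<n. if 1 \<le> e i then 1 else 0)"
  proof (intro sum.cong refl)
    fix i assume "i \<in> {..<n}"
    then show "e i = (if 1 \<le> e i then 1 else 0)" using e01[of i] by auto
  qed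
  also have "\<dots> = int (card ({..<n} \<inter> {i. 1 \<le> e i}))" by (simp add: sum.If_cases)
  also have "{..<n} \<inter> {i. 1 \<le> e i} = {i. i < n \<and> 1 \<le> e i}" by auto
  finally have k: "k = card {i. i < n \<and> 1 \<le> e i}" by simp
  have "card {i. i < n \<and> 1 \<le> e i} \<le> card {..<n}" by (rule card_mono) auto
  then show "k \<le> n" unfolding k by simp
  have "w powi e i = (if i < k then w else 1)" if i: "i < n" for i
  proof -
    have "(1 \<le> e i) = (i < k)"
      unfolding k by (rule sorted_ge_iff) (use s i in auto)
    moreover have "e i = (if 1 \<le> e i then 1 else 0)" using e01[OF i] by auto
    ultimately show ?thesis by (metis power_int_0_right power_int_1_right)
  qed
  then have Deq: "mat_diag n (\<lambda>i. w powi e i) = mat_diag n (\<lambda>i. if i < k then w else 1)"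
    by (intro eq_matI) (auto simp: mat_diag_def)
  have "g = minv P * (P * g * Q * minv Q)"
    using mat_cancel_right(1)[OF q(1,2), of "P * g" n] mat_cancel_left(1)[OF p(1,2) G(1)] p G by simp
  also have "P * g * Q = mat_diag n (\<lambda>i. if i < k then w else 1)" using PQ(3) Deq by simp
  finally show "\<exists>P\<in>GL_int v n. \<exists>Q\<in>GL_int v n. g = P * (mat_diag n (\<lambda>i. if i < k then w else 1) * Q)"
    using GL_int_minv[OF PQ(1)] GL_int_minv[OF PQ(2)] by blast
qed

lemma supp_G_double_coset:
  assumes "k \<le> 2 * m"
  shows "supp_G m k = double_coset v m (w powi int k, mat_diag (2 * m) (\<lambda>i. if i < k then w else 1))"
proof (intro equalityI subsetI)
  fix x assume "x \<in> supp_G m k"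
  then obtain c g where x: "x = (c, g)" "c \<noteq> 0" "v c = int k" "g \<in> supp_GL (2 * m) k"
    by (auto simp: supp_G_def)
  have u: "c / w powi int k \<in> int_units v" "1 \<in> int_units v" using x by (simp_all add: int_units_iff val_divide)
  have "c = c / w powi int k * (w powi int k * 1)" by simp
  then show "x \<in> double_coset v m (w powi int k, mat_diag (2 * m) (\<lambda>i. if i < k then w else 1))"
    unfolding x(1) double_coset_iff using supp_GL_cartan(2)[OF x(4)] u by blast
next
  fix x assume x: "x \<in> double_coset v m (w powi int k, mat_diag (2 * m) (\<lambda>i. if i < k then w else 1))"
  obtain c g where cg: "x = (c, g)" by (cases x)
  obtain a b P Q where *: "a \<in> int_units v" "b \<in> int_units v" "c = a * (w powi int k * b)"
    "P \<in> GL_int v (2 * m)" "Q \<in> GL_int v (2 * m)" "g = P * (mat_diag (2 * m) (\<lambda>i. if i < k then w else 1) * Q)"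
    using x unfolding cg double_coset_iff by blast
  show "x \<in> supp_G m k"
    unfolding cg *(6) supp_G_def using supp_GL_biinvariant[OF *(4,5) supp_GL_diag[OF assms]] *(1-3)
    by (simp add: int_units_iff val_mult)
qed

section \<open>Hermite normal forms\<close>

definition hnf_off :: "nat \<Rightarrow> nat set \<Rightarrow> (nat \<times> nat \<Rightarrow> 'f) \<Rightarrow> nat \<Rightarrow> nat \<Rightarrow> 'f" where
  "hnf_off n S x i j = (if (i, j) \<in> inversions n S then x (i, j) else 0)"

text \<open>Representatives of the left cosets in a minuscule double coset: w on the diagonal at the
  rows in S, and free entries in such a row only at later columns outside S.\<close>

definition hnf :: "nat \<Rightarrow> nat set \<Rightarrow> (nat \<times> nat \<Rightarrow> 'f) \<Rightarrow> 'f mat" where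
  "hnf n S x = mat n n (\<lambda>(i, j). (if i = j then (if i \<in> S then w else 1) else 0) + hnf_off n S x i j)"

text \<open>This is w times the inverse of \<open>hnf n S x\<close>. The off-diagonal part maps
  indices outside S to indices in S, so its square is zero and inverting just reverses its
  sign.\<close>

definition hnf_adj :: "nat \<Rightarrow> nat set \<Rightarrow> (nat \<times> nat \<Rightarrow> 'f) \<Rightarrow> 'f mat" where
  "hnf_adj n S x = mat n n (\<lambda>(i, j). (if i = j then (if i \<in> S then 1 else w) else 0) - hnf_off n S x i j)"

lemma hnf_carrier [simp]: "hnf n S x \<in> carrier_mat n n" "hnf_adj n S x \<in> carrier_mat n n"
  by (simp_all add: hnf_def hnf_adj_def)

lemma hnf_off_zero: "i \<notin> S \<or> j \<in> S \<or> j \<le> i \<Longrightarrow> hnf_off n S x i j = 0"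
  by (auto simp: hnf_off_def inversions_def)

lemma hnf_mult:
  assumes A: "A \<in> carrier_mat n n" and ij: "i < n" "j < n"
  shows "(hnf n S x * A) $$ (i, j) = (if i \<in> S then w else 1) * A $$ (i, j) + (\<Sum>k<n. hnf_off n S x i k * A $$ (k, j))"
    "(hnf_adj n S x * A) $$ (i, j) = (if i \<in> S then 1 else w) * A $$ (i, j) - (\<Sum>k<n. hnf_off n S x i k * A $$ (k, j))"
proof -
  have s: "(\<Sum>k<n. (if i = k then d else 0) * A $$ (k, j)) = d * A $$ (i, j)" for d
    using ij by (subst sum.cong[OF refl, of _ _ "\<lambda>k. if i = k then d * A $$ (k, j) else 0"]) auto
  have "(hnf n S x * A) $$ (i, j) = (\<Sum>k<n. (if i = k then (if i \<in> S then w else 1) else 0) * A $$ (k, j) + hnf_off n S x i k * A $$ (k, j))"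
    using A ij by (subst mult_mat_entry[of _ n n _ n]) (auto simp: hnf_def distrib_right intro!: sum.cong)
  then show "(hnf n S x * A) $$ (i, j) = (if i \<in> S then w else 1) * A $$ (i, j) + (\<Sum>k<n. hnf_off n S x i k * A $$ (k, j))"
    by (simp only: sum.distrib s)
  have "(hnf_adj n S x * A) $$ (i, j) = (\<Sum>k<n. (if i = k then (if i \<in> S then 1 else w) else 0) * A $$ (k, j) - hnf_off n S x i k * A $$ (k, j))"
    using A ij by (subst mult_mat_entry[of _ n n _ n]) (auto simp: hnf_adj_def left_diff_distrib intro!: sum.cong)
  then show "(hnf_adj n S x * A) $$ (i, j) = (if i \<in> S then 1 else w) * A $$ (i, j) - (\<Sum>k<n. hnf_off n S x i k * A $$ (k, j))"
    by (simp only: sum_subtractf s)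
qed

lemma hnf_adj_inverse: "hnf n S x * hnf_adj n S x = w \<cdot>\<^sub>m 1\<^sub>m n"
proof (rule eq_matI)
  fix i j assume "i < dim_row (w \<cdot>\<^sub>m 1\<^sub>m n)" "j < dim_col (w \<cdot>\<^sub>m 1\<^sub>m n)"
  then have ij: "i < n" "j < n" by auto
  have "(\<Sum>k<n. hnf_off n S x i k * hnf_adj n S x $$ (k, j)) = (\<Sum>k<n. if k = j then hnf_off n S x i j * w else 0)"
  proof (intro sum.cong refl)
    fix k assume k: "k \<in> {..<n}"
    show "hnf_off n S x i k * hnf_adj n S x $$ (k, j) = (if k = j then hnf_off n S x i j * w else 0)"
    proof (cases "k \<in> S")
      case True
      then show ?thesis using hnf_off_zero[of i S k n x] by auto
    next
      case False
      then show ?thesis using k ij hnf_off_zero[of k S j n x] by (auto simp: hnf_adj_def)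
    qed
  qed
  also have "\<dots> = hnf_off n S x i j * w" using ij by simp
  finally have s: "(\<Sum>k<n. hnf_off n S x i k * hnf_adj n S x $$ (k, j)) = hnf_off n S x i j * w" .
  show "(hnf n S x * hnf_adj n S x) $$ (i, j) = (w \<cdot>\<^sub>m 1\<^sub>m n) $$ (i, j)"
    unfolding hnf_mult(1)[OF hnf_carrier(2) ij] s
    using ij hnf_off_zero[of i S j n x] by (cases "i \<in> S") (auto simp: hnf_adj_def)
qed (auto simp: hnf_def hnf_adj_def)

lemma minv_hnf: "minv (hnf n S x) = inverse w \<cdot>\<^sub>m hnf_adj n S x" "det (hnf n S x) \<noteq> 0"
proof -
  have "hnf n S x * (inverse w \<cdot>\<^sub>m hnf_adj n S x) = inverse w \<cdot>\<^sub>m (w \<cdot>\<^sub>m 1\<^sub>m n)"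
    by (simp add: mult_smult_distrib[OF hnf_carrier(1) hnf_carrier(2)] hnf_adj_inverse)
  also have "\<dots> = 1\<^sub>m n" by (intro eq_matI) auto
  finally have e: "hnf n S x * (inverse w \<cdot>\<^sub>m hnf_adj n S x) = 1\<^sub>m n" .
  note u = right_inverse_unique[OF hnf_carrier(1) _ e]
  show "minv (hnf n S x) = inverse w \<cdot>\<^sub>m hnf_adj n S x" by (rule u(2)[symmetric]) simp
  show "det (hnf n S x) \<noteq> 0" by (rule u(1)) simp
qed

lemma hnf_upper: "upper_triangular (hnf n S x)" "i < n \<Longrightarrow> hnf n S x $$ (i, i) = (if i \<in> S then w else 1)"
  using hnf_off_zero[of _ S _ n x] by (auto simp: hnf_def)

definition hnf_params :: "nat \<Rightarrow> nat set \<Rightarrow> (nat \<times> nat \<Rightarrow> 'f) set" where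
  "hnf_params n S = (\<Pi>\<^sub>E ij\<in>inversions n S. res_reps)"

lemma hnf_off_integral: "x \<in> hnf_params n S \<Longrightarrow> hnf_off n S x i j \<in> I 0"
  using res_reps(1) by (auto simp: hnf_off_def hnf_params_def PiE_iff)

lemma hnf_supp:
  assumes x: "x \<in> hnf_params n S" and S: "S \<subseteq> {..<n}" "card S = k"
  shows "hnf n S x \<in> supp_GL n k"
proof -
  have "v (det (hnf n S x)) = (\<Sum>i<n. v (hnf n S x $$ (i, i)))"
    unfolding det_upper_triangular_prod[OF hnf_carrier(1) hnf_upper(1)] by (rule val_prod) (simp add: hnf_upper(2))
  also have "\<dots> = (\<Sum>i<n. if i \<in> S then 1 else 0)" by (intro sum.cong) (auto simp: hnf_upper(2))
  also have "\<dots> = int (card ({..<n} \<inter> S))" by (simp add: sum.If_cases)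
  also have "{..<n} \<inter> S = S" using S(1) by blast
  finally have "v (det (hnf n S x)) = int k" using S(2) by simp
  moreover have "hnf n S x \<in> M 0 n n"
    by (rule MI[OF hnf_carrier(1)]) (auto simp: hnf_def I_iff_val intro!: I_add hnf_off_integral[OF x])
  moreover have "hnf_adj n S x \<in> M 0 n n"
    by (rule MI[OF hnf_carrier(2)]) (auto simp: hnf_adj_def I_iff_val intro!: I_diff hnf_off_integral[OF x])
  then have "minv (hnf n S x) \<in> M (-1) n n"
    unfolding minv_hnf(1) by (subst M_smult_iff) (simp_all add: val_inverse)
  ultimately show ?thesis using minv_hnf(2) by (simp add: supp_GL_def carrier_GL)
qed

lemma hnf_factor:
  assumes S: "S \<subseteq> {..<n}"
  obtains u where "u \<in> unipotent n" "hnf n S x = mat_diag n (\<lambda>i. w powi wcoord (minuscule n S) i) * u"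
proof
  define u where "u = mat n n (\<lambda>(i, j). (if i = j then 1 else 0) + inverse w * hnf_off n S x i j)"
  show "u \<in> unipotent n"
    using hnf_off_zero[of _ S _ n x] by (auto simp: unipotent_def u_def)
  have uc: "u \<in> carrier_mat n n" by (simp add: u_def)
  show "hnf n S x = mat_diag n (\<lambda>i. w powi wcoord (minuscule n S) i) * u"
    unfolding mat_diag_mult_left[OF uc]
  proof (rule eq_matI)
    fix i j assume "i < dim_row (mat n n (\<lambda>(i, j). w powi wcoord (minuscule n S) i * u $$ (i, j)))"
      "j < dim_col (mat n n (\<lambda>(i, j). w powi wcoord (minuscule n S) i * u $$ (i, j)))"
    then have ij: "i < n" "j < n" by auto
    then show "hnf n S x $$ (i, j) = mat n n (\<lambda>(i, j). w powi wcoord (minuscule n S) i * u $$ (i, j)) $$ (i, j)"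
      using hnf_off_zero[of i S j n x]
      by (cases "i \<in> S") (auto simp: hnf_def u_def lookup_minuscule(2) distrib_left)
  qed (auto simp: hnf_def)
qed

text \<open>If the two forms span the same coset, then \<open>hnf_adj n S x * hnf n S y\<close> is
  divisible by w, and its entry at an inversion is the difference of the two digits. Congruent
  digits are equal.\<close>

lemma hnf_inj:
  assumes x: "x \<in> hnf_params n S" and y: "y \<in> hnf_params n S" and M: "minv (hnf n S x) * hnf n S y \<in> M 0 n n"
  shows "x = y"
proof (rule PiE_ext[of x "inversions n S" "\<lambda>_. res_reps" y])
  show "x \<in> (\<Pi>\<^sub>E ij\<in>inversions n S. res_reps)" "y \<in> (\<Pi>\<^sub>E ij\<in>inversions n S. res_reps)"
    using x y by (simp_all add: hnf_params_def)
  fix ij assume ij: "ij \<in> inversions n S"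
  obtain i j where e: "ij = (i, j)" by (cases ij)
  have ij': "i < n" "j < n" "i < j" "i \<in> S" "j \<notin> S" using ij by (auto simp: e inversions_def)
  have "inverse w \<cdot>\<^sub>m (hnf_adj n S x * hnf n S y) \<in> M 0 n n"
    using M unfolding minv_hnf(1) by (simp add: mult_smult_assoc_mat[OF hnf_carrier(2) hnf_carrier(1)])
  then have "hnf_adj n S x * hnf n S y \<in> M 1 n n"
    by (subst (asm) M_smult_iff) (simp_all add: val_inverse)
  from M_entry[OF this ij'(1,2)] have 1: "hnf n S y $$ (i, j) - (\<Sum>k<n. hnf_off n S x i k * hnf n S y $$ (k, j)) \<in> I 1"
    unfolding hnf_mult(2)[OF hnf_carrier(1) ij'(1,2)] using ij' by simp
  have "(\<Sum>k<n. hnf_off n S x i k * hnf n S y $$ (k, j)) = (\<Sum>k<n. if k = j then hnf_off n S x i j else 0)"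
  proof (intro sum.cong refl)
    fix k assume "k \<in> {..<n}"
    then show "hnf_off n S x i k * hnf n S y $$ (k, j) = (if k = j then hnf_off n S x i j else 0)"
      using ij' hnf_off_zero[of i S k n x] hnf_off_zero[of k S j n y] by (cases "k \<in> S") (auto simp: hnf_def)
  qed
  also have "\<dots> = hnf_off n S x i j" using ij' by simp
  finally have "hnf_off n S y i j - hnf_off n S x i j \<in> I 1" using 1 ij' by (simp add: hnf_def)
  then have "y ij - x ij \<in> I 1" using ij by (simp add: hnf_off_def e)
  moreover have "x ij \<in> res_reps" "y ij \<in> res_reps"
    using PiE_mem[OF x[unfolded hnf_params_def] ij] PiE_mem[OF y[unfolded hnf_params_def] ij] .
  ultimately show "x ij = y ij" using res_reps_eq[of "y ij" "x ij"] by simp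
qed

text \<open>Each representative in the Satake sum is reduced to normal form: its diagonal exponents
  are 0 or 1, and modulo w its rows in S are combinations of later rows outside S. The digits of
  these coefficients are the free entries of the normal form.\<close>

lemma hnf_exists:
  assumes u: "u \<in> unipotent n" and l: "g = mat_diag n (\<lambda>i. w powi l i) * u" and g: "g \<in> supp_GL n k"
  defines "S \<equiv> {i. i < n \<and> l i = 1}"
  shows "\<forall>i<n. l i = (if i \<in> S then 1 else 0)" "card S = k"
    "\<exists>x\<in>hnf_params n S. minv (hnf n S x) * g \<in> GL_int v n"
proof -
  note G = supp_GL_D[OF g]
  have uc: "u \<in> carrier_mat n n" "upper_triangular u" "\<And>i. i < n \<Longrightarrow> u $$ (i, i) = 1"
    using u by (auto simp: unipotent_def)
  have gij: "g $$ (i, j) = w powi l i * u $$ (i, j)" if "i < n" "j < n" for i j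
    unfolding l mat_diag_mult_left[OF uc(1)] using that by simp
  have gu: "upper_triangular g" using gij uc G(1) by (auto simp: upper_triangularD)
  have gii: "g $$ (i, i) = w powi l i" if "i < n" for i using gij[OF that that] uc(3)[OF that] by simp
  \<comment> \<open>Membership in \<open>supp_GL\<close> says precisely that h is integral. It is
    upper triangular as well, and comparing diagonals in g h = w bounds the exponents by 1.\<close>
  define h where "h = w \<cdot>\<^sub>m minv g"
  note gi = minv[OF G(1,2)]
  have hM: "h \<in> M 0 n n" unfolding h_def using G(4) by (subst M_smult_iff) auto
  note hc = M_carrier[OF hM]
  have gh: "g * h = w \<cdot>\<^sub>m 1\<^sub>m n" unfolding h_def by (simp add: mult_smult_distrib[OF G(1) gi(1)] gi(2))
  have hg: "h * g = w \<cdot>\<^sub>m 1\<^sub>m n" unfolding h_def by (simp add: mult_smult_assoc_mat[OF gi(1) G(1)] gi(3))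
  have ghu: "upper_triangular (g * h)" unfolding gh by auto
  have gnz: "g $$ (i, i) \<noteq> 0" if "i < n" for i using gii[OF that] by simp
  have rf1: "h $$ (i, j) = 0" if "i < n" "j < i" for i j
    by (rule upper_triangular_right_factor(1)[OF G(1) gu _ hc ghu that]) (rule gnz)
  have rf2: "(g * h) $$ (i, i) = g $$ (i, i) * h $$ (i, i)" if "i < n" for i
    by (rule upper_triangular_right_factor(2)[OF G(1) gu _ hc ghu that]) (rule gnz)
  have hii: "w = w powi l i * h $$ (i, i)" if i: "i < n" for i
    using rf2[OF i] gii[OF i] i by (simp add: gh)
  have l01: "0 \<le> l i" "l i \<le> 1" if i: "i < n" for i
  proof -
    show "0 \<le> l i" using M_entry[OF G(3) i i] gii[OF i] by (simp add: I_iff_val)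
    have ne: "h $$ (i, i) \<noteq> 0" using hii[OF i] by auto
    have "v w = v (w powi l i * h $$ (i, i))" by (rule arg_cong[OF hii[OF i]])
    then have "1 = l i + v (h $$ (i, i))" using ne by (simp add: val_mult)
    moreover have "v (h $$ (i, i)) \<ge> 0" using M_entry[OF hM i i] ne by (simp add: I_iff_val)
    ultimately show "l i \<le> 1" by linarith
  qed
  show lS: "\<forall>i<n. l i = (if i \<in> S then 1 else 0)"
  proof (intro allI impI)
    fix i assume "i < n"
    then show "l i = (if i \<in> S then 1 else 0)" using l01[of i] by (auto simp: S_def)
  qed
  have SS: "S \<subseteq> {..<n}" by (auto simp: S_def)
  have "int k = (\<Sum>i<n. v (g $$ (i, i)))"
    unfolding G(5)[symmetric] det_upper_triangular_prod[OF G(1) gu] by (rule val_prod) (rule gnz)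
  also have "\<dots> = (\<Sum>i<n. if i \<in> S then 1 else 0)" by (intro sum.cong) (simp_all add: gii lS)
  also have "\<dots> = int (card ({..<n} \<inter> S))" by (simp add: sum.If_cases)
  also have "{..<n} \<inter> S = S" using SS by blast
  finally show cS: "card S = k" by simp
  have h1: "h $$ (i, i) = 1" if "i \<in> S" for i
    using hii[of i] lS that SS by auto
  \<comment> \<open>Row i of h g = w is a linear relation modulo w between row i of g, with
    coefficient 1 when i is in S, and later rows. Those later rows that lie in S are eliminated by
    descending induction.\<close>
  have comb: "\<exists>y. (\<forall>t. y t \<in> I 0) \<and> (\<forall>t. (i, t) \<notin> inversions n S \<longrightarrow> y t = 0) \<and>
      (\<forall>j<n. g $$ (i, j) - (\<Sum>t<n. y t * g $$ (t, j)) \<in> I 1)" if "i \<in> S" for i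
    using that
  proof (induction "n - i" arbitrary: i rule: less_induct)
    case less
    have i: "i < n" using less.prems SS by blast
    have "\<exists>y. \<forall>k\<in>{k \<in> S. i < k}. (\<forall>t. y k t \<in> I 0) \<and> (\<forall>t. (k, t) \<notin> inversions n S \<longrightarrow> y k t = 0) \<and>
      (\<forall>j<n. g $$ (k, j) - (\<Sum>t<n. y k t * g $$ (t, j)) \<in> I 1)"
    proof (rule bchoice, intro ballI)
      fix k assume "k \<in> {k \<in> S. i < k}"
      then show "\<exists>y. (\<forall>t. y t \<in> I 0) \<and> (\<forall>t. (k, t) \<notin> inversions n S \<longrightarrow> y t = 0) \<and>
        (\<forall>j<n. g $$ (k, j) - (\<Sum>t<n. y t * g $$ (t, j)) \<in> I 1)"
        using SS i by (intro less.hyps) auto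
    qed
    then obtain y where y: "\<And>k t. k \<in> S \<Longrightarrow> i < k \<Longrightarrow> y k t \<in> I 0"
      "\<And>k t. k \<in> S \<Longrightarrow> i < k \<Longrightarrow> (k, t) \<notin> inversions n S \<Longrightarrow> y k t = 0"
      "\<And>k j. k \<in> S \<Longrightarrow> i < k \<Longrightarrow> j < n \<Longrightarrow> g $$ (k, j) - (\<Sum>t<n. y k t * g $$ (t, j)) \<in> I 1"
      by blast
    let ?A = "{k \<in> S. i < k}" and ?B = "{t. i < t \<and> t < n \<and> t \<notin> S}"
    have fA: "finite ?A" using SS by (auto intro: finite_subset[OF _ finite_lessThan])
    \<comment> \<open>Solving the relation for row i: the first term is the direct coefficient of a
      row outside S, the sum substitutes the combinations already found for later rows in S.\<close>
    define z where "z t = (if t \<in> ?B then - h $$ (i, t) else 0) - (\<Sum>k\<in>?A. h $$ (i, k) * y k t)" for t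
    have hI: "h $$ (i, t) \<in> I 0" if "t < n" for t using M_entry[OF hM i that] .
    have AI: "h $$ (i, k) \<in> I 0" if "k \<in> ?A" for k using hI that SS by auto
    have z0: "z t \<in> I 0" for t
      unfolding z_def using y(1) by (intro I_diff I_sum I_mult0(1)) (auto intro: hI AI)
    have z1: "z t = 0" if t: "(i, t) \<notin> inversions n S" for t
    proof -
      have a: "(if t \<in> ?B then - h $$ (i, t) else 0) = 0"
        using t less.prems by (auto simp: inversions_def)
      have "y k t = 0" if "k \<in> ?A" for k
      proof (rule y(2))
        show "k \<in> S" "i < k" using that by auto
        show "(k, t) \<notin> inversions n S" using t less.prems that by (auto simp: inversions_def)
      qed
      then have b: "(\<Sum>k\<in>?A. h $$ (i, k) * y k t) = 0" by (intro sum.neutral) auto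
      show ?thesis unfolding z_def a b by simp
    qed
    have z2: "g $$ (i, j) - (\<Sum>t<n. z t * g $$ (t, j)) \<in> I 1" if j: "j < n" for j
    proof -
      have "(h * g) $$ (i, j) = (\<Sum>k<n. h $$ (i, k) * g $$ (k, j))"
        using hc G(1) i j by (intro mult_mat_entry) auto
      also have "\<dots> = (\<Sum>k\<in>insert i (?A \<union> ?B). h $$ (i, k) * g $$ (k, j))"
      proof (intro sum.mono_neutral_right ballI)
        show "insert i (?A \<union> ?B) \<subseteq> {..<n}" using SS i by auto
        fix k assume "k \<in> {..<n} - insert i (?A \<union> ?B)"
        then have "k < i" by auto
        then show "h $$ (i, k) * g $$ (k, j) = 0" using rf1[OF i] by simp
      qed simp
      also have "\<dots> = g $$ (i, j) + ((\<Sum>k\<in>?A. h $$ (i, k) * g $$ (k, j)) + (\<Sum>t\<in>?B. h $$ (i, t) * g $$ (t, j)))"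
        using fA h1[OF less.prems] by (subst sum.insert) (auto simp: sum.union_disjoint intro!: sum.union_disjoint)
      finally have e1: "g $$ (i, j) = (h * g) $$ (i, j) - (\<Sum>k\<in>?A. h $$ (i, k) * g $$ (k, j)) - (\<Sum>t\<in>?B. h $$ (i, t) * g $$ (t, j))"
        by simp
      have "(\<Sum>t<n. (if t \<in> ?B then - h $$ (i, t) else 0) * g $$ (t, j)) = (\<Sum>t\<in>?B. - h $$ (i, t) * g $$ (t, j))"
        by (rule sum.mono_neutral_cong_right) auto
      moreover have "(\<Sum>t<n. (\<Sum>k\<in>?A. h $$ (i, k) * y k t) * g $$ (t, j)) = (\<Sum>k\<in>?A. h $$ (i, k) * (\<Sum>t<n. y k t * g $$ (t, j)))"
        unfolding sum_distrib_left sum_distrib_right by (subst sum.swap) (simp add: mult.assoc)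
      ultimately have e2: "(\<Sum>t<n. z t * g $$ (t, j)) = (\<Sum>t\<in>?B. - h $$ (i, t) * g $$ (t, j)) - (\<Sum>k\<in>?A. h $$ (i, k) * (\<Sum>t<n. y k t * g $$ (t, j)))"
        unfolding z_def by (simp add: left_diff_distrib sum_subtractf)
      have "g $$ (i, j) - (\<Sum>t<n. z t * g $$ (t, j)) =
          (h * g) $$ (i, j) - (\<Sum>k\<in>?A. h $$ (i, k) * (g $$ (k, j) - (\<Sum>t<n. y k t * g $$ (t, j))))"
        unfolding e1 e2 by (simp add: right_diff_distrib sum_subtractf sum_negf)
      moreover have "(h * g) $$ (i, j) \<in> I 1" unfolding hg using i j by (simp add: I_iff_val)
      moreover have "(\<Sum>k\<in>?A. h $$ (i, k) * (g $$ (k, j) - (\<Sum>t<n. y k t * g $$ (t, j)))) \<in> I 1"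
        using y(3) j AI by (intro I_sum I_mult0(1)) auto
      ultimately show ?thesis by (simp only: I_diff)
    qed
    show ?case using z0 z1 z2 by (intro exI[of _ z]) blast
  qed
  have "\<exists>y. \<forall>i\<in>S. (\<forall>t. y i t \<in> I 0) \<and> (\<forall>t. (i, t) \<notin> inversions n S \<longrightarrow> y i t = 0) \<and>
      (\<forall>j<n. g $$ (i, j) - (\<Sum>t<n. y i t * g $$ (t, j)) \<in> I 1)"
    by (rule bchoice) (use comb in blast)
  then obtain y where y: "\<And>i t. i \<in> S \<Longrightarrow> y i t \<in> I 0"
      "\<And>i t. i \<in> S \<Longrightarrow> (i, t) \<notin> inversions n S \<Longrightarrow> y i t = 0"
      "\<And>i j. i \<in> S \<Longrightarrow> j < n \<Longrightarrow> g $$ (i, j) - (\<Sum>t<n. y i t * g $$ (t, j)) \<in> I 1"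
    by blast
  have "\<exists>x. \<forall>ij\<in>inversions n S. x ij \<in> res_reps \<and> y (fst ij) (snd ij) - x ij \<in> I 1"
  proof (rule bchoice, intro ballI)
    fix ij assume "ij \<in> inversions n S"
    then have "y (fst ij) (snd ij) \<in> I 0" using y(1) by (auto simp: inversions_def)
    from res_reps(2)[OF this] show "\<exists>x. x \<in> res_reps \<and> y (fst ij) (snd ij) - x \<in> I 1" by blast
  qed
  then obtain x where x: "\<And>ij. ij \<in> inversions n S \<Longrightarrow> x ij \<in> res_reps"
    "\<And>i j. (i, j) \<in> inversions n S \<Longrightarrow> y i j - x (i, j) \<in> I 1" by force
  define X where "X = restrict x (inversions n S)"
  have X: "X \<in> hnf_params n S" using x(1) by (simp add: X_def hnf_params_def)
  have off: "y i t - hnf_off n S X i t \<in> I 1" if "i \<in> S" for i t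
    using x(2)[of i t] y(2)[OF that, of t] by (simp add: hnf_off_def X_def)
  have "hnf_adj n S X * g \<in> M 1 n n"
  proof (rule MI)
    show "hnf_adj n S X * g \<in> carrier_mat n n" using G(1) by simp
    fix i j assume ij: "i < n" "j < n"
    show "(hnf_adj n S X * g) $$ (i, j) \<in> I 1"
    proof (cases "i \<in> S")
      case False
      then have "(hnf_adj n S X * g) $$ (i, j) = w * g $$ (i, j)"
        unfolding hnf_mult(2)[OF G(1) ij] using hnf_off_zero[of i S _ n X] by simp
      then show ?thesis using M_entry[OF G(3) ij] by (simp add: I_scale)
    next
      case True
      have "(hnf_adj n S X * g) $$ (i, j) = (g $$ (i, j) - (\<Sum>t<n. y i t * g $$ (t, j))) +
          (\<Sum>t<n. (y i t - hnf_off n S X i t) * g $$ (t, j))"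
        unfolding hnf_mult(2)[OF G(1) ij] using True by (simp add: left_diff_distrib sum_subtractf)
      also have "\<dots> \<in> I 1"
        using y(3)[OF True ij(2)] off[OF True] M_entry[OF G(3) _ ij(2)] by (intro I_add I_sum I_mult0(2)) auto
      finally show ?thesis .
    qed
  qed
  then have "inverse w \<cdot>\<^sub>m (hnf_adj n S X * g) \<in> M 0 n n" by (subst M_smult_iff) (simp_all add: val_inverse)
  then have "minv (hnf n S X) * g \<in> M 0 n n"
    unfolding minv_hnf(1) by (simp add: mult_smult_assoc_mat[OF hnf_carrier(2) G(1)])
  moreover have "det (minv (hnf n S X) * g) \<in> int_units v"
  proof -
    note H = supp_GL_D[OF hnf_supp[OF X SS cS]]
    have "det (minv (hnf n S X) * g) = inverse (det (hnf n S X)) * det g"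
      using minv[OF H(1,2)] G(1) by (simp add: det_mult[of _ n])
    then show ?thesis using H G by (simp add: int_units_iff val_mult val_inverse)
  qed
  ultimately show "\<exists>x\<in>hnf_params n S. minv (hnf n S x) * g \<in> GL_int v n"
    using X by (auto simp: GL_int_iff)
qed

end

section \<open>Coefficients of the Hecke polynomial\<close>

lemma coeff_prod_linear:
  fixes a :: "'i \<Rightarrow> 'a::comm_ring_1"
  assumes "finite A"
  shows "Polynomial.coeff (\<Prod>i\<in>A. [:1, a i:]) k = (\<Sum>S\<in>{S. S \<subseteq> A \<and> card S = k}. \<Prod>i\<in>S. a i)"
proof -
  have "(\<Prod>i\<in>A. [:1, a i:]) = (\<Prod>i\<in>A. Polynomial.monom (a i) 1 + 1)"
    by (simp add: monom_Suc monom_0 one_pCons)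
  also have "\<dots> = (\<Sum>X\<in>Pow A. (\<Prod>i\<in>X. Polynomial.monom (a i) 1) * (\<Prod>i\<in>A - X. 1))"
    by (rule prod_add[OF assms])
  also have "\<dots> = (\<Sum>X\<in>Pow A. Polynomial.monom (\<Prod>i\<in>X. a i) (card X))"
  proof (intro sum.cong refl)
    fix X assume "X \<in> Pow A"
    then have "finite X" using assms finite_subset by blast
    then have "(\<Prod>i\<in>X. Polynomial.monom (a i) 1) = Polynomial.monom (\<Prod>i\<in>X. a i) (card X)"
      by (induction X) (auto simp: mult_monom)
    then show "(\<Prod>i\<in>X. Polynomial.monom (a i) 1) * (\<Prod>i\<in>A - X. 1) = Polynomial.monom (\<Prod>i\<in>X. a i) (card X)"
      by (simp only: prod.neutral_const mult_1_right)
  qed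
  finally have "Polynomial.coeff (\<Prod>i\<in>A. [:1, a i:]) k = (\<Sum>X\<in>Pow A. if card X = k then \<Prod>i\<in>X. a i else 0)"
    by (simp add: Polynomial.coeff_sum)
  also have "\<dots> = (\<Sum>S\<in>{S \<in> Pow A. card S = k}. \<Prod>i\<in>S. a i)"
    using assms by (intro sum.inter_filter[symmetric]) simp
  also have "{S \<in> Pow A. card S = k} = {S. S \<subseteq> A \<and> card S = k}" by auto
  finally show ?thesis .
qed

lemma prod_single:
  "finite S \<Longrightarrow> (\<Prod>i\<in>S. Poly_Mapping.single (f i :: weight) (\<beta> :: real)) = Poly_Mapping.single (\<Sum>i\<in>S. f i) (\<beta> ^ card S)"
  by (induction S rule: finite_induct) (auto simp: mult_single)

lemma sum_minuscule:
  assumes "S \<subseteq> {..<n}"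
  shows "(\<Sum>i\<in>S. Poly_Mapping.single 0 1 + Poly_Mapping.single (Suc i) 1) = minuscule n S"
proof (rule poly_mapping_eqI)
  fix j :: nat
  have fS: "finite S" using assms finite_subset by blast
  show "Poly_Mapping.lookup (\<Sum>i\<in>S. Poly_Mapping.single 0 1 + Poly_Mapping.single (Suc i) 1) j = Poly_Mapping.lookup (minuscule n S) j"
  proof (cases j)
    case 0
    then show ?thesis by (simp add: lookup_sum lookup_add lookup_single lookup_minuscule(1))
  next
    case (Suc l)
    have "Poly_Mapping.lookup (\<Sum>i\<in>S. Poly_Mapping.single 0 1 + Poly_Mapping.single (Suc i) 1) j = (\<Sum>i\<in>S. if i = l then 1 else 0)"
      unfolding lookup_sum Suc by (intro sum.cong) (auto simp: lookup_add lookup_single when_def)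
    also have "\<dots> = (if l \<in> S then 1 else 0)" using fS by simp
    also have "\<dots> = Poly_Mapping.lookup (minuscule n S) j"
      using assms Suc by (auto simp: minuscule_def lookup_weight_of)
    finally show ?thesis .
  qed
qed

lemma subring_gen_subring: "is_subring (subring_gen S)"
  by (auto simp: subring_gen_def is_subring_def)

lemma subring_gen_superset: "S \<subseteq> subring_gen S"
  by (auto simp: subring_gen_def)

context
  fixes R :: "'a::ring_1 set"
  assumes R: "is_subring R"
begin

lemma subring_one: "1 \<in> R" and subring_diff: "x \<in> R \<Longrightarrow> y \<in> R \<Longrightarrow> x - y \<in> R"
  and subring_mult: "x \<in> R \<Longrightarrow> y \<in> R \<Longrightarrow> x * y \<in> R"
  using R by (auto simp: is_subring_def)

lemma subring_zero: "0 \<in> R"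
  using subring_diff[OF subring_one subring_one] by simp

lemma subring_uminus: "x \<in> R \<Longrightarrow> - x \<in> R"
  using subring_diff[OF subring_zero] by simp

lemma subring_add: "x \<in> R \<Longrightarrow> y \<in> R \<Longrightarrow> x + y \<in> R"
  using subring_diff[OF _ subring_uminus, of x y] by simp

lemma subring_power: "x \<in> R \<Longrightarrow> x ^ n \<in> R"
  by (induction n) (auto intro: subring_one subring_mult)

lemma subring_of_nat: "of_nat n \<in> R"
  by (induction n) (auto intro: subring_zero subring_one subring_add)

lemma subring_sum: "(\<And>i. i \<in> A \<Longrightarrow> f i \<in> R) \<Longrightarrow> sum f A \<in> R"
  by (induction A rule: infinite_finite_induct) (auto intro: subring_zero subring_add)

end

lemma subring_power_int:
  fixes x :: "'a::field"
  assumes "is_subring R" "x \<in> R" "inverse x \<in> R"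
  shows "x powi z \<in> R"
  using subring_power[OF assms(1,2)] subring_power[OF assms(1,3)] by (simp add: power_int_def)

lemma rat_transfer_of_rat: "rat_transfer (of_rat x) = of_rat x"
  unfolding rat_transfer_def by (subst the_inv_f_f) (auto simp: inj_def)

lemma of_rat_power_int: "of_rat (x powi z) = (of_rat x :: 'a::field_char_0) powi z"
  by (simp add: power_int_def of_rat_power of_rat_inverse)

context local_field_unif
begin

lemma l_coset_G_eq_iff:
  assumes "c \<noteq> 0" "g \<in> carrier (GL (2 * m))" "c' \<noteq> 0" "g' \<in> carrier (GL (2 * m))"
  shows "(c, g) <#\<^bsub>grp_G m\<^esub> sub_K v m = (c', g') <#\<^bsub>grp_G m\<^esub> sub_K v m \<longleftrightarrow>
    c' / c \<in> int_units v \<and> minv g * g' \<in> GL_int v (2 * m)"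
proof -
  interpret td_group "grp_G m" "top_G v m" "\<lambda>N. mult_U N \<times> GL_U (2 * m) N" "\<lambda>N. mult_B N \<times> GL_B (2 * m) N"
    by (rule td_group_G)
  have c: "(c, g) \<in> carrier (grp_G m)" "(c', g') \<in> carrier (grp_G m)"
    using assms by (simp_all add: carrier_grp_G)
  show ?thesis
    unfolding l_coset_eq_iff[OF subgroup_sub_K c] l_coset_mem_iff[OF subgroup_sub_K c] inv_grp_G[OF assms(1,2)]
      mult_grp_G sub_K_iff by (simp add: divide_inverse mult.commute)
qed

lemma supp_G_carrier: "supp_G m k \<subseteq> carrier (grp_G m)"
  by (auto simp: supp_G_def supp_GL_def carrier_grp_G)

lemma supp_G_biinvariant:
  assumes "x \<in> supp_G m k" "a \<in> sub_K v m"
  shows "a \<otimes>\<^bsub>grp_G m\<^esub> x \<in> supp_G m k" "x \<otimes>\<^bsub>grp_G m\<^esub> a \<in> supp_G m k"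
proof -
  obtain c g where x: "x = (c, g)" "c \<noteq> 0" "v c = int k" "g \<in> supp_GL (2 * m) k"
    using assms(1) by (auto simp: supp_G_def)
  obtain b P where a: "a = (b, P)" "b \<in> int_units v" "P \<in> GL_int v (2 * m)"
    using assms(2) by (auto simp: sub_K_def)
  note G = supp_GL_D[OF x(4)] and p = GL_int_D[OF a(3)]
  show "a \<otimes>\<^bsub>grp_G m\<^esub> x \<in> supp_G m k"
    using supp_GL_biinvariant[OF a(3) GL_int_one x(4)] x a right_mult_one_mat[OF G(1)]
    by (simp add: supp_G_def int_units_iff val_mult)
  show "x \<otimes>\<^bsub>grp_G m\<^esub> a \<in> supp_G m k"
    using supp_GL_biinvariant[OF GL_int_one a(3) x(4)] x a left_mult_one_mat[of "g * P" "2 * m" "2 * m"] G p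
    by (simp add: supp_G_def int_units_iff val_mult)
qed

lemma l_coset_supp_G: "x \<in> carrier (grp_G m) \<Longrightarrow> x <#\<^bsub>grp_G m\<^esub> sub_K v m \<subseteq> supp_G m k \<longleftrightarrow> x \<in> supp_G m k"
proof -
  interpret td_group "grp_G m" "top_G v m" "\<lambda>N. mult_U N \<times> GL_U (2 * m) N" "\<lambda>N. mult_B N \<times> GL_B (2 * m) N"
    by (rule td_group_G)
  assume x: "x \<in> carrier (grp_G m)"
  show ?thesis
  proof
    show "x \<in> supp_G m k" if "x <#\<^bsub>grp_G m\<^esub> sub_K v m \<subseteq> supp_G m k"
      using that l_coset_self[OF subgroup_sub_K x] by blast
    show "x <#\<^bsub>grp_G m\<^esub> sub_K v m \<subseteq> supp_G m k" if "x \<in> supp_G m k"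
      using supp_G_biinvariant(2)[OF that] by (auto simp: l_coset_def)
  qed
qed

definition hnf_cosets :: "nat \<Rightarrow> nat \<Rightarrow> nat set \<Rightarrow> ('f \<times> 'f mat) set set" where
  "hnf_cosets m k S = (\<lambda>x. (w powi int k, hnf (2 * m) S x) <#\<^bsub>grp_G m\<^esub> sub_K v m) ` hnf_params (2 * m) S"

lemma hnf_GL: "hnf n S x \<in> carrier (GL n)"
  using minv_hnf(2) by (simp add: carrier_GL)

text \<open>Hermite normal forms enumerate the cosets over each weight, and S is recovered from a
  minuscule weight as the set of its coordinates equal to 1.\<close>

lemma satake_pairs_supp_G:
  "satake_pairs m (supp_G m k) = (SIGMA l : minuscule (2 * m) ` {S. S \<subseteq> {..<2 * m} \<and> card S = k}.
     hnf_cosets m k {i. i < 2 * m \<and> wcoord l i = 1})"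
proof (intro equalityI subsetI)
  fix p assume "p \<in> satake_pairs m (supp_G m k)"
  then obtain l B u where p: "p = (l, B)" "l \<in> weights (2 * m)" "B \<subseteq> supp_G m k" "u \<in> unipotent (2 * m)"
    "B = (varpi_pow w (2 * m) l \<otimes>\<^bsub>grp_G m\<^esub> (1, u)) <#\<^bsub>grp_G m\<^esub> sub_K v m"
    unfolding satake_pairs_def by blast
  define g where "g = mat_diag (2 * m) (\<lambda>i. w powi wcoord l i) * u"
  have e: "varpi_pow w (2 * m) l \<otimes>\<^bsub>grp_G m\<^esub> (1, u) = (w powi Poly_Mapping.lookup l 0, g)"
    by (simp add: varpi_pow_alt g_def)
  have "(w powi Poly_Mapping.lookup l 0, g) \<in> supp_G m k"
    using l_coset_supp_G[OF varpi_unip_carrier[OF p(4), of l]] p(3,5) e by simp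
  then have l0: "Poly_Mapping.lookup l 0 = int k" and g: "g \<in> supp_GL (2 * m) k"
    by (simp_all add: supp_G_def)
  define S where "S = {i. i < 2 * m \<and> wcoord l i = 1}"
  note ex = hnf_exists[OF p(4) g_def g, folded S_def]
  have SS: "S \<subseteq> {..<2 * m}" by (auto simp: S_def)
  have l: "l = minuscule (2 * m) S"
  proof (rule weights_eqI[OF p(2) minuscule_weights])
    fix i assume i: "i \<le> 2 * m"
    show "Poly_Mapping.lookup l i = Poly_Mapping.lookup (minuscule (2 * m) S) i"
    proof (cases i)
      case 0
      then show ?thesis using l0 ex(2) by (simp add: lookup_minuscule)
    next
      case (Suc j)
      then show ?thesis using ex(1) i by (simp add: lookup_minuscule)
    qed
  qed
  obtain x where x: "x \<in> hnf_params (2 * m) S" "minv (hnf (2 * m) S x) * g \<in> GL_int v (2 * m)" using ex(3) by blast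
  have "(w powi int k, hnf (2 * m) S x) <#\<^bsub>grp_G m\<^esub> sub_K v m = (w powi int k, g) <#\<^bsub>grp_G m\<^esub> sub_K v m"
    using x(2) hnf_GL supp_GL_D(6)[OF g] by (subst l_coset_G_eq_iff) (auto simp: int_units_iff)
  then have "B \<in> hnf_cosets m k S"
    unfolding hnf_cosets_def p(5) e l0 using x(1) by (intro image_eqI[of _ _ x]) simp_all
  then show "p \<in> (SIGMA l : minuscule (2 * m) ` {S. S \<subseteq> {..<2 * m} \<and> card S = k}. hnf_cosets m k {i. i < 2 * m \<and> wcoord l i = 1})"
    unfolding p(1) using minuscule_inj[OF SS] l SS ex(2) by auto
next
  fix p assume "p \<in> (SIGMA l : minuscule (2 * m) ` {S. S \<subseteq> {..<2 * m} \<and> card S = k}. hnf_cosets m k {i. i < 2 * m \<and> wcoord l i = 1})"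
  then obtain S B where p: "p = (minuscule (2 * m) S, B)" "S \<subseteq> {..<2 * m}" "card S = k" "B \<in> hnf_cosets m k S"
    by (auto simp: minuscule_inj)
  obtain x where x: "x \<in> hnf_params (2 * m) S" "B = (w powi int k, hnf (2 * m) S x) <#\<^bsub>grp_G m\<^esub> sub_K v m"
    using p(4) by (auto simp: hnf_cosets_def)
  obtain u where u: "u \<in> unipotent (2 * m)" "hnf (2 * m) S x = mat_diag (2 * m) (\<lambda>i. w powi wcoord (minuscule (2 * m) S) i) * u"
    using hnf_factor[OF p(2)] by blast
  have e: "varpi_pow w (2 * m) (minuscule (2 * m) S) \<otimes>\<^bsub>grp_G m\<^esub> (1, u) = (w powi int k, hnf (2 * m) S x)"
    using u(2) p(3) by (simp add: varpi_pow_alt lookup_minuscule(1))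
  have "(w powi int k, hnf (2 * m) S x) \<in> supp_G m k"
    using hnf_supp[OF x(1) p(2,3)] by (simp add: supp_G_def)
  then have "B \<subseteq> supp_G m k"
    unfolding x(2) using l_coset_supp_G supp_G_carrier by blast
  then show "p \<in> satake_pairs m (supp_G m k)"
    unfolding p(1) satake_pairs_def using minuscule_weights u(1) x(2) e by (auto intro!: bexI[OF _ u(1)])
qed

lemma card_hnf_cosets: "card (hnf_cosets m k S) = q ^ card (inversions (2 * m) S)" "finite (hnf_cosets m k S)"
proof -
  have "inj_on (\<lambda>x. (w powi int k, hnf (2 * m) S x) <#\<^bsub>grp_G m\<^esub> sub_K v m) (hnf_params (2 * m) S)"
  proof (rule inj_onI)
    fix x y assume x: "x \<in> hnf_params (2 * m) S" and y: "y \<in> hnf_params (2 * m) S"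
      and eq: "(w powi int k, hnf (2 * m) S x) <#\<^bsub>grp_G m\<^esub> sub_K v m = (w powi int k, hnf (2 * m) S y) <#\<^bsub>grp_G m\<^esub> sub_K v m"
    have "minv (hnf (2 * m) S x) * hnf (2 * m) S y \<in> GL_int v (2 * m)"
      using eq hnf_GL by (subst (asm) l_coset_G_eq_iff) auto
    then show "x = y" by (rule hnf_inj[OF x y GL_int_D(3)])
  qed
  then have "card (hnf_cosets m k S) = card (hnf_params (2 * m) S)"
    unfolding hnf_cosets_def by (rule card_image)
  also have "\<dots> = q ^ card (inversions (2 * m) S)"
    unfolding hnf_params_def by (subst card_PiE) (simp_all add: res_reps(4))
  finally show "card (hnf_cosets m k S) = q ^ card (inversions (2 * m) S)" .
  have "finite (hnf_params (2 * m) S)"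
    unfolding hnf_params_def by (intro finite_PiE) (simp_all add: res_reps(3))
  then show "finite (hnf_cosets m k S)" unfolding hnf_cosets_def by simp
qed

text \<open>Over the weight of S there are q to the number of inversions many cosets. By
  \<open>card_inversions\<close> the dependence on S cancels against the factor from the delta
  pairing, so all weights in the orbit carry the same coefficient.\<close>

lemma satake_ch_supp_G:
  "satake_ch v w m (supp_G m k) = (\<Sum>S\<in>{S. S \<subseteq> {..<2 * m} \<and> card S = k}.
     Poly_Mapping.single (minuscule (2 * m) S) (real q powr (real k * (2 * real m - real k) / 2)))"
proof -
  let ?n = "2 * m" and ?SS = "{S. S \<subseteq> {..<2 * m} \<and> card S = k}"
  have fin: "finite ?SS" by (rule finite_subset[of _ "Pow {..<2 * m}"]) auto
  have inj: "inj_on (minuscule ?n) ?SS"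
    by (rule inj_on_inverseI[of _ "\<lambda>l. {i. i < ?n \<and> wcoord l i = 1}"]) (simp add: minuscule_inj)
  have q0: "real q > 0" using q_ge_2 by simp
  have "satake_ch v w m (supp_G m k) = (\<Sum>l\<in>minuscule ?n ` ?SS. \<Sum>B\<in>hnf_cosets m k {i. i < ?n \<and> wcoord l i = 1}.
      Poly_Mapping.single l (real q powr (- delta_pairing ?n l)))"
    unfolding satake_ch_alt satake_pairs_supp_G
    by (subst sum.Sigma[symmetric]) (use fin card_hnf_cosets(2) in auto)
  also have "\<dots> = (\<Sum>S\<in>?SS. \<Sum>B\<in>hnf_cosets m k {i. i < ?n \<and> wcoord (minuscule ?n S) i = 1}.
      Poly_Mapping.single (minuscule ?n S) (real q powr (- delta_pairing ?n (minuscule ?n S))))"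
    by (rule sum.reindex[OF inj, unfolded comp_def])
  also have "\<dots> = (\<Sum>S\<in>?SS. Poly_Mapping.single (minuscule ?n S) (real q powr (real k * (2 * real m - real k) / 2)))"
  proof (intro sum.cong refl)
    fix S assume "S \<in> ?SS"
    then have S: "S \<subseteq> {..<?n}" "card S = k" by auto
    let ?x = "real q powr (- delta_pairing ?n (minuscule ?n S))"
    have "(\<Sum>B\<in>hnf_cosets m k {i. i < ?n \<and> wcoord (minuscule ?n S) i = 1}. Poly_Mapping.single (minuscule ?n S) ?x)
        = of_nat (q ^ card (inversions ?n S)) * Poly_Mapping.single (minuscule ?n S) ?x"
      unfolding minuscule_inj[OF S(1)] by (simp add: card_hnf_cosets(1))
    also have "\<dots> = Poly_Mapping.single 0 (of_nat (q ^ card (inversions ?n S))) * Poly_Mapping.single (minuscule ?n S) ?x"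
      by (simp only: single_of_nat)
    also have "\<dots> = Poly_Mapping.single (minuscule ?n S) (real q ^ card (inversions ?n S) * ?x)"
      by (simp add: mult_single)
    also have "real q ^ card (inversions ?n S) * ?x = real q powr (real (card (inversions ?n S)) - delta_pairing ?n (minuscule ?n S))"
      using q0 by (simp add: powr_realpow[symmetric] powr_add[symmetric])
    also have "real (card (inversions ?n S)) - delta_pairing ?n (minuscule ?n S) = real k * (2 * real m - real k) / 2"
      unfolding card_inversions[OF S(1)] delta_pairing_minuscule[OF S(1)] S(2) by simp
    finally show "(\<Sum>B\<in>hnf_cosets m k {i. i < ?n \<and> wcoord (minuscule ?n S) i = 1}. Poly_Mapping.single (minuscule ?n S) ?x)
        = Poly_Mapping.single (minuscule ?n S) (real q powr (real k * (2 * real m - real k) / 2))" .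
  qed
  finally show ?thesis .
qed

lemma coeff_satake_poly:
  "Polynomial.coeff (satake_poly v m c) k = (\<Sum>S\<in>{S. S \<subseteq> {..<2 * m} \<and> card S = k}.
     Poly_Mapping.single (minuscule (2 * m) S) ((- (real q powr (- real_of_int c / 2))) ^ k))"
proof -
  define \<beta> where "\<beta> = real q powr (- real_of_int c / 2)"
  have y: "- (y_var 0 * y_var (Suc i) * Poly_Mapping.single 0 \<beta>) =
      Poly_Mapping.single (Poly_Mapping.single 0 1 + Poly_Mapping.single (Suc i) 1) (- \<beta>)" for i
    by (simp add: y_var_def mult_single single_uminus)
  have "satake_poly v m c = (\<Prod>i<2 * m. [:1, Poly_Mapping.single (Poly_Mapping.single 0 1 + Poly_Mapping.single (Suc i) 1) (- \<beta>):])"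
    unfolding satake_poly_def \<beta>_def[symmetric] One_nat_def prod.atLeast_Suc_atMost_Suc_shift
    by (subst prod.atLeast1_atMost_eq[unfolded One_nat_def]) (simp only: y)
  then have "Polynomial.coeff (satake_poly v m c) k = (\<Sum>S\<in>{S. S \<subseteq> {..<2 * m} \<and> card S = k}.
      \<Prod>i\<in>S. Poly_Mapping.single (Poly_Mapping.single 0 1 + Poly_Mapping.single (Suc i) 1) (- \<beta>))"
    by (simp only: coeff_prod_linear[OF finite_lessThan])
  also have "\<dots> = (\<Sum>S\<in>{S. S \<subseteq> {..<2 * m} \<and> card S = k}. Poly_Mapping.single (minuscule (2 * m) S) ((- \<beta>) ^ k))"
  proof (intro sum.cong refl)
    fix S assume "S \<in> {S. S \<subseteq> {..<2 * m} \<and> card S = k}"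
    then have S: "S \<subseteq> {..<2 * m}" "card S = k" by auto
    then have "finite S" using finite_subset by blast
    then show "(\<Prod>i\<in>S. Poly_Mapping.single (Poly_Mapping.single 0 1 + Poly_Mapping.single (Suc i) 1) (- \<beta>)) =
        Poly_Mapping.single (minuscule (2 * m) S) ((- \<beta>) ^ k)"
      by (simp only: prod_single sum_minuscule[OF S(1)] S(2))
  qed
  finally show ?thesis by (simp add: \<beta>_def)
qed

text \<open>Combines the factor q^(-ck/2) of the polynomial with the factor q^(-k(2m-k)/2) that
  undoes the transform of the double coset. For odd c the number k (c + 2m - k) is even for every k,
  so the division is exact.\<close>

definition hecke_num :: "nat \<Rightarrow> int \<Rightarrow> nat \<Rightarrow> rat" where
  "hecke_num m c k = (-1) ^ k * of_nat q powi (- (int k * (c + 2 * int m - int k) div 2))"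

lemma hecke_num_real:
  assumes "odd c"
  shows "real_of_rat (hecke_num m c k) * (real q powr (real k * (2 * real m - real k) / 2)) = (- (real q powr (- real_of_int c / 2))) ^ k"
proof -
  have q0: "real q > 0" using q_ge_2 by simp
  have "even (int k * (c + 2 * int m - int k))" using assms by auto
  then have d: "real_of_int (int k * (c + 2 * int m - int k) div 2) = real_of_int (int k * (c + 2 * int m - int k)) / 2"
    by (metis dvd_div_mult_self mult.commute nonzero_mult_div_cancel_left of_int_mult of_int_numeral zero_neq_numeral)
  have "real_of_rat (hecke_num m c k) = (-1) ^ k * real q powi (- (int k * (c + 2 * int m - int k) div 2))"
    by (simp add: hecke_num_def of_rat_mult of_rat_power of_rat_power_int)
  also have "real q powi (- (int k * (c + 2 * int m - int k) div 2)) = real q powr (- (real k * (real_of_int c + 2 * real m - real k) / 2))"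
  proof -
    have "real q powi (- (int k * (c + 2 * int m - int k) div 2)) = real q powr (real_of_int (- (int k * (c + 2 * int m - int k) div 2)))"
      using q0 by (intro powr_real_of_int'[symmetric]) auto
    also have "real_of_int (- (int k * (c + 2 * int m - int k) div 2)) = - (real k * (real_of_int c + 2 * real m - real k) / 2)"
      unfolding of_int_minus d by simp
    finally show ?thesis .
  qed
  finally have "real_of_rat (hecke_num m c k) * (real q powr (real k * (2 * real m - real k) / 2)) =
      (-1) ^ k * (real q powr (- (real k * (real_of_int c + 2 * real m - real k) / 2) + real k * (2 * real m - real k) / 2))"
    by (simp only: powr_add mult.assoc)
  also have "- (real k * (real_of_int c + 2 * real m - real k) / 2) + real k * (2 * real m - real k) / 2 = (- real_of_int c / 2) * real k"
    by (simp add: field_simps)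
  also have "(-1) ^ k * (real q powr ((- real_of_int c / 2) * real k)) = (- (real q powr (- real_of_int c / 2))) ^ k"
    using q0 by (subst powr_powr[symmetric], subst powr_realpow) (auto simp: power_minus[of "real q powr _"])
  finally show ?thesis .
qed

text \<open>The indicated multiple of the characteristic function has the right transform by
  \<open>satake_ch_supp_G\<close>; \<open>satake_inj\<close> identifies it with the described
  coefficient.\<close>

lemma hecke_std_coeff_eq:
  assumes c: "odd c" and k: "k \<le> 2 * m"
  shows "hecke_std_coeff v w m c k = (\<lambda>g. if g \<in> supp_G m k then real_of_rat (hecke_num m c k) else 0)" (is "_ = ?\<phi>")
proof -
  interpret td_group "grp_G m" "top_G v m" "\<lambda>N. mult_U N \<times> GL_U (2 * m) N" "\<lambda>N. mult_B N \<times> GL_B (2 * m) N"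
    by (rule td_group_G)
  let ?\<sigma> = "(w powi int k, mat_diag (2 * m) (\<lambda>i. if i < k then w else 1))"
  have \<sigma>: "?\<sigma> \<in> carrier (grp_G m)" using supp_GL_D(6)[OF supp_GL_diag[OF k]] by (simp add: carrier_grp_G)
  note D = supp_G_double_coset[OF k]
  have ne0: "hecke_num m c k \<noteq> 0" using q_ge_2 by (simp add: hecke_num_def)
  then have ne: "real_of_rat (hecke_num m c k) \<noteq> 0" by simp
  have Z: "is_subring (Z_q_half v)" "sqrt (real q) \<in> Z_q_half v" "inverse (sqrt (real q)) \<in> Z_q_half v"
    using subring_gen_subring subring_gen_superset unfolding Z_q_half_def by blast+
  have qZ: "real q \<in> Z_q_half v" "inverse (real q) \<in> Z_q_half v"
    using subring_mult[OF Z(1) Z(2,2)] subring_mult[OF Z(1) Z(3,3)]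
    by (simp_all flip: inverse_mult_distrib)
  have "real_of_rat (hecke_num m c k) = (-1) ^ k * real q powi (- (int k * (c + 2 * int m - int k) div 2))"
    by (simp add: hecke_num_def of_rat_mult of_rat_power of_rat_power_int)
  also have "\<dots> \<in> Z_q_half v"
    by (intro subring_mult[OF Z(1)] subring_power[OF Z(1)] subring_uminus[OF Z(1)] subring_one[OF Z(1)]
        subring_power_int[OF Z(1) qZ])
  finally have vZ: "real_of_rat (hecke_num m c k) \<in> Z_q_half v" .
  have bi: "(a \<otimes>\<^bsub>grp_G m\<^esub> g \<in> supp_G m k) = (g \<in> supp_G m k) \<and> (g \<otimes>\<^bsub>grp_G m\<^esub> a \<in> supp_G m k) = (g \<in> supp_G m k)"
    if g: "g \<in> carrier (grp_G m)" and a: "a \<in> sub_K v m" for g a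
  proof -
    have ac: "a \<in> carrier (grp_G m)" using a subgroup.subset[OF subgroup_sub_K] by blast
    have ia: "inv\<^bsub>grp_G m\<^esub> a \<in> sub_K v m" by (rule subgroup.m_inv_closed[OF subgroup_sub_K a])
    have e1: "inv\<^bsub>grp_G m\<^esub> a \<otimes>\<^bsub>grp_G m\<^esub> (a \<otimes>\<^bsub>grp_G m\<^esub> g) = g" using ac g by (simp add: m_assoc[symmetric])
    have e2: "g \<otimes>\<^bsub>grp_G m\<^esub> a \<otimes>\<^bsub>grp_G m\<^esub> inv\<^bsub>grp_G m\<^esub> a = g" using ac g by (simp add: m_assoc)
    show ?thesis
      using supp_G_biinvariant[of g m k a] supp_G_biinvariant(1)[of "a \<otimes>\<^bsub>grp_G m\<^esub> g" m k, OF _ ia]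
        supp_G_biinvariant(2)[of "g \<otimes>\<^bsub>grp_G m\<^esub> a" m k, OF _ ia] a unfolding e1 e2 by blast
  qed
  have \<phi>: "?\<phi> \<in> hecke_space v m (Z_q_half v)"
    unfolding hecke_space_def
  proof (intro CollectI conjI allI impI ballI)
    show "?\<phi> g = 0" if "g \<notin> carrier (grp_G m)" for g using that supp_G_carrier by auto
    show "?\<phi> g \<in> Z_q_half v" for g using vZ subring_zero[OF Z(1)] by simp
    show "?\<phi> (a \<otimes>\<^bsub>grp_G m\<^esub> g) = ?\<phi> g" "?\<phi> (g \<otimes>\<^bsub>grp_G m\<^esub> a) = ?\<phi> g"
      if "g \<in> carrier (grp_G m)" "a \<in> sub_K v m" for g a
      using bi[OF that] by simp_all
    show "compactly_supported (top_G v m) ?\<phi>"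
      by (rule nice_compactly_supported[OF nice_double_coset[OF \<sigma>]]) (simp add: D ne0)
  qed
  have img: "?\<phi> ` supp_G m k = {real_of_rat (hecke_num m c k)}"
    using double_coset_self[OF \<sigma>] D by auto
  have "{D \<in> double_cosets m. ?\<phi> ` D \<noteq> {0}} = {supp_G m k}"
  proof (intro equalityI subsetI)
    fix E assume "E \<in> {D \<in> double_cosets m. ?\<phi> ` D \<noteq> {0}}"
    then obtain x where x: "x \<in> carrier (grp_G m)" "E = double_coset v m x" "?\<phi> ` E \<noteq> {0}" by blast
    then have "?\<phi> x \<noteq> 0" using hecke_image_double_coset[OF \<phi> x(1)] by simp
    then have "x \<in> supp_G m k" by (simp split: if_splits)
    then have "x \<in> double_coset v m ?\<sigma>" using D by simp
    then have "double_coset v m x = double_coset v m ?\<sigma>"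
      unfolding double_coset_def by (rule double_coset_eq[OF subgroup_sub_K \<sigma>])
    then show "E \<in> {supp_G m k}" using x(2) D by simp
  next
    fix E assume "E \<in> {supp_G m k}"
    then show "E \<in> {D \<in> double_cosets m. ?\<phi> ` D \<noteq> {0}}" using D \<sigma> img ne by auto
  qed
  then have "satake v w m ?\<phi> = Poly_Mapping.single 0 (real_of_rat (hecke_num m c k)) * satake_ch v w m (supp_G m k)"
    unfolding satake_def using img by simp
  also have "\<dots> = Polynomial.coeff (satake_poly v m c) k"
    unfolding satake_ch_supp_G coeff_satake_poly sum_distrib_left mult_single add_0_left hecke_num_real[OF c] ..
  finally have s: "satake v w m ?\<phi> = Polynomial.coeff (satake_poly v m c) k" .
  show ?thesis
    unfolding hecke_std_coeff_def
  proof (rule the_equality)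
    show "?\<phi> \<in> hecke_space v m (Z_q_half v) \<and> satake v w m ?\<phi> = Polynomial.coeff (satake_poly v m c) k"
      using \<phi> s by blast
    fix \<psi> assume "\<psi> \<in> hecke_space v m (Z_q_half v) \<and> satake v w m \<psi> = Polynomial.coeff (satake_poly v m c) k"
    then have "\<psi> \<in> hecke_space v m (Z_q_half v)" "satake v w m \<psi> = satake v w m ?\<phi>"
      using s by (simp_all only:)
    then show "\<psi> = ?\<phi>" by (rule satake_inj[OF _ \<phi>])
  qed
qed

definition supp_Gt :: "nat \<Rightarrow> nat \<Rightarrow> (('f \<times> 'f mat) \<times> 'f) set" where
  "supp_Gt m k = {(g, t). g \<in> supp_G m k \<and> t \<noteq> 0 \<and> v t = - int k}"

lemma hecke_tilde_eq:
  assumes "odd c"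
  shows "(hecke_tilde v w m c :: _ \<Rightarrow> 'p::field_char_0) x =
    (\<Sum>k\<le>2 * m. if x \<in> supp_Gt m k then of_rat (hecke_num m c k) else 0)"
proof -
  obtain g t where x: "x = (g, t)" by (cases x)
  have t: "t \<in> (w powi (- int k)) <#\<^bsub>mult_group\<^esub> int_units v \<longleftrightarrow> t \<noteq> 0 \<and> v t = - int k" for k
  proof
    assume "t \<in> (w powi (- int k)) <#\<^bsub>mult_group\<^esub> int_units v"
    then obtain u where "u \<in> int_units v" "t = w powi (- int k) * u" by (auto simp: l_coset_def)
    then show "t \<noteq> 0 \<and> v t = - int k" by (simp only: int_units_iff val_mult val_w_powi) (simp add: val_mult int_units_iff)
  next
    assume t: "t \<noteq> 0 \<and> v t = - int k"
    then have "t / w powi (- int k) \<in> int_units v" by (simp only: int_units_iff) (simp add: val_divide val_inverse val_mult power_int_minus)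
    moreover have "t = w powi (- int k) * (t / w powi (- int k))" by simp
    ultimately show "t \<in> (w powi (- int k)) <#\<^bsub>mult_group\<^esub> int_units v" unfolding l_coset_def mult_mult_group by blast
  qed
  have z: "rat_transfer 0 = (0::'p)" using rat_transfer_of_rat[of 0] by simp
  show ?thesis
    unfolding hecke_tilde_def x prod.case
  proof (intro sum.cong refl)
    fix k assume "k \<in> {..2 * m}"
    then have k: "k \<le> 2 * m" by simp
    show "rat_transfer (hecke_std_coeff v w m c k g) * (if t \<in> (w powi (- int k)) <#\<^bsub>mult_group\<^esub> int_units v then 1 else 0) =
        (if (g, t) \<in> supp_Gt m k then of_rat (hecke_num m c k) else (0::'p))"
      unfolding hecke_std_coeff_eq[OF assms k] t supp_Gt_def by (simp add: rat_transfer_of_rat z)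
  qed
qed

end

section \<open>Block triangular matrices\<close>

definition tri :: "nat \<Rightarrow> 'f::field mat \<Rightarrow> 'f mat \<Rightarrow> 'f mat \<Rightarrow> 'f mat" where
  "tri m A B D = four_block_mat A B (0\<^sub>m m m) D"

lemma tri_carrier [simp]:
  assumes "A \<in> carrier_mat m m" "D \<in> carrier_mat m m"
  shows "tri m A B D \<in> carrier_mat (2 * m) (2 * m)"
  using four_block_carrier_mat[OF assms, of B "0\<^sub>m m m"] by (simp add: tri_def mult_2)

lemma tri_mult:
  assumes "A \<in> carrier_mat m m" "B \<in> carrier_mat m m" "D \<in> carrier_mat m m"
    "A' \<in> carrier_mat m m" "B' \<in> carrier_mat m m" "D' \<in> carrier_mat m m"
  shows "tri m A B D * tri m A' B' D' = tri m (A * A') (A * B' + B * D') (D * D')"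
proof -
  have z: "A * A' + B * 0\<^sub>m m m = A * A'" "0\<^sub>m m m * A' + D * 0\<^sub>m m m = 0\<^sub>m m m" "0\<^sub>m m m * B' + D * D' = D * D'"
    using assms by (auto simp: right_mult_zero_mat[of _ m m] left_mult_zero_mat[of _ m m])
  show ?thesis
    unfolding tri_def
    by (subst mult_four_block_mat[OF assms(1,2) zero_carrier_mat assms(3,4,5) zero_carrier_mat assms(6)]) (simp only: z)
qed

lemma det_tri:
  assumes "A \<in> carrier_mat m m" "B \<in> carrier_mat m m" "D \<in> carrier_mat m m"
  shows "det (tri m A B D) = det A * det D"
  unfolding tri_def using assms by (intro det_four_block_mat_lower_left_zero) auto

lemma tri_one: "tri m (1\<^sub>m m) (0\<^sub>m m m) (1\<^sub>m m) = 1\<^sub>m (2 * m)"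
  by (intro eq_matI) (auto simp: tri_def)

lemma tri_minv:
  assumes A: "A \<in> carrier (GL m)" and B: "B \<in> carrier_mat m m" and D: "D \<in> carrier (GL m)"
  shows "minv (tri m A B D) = tri m (minv A) (- (minv A * B * minv D)) (minv D)"
proof -
  have a: "A \<in> carrier_mat m m" "det A \<noteq> 0" and d: "D \<in> carrier_mat m m" "det D \<noteq> 0" using A D by (auto simp: carrier_GL)
  note ia = minv[OF a] and id = minv[OF d]
  have e: "A * (- (minv A * B * minv D)) + B * minv D = 0\<^sub>m m m"
  proof -
    have "A * (minv A * B * minv D) = B * minv D"
      using a B ia id mat_cancel_left(2)[OF a, of "B * minv D" m] by (simp add: assoc_mult_mat[of _ m m _ m _ m])
    then have "A * (- (minv A * B * minv D)) = - (B * minv D)"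
      using a B ia id by (simp add: uminus_mult_right_mat[of A "minv A * B * minv D"])
    then show ?thesis using B id by (simp add: uminus_l_inv_mat[of _ m m])
  qed
  have "tri m A B D * tri m (minv A) (- (minv A * B * minv D)) (minv D) = tri m (1\<^sub>m m) (0\<^sub>m m m) (1\<^sub>m m)"
    using a B d ia id e by (subst tri_mult) auto
  then have "tri m A B D * tri m (minv A) (- (minv A * B * minv D)) (minv D) = 1\<^sub>m (2 * m)" by (simp only: tri_one)
  then show ?thesis
    by (rule right_inverse_unique(2)[OF tri_carrier[OF a(1) d(1)] tri_carrier[OF ia(1) id(1)], symmetric])
qed

lemma tri_of_upper:
  assumes "b \<in> carrier_mat (2 * m) (2 * m)" "upper_triangular b"
  shows "b = tri m (mat m m (\<lambda>(i, j). b $$ (i, j))) (mat m m (\<lambda>(i, j). b $$ (i, j + m))) (mat m m (\<lambda>(i, j). b $$ (i + m, j + m)))"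
  using assms by (intro eq_matI) (auto simp: tri_def upper_triangularD)

context local_field_unif
begin

lemma tri_M:
  assumes "A \<in> carrier_mat m m" "B \<in> carrier_mat m m" "D \<in> carrier_mat m m"
  shows "tri m A B D \<in> M k (2 * m) (2 * m) \<longleftrightarrow> A \<in> M k m m \<and> B \<in> M k m m \<and> D \<in> M k m m"
proof
  assume T: "tri m A B D \<in> M k (2 * m) (2 * m)"
  have e: "tri m A B D $$ (i, j) \<in> I k" if "i < 2 * m" "j < 2 * m" for i j by (rule M_entry[OF T that])
  show "A \<in> M k m m \<and> B \<in> M k m m \<and> D \<in> M k m m"
  proof (intro conjI MI assms)
    fix i j assume ij: "i < m" "j < m"
    show "A $$ (i, j) \<in> I k" using e[of i j] ij assms by (simp add: tri_def)
    show "B $$ (i, j) \<in> I k" using e[of i "j + m"] ij assms by (simp add: tri_def)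
    show "D $$ (i, j) \<in> I k" using e[of "i + m" "j + m"] ij assms by (simp add: tri_def)
  qed
next
  assume *: "A \<in> M k m m \<and> B \<in> M k m m \<and> D \<in> M k m m"
  show "tri m A B D \<in> M k (2 * m) (2 * m)"
  proof (rule MI)
    show "tri m A B D \<in> carrier_mat (2 * m) (2 * m)" using assms by simp
    fix i j assume "i < 2 * m" "j < 2 * m"
    then show "tri m A B D $$ (i, j) \<in> I k"
      using * assms M_entry[of A k m m i j] M_entry[of B k m m i "j - m"] M_entry[of D k m m "i - m" "j - m"]
      by (auto simp: tri_def)
  qed
qed

lemma tri_GL_int:
  assumes "A \<in> carrier_mat m m" "B \<in> carrier_mat m m" "D \<in> carrier_mat m m"
  shows "tri m A B D \<in> GL_int v (2 * m) \<longleftrightarrow> A \<in> GL_int v m \<and> B \<in> M 0 m m \<and> D \<in> GL_int v m"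
proof -
  have "x * y \<in> int_units v \<longleftrightarrow> x \<in> int_units v \<and> y \<in> int_units v" if "x \<in> I 0" "y \<in> I 0" for x y
    using that by (auto simp: int_units_iff val_mult I_iff_val)
  then show ?thesis
    unfolding GL_int_iff tri_M[OF assms] det_tri[OF assms] using det_M0[of A m] det_M0[of D m] by blast
qed

end

section \<open>The embedding\<close>

lemma iota_t_alt: "iota_t m (a, h1, h2) = ((a, tri m h1 (0\<^sub>m m m) h2), det h2 / det h1)"
  by (simp add: iota_t_def iota_def nu_def tri_def)

context local_field_unif
begin

lemma carrier_grp_Gt: "((a, g), t) \<in> carrier (grp_Gt m) \<longleftrightarrow> a \<noteq> 0 \<and> g \<in> carrier (GL (2 * m)) \<and> t \<noteq> 0"
  by (auto simp: grp_Gt_def carrier_grp_G carrier_mult_group)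

lemma mult_grp_Gt [simp]: "(x, t) \<otimes>\<^bsub>grp_Gt m\<^esub> (x', t') = (x \<otimes>\<^bsub>grp_G m\<^esub> x', t * t')"
  by (simp add: grp_Gt_def)

lemma inv_grp_Gt: "((a, g), t) \<in> carrier (grp_Gt m) \<Longrightarrow> inv\<^bsub>grp_Gt m\<^esub> ((a, g), t) = ((inverse a, minv g), inverse t)"
  unfolding grp_Gt_def
  by (subst inv_DirProd[OF group_grp_G group_mult_group])
    (auto simp: carrier_mult_group carrier_grp_G inv_grp_G inv_mult_group)

lemma inv_grp_H: "(a, h1, h2) \<in> carrier (grp_H m) \<Longrightarrow> inv\<^bsub>grp_H m\<^esub> (a, h1, h2) = (inverse a, minv h1, minv h2)"
  unfolding grp_H_def
  by (subst inv_DirProd[OF group_mult_group DirProd_group[OF group_GL group_GL]])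
    (auto simp: carrier_mult_group inv_mult_group inv_DirProd[OF group_GL group_GL] inv_GL)

lemma sub_Kt_alt: "sub_Kt v m = (mult_B 0 \<times> GL_B (2 * m) 0) \<times> mult_B 0"
  by (simp add: sub_Kt_def sub_K_alt mult_B0)

lemma subgroup_sub_Kt: "subgroup (sub_Kt v m) (grp_Gt m)"
  using td_group.B_subgroup[OF td_group_Gt] by (simp add: sub_Kt_alt)

lemma iota_t_carrier: "h \<in> carrier (grp_H m) \<Longrightarrow> iota_t m h \<in> carrier (grp_Gt m)"
  by (cases h) (auto simp: iota_t_alt carrier_grp_H carrier_grp_Gt carrier_GL det_tri)

lemma iota_t_mult:
  assumes "h \<in> carrier (grp_H m)" "h' \<in> carrier (grp_H m)"
  shows "iota_t m (h \<otimes>\<^bsub>grp_H m\<^esub> h') = iota_t m h \<otimes>\<^bsub>grp_Gt m\<^esub> iota_t m h'"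
proof -
  obtain a h1 h2 b k1 k2 where h: "h = (a, h1, h2)" "h' = (b, k1, k2)" by (metis prod_cases3)
  have c: "h1 \<in> carrier_mat m m" "h2 \<in> carrier_mat m m" "k1 \<in> carrier_mat m m" "k2 \<in> carrier_mat m m"
    using assms by (auto simp: h carrier_grp_H carrier_GL)
  have z: "h1 * 0\<^sub>m m m + 0\<^sub>m m m * k2 = 0\<^sub>m m m"
    using c by (simp add: right_mult_zero_mat[of _ m m] left_mult_zero_mat[of _ m m])
  show ?thesis
    unfolding h mult_grp_H iota_t_alt mult_grp_Gt mult_grp_G
    using c z by (simp add: tri_mult det_mult[of _ m])
qed

lemma iota_t_group_hom: "group_hom (grp_H m) (grp_Gt m) (iota_t m)"
  using iota_t_carrier iota_t_mult
  by (intro group_hom.intro group_grp_H group_grp_Gt group_hom_axioms.intro) (auto simp: hom_def)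

lemma sub_U_alt: "sub_U v m = mult_B 0 \<times> (GL_B m 0 \<times> GL_B m 0)"
proof -
  have "(a, h1, h2) \<in> sub_U v m \<longleftrightarrow> (a, h1, h2) \<in> mult_B 0 \<times> (GL_B m 0 \<times> GL_B m 0)" for a h1 h2
  proof -
    have "(a, h1, h2) \<in> sub_U v m \<longleftrightarrow> (a, h1, h2) \<in> carrier (grp_H m) \<and> a \<in> int_units v \<and> tri m h1 (0\<^sub>m m m) h2 \<in> GL_int v (2 * m)"
      by (simp add: sub_U_def iota_def tri_def sub_K_iff)
    also have "\<dots> \<longleftrightarrow> a \<in> int_units v \<and> h1 \<in> GL_int v m \<and> h2 \<in> GL_int v m"
      using tri_GL_int[of h1 m "0\<^sub>m m m" h2] GL_int_D(1,2,7) M_zero[of m m 0]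
      by (auto simp: carrier_grp_H carrier_GL int_units_iff)
    finally show ?thesis by (simp add: mult_B0 GL_B0)
  qed
  then show ?thesis by auto
qed

end

context haar_td_group
begin

text \<open>Unimodularity gives every right coset of W the measure of W. Together with
  \<open>measure_l_cosets\<close> this converts counts of left cosets into counts of right
  cosets.\<close>

lemma measure_r_cosets:
  assumes W: "subgroup W G" "nice W" and S: "nice S" "\<And>g h. g \<in> S \<Longrightarrow> h \<in> W \<Longrightarrow> h \<otimes> g \<in> S"
    and unimod: "\<And>h. h \<in> carrier G \<Longrightarrow> modular h = 1"
  shows "measure \<mu> S = of_nat (card ((\<lambda>g. W #> g) ` S)) * measure \<mu> W"
proof -
  note Sc = nice_carrier[OF S(1)]
  have U: "\<Union>((\<lambda>g. W #> g) ` S) = S"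
  proof
    show "\<Union>((\<lambda>g. W #> g) ` S) \<subseteq> S" using S(2) by (auto simp: r_coset_def)
    show "S \<subseteq> \<Union>((\<lambda>g. W #> g) ` S)" using r_coset_self[OF W(1)] Sc by auto
  qed
  have n: "nice T" "T \<noteq> {}" "measure \<mu> T = measure \<mu> W" if T: "T \<in> (\<lambda>g. W #> g) ` S" for T
  proof -
    obtain g where g: "g \<in> S" "T = W #> g" using T by (rule imageE)
    then have gc: "g \<in> carrier G" using Sc by blast
    show "nice T" "T \<noteq> {}" "measure \<mu> T = measure \<mu> W"
      using g nice_r_coset[OF W(2) gc] r_coset_self[OF W(1) gc] measure_r_coset[OF W(2) gc] unimod[OF gc] by auto
  qed
  have d: "T = T'" if T: "T \<in> (\<lambda>g. W #> g) ` S" and T': "T' \<in> (\<lambda>g. W #> g) ` S" and ne: "T \<inter> T' \<noteq> {}" for T T'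
  proof -
    obtain g where g: "g \<in> S" "T = W #> g" using T by (rule imageE)
    obtain h where h: "h \<in> S" "T' = W #> h" using T' by (rule imageE)
    show ?thesis
      using r_cosets_disjoint[OF W(1), of g h] g h ne Sc by auto
  qed
  show ?thesis
    by (rule measure_blocks(2)[OF S(1) U n(1,2) d n(3)])
qed

end

context td_group
begin

lemma nice_empty: "nice {}"
  by (simp add: nice_def)

lemma nice_Un: "nice S \<Longrightarrow> nice T \<Longrightarrow> nice (S \<union> T)"
proof -
  assume "nice S" "nice T"
  then obtain N L N' L' where S: "S \<subseteq> carrier G" "\<forall>g\<in>S. \<forall>u\<in>U N. g \<otimes> u \<in> S" "S \<subseteq> B L"
    "T \<subseteq> carrier G" "\<forall>g\<in>T. \<forall>u\<in>U N'. g \<otimes> u \<in> T" "T \<subseteq> B L'"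
    by (auto simp: nice_def)
  have "U (max N N') \<subseteq> U N" "U (max N N') \<subseteq> U N'" "B L \<subseteq> B (max L L')" "B L' \<subseteq> B (max L L')"
    using U_le B_le by simp_all
  with S show ?thesis by (intro niceI[of _ "max N N'" "max L L'"]) auto
qed

lemma nice_UN: "finite A \<Longrightarrow> (\<And>a. a \<in> A \<Longrightarrow> nice (F a)) \<Longrightarrow> nice (\<Union>a\<in>A. F a)"
  by (induction A rule: finite_induct) (auto intro: nice_empty nice_Un)

end

section \<open>Counting on an orbit\<close>

text \<open>The data of a single base point: the diagonal \<open>xs\<close> of its upper right block
  and its component \<open>t0\<close> in T.\<close>

locale orbit = local_field_unif v w for v :: "'f::field_char_0 \<Rightarrow> int" and w +
  fixes m :: nat and xs :: "nat \<Rightarrow> 'f" and t0 :: 'f and \<mu> :: "('f \<times> 'f mat \<times> 'f mat) measure"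
  assumes xs: "i < m \<Longrightarrow> xs i = 0 \<or> v (xs i) < 0"
    and t0: "t0 \<noteq> 0"
    and haar_H: "haar_measure (grp_H m) (top_H v m) \<mu>"
begin

sublocale H: td_group "grp_H m" "top_H v m" "\<lambda>N. mult_U N \<times> (GL_U m N \<times> GL_U m N)" "\<lambda>N. mult_B N \<times> (GL_B m N \<times> GL_B m N)"
  by (rule td_group_H)

sublocale H: haar_td_group "grp_H m" "top_H v m" "\<lambda>N. mult_U N \<times> (GL_U m N \<times> GL_U m N)"
    "\<lambda>N. mult_B N \<times> (GL_B m N \<times> GL_B m N)" \<mu>
  by unfold_locales (rule haar_H)

sublocale Gt: td_group "grp_Gt m" "top_Gt v m" "\<lambda>N. (mult_U N \<times> GL_U (2 * m) N) \<times> mult_U N"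
    "\<lambda>N. (mult_B N \<times> GL_B (2 * m) N) \<times> mult_B N"
  by (rule td_group_Gt)

sublocale \<iota>: group_hom "grp_H m" "grp_Gt m" "iota_t m"
  by (rule iota_t_group_hom)

lemma unimodular: "h \<in> carrier (grp_H m) \<Longrightarrow> H.modular h = 1"
  using modular_H_trivial[OF haar_H] .

definition X :: "'f mat" where "X = mat_diag m xs"

definition y0 :: "('f \<times> 'f mat) \<times> 'f" where "y0 = ((1, tri m (1\<^sub>m m) X (1\<^sub>m m)), t0)"

text \<open>The stabilizer in H of the coset of \<open>y0\<close>.\<close>

definition H0 :: "('f \<times> 'f mat \<times> 'f mat) set" where
  "H0 = {h \<in> carrier (grp_H m). inv\<^bsub>grp_Gt m\<^esub> y0 \<otimes>\<^bsub>grp_Gt m\<^esub> iota_t m h \<otimes>\<^bsub>grp_Gt m\<^esub> y0 \<in> sub_Kt v m}"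

text \<open>The set measured in two ways below: it is right invariant under \<open>H0\<close>, its
  left cosets being the cosets of the orbit that lie in the k-th support, and left invariant under
  U.\<close>

definition A :: "nat \<Rightarrow> ('f \<times> 'f mat \<times> 'f mat) set" where
  "A k = {h \<in> carrier (grp_H m). iota_t m h \<otimes>\<^bsub>grp_Gt m\<^esub> y0 \<in> supp_Gt m k}"

lemma X_carrier [simp]: "X \<in> carrier_mat m m" by (simp add: X_def)

lemma X_dim [simp]: "dim_row X = m" "dim_col X = m" by (simp_all add: X_def)

lemma one_GL: "1\<^sub>m m \<in> carrier (GL m)" by (simp add: carrier_GL)

lemma y0_carrier: "y0 \<in> carrier (grp_Gt m)"
  using t0 by (simp add: y0_def carrier_grp_Gt carrier_GL det_tri)

lemma inv_y0: "inv\<^bsub>grp_Gt m\<^esub> y0 = ((1, tri m (1\<^sub>m m) (- X) (1\<^sub>m m)), inverse t0)"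
  using y0_carrier unfolding y0_def by (subst inv_grp_Gt) (auto simp: tri_minv[OF one_GL X_carrier one_GL] left_mult_one_mat[OF X_carrier] right_mult_one_mat[OF X_carrier])

lemma iota_y0:
  assumes "h1 \<in> carrier_mat m m" "h2 \<in> carrier_mat m m"
  shows "iota_t m (a, h1, h2) \<otimes>\<^bsub>grp_Gt m\<^esub> y0 = ((a, tri m h1 (h1 * X) h2), det h2 / det h1 * t0)"
  using assms by (simp add: iota_t_alt y0_def tri_mult left_mult_zero_mat[of _ m m])

lemma conj_y0:
  assumes "h1 \<in> carrier_mat m m" "h2 \<in> carrier_mat m m"
  shows "inv\<^bsub>grp_Gt m\<^esub> y0 \<otimes>\<^bsub>grp_Gt m\<^esub> iota_t m (a, h1, h2) \<otimes>\<^bsub>grp_Gt m\<^esub> y0 = ((a, tri m h1 (h1 * X - X * h2) h2), det h2 / det h1)"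
proof -
  have "tri m (1\<^sub>m m) (- X) (1\<^sub>m m) * tri m h1 (0\<^sub>m m m) h2 = tri m h1 (- (X * h2)) h2"
    using assms by (subst tri_mult) (auto simp: uminus_mult_left_mat[of X h2])
  moreover have "tri m h1 (- (X * h2)) h2 * tri m (1\<^sub>m m) X (1\<^sub>m m) = tri m h1 (h1 * X - X * h2) h2"
    using assms by (subst tri_mult) (auto simp: add_uminus_minus_mat[of _ m m])
  ultimately show ?thesis
    unfolding inv_y0 using t0 by (simp add: y0_def iota_t_alt)
qed

lemma H0_iff: "(a, h1, h2) \<in> H0 \<longleftrightarrow> a \<in> int_units v \<and> h1 \<in> GL_int v m \<and> h2 \<in> GL_int v m \<and> h1 * X - X * h2 \<in> M 0 m m"
proof -
  have "(a, h1, h2) \<in> H0 \<longleftrightarrow> (a, h1, h2) \<in> carrier (grp_H m) \<and>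
      ((a, tri m h1 (h1 * X - X * h2) h2), det h2 / det h1) \<in> sub_Kt v m"
    unfolding H0_def using conj_y0[of h1 h2 a] by (auto simp: carrier_grp_H carrier_GL)
  also have "\<dots> \<longleftrightarrow> (a, h1, h2) \<in> carrier (grp_H m) \<and> a \<in> int_units v \<and> h1 \<in> GL_int v m \<and> h1 * X - X * h2 \<in> M 0 m m \<and>
      h2 \<in> GL_int v m \<and> det h2 / det h1 \<in> int_units v"
  proof (rule conj_cong[OF refl])
    assume "(a, h1, h2) \<in> carrier (grp_H m)"
    then have "h1 \<in> carrier_mat m m" "h2 \<in> carrier_mat m m" by (auto simp: carrier_grp_H carrier_GL)
    then have "tri m h1 (h1 * X - X * h2) h2 \<in> GL_int v (2 * m) \<longleftrightarrow> h1 \<in> GL_int v m \<and> h1 * X - X * h2 \<in> M 0 m m \<and> h2 \<in> GL_int v m"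
      by (intro tri_GL_int) (auto intro!: minus_carrier_mat square_mult_carrier)
    then show "((a, tri m h1 (h1 * X - X * h2) h2), det h2 / det h1) \<in> sub_Kt v m \<longleftrightarrow>
      a \<in> int_units v \<and> h1 \<in> GL_int v m \<and> h1 * X - X * h2 \<in> M 0 m m \<and> h2 \<in> GL_int v m \<and> det h2 / det h1 \<in> int_units v"
      by (simp add: sub_Kt_def sub_K_iff)
  qed
  also have "\<dots> \<longleftrightarrow> a \<in> int_units v \<and> h1 \<in> GL_int v m \<and> h2 \<in> GL_int v m \<and> h1 * X - X * h2 \<in> M 0 m m"
    using GL_int_D(2,6,7)[of h1 m] GL_int_D(2,6,7)[of h2 m] by (auto simp: carrier_grp_H int_units_iff val_divide)
  finally show ?thesis .
qed

lemma A_iff: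
  assumes "(a, h1, h2) \<in> carrier (grp_H m)"
  shows "(a, h1, h2) \<in> A k \<longleftrightarrow> v a = int k \<and> h1 \<in> M 0 m m \<and> h1 * X \<in> M 0 m m \<and> h2 \<in> M 0 m m \<and>
     minv h1 \<in> M (-1) m m \<and> X * minv h2 \<in> M (-1) m m \<and> minv h2 \<in> M (-1) m m \<and>
     v (det h1) + v (det h2) = int k \<and> v (det h2) - v (det h1) + v t0 = - int k"
proof -
  have c: "a \<noteq> 0" "h1 \<in> carrier (GL m)" "h2 \<in> carrier (GL m)" "h1 \<in> carrier_mat m m" "det h1 \<noteq> 0" "h2 \<in> carrier_mat m m" "det h2 \<noteq> 0"
    using assms by (auto simp: carrier_grp_H carrier_GL)
  note i1 = minv[OF c(4,5)] and i2 = minv[OF c(6,7)]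
  have "minv h1 * (h1 * X) * minv h2 = X * minv h2" using mat_cancel_left(1)[OF c(4,5) X_carrier] by simp
  then have inv: "minv (tri m h1 (h1 * X) h2) = tri m (minv h1) (- (X * minv h2)) (minv h2)"
    using tri_minv[OF c(2) _ c(3), of "h1 * X"] c by simp
  have neg: "- (X * minv h2) \<in> M (-1) m m \<longleftrightarrow> X * minv h2 \<in> M (-1) m m"
    using M_uminus[of "X * minv h2" "-1" m m] M_uminus[of "- (X * minv h2)" "-1" m m] by auto
  have t: "det h2 / det h1 * t0 \<noteq> 0" "v (det h2 / det h1 * t0) = v (det h2) - v (det h1) + v t0"
    using c t0 by (simp_all add: val_mult val_divide)
  have d: "det (tri m h1 (h1 * X) h2) = det h1 * det h2" using c by (intro det_tri) auto
  have "(a, h1, h2) \<in> A k \<longleftrightarrow> ((a, tri m h1 (h1 * X) h2), det h2 / det h1 * t0) \<in> supp_Gt m k"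
    using assms iota_y0[OF c(4,6), of a] by (simp add: A_def)
  also have "\<dots> \<longleftrightarrow> v a = int k \<and> tri m h1 (h1 * X) h2 \<in> supp_GL (2 * m) k \<and> v (det h2) - v (det h1) + v t0 = - int k"
    using c(1) t by (auto simp: supp_Gt_def supp_G_def)
  also have "tri m h1 (h1 * X) h2 \<in> supp_GL (2 * m) k \<longleftrightarrow> h1 \<in> M 0 m m \<and> h1 * X \<in> M 0 m m \<and> h2 \<in> M 0 m m \<and>
     minv h1 \<in> M (-1) m m \<and> X * minv h2 \<in> M (-1) m m \<and> minv h2 \<in> M (-1) m m \<and> v (det h1) + v (det h2) = int k"
  proof -
    have "tri m h1 (h1 * X) h2 \<in> M 0 (2 * m) (2 * m) \<longleftrightarrow> h1 \<in> M 0 m m \<and> h1 * X \<in> M 0 m m \<and> h2 \<in> M 0 m m"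
      using c by (intro tri_M) auto
    moreover have "tri m (minv h1) (- (X * minv h2)) (minv h2) \<in> M (-1) (2 * m) (2 * m) \<longleftrightarrow>
        minv h1 \<in> M (-1) m m \<and> X * minv h2 \<in> M (-1) m m \<and> minv h2 \<in> M (-1) m m"
      unfolding neg[symmetric] using i1 i2 by (intro tri_M) auto
    ultimately show ?thesis
      using c d by (simp add: supp_GL_def inv carrier_GL val_mult conj_assoc)
  qed
  finally show ?thesis by blast
qed

lemma H0_carrier: "H0 \<subseteq> carrier (grp_H m)" by (auto simp: H0_def)

lemma H0_sub_U: "H0 \<subseteq> sub_U v m"
proof
  fix h assume "h \<in> H0"
  then show "h \<in> sub_U v m" by (cases h) (simp add: H0_iff sub_U_alt mult_B0 GL_B0)
qed

lemma subgroup_H0: "subgroup H0 (grp_H m)"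
proof (rule H.subgroupI)
  let ?c = "\<lambda>h. inv\<^bsub>grp_Gt m\<^esub> y0 \<otimes>\<^bsub>grp_Gt m\<^esub> iota_t m h \<otimes>\<^bsub>grp_Gt m\<^esub> y0"
  note y = y0_carrier
  have cm: "?c (h \<otimes>\<^bsub>grp_H m\<^esub> h') = ?c h \<otimes>\<^bsub>grp_Gt m\<^esub> ?c h'" if "h \<in> carrier (grp_H m)" "h' \<in> carrier (grp_H m)" for h h'
  proof -
    have c: "iota_t m h \<in> carrier (grp_Gt m)" "iota_t m h' \<in> carrier (grp_Gt m)" using that by (auto intro: iota_t_carrier)
    have "y0 \<otimes>\<^bsub>grp_Gt m\<^esub> (inv\<^bsub>grp_Gt m\<^esub> y0 \<otimes>\<^bsub>grp_Gt m\<^esub> (iota_t m h' \<otimes>\<^bsub>grp_Gt m\<^esub> y0)) = iota_t m h' \<otimes>\<^bsub>grp_Gt m\<^esub> y0"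
      using y c by (simp add: Gt.m_assoc[symmetric])
    then show ?thesis unfolding iota_t_mult[OF that] using y c by (simp add: Gt.m_assoc)
  qed
  have ci: "?c (inv\<^bsub>grp_H m\<^esub> h) = inv\<^bsub>grp_Gt m\<^esub> (?c h)" if "h \<in> carrier (grp_H m)" for h
    using y iota_t_carrier[OF that] that by (simp add: Gt.inv_mult_group Gt.m_assoc)
  show "H0 \<subseteq> carrier (grp_H m)" by (rule H0_carrier)
  have "\<one>\<^bsub>grp_H m\<^esub> \<in> H0"
    unfolding H0_def using y subgroup.one_closed[OF subgroup_sub_Kt] by simp
  then show "H0 \<noteq> {}" by blast
  show "inv\<^bsub>grp_H m\<^esub> h \<in> H0" if "h \<in> H0" for h
    using that subgroup.m_inv_closed[OF subgroup_sub_Kt] ci unfolding H0_def by simp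
  show "h \<otimes>\<^bsub>grp_H m\<^esub> h' \<in> H0" if "h \<in> H0" "h' \<in> H0" for h h'
    using that subgroup.m_closed[OF subgroup_sub_Kt] cm unfolding H0_def by simp
qed

lemma nice_H0: "H.nice H0"
proof -
  \<comment> \<open>N bounds the denominators of X, so elements congruent to 1 at level N commute
    with X up to an integral matrix.\<close>
  obtain N where N: "X \<in> M (- int N) m m" using ex_M[OF X_carrier] by blast
  show ?thesis
  proof (rule H.niceI[of _ N 0])
    show "H0 \<subseteq> carrier (grp_H m)" by (rule H0_carrier)
    show "H0 \<subseteq> mult_B 0 \<times> GL_B m 0 \<times> GL_B m 0" using H0_sub_U by (simp add: sub_U_alt)
    fix g u assume g: "g \<in> H0" and u: "u \<in> mult_U N \<times> GL_U m N \<times> GL_U m N"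
    obtain a u1 u2 where u': "u = (a, u1, u2)" "a \<in> mult_U N" "u1 \<in> GL_U m N" "u2 \<in> GL_U m N" using u by auto
    note d1 = GL_int_D[OF GL_U_int[OF u'(3)]] and d2 = GL_int_D[OF GL_U_int[OF u'(4)]]
    have 1: "(u1 - 1\<^sub>m m) * X \<in> M 0 m m"
      using M_mult[of "u1 - 1\<^sub>m m" "int N + 1" m m X "- int N" m] u'(3) N M_mono[of 0 1] by (auto simp: GL_U_def)
    have 2: "X * (u2 - 1\<^sub>m m) \<in> M 0 m m"
      using M_mult[of X "- int N" m m "u2 - 1\<^sub>m m" "int N + 1" m] u'(4) N M_mono[of 0 1] by (auto simp: GL_U_def)
    have "u1 * X - X * u2 = (u1 - 1\<^sub>m m) * X - X * (u2 - 1\<^sub>m m)"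
    proof -
      have "(u1 - 1\<^sub>m m) * X = u1 * X - X" using d1 by (simp add: minus_mult_distrib_mat[of u1 m m "1\<^sub>m m" X m] left_mult_one_mat[OF X_carrier])
      moreover have "X * (u2 - 1\<^sub>m m) = X * u2 - X" by (rule mult_minus_one[OF X_carrier d2(1)])
      ultimately show ?thesis using d1(1) d2(1) by (intro eq_matI) auto
    qed
    then have "u1 * X - X * u2 \<in> M 0 m m" using M_diff[OF 1 2] by simp
    then have "u \<in> H0"
      using u' GL_U_int mult_U_unit[OF u'(2)] by (auto simp: H0_iff int_units_iff)
    then show "g \<otimes>\<^bsub>grp_H m\<^esub> u \<in> H0" using subgroup.m_closed[OF subgroup_H0 g] by simp
  qed
qed

lemma subgroup_U: "subgroup (sub_U v m) (grp_H m)" and nice_U: "H.nice (sub_U v m)"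
  using H.B_subgroup H.nice_B0 by (simp_all add: sub_U_alt)

lemma iota_U: "u \<in> sub_U v m \<Longrightarrow> iota_t m u \<in> sub_Kt v m"
proof -
  assume u: "u \<in> sub_U v m"
  obtain a u1 u2 where u': "u = (a, u1, u2)" "a \<in> int_units v" "u1 \<in> GL_int v m" "u2 \<in> GL_int v m"
    using u by (cases u) (auto simp: sub_U_alt mult_B0 GL_B0)
  note d1 = GL_int_D[OF u'(3)] and d2 = GL_int_D[OF u'(4)]
  have "tri m u1 (0\<^sub>m m m) u2 \<in> GL_int v (2 * m)"
    using d1 d2 u' M_zero by (subst tri_GL_int) auto
  then show ?thesis
    using u'(2) d1 d2 by (simp add: u'(1) iota_t_alt sub_Kt_def sub_K_iff int_units_iff val_divide)
qed

lemma supp_Gt_biinvariant: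
  assumes "y \<in> supp_Gt m k" "a \<in> sub_Kt v m"
  shows "a \<otimes>\<^bsub>grp_Gt m\<^esub> y \<in> supp_Gt m k" "y \<otimes>\<^bsub>grp_Gt m\<^esub> a \<in> supp_Gt m k"
  using assms supp_G_biinvariant by (auto simp: supp_Gt_def sub_Kt_def int_units_iff val_mult)

lemma A_carrier: "A k \<subseteq> carrier (grp_H m)" by (auto simp: A_def)

lemma A_left:
  assumes "h \<in> A k" "u \<in> sub_U v m"
  shows "u \<otimes>\<^bsub>grp_H m\<^esub> h \<in> A k"
proof -
  have c: "u \<in> carrier (grp_H m)" "h \<in> carrier (grp_H m)"
    using assms subgroup.subset[OF subgroup_U] A_carrier by auto
  have "iota_t m (u \<otimes>\<^bsub>grp_H m\<^esub> h) \<otimes>\<^bsub>grp_Gt m\<^esub> y0 = iota_t m u \<otimes>\<^bsub>grp_Gt m\<^esub> (iota_t m h \<otimes>\<^bsub>grp_Gt m\<^esub> y0)"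
    using c y0_carrier iota_t_carrier by (simp add: Gt.m_assoc)
  then show ?thesis
    using supp_Gt_biinvariant(1)[OF _ iota_U[OF assms(2)]] assms(1) c by (simp add: A_def)
qed

lemma A_right:
  assumes "h \<in> A k" "g \<in> H0"
  shows "h \<otimes>\<^bsub>grp_H m\<^esub> g \<in> A k"
proof -
  have c: "g \<in> carrier (grp_H m)" "h \<in> carrier (grp_H m)"
    using assms H0_carrier A_carrier by auto
  have i: "iota_t m g \<in> carrier (grp_Gt m)" "iota_t m h \<in> carrier (grp_Gt m)" using c iota_t_carrier by auto
  have "y0 \<otimes>\<^bsub>grp_Gt m\<^esub> (inv\<^bsub>grp_Gt m\<^esub> y0 \<otimes>\<^bsub>grp_Gt m\<^esub> (iota_t m g \<otimes>\<^bsub>grp_Gt m\<^esub> y0)) = iota_t m g \<otimes>\<^bsub>grp_Gt m\<^esub> y0"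
    using i y0_carrier by (simp add: Gt.m_assoc[symmetric])
  then have "iota_t m (h \<otimes>\<^bsub>grp_H m\<^esub> g) \<otimes>\<^bsub>grp_Gt m\<^esub> y0 =
      (iota_t m h \<otimes>\<^bsub>grp_Gt m\<^esub> y0) \<otimes>\<^bsub>grp_Gt m\<^esub> (inv\<^bsub>grp_Gt m\<^esub> y0 \<otimes>\<^bsub>grp_Gt m\<^esub> iota_t m g \<otimes>\<^bsub>grp_Gt m\<^esub> y0)"
    unfolding iota_t_mult[OF c(2,1)] using i y0_carrier by (simp add: Gt.m_assoc)
  then show ?thesis
    using supp_Gt_biinvariant(2) assms c by (simp add: A_def H0_def)
qed

lemma nice_A: "H.nice (A k)"
proof (rule H.nice_invariantI[OF nice_H0 subgroup.one_closed[OF subgroup_H0] A_carrier _ A_right])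
  \<comment> \<open>The bound \<open>Suc k\<close> covers the valuation k of the first component and
    also, when k = 0, the one denominator w allowed in the inverses.\<close>
  show "A k \<subseteq> mult_B (Suc k) \<times> GL_B m (Suc k) \<times> GL_B m (Suc k)"
  proof
    fix h assume h: "h \<in> A k"
    obtain a h1 h2 where e: "h = (a, h1, h2)" by (cases h)
    have c: "(a, h1, h2) \<in> carrier (grp_H m)" using h e A_carrier by blast
    note * = A_iff[OF c, of k, THEN iffD1, OF h[unfolded e]]
    show "h \<in> mult_B (Suc k) \<times> GL_B m (Suc k) \<times> GL_B m (Suc k)"
      using * c M_mono[of "- int (Suc k)" 0 h1] M_mono[of "- int (Suc k)" 0 h2] M_mono[of "- int (Suc k)" "-1" "minv h1"]
        M_mono[of "- int (Suc k)" "-1" "minv h2"]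
      by (auto simp: e mult_B_def GL_B_def carrier_grp_H)
  qed
qed

text \<open>\<open>cosets_M\<close> is what the zeta element sums over an orbit (see
  \<open>card_orbit_cosets\<close>); \<open>cosets_N\<close> is the count on the other side, on
  which the torus in the stabilizer acts.\<close>

definition cosets_M :: "nat \<Rightarrow> nat" where
  "cosets_M k = card ((\<lambda>h. h <#\<^bsub>grp_H m\<^esub> H0) ` A k)"

definition cosets_N :: "nat \<Rightarrow> nat" where
  "cosets_N k = card ((\<lambda>h. sub_U v m #>\<^bsub>grp_H m\<^esub> h) ` A k)"

lemma measure_A: "measure \<mu> (A k) = of_nat (cosets_M k) * measure \<mu> H0" "measure \<mu> (A k) = of_nat (cosets_N k) * measure \<mu> (sub_U v m)"
proof -
  show "measure \<mu> (A k) = of_nat (cosets_M k) * measure \<mu> H0"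
    unfolding cosets_M_def by (rule H.measure_l_cosets(2)[OF subgroup_H0 nice_H0 nice_A A_right])
  show "measure \<mu> (A k) = of_nat (cosets_N k) * measure \<mu> (sub_U v m)"
    unfolding cosets_N_def by (rule H.measure_r_cosets[OF subgroup_U nice_U nice_A A_left unimodular])
qed

lemma measure_pos: "subgroup W (grp_H m) \<Longrightarrow> H.nice W \<Longrightarrow> measure \<mu> W > 0"
  by (rule H.nice_measure_pos[OF _ H.subgroup_ne])

text \<open>\<open>gen_index\<close> transports a real quotient to the coefficient field, and this
  is under control once the quotient is exhibited as rational. Here it is a quotient of counts,
  unless \<open>cosets_N k\<close> is 0, in which case the measure of \<open>A k\<close> vanishes
  and so does the left side.\<close>

lemma cosets_M_eq:
  assumes V: "subgroup V (grp_H m)" "H.nice V" and d: "measure \<mu> H0 = of_nat d * measure \<mu> V"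
  shows "(of_nat (cosets_M k) * of_nat d :: 'p::field_char_0) = gen_index \<mu> (sub_U v m) V * of_nat (cosets_N k)"
proof -
  have pV: "measure \<mu> V > 0" and pU: "measure \<mu> (sub_U v m) > 0" and pH: "measure \<mu> H0 > 0"
    using measure_pos V subgroup_U nice_U subgroup_H0 nice_H0 by auto
  have e: "of_nat (cosets_M k) * (of_nat d * measure \<mu> V) = of_nat (cosets_N k) * measure \<mu> (sub_U v m)"
    using measure_A[of k] d by simp
  show ?thesis
  proof (cases "cosets_N k = 0")
    case True
    then have "of_nat (cosets_M k) * (of_nat d * measure \<mu> V) = 0" using e by simp
    then have "cosets_M k = 0 \<or> d = 0" using pV by simp
    then show ?thesis using True by auto
  next
    case False
    have "measure \<mu> (sub_U v m) / measure \<mu> V = of_nat (cosets_M k) * of_nat d / of_nat (cosets_N k)"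
      using e False pV by (simp add: field_simps)
    also have "\<dots> = real_of_rat (of_nat (cosets_M k) * of_nat d / of_nat (cosets_N k))"
      by (simp add: of_rat_mult of_rat_divide)
    finally have "gen_index \<mu> (sub_U v m) V = (of_rat (of_nat (cosets_M k) * of_nat d / of_nat (cosets_N k)) :: 'p)"
      unfolding gen_index_def by (simp only: rat_transfer_of_rat)
    then show ?thesis using False by (simp add: of_rat_mult of_rat_divide)
  qed
qed

lemma A_le: "h \<in> A k \<Longrightarrow> k \<le> 2 * m"
  using supp_GL_cartan(1) by (auto simp: A_def supp_Gt_def supp_G_def)

lemma stab_conj:
  assumes "h \<in> H0" "det (snd (snd h)) / det (fst (snd h)) \<in> sub_D v w"
  shows "iota_t m h \<in> y0 <#\<^bsub>grp_Gt m\<^esub> (sub_Lt v w m #>\<^bsub>grp_Gt m\<^esub> inv\<^bsub>grp_Gt m\<^esub> y0)"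
proof -
  let ?k = "inv\<^bsub>grp_Gt m\<^esub> y0 \<otimes>\<^bsub>grp_Gt m\<^esub> iota_t m h \<otimes>\<^bsub>grp_Gt m\<^esub> y0"
  obtain a h1 h2 where e: "h = (a, h1, h2)" by (cases h)
  have c: "h1 \<in> carrier_mat m m" "h2 \<in> carrier_mat m m" using assms(1) H0_carrier by (auto simp: e carrier_grp_H carrier_GL)
  have i: "iota_t m h \<in> carrier (grp_Gt m)" using assms(1) H0_carrier iota_t_carrier by blast
  have "?k \<in> sub_Kt v m" using assms(1) by (simp add: H0_def)
  then have "?k \<in> sub_Lt v w m" using assms(2) unfolding e conj_y0[OF c] by (simp add: sub_Kt_def sub_Lt_def)
  then have "y0 \<otimes>\<^bsub>grp_Gt m\<^esub> (?k \<otimes>\<^bsub>grp_Gt m\<^esub> inv\<^bsub>grp_Gt m\<^esub> y0) \<in> y0 <#\<^bsub>grp_Gt m\<^esub> (sub_Lt v w m #>\<^bsub>grp_Gt m\<^esub> inv\<^bsub>grp_Gt m\<^esub> y0)"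
    by (intro Gt.l_coset_memI Gt.r_coset_memI)
  moreover have "y0 \<otimes>\<^bsub>grp_Gt m\<^esub> (?k \<otimes>\<^bsub>grp_Gt m\<^esub> inv\<^bsub>grp_Gt m\<^esub> y0) = iota_t m h"
  proof -
    have "y0 \<otimes>\<^bsub>grp_Gt m\<^esub> (?k \<otimes>\<^bsub>grp_Gt m\<^esub> inv\<^bsub>grp_Gt m\<^esub> y0) =
       (y0 \<otimes>\<^bsub>grp_Gt m\<^esub> inv\<^bsub>grp_Gt m\<^esub> y0) \<otimes>\<^bsub>grp_Gt m\<^esub> (iota_t m h \<otimes>\<^bsub>grp_Gt m\<^esub> (y0 \<otimes>\<^bsub>grp_Gt m\<^esub> inv\<^bsub>grp_Gt m\<^esub> y0))"
      by (simp only: Gt.m_assoc Gt.m_closed Gt.inv_closed i y0_carrier)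
    then show ?thesis using i y0_carrier by simp
  qed
  ultimately show ?thesis by simp
qed

text \<open>All entries of X have negative valuation, so the inverse of X is divisible by w.
  Multiplying the integral matrix h1 X - X h2 by it shows that the conjugate of h1 by X is congruent
  to h2 modulo w, and the determinants follow.\<close>

lemma nu_in_D:
  assumes nz: "\<And>i. i < m \<Longrightarrow> xs i \<noteq> 0" and h: "(a, h1, h2) \<in> H0"
  shows "det h2 / det h1 \<in> sub_D v w"
proof -
  have h': "h1 \<in> GL_int v m" "h2 \<in> GL_int v m" "h1 * X - X * h2 \<in> M 0 m m" using h by (auto simp: H0_iff)
  note d1 = GL_int_D[OF h'(1)] and d2 = GL_int_D[OF h'(2)]
  have X: "det X \<noteq> 0" using nz by (simp add: X_def det_mat_diag)
  have Xi: "minv X = mat_diag m (\<lambda>i. inverse (xs i))" unfolding X_def by (rule minv_mat_diag[OF nz])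
  have XM: "minv X \<in> M 1 m m"
    unfolding Xi
  proof (rule MI)
    fix i j assume ij: "i < m" "j < m"
    show "mat_diag m (\<lambda>i. inverse (xs i)) $$ (i, j) \<in> I 1"
      using nz[OF ij(2)] xs[OF ij(2)] ij by (auto simp: mat_diag_def I_iff_val val_inverse)
  qed (simp add: mat_diag_def)
  have Xc: "minv X \<in> carrier_mat m m" by (rule minv(1)[OF X_carrier X])
  let ?E = "minv X * (h1 * X - X * h2)"
  have E: "?E \<in> M 1 m m" by (rule M_mult0(2)[OF XM h'(3)])
  have Eeq: "?E = minv X * (h1 * X) - h2"
    using mult_minus_distrib_mat[OF Xc, of "h1 * X" m "X * h2"] mat_cancel_left(1)[OF X_carrier X d2(1)] d1 d2 by simp
  have "minv X * (h1 * X) = ?E + h2" unfolding Eeq using Xc d1 d2 by (intro eq_matI) auto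
  then have AM: "minv X * (h1 * X) \<in> M 0 m m"
    using M_add[OF M_mono[of 0 1, OF _ E] d2(3)] by simp
  have "det (minv X * (h1 * X)) = det h1"
    using Xc d1 X minv(4)[OF X_carrier X] by (simp add: det_mult[of _ m])
  then have "det h1 - det h2 \<in> I 1"
    using det_congruent[OF AM, of h2 1] E d2(1) unfolding Eeq by simp
  then have "det h2 - det h1 \<in> I 1" by (simp only: I_diff_commute)
  then have "det h1 * (det h2 / det h1 - 1) \<in> I 1" using d1(2) by (simp add: right_diff_distrib)
  then show ?thesis using d1(2,6) by (simp add: sub_D_iff I_scale)
qed

end

context haar_td_group
begin

text \<open>Niceness asks for invariance on the right, but S is only known to be invariant on the
  left. It is a union of right cosets of W inside T; there are finitely many of these, and each is
  nice.\<close>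

lemma nice_left_invariant:
  assumes W: "subgroup W G" "nice W" and T: "nice T" "\<And>g h. g \<in> T \<Longrightarrow> h \<in> W \<Longrightarrow> h \<otimes> g \<in> T"
    and S: "S \<subseteq> T" "\<And>g h. g \<in> S \<Longrightarrow> h \<in> W \<Longrightarrow> h \<otimes> g \<in> S"
    and unimod: "\<And>h. h \<in> carrier G \<Longrightarrow> modular h = 1"
  shows "nice S"
proof -
  note Tc = nice_carrier[OF T(1)]
  have U: "\<Union> ((\<lambda>g. W #> g) ` Q) = Q" if "Q \<subseteq> T" "\<And>g h. g \<in> Q \<Longrightarrow> h \<in> W \<Longrightarrow> h \<otimes> g \<in> Q" for Q
  proof
    show "\<Union> ((\<lambda>g. W #> g) ` Q) \<subseteq> Q" using that(2) by (auto simp: r_coset_def)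
    show "Q \<subseteq> \<Union> ((\<lambda>g. W #> g) ` Q)"
    proof
      fix g assume g: "g \<in> Q"
      then have "g \<in> W #> g" using r_coset_self[OF W(1)] that(1) Tc by blast
      then show "g \<in> \<Union> ((\<lambda>g. W #> g) ` Q)" using g by blast
    qed
  qed
  have "finite ((\<lambda>g. W #> g) ` T)"
  proof (rule measure_blocks(1)[OF T(1) U[OF subset_refl T(2)]])
    fix C assume "C \<in> (\<lambda>g. W #> g) ` T"
    then obtain g where g: "g \<in> T" "C = W #> g" by blast
    then have gc: "g \<in> carrier G" using Tc by blast
    show "nice C" unfolding g(2) by (rule nice_r_coset[OF W(2) gc])
    show "C \<noteq> {}" using r_coset_self[OF W(1) gc] g(2) by blast
    show "measure \<mu> C = measure \<mu> W" unfolding g(2) using measure_r_coset[OF W(2) gc] unimod[OF gc] by simp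
  next
    fix C C' assume "C \<in> (\<lambda>g. W #> g) ` T" "C' \<in> (\<lambda>g. W #> g) ` T" "C \<inter> C' \<noteq> {}"
    then show "C = C'" using r_cosets_disjoint[OF W(1)] Tc by blast
  qed
  then have "finite ((\<lambda>g. W #> g) ` S)" by (rule finite_subset[rotated]) (use S(1) in blast)
  then have "nice (\<Union>C\<in>(\<lambda>g. W #> g) ` S. C)"
    by (rule nice_UN) (use nice_r_coset[OF W(2)] S(1) Tc in auto)
  moreover have "(\<Union>C\<in>(\<lambda>g. W #> g) ` S. C) = S" using U[OF S] by simp
  ultimately show ?thesis by simp
qed

end

section \<open>Orbits whose stabilizer contains a torus\<close>

locale torus_orbit = orbit v w m xs t0 \<mu>
  for v :: "'f::field_char_0 \<Rightarrow> int" and w m xs t0 and \<mu> :: "('f \<times> 'f mat \<times> 'f mat) measure" +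
  fixes i :: nat
  assumes i: "i < m" "xs i = 0"
begin

text \<open>The torus in the coordinate i. Because \<open>xs i = 0\<close> it satisfies
  \<open>E r * X = X\<close>, so for units r it lies in the stabilizer of the base point.
  \<open>P\<close> is the projector with E r = 1 + (r - 1) P.\<close>

definition E :: "'f \<Rightarrow> 'f mat" where "E r = mat_diag m (\<lambda>j. if j = i then r else 1)"
definition P :: "'f mat" where "P = mat_diag m (\<lambda>j. if j = i then 1 else 0)"

lemma E_carrier [simp]: "E r \<in> carrier_mat m m" "dim_row (E r) = m" "dim_col (E r) = m"
  and P_carrier [simp]: "P \<in> carrier_mat m m" "dim_row P = m" "dim_col P = m" by (simp_all add: E_def P_def)

lemma E_mult: "E r * E s = E (r * s)"
  unfolding E_def by (subst mat_diag_diag) (rule arg_cong[of _ _ "mat_diag m"], auto)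

lemma E_one: "E 1 = 1\<^sub>m m" by (intro eq_matI) (auto simp: E_def mat_diag_def)

lemma det_E: "det (E r) = r" using i by (simp add: E_def det_mat_diag)

lemma minv_E: "r \<noteq> 0 \<Longrightarrow> minv (E r) = E (inverse r)"
  using right_inverse_unique(2)[OF E_carrier(1)[of r] E_carrier(1)[of "inverse r"]] by (simp add: E_mult E_one)

lemma E_GL: "r \<noteq> 0 \<Longrightarrow> E r \<in> carrier (GL m)" by (simp add: carrier_GL det_E)

lemma E_X: "E r * X = X"
  unfolding E_def X_def by (subst mat_diag_diag) (intro eq_matI, auto simp: mat_diag_def i)

lemma E_P: "E r * P = r \<cdot>\<^sub>m P" "P * E r = r \<cdot>\<^sub>m P"
  unfolding E_def P_def mat_diag_diag by (intro eq_matI; auto simp: mat_diag_def)+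

lemma P_P: "P * P = P"
  unfolding P_def by (subst mat_diag_diag, intro eq_matI, auto simp: mat_diag_def)

lemma mult_E: "B \<in> carrier_mat n m \<Longrightarrow> B * E r = B + (r - 1) \<cdot>\<^sub>m (B * P)"
  unfolding E_def P_def by (intro eq_matI) (auto simp: mat_diag_mult_right algebra_simps)

lemma E_mult_left: "B \<in> carrier_mat m n \<Longrightarrow> E r * B = B + (r - 1) \<cdot>\<^sub>m (P * B)"
  unfolding E_def P_def by (intro eq_matI) (auto simp: mat_diag_mult_left algebra_simps)

lemma E_M: "r \<in> I 0 \<Longrightarrow> E r \<in> M 0 m m" and P_M: "P \<in> M 0 m m"
  by (intro MI; auto simp: E_def P_def mat_diag_def)+

lemma P_not_M1: "P \<notin> M 1 m m"
  using M_entry[of P 1 m m i i] i by (auto simp: P_def mat_diag_def)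

text \<open>A conjugated rank one projector. Conjugating the torus by B gives 1 + (r - 1)
  \<open>pr B\<close>, so the denominators of \<open>pr B\<close> decide which torus elements fix
  the coset of B.\<close>

definition pr :: "'f mat \<Rightarrow> 'f mat" where "pr B = B * P * minv B"

lemma pr_carrier: "B \<in> carrier (GL m) \<Longrightarrow> pr B \<in> carrier_mat m m"
  using minv(1)[of B m] by (simp add: pr_def carrier_GL)

lemma pr_entry: "B \<in> carrier (GL m) \<Longrightarrow> a < m \<Longrightarrow> b < m \<Longrightarrow> pr B $$ (a, b) = B $$ (a, i) * minv B $$ (i, b)"
proof -
  assume a: "B \<in> carrier (GL m)" "a < m" "b < m"
  then have c: "B \<in> carrier_mat m m" "minv B \<in> carrier_mat m m" using minv(1)[of B m] by (auto simp: carrier_GL)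
  have "pr B $$ (a, b) = (\<Sum>k<m. (B * P) $$ (a, k) * minv B $$ (k, b))"
    unfolding pr_def using c a by (intro mult_mat_entry) auto
  also have "\<dots> = (\<Sum>k<m. if k = i then B $$ (a, i) * minv B $$ (i, b) else 0)"
    using c a unfolding P_def by (intro sum.cong refl) (auto simp: mat_diag_mult_right)
  finally show ?thesis using i by simp
qed

lemma pr_left:
  assumes "k \<in> GL_int v m" "B \<in> carrier (GL m)"
  shows "pr (k * B) \<in> M 0 m m \<longleftrightarrow> pr B \<in> M 0 m m"
proof -
  note k = GL_int_D[OF assms(1)]
  have a: "B \<in> carrier_mat m m" "det B \<noteq> 0" "minv B \<in> carrier_mat m m" using assms(2) minv(1)[of B m] by (auto simp: carrier_GL)
  have "pr (k * B) = k * (B * P * minv B) * minv k"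
    unfolding pr_def minv_mult[OF k(1,2) a(1,2)] using k a by (simp add: assoc_mult_mat[of _ m m _ m _ m])
  then show ?thesis
    using M_GL_int_left[OF assms(1)] M_GL_int_right[OF GL_int_minv[OF assms(1)]] k a by (simp add: pr_def)
qed

lemma pr_E:
  assumes "r \<noteq> 0" "B \<in> carrier (GL m)"
  shows "pr (B * E r) = pr B"
proof -
  have a: "B \<in> carrier_mat m m" "det B \<noteq> 0" "minv B \<in> carrier_mat m m" using assms(2) minv(1)[of B m] by (auto simp: carrier_GL)
  have e: "minv (B * E r) = E (inverse r) * minv B"
    using minv_mult[OF a(1,2) E_carrier(1)[of r]] assms(1) by (simp add: minv_E det_E)
  have "pr (B * E r) = B * (E r * P * E (inverse r)) * minv B"
    unfolding pr_def e using a by (simp add: assoc_mult_mat[of _ m m _ m _ m])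
  also have "E r * P * E (inverse r) = P"
    unfolding E_P(1) mult_smult_assoc_mat[OF P_carrier(1) E_carrier(1)] E_P(2)
    using assms(1) by (intro eq_matI) auto
  finally show ?thesis by (simp add: pr_def)
qed

lemma conj_E:
  assumes "B \<in> carrier (GL m)"
  shows "B * E r * minv B = 1\<^sub>m m + (r - 1) \<cdot>\<^sub>m pr B"
proof -
  have a: "B \<in> carrier_mat m m" "det B \<noteq> 0" using assms by (auto simp: carrier_GL)
  note ai = minv[OF a]
  have "B * E r * minv B = B * minv B + (r - 1) \<cdot>\<^sub>m (B * P) * minv B"
    unfolding mult_E[OF a(1)] using a ai by (intro add_mult_distrib_mat) auto
  then show ?thesis
    using a ai by (simp add: pr_def mult_smult_assoc_mat[of "B * P" m m])
qed

lemma conj_E_int: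
  assumes "B \<in> carrier (GL m)" "r \<in> int_units v"
  shows "B * E r * minv B \<in> GL_int v m \<longleftrightarrow> (r - 1) \<cdot>\<^sub>m pr B \<in> M 0 m m"
proof -
  have a: "B \<in> carrier_mat m m" "det B \<noteq> 0" using assms by (auto simp: carrier_GL)
  note ai = minv[OF a]
  have "det (B * E r * minv B) = r" using a ai by (simp add: det_mult[of _ m] det_E)
  then have "B * E r * minv B \<in> GL_int v m \<longleftrightarrow> 1\<^sub>m m + (r - 1) \<cdot>\<^sub>m pr B \<in> M 0 m m"
    using assms(2) by (simp add: GL_int_iff conj_E[OF assms(1)])
  also have "\<dots> \<longleftrightarrow> (r - 1) \<cdot>\<^sub>m pr B \<in> M 0 m m"
  proof
    assume "1\<^sub>m m + (r - 1) \<cdot>\<^sub>m pr B \<in> M 0 m m"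
    from M_diff[OF this M_one] have "1\<^sub>m m + (r - 1) \<cdot>\<^sub>m pr B - 1\<^sub>m m \<in> M 0 m m" .
    also have "1\<^sub>m m + (r - 1) \<cdot>\<^sub>m pr B - 1\<^sub>m m = (r - 1) \<cdot>\<^sub>m pr B"
      using pr_carrier[OF assms(1)] by (intro eq_matI) auto
    finally show "(r - 1) \<cdot>\<^sub>m pr B \<in> M 0 m m" .
  qed (rule M_add[OF M_one])
  finally show ?thesis .
qed

text \<open>\<open>fixd k\<close> consists of the \<open>h\<close> whose coset \<open>U h\<close> is fixed by the torus \<open>\<tau>\<close>. Right translation by \<open>\<delta>\<close>
  carries \<open>yes (k + 1)\<close> onto \<open>fixd k - yes k\<close>, so that the alternating sum over the fixed part
  telescopes. Off the fixed part the torus orbits have length \<open>q - 1\<close>.\<close>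

definition fixd :: "nat \<Rightarrow> ('f \<times> 'f mat \<times> 'f mat) set" where
  "fixd k = {h \<in> A k. pr (fst (snd h)) \<in> M 0 m m}"
definition yes :: "nat \<Rightarrow> ('f \<times> 'f mat \<times> 'f mat) set" where
  "yes k = {h \<in> fixd k. fst (snd h) * P \<in> M 1 m m}"
definition \<delta> :: "'f \<times> 'f mat \<times> 'f mat" where
  "\<delta> = (inverse w, E (inverse w), 1\<^sub>m m)"
definition \<tau> :: "'f \<Rightarrow> 'f \<times> 'f mat \<times> 'f mat" where
  "\<tau> r = (1, E r, 1\<^sub>m m)"

lemma \<delta>_carrier: "\<delta> \<in> carrier (grp_H m)" by (simp add: \<delta>_def carrier_grp_H E_GL one_GL)
lemma \<tau>_carrier: "r \<noteq> 0 \<Longrightarrow> \<tau> r \<in> carrier (grp_H m)" by (simp add: \<tau>_def carrier_grp_H E_GL one_GL)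

lemma left_invariant:
  assumes "u \<in> sub_U v m"
  shows "h \<in> fixd k \<Longrightarrow> u \<otimes>\<^bsub>grp_H m\<^esub> h \<in> fixd k" "h \<in> yes k \<Longrightarrow> u \<otimes>\<^bsub>grp_H m\<^esub> h \<in> yes k"
    "h \<in> fixd k - yes k \<Longrightarrow> u \<otimes>\<^bsub>grp_H m\<^esub> h \<in> fixd k - yes k" "h \<in> A k - fixd k \<Longrightarrow> u \<otimes>\<^bsub>grp_H m\<^esub> h \<in> A k - fixd k"
proof -
  obtain b u1 u2 where u: "u = (b, u1, u2)" "u1 \<in> GL_int v m" using assms by (cases u) (auto simp: sub_U_alt GL_B0)
  note d = GL_int_D[OF u(2)]
  have f: "u \<otimes>\<^bsub>grp_H m\<^esub> h \<in> fixd k \<longleftrightarrow> h \<in> fixd k" and y: "u \<otimes>\<^bsub>grp_H m\<^esub> h \<in> yes k \<longleftrightarrow> h \<in> yes k" if "h \<in> A k" for h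
  proof -
    obtain a h1 h2 where h: "h = (a, h1, h2)" by (cases h)
    have "(a, h1, h2) \<in> carrier (grp_H m)" using that A_carrier h by blast
    then have c: "h1 \<in> carrier (GL m)" "h1 \<in> carrier_mat m m" by (auto simp: carrier_grp_H carrier_GL)
    show f: "u \<otimes>\<^bsub>grp_H m\<^esub> h \<in> fixd k \<longleftrightarrow> h \<in> fixd k"
      using A_left[OF that assms] that pr_left[OF u(2) c(1)] by (simp add: fixd_def u h)
    show "u \<otimes>\<^bsub>grp_H m\<^esub> h \<in> yes k \<longleftrightarrow> h \<in> yes k"
      using f M_GL_int_left[OF u(2), of "h1 * P"] c d by (simp add: yes_def u h assoc_mult_mat[of u1 m m h1 m P m])
  qed
  have A: "h \<in> fixd k \<Longrightarrow> h \<in> A k" "h \<in> yes k \<Longrightarrow> h \<in> A k" by (auto simp: fixd_def yes_def)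
  show "h \<in> fixd k \<Longrightarrow> u \<otimes>\<^bsub>grp_H m\<^esub> h \<in> fixd k" using f A by blast
  show "h \<in> yes k \<Longrightarrow> u \<otimes>\<^bsub>grp_H m\<^esub> h \<in> yes k" using y A by blast
  show "h \<in> fixd k - yes k \<Longrightarrow> u \<otimes>\<^bsub>grp_H m\<^esub> h \<in> fixd k - yes k" using f y A by blast
  show "h \<in> A k - fixd k \<Longrightarrow> u \<otimes>\<^bsub>grp_H m\<^esub> h \<in> A k - fixd k" using f A_left[OF _ assms] by blast
qed

lemma nice_part:
  assumes "S \<subseteq> A k" "\<And>g h. g \<in> S \<Longrightarrow> h \<in> sub_U v m \<Longrightarrow> h \<otimes>\<^bsub>grp_H m\<^esub> g \<in> S"
  shows "H.nice S"
  by (rule H.nice_left_invariant[OF subgroup_U nice_U nice_A A_left assms unimodular])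

lemma nice_parts: "H.nice (fixd k)" "H.nice (yes k)" "H.nice (fixd k - yes k)" "H.nice (A k - fixd k)"
  by (rule nice_part[of _ k]; use left_invariant in \<open>auto simp: fixd_def yes_def\<close>)+

text \<open>\<open>yes\<close> says that the i-th column of \<open>h1\<close> is divisible by w, and
  right translation divides it by w. The valuations of the first component and of
  \<open>det h1\<close> drop by one, which turns the conditions for k + 1 into those for k; the
  product with X is unchanged.\<close>

lemma \<delta>_yes:
  assumes "h \<in> yes (Suc k)"
  shows "h \<otimes>\<^bsub>grp_H m\<^esub> \<delta> \<in> fixd k - yes k"
proof -
  obtain a h1 h2 where h: "h = (a, h1, h2)" by (cases h)
  have A: "(a, h1, h2) \<in> A (Suc k)" and fx: "pr h1 \<in> M 0 m m" and y: "h1 * P \<in> M 1 m m"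
    using assms by (auto simp: h yes_def fixd_def)
  have c: "(a, h1, h2) \<in> carrier (grp_H m)" using A A_carrier by blast
  have c1: "a \<noteq> 0" "h1 \<in> carrier (GL m)" "h1 \<in> carrier_mat m m" "det h1 \<noteq> 0" "h2 \<in> carrier (GL m)" "h2 \<in> carrier_mat m m" "det h2 \<noteq> 0"
    using c by (auto simp: carrier_grp_H carrier_GL)
  note ai = minv[OF c1(3,4)]
  note * = A_iff[OF c, THEN iffD1, OF A]
  let ?g = "h1 * E (inverse w)"
  have gc: "(a * inverse w, ?g, h2) \<in> carrier (grp_H m)"
    using H.m_closed[OF c \<delta>_carrier] c1(6) by (simp add: \<delta>_def)
  have gi: "minv ?g = E w * minv h1"
    using minv_mult[OF c1(3,4) E_carrier(1)[of "inverse w"]] by (simp add: det_E minv_E)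
  have g0: "?g \<in> M 0 m m"
  proof -
    have "(inverse w - 1) \<in> I (- 1)" by (intro I_diff) (auto simp: I_iff_val val_inverse)
    from M_smult[OF y this] have "(inverse w - 1) \<cdot>\<^sub>m (h1 * P) \<in> M 0 m m" by simp
    then show ?thesis unfolding mult_E[OF c1(3)] using * by (intro M_add) auto
  qed
  have gX: "?g * X = h1 * X" using c1 by (simp add: assoc_mult_mat[of h1 m m _ m X m] E_X)
  have gi1: "minv ?g \<in> M (- 1) m m" unfolding gi using * M_mult0(1)[OF E_M[of w]] by (simp add: I_iff_val)
  have vg: "v (det ?g) = v (det h1) - 1" using c1 by (simp add: det_mult[of _ m] det_E val_mult val_inverse)
  have gA: "(a * inverse w, ?g, h2) \<in> A k"
    using * g0 gX gi1 vg c1(1) by (subst A_iff[OF gc]) (auto simp: val_mult val_inverse)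
  have gf: "pr ?g \<in> M 0 m m" using fx pr_E[OF _ c1(2), of "inverse w"] by simp
  have "?g * P \<notin> M 1 m m"
  proof
    assume n: "?g * P \<in> M 1 m m"
    \<comment> \<open>Row i of the new inverse is w times a row with at most one denominator, hence
      integral. If the new i-th column were still divisible by w, the product of this row part with
      the column part, which is P, would be divisible by w too.\<close>
    have "P * minv ?g = w \<cdot>\<^sub>m (P * minv h1)"
      unfolding gi using ai by (simp add: assoc_mult_mat[symmetric, of P m m _ m _ m] E_P mult_smult_assoc_mat[of P m m])
    moreover have "w \<cdot>\<^sub>m (P * minv h1) \<in> M 0 m m"
      using M_smult[of "P * minv h1" "-1" m m w 1] M_mult0(1)[OF P_M, of "minv h1" "-1" m] * by (simp add: I_iff_val)
    ultimately have "P * minv ?g * (?g * P) \<in> M 1 m m" using M_mult0(1)[OF _ n] by metis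
    moreover have "P * minv ?g * (?g * P) = P"
    proof -
      have gcm: "?g \<in> carrier_mat m m" "det ?g \<noteq> 0" using c1 by (auto simp: det_mult[of _ m] det_E)
      have "P * minv ?g * (?g * P) = P * (minv ?g * (?g * P))"
        using minv(1)[OF gcm] gcm by (intro assoc_mult_mat[of _ m m _ m _ m]) auto
      then show ?thesis using mat_cancel_left(1)[OF gcm P_carrier(1)] by (simp add: P_P)
    qed
    ultimately show False using P_not_M1 by simp
  qed
  then show ?thesis
    using gA gf c1(6) by (simp add: h \<delta>_def fixd_def yes_def right_mult_one_mat)
qed

text \<open>The i-th column of \<open>h1\<close> has a unit entry. Since \<open>pr h1\<close> is
  integral, the product of that entry with row i of the inverse is integral, so this row is integral
  and can absorb the division by w caused by multiplying the column by w.\<close>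

lemma no_\<delta>:
  assumes "h \<in> fixd k - yes k"
  shows "h \<otimes>\<^bsub>grp_H m\<^esub> inv\<^bsub>grp_H m\<^esub> \<delta> \<in> yes (Suc k)"
proof -
  obtain a h1 h2 where h: "h = (a, h1, h2)" by (cases h)
  have A: "(a, h1, h2) \<in> A k" and fx: "pr h1 \<in> M 0 m m" and y: "h1 * P \<notin> M 1 m m"
    using assms by (auto simp: h yes_def fixd_def)
  have c: "(a, h1, h2) \<in> carrier (grp_H m)" using A A_carrier by blast
  have c1: "a \<noteq> 0" "h1 \<in> carrier (GL m)" "h1 \<in> carrier_mat m m" "det h1 \<noteq> 0" "h2 \<in> carrier (GL m)" "h2 \<in> carrier_mat m m" "det h2 \<noteq> 0"
    using c by (auto simp: carrier_grp_H carrier_GL)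
  note ai = minv[OF c1(3,4)]
  note * = A_iff[OF c, THEN iffD1, OF A]
  have "inv\<^bsub>grp_H m\<^esub> \<delta> = (w, E w, 1\<^sub>m m)"
    using \<delta>_carrier unfolding \<delta>_def by (subst inv_grp_H) (auto simp: minv_E)
  then have hd: "h \<otimes>\<^bsub>grp_H m\<^esub> inv\<^bsub>grp_H m\<^esub> \<delta> = (a * w, h1 * E w, h2)"
    using c1(6) by (simp add: h right_mult_one_mat)
  let ?g = "h1 * E w"
  have gc: "(a * w, ?g, h2) \<in> carrier (grp_H m)"
    using H.m_closed[OF c H.inv_closed[OF \<delta>_carrier]] hd by (simp add: h)
  have gi: "minv ?g = E (inverse w) * minv h1"
    using minv_mult[OF c1(3,4) E_carrier(1)[of w]] by (simp add: det_E minv_E)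
  have w0: "w \<in> I 0" "w \<in> I 1" by (simp_all add: I_iff_val)
  have g0: "?g \<in> M 0 m m" using M_mult0(2)[OF _ E_M[OF w0(1)]] * by blast
  have gX: "?g * X = h1 * X" using c1 by (simp add: assoc_mult_mat[of h1 m m _ m X m] E_X)
  obtain r where r: "r < m" "h1 $$ (r, i) \<notin> I 1"
  proof (rule ccontr)
    assume "\<not> thesis"
    then have n: "h1 $$ (r, i) \<in> I 1" if "r < m" for r using that \<open>\<And>r. r < m \<Longrightarrow> h1 $$ (r, i) \<notin> I 1 \<Longrightarrow> thesis\<close> by blast
    have "h1 * P \<in> M 1 m m"
      by (rule MI) (use c1 n in \<open>auto simp: P_def mat_diag_mult_right\<close>)
    with y show False by simp
  qed
  have u: "h1 $$ (r, i) \<in> int_units v" using r M_entry[of h1 0 m m r i] * i I0_not_unit by blast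
  have Pm: "P * minv h1 \<in> M 0 m m"
  proof (rule MI)
    fix c b assume cb: "c < m" "b < m"
    have "h1 $$ (r, i) * minv h1 $$ (i, b) \<in> I 0"
      using M_entry[OF fx r(1) cb(2)] pr_entry[OF c1(2) r(1) cb(2)] by simp
    then have "minv h1 $$ (i, b) \<in> I 0" using u by (simp add: I_scale int_units_iff)
    then show "(P * minv h1) $$ (c, b) \<in> I 0" using ai cb by (auto simp: P_def mat_diag_mult_left)
  qed (use ai in simp)
  have gi1: "minv ?g \<in> M (- 1) m m"
  proof -
    have "(inverse w - 1) \<in> I (- 1)" by (intro I_diff) (auto simp: I_iff_val val_inverse)
    from M_smult[OF Pm this] have "(inverse w - 1) \<cdot>\<^sub>m (P * minv h1) \<in> M (- 1) m m" by simp
    then show ?thesis unfolding gi E_mult_left[OF ai(1)] using * by (intro M_add) auto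
  qed
  have vg: "v (det ?g) = v (det h1) + 1" using c1 by (simp add: det_mult[of _ m] det_E val_mult)
  have gA: "(a * w, ?g, h2) \<in> A (Suc k)"
    using * g0 gX gi1 vg c1(1) by (subst A_iff[OF gc]) (auto simp: val_mult)
  have gf: "pr ?g \<in> M 0 m m" using fx pr_E[OF _ c1(2), of w] by simp
  have "?g * P = w \<cdot>\<^sub>m (h1 * P)"
    using c1 by (simp add: assoc_mult_mat[of h1 m m _ m P m] E_P mult_smult_distrib[of h1 m m P m])
  moreover have "w \<cdot>\<^sub>m (h1 * P) \<in> M 1 m m"
    using M_smult[of "h1 * P" 0 m m w 1] M_mult0(2)[OF _ P_M] * w0 by simp
  ultimately show ?thesis using gA gf unfolding hd by (simp add: fixd_def yes_def)
qed

text \<open>Right translation by \<open>\<delta>\<close> is the bijection given by the two preceding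
  lemmas, and it preserves the measure because H is unimodular.\<close>

lemma measure_no: "measure \<mu> (fixd k - yes k) = measure \<mu> (yes (Suc k))"
proof -
  have "yes (Suc k) #>\<^bsub>grp_H m\<^esub> \<delta> = fixd k - yes k"
  proof
    show "yes (Suc k) #>\<^bsub>grp_H m\<^esub> \<delta> \<subseteq> fixd k - yes k" using \<delta>_yes by (auto simp: r_coset_def)
    show "fixd k - yes k \<subseteq> yes (Suc k) #>\<^bsub>grp_H m\<^esub> \<delta>"
    proof
      fix h assume h: "h \<in> fixd k - yes k"
      then have c: "h \<in> carrier (grp_H m)" using A_carrier by (auto simp: fixd_def)
      have "(h \<otimes>\<^bsub>grp_H m\<^esub> inv\<^bsub>grp_H m\<^esub> \<delta>) \<otimes>\<^bsub>grp_H m\<^esub> \<delta> \<in> yes (Suc k) #>\<^bsub>grp_H m\<^esub> \<delta>"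
        by (rule H.r_coset_memI[OF no_\<delta>[OF h]])
      then show "h \<in> yes (Suc k) #>\<^bsub>grp_H m\<^esub> \<delta>" using c \<delta>_carrier by (simp add: H.m_assoc)
    qed
  qed
  then show ?thesis using H.measure_r_coset[OF nice_parts(2)[of "Suc k"] \<delta>_carrier] unimodular[OF \<delta>_carrier] by simp
qed

text \<open>For k = 0 the two determinants have nonnegative valuations with sum zero, so
  \<open>h1\<close> is invertible over the integers and none of its columns is divisible by
  w.\<close>

lemma yes_0: "yes 0 = {}"
proof -
  have False if "h \<in> yes 0" for h
  proof -
    obtain a h1 h2 where h: "h = (a, h1, h2)" by (cases h)
    have A: "(a, h1, h2) \<in> A 0" and y: "h1 * P \<in> M 1 m m" using that by (auto simp: h yes_def fixd_def)
    have c: "(a, h1, h2) \<in> carrier (grp_H m)" using A A_carrier by blast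
    have c1: "h1 \<in> carrier_mat m m" "det h1 \<noteq> 0" "h2 \<in> carrier_mat m m" "det h2 \<noteq> 0"
      using c by (auto simp: carrier_grp_H carrier_GL)
    note * = A_iff[OF c, THEN iffD1, OF A]
    have "v (det h1) = 0" using * det_M0[of h1 m] det_M0[of h2 m] c1 by (auto simp: I_iff_val)
    then have "minv h1 \<in> M 0 m m" using * c1 by (intro minv_M0) (auto simp: int_units_iff)
    from M_mult0(1)[OF this y] have "P \<in> M 1 m m" using mat_cancel_left(1)[OF c1(1,2) P_carrier(1)] by simp
    with P_not_M1 show False by simp
  qed
  then show ?thesis by blast
qed

lemma ex_count:
  assumes "S \<subseteq> A k" "\<And>g h. g \<in> S \<Longrightarrow> h \<in> sub_U v m \<Longrightarrow> h \<otimes>\<^bsub>grp_H m\<^esub> g \<in> S"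
  shows "measure \<mu> S = of_nat (card ((\<lambda>h. sub_U v m #>\<^bsub>grp_H m\<^esub> h) ` S)) * measure \<mu> (sub_U v m)"
  by (rule H.measure_r_cosets[OF subgroup_U nice_U nice_part[OF assms] assms(2) unimodular])

section \<open>Free torus orbits off the fixed part\<close>

lemma conj_\<tau>:
  assumes "h \<in> carrier (grp_H m)" "r \<in> int_units v"
  shows "h \<otimes>\<^bsub>grp_H m\<^esub> \<tau> r \<otimes>\<^bsub>grp_H m\<^esub> inv\<^bsub>grp_H m\<^esub> h \<in> sub_U v m \<longleftrightarrow> (r - 1) \<cdot>\<^sub>m pr (fst (snd h)) \<in> M 0 m m"
proof -
  obtain a h1 h2 where h: "h = (a, h1, h2)" by (cases h)
  have c: "a \<noteq> 0" "h1 \<in> carrier (GL m)" "h1 \<in> carrier_mat m m" "det h1 \<noteq> 0" "h2 \<in> carrier_mat m m" "det h2 \<noteq> 0"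
    using assms(1) by (auto simp: h carrier_grp_H carrier_GL)
  have "h \<otimes>\<^bsub>grp_H m\<^esub> \<tau> r \<otimes>\<^bsub>grp_H m\<^esub> inv\<^bsub>grp_H m\<^esub> h = (1, h1 * E r * minv h1, 1\<^sub>m m)"
    using c inv_grp_H[OF assms(1)[unfolded h]] by (simp add: h \<tau>_def minv(2)[OF c(5,6)] right_mult_one_mat)
  then show ?thesis
    using conj_E_int[OF c(2) assms(2)] by (simp add: h sub_U_alt mult_B0 GL_B0 GL_int_one int_units_iff)
qed

lemma \<tau>_mult: "\<tau> r \<otimes>\<^bsub>grp_H m\<^esub> \<tau> s = \<tau> (r * s)"
  by (simp add: \<tau>_def E_mult)

lemma \<tau>_H0: "r \<in> int_units v \<Longrightarrow> \<tau> r \<in> H0"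
proof -
  assume r: "r \<in> int_units v"
  have "E r * X - X * 1\<^sub>m m = 0\<^sub>m m m" by (simp add: E_X right_mult_one_mat[OF X_carrier])
  moreover have "E r \<in> GL_int v m" using r by (auto simp: GL_int_iff det_E int_units_iff I_iff_val intro!: E_M)
  ultimately show ?thesis
    by (simp add: \<tau>_def H0_iff GL_int_one M_zero int_units_iff)
qed

lemma nonfixed_\<tau>:
  assumes "h \<in> A k - fixd k" "r \<in> int_units v"
  shows "h \<otimes>\<^bsub>grp_H m\<^esub> \<tau> r \<in> A k - fixd k"
proof -
  obtain a h1 h2 where h: "h = (a, h1, h2)" by (cases h)
  have "(a, h1, h2) \<in> carrier (grp_H m)" using assms(1) A_carrier h by blast
  then have "pr (h1 * E r) = pr h1" using assms(2) by (intro pr_E) (auto simp: carrier_grp_H int_units_iff)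
  moreover have "h \<otimes>\<^bsub>grp_H m\<^esub> \<tau> r \<in> A k" using A_right[OF _ \<tau>_H0[OF assms(2)]] assms(1) by blast
  ultimately show ?thesis using assms(1) by (simp add: h \<tau>_def fixd_def)
qed

text \<open>The union of the cosets \<open>U h \<tau>(r)\<close> in one torus orbit, hence a set
  that can be measured.\<close>

definition block :: "'f \<times> 'f mat \<times> 'f mat \<Rightarrow> ('f \<times> 'f mat \<times> 'f mat) set" where
  "block h = {u \<otimes>\<^bsub>grp_H m\<^esub> (h \<otimes>\<^bsub>grp_H m\<^esub> \<tau> r) | u r. u \<in> sub_U v m \<and> r \<in> int_units v}"

lemma units_mult: "r \<in> int_units v \<Longrightarrow> s \<in> int_units v \<Longrightarrow> r * s \<in> int_units v"
  and units_inverse: "r \<in> int_units v \<Longrightarrow> inverse r \<in> int_units v"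
  by (auto simp: int_units_iff val_mult val_inverse)

lemma U_closed: "u \<in> sub_U v m \<Longrightarrow> u \<in> carrier (grp_H m)"
  using subgroup.subset[OF subgroup_U] by blast

lemma block_translate:
  assumes h: "h \<in> carrier (grp_H m)" and u: "u \<in> sub_U v m" and r: "r \<in> int_units v"
  shows "block (u \<otimes>\<^bsub>grp_H m\<^esub> (h \<otimes>\<^bsub>grp_H m\<^esub> \<tau> r)) \<subseteq> block h"
proof
  fix x assume "x \<in> block (u \<otimes>\<^bsub>grp_H m\<^esub> (h \<otimes>\<^bsub>grp_H m\<^esub> \<tau> r))"
  then obtain u' s where x: "x = u' \<otimes>\<^bsub>grp_H m\<^esub> (u \<otimes>\<^bsub>grp_H m\<^esub> (h \<otimes>\<^bsub>grp_H m\<^esub> \<tau> r) \<otimes>\<^bsub>grp_H m\<^esub> \<tau> s)" "u' \<in> sub_U v m" "s \<in> int_units v"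
    unfolding block_def by blast
  have c: "u \<in> carrier (grp_H m)" "u' \<in> carrier (grp_H m)" "\<tau> r \<in> carrier (grp_H m)" "\<tau> s \<in> carrier (grp_H m)"
    using u x(2,3) r U_closed \<tau>_carrier by (auto simp: int_units_iff)
  have "x = (u' \<otimes>\<^bsub>grp_H m\<^esub> u) \<otimes>\<^bsub>grp_H m\<^esub> (h \<otimes>\<^bsub>grp_H m\<^esub> \<tau> (r * s))"
    unfolding x(1) \<tau>_mult[symmetric] using c h by (simp add: H.m_assoc)
  then show "x \<in> block h"
    unfolding block_def using subgroup.m_closed[OF subgroup_U x(2) u] units_mult[OF r x(3)] by blast
qed

lemma block_eq:
  assumes h: "h \<in> carrier (grp_H m)" and x: "x \<in> block h"
  shows "block x = block h"
proof
  obtain u r where x: "x = u \<otimes>\<^bsub>grp_H m\<^esub> (h \<otimes>\<^bsub>grp_H m\<^esub> \<tau> r)" "u \<in> sub_U v m" "r \<in> int_units v"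
    using x unfolding block_def by blast
  then show "block x \<subseteq> block h" using block_translate[OF h] by simp
  have c: "u \<in> carrier (grp_H m)" "\<tau> r \<in> carrier (grp_H m)" "\<tau> (inverse r) \<in> carrier (grp_H m)" "r \<noteq> 0"
    using x(2,3) U_closed \<tau>_carrier by (auto simp: int_units_iff)
  have one: "\<tau> 1 = \<one>\<^bsub>grp_H m\<^esub>" by (simp add: \<tau>_def E_one grp_H_def)
  have "inv\<^bsub>grp_H m\<^esub> u \<otimes>\<^bsub>grp_H m\<^esub> (x \<otimes>\<^bsub>grp_H m\<^esub> \<tau> (inverse r)) =
      (inv\<^bsub>grp_H m\<^esub> u \<otimes>\<^bsub>grp_H m\<^esub> u) \<otimes>\<^bsub>grp_H m\<^esub> (h \<otimes>\<^bsub>grp_H m\<^esub> (\<tau> r \<otimes>\<^bsub>grp_H m\<^esub> \<tau> (inverse r)))"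
    unfolding x(1) using c h by (simp only: H.m_assoc H.m_closed H.inv_closed)
  also have "\<dots> = h" using c h by (simp add: \<tau>_mult one)
  finally show "block h \<subseteq> block x"
    using block_translate[of x "inv\<^bsub>grp_H m\<^esub> u" "inverse r"] x c h subgroup.m_inv_closed[OF subgroup_U x(2)] units_inverse by simp
qed

lemma block_self: "h \<in> carrier (grp_H m) \<Longrightarrow> h \<in> block h"
proof -
  assume h: "h \<in> carrier (grp_H m)"
  have "\<tau> 1 = \<one>\<^bsub>grp_H m\<^esub>" by (simp add: \<tau>_def E_one grp_H_def)
  have unit1: "1 \<in> int_units v" by (simp add: int_units_iff)
  have "h = \<one>\<^bsub>grp_H m\<^esub> \<otimes>\<^bsub>grp_H m\<^esub> (h \<otimes>\<^bsub>grp_H m\<^esub> \<tau> 1)" using h \<open>\<tau> 1 = \<one>\<^bsub>grp_H m\<^esub>\<close> by simp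
  then show ?thesis
    unfolding block_def using subgroup.one_closed[OF subgroup_U] unit1
    by (intro CollectI exI[of _ "\<one>\<^bsub>grp_H m\<^esub>"] exI[of _ 1] conjI)
qed

lemma coset_\<tau>_eq_iff:
  assumes h: "h \<in> carrier (grp_H m)" and r: "r \<in> int_units v" and s: "s \<in> int_units v"
  shows "sub_U v m #>\<^bsub>grp_H m\<^esub> (h \<otimes>\<^bsub>grp_H m\<^esub> \<tau> r) = sub_U v m #>\<^bsub>grp_H m\<^esub> (h \<otimes>\<^bsub>grp_H m\<^esub> \<tau> s) \<longleftrightarrow>
    (r * inverse s - 1) \<cdot>\<^sub>m pr (fst (snd h)) \<in> M 0 m m"
proof -
  have nz: "s \<noteq> 0" using s by (simp add: int_units_iff)
  have c: "\<tau> r \<in> carrier (grp_H m)" "\<tau> s \<in> carrier (grp_H m)" using r s \<tau>_carrier by (auto simp: int_units_iff)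
  have one: "\<tau> 1 = \<one>\<^bsub>grp_H m\<^esub>" by (simp add: \<tau>_def E_one grp_H_def)
  have ti: "inv\<^bsub>grp_H m\<^esub> (\<tau> s) = \<tau> (inverse s)"
    using \<tau>_mult[of "inverse s" s] nz c \<tau>_carrier[of "inverse s"] by (intro H.inv_equality) (auto simp: one)
  have "sub_U v m #>\<^bsub>grp_H m\<^esub> (h \<otimes>\<^bsub>grp_H m\<^esub> \<tau> r) = sub_U v m #>\<^bsub>grp_H m\<^esub> (h \<otimes>\<^bsub>grp_H m\<^esub> \<tau> s) \<longleftrightarrow>
      (h \<otimes>\<^bsub>grp_H m\<^esub> \<tau> r) \<otimes>\<^bsub>grp_H m\<^esub> inv\<^bsub>grp_H m\<^esub> (h \<otimes>\<^bsub>grp_H m\<^esub> \<tau> s) \<in> sub_U v m"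
  proof
    assume e: "sub_U v m #>\<^bsub>grp_H m\<^esub> (h \<otimes>\<^bsub>grp_H m\<^esub> \<tau> r) = sub_U v m #>\<^bsub>grp_H m\<^esub> (h \<otimes>\<^bsub>grp_H m\<^esub> \<tau> s)"
    have "h \<otimes>\<^bsub>grp_H m\<^esub> \<tau> r \<in> sub_U v m #>\<^bsub>grp_H m\<^esub> (h \<otimes>\<^bsub>grp_H m\<^esub> \<tau> s)"
      unfolding e[symmetric] using h c by (intro H.r_coset_self[OF subgroup_U]) simp
    then obtain u where u: "u \<in> sub_U v m" "h \<otimes>\<^bsub>grp_H m\<^esub> \<tau> r = u \<otimes>\<^bsub>grp_H m\<^esub> (h \<otimes>\<^bsub>grp_H m\<^esub> \<tau> s)"
      unfolding r_coset_def by blast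
    have "(h \<otimes>\<^bsub>grp_H m\<^esub> \<tau> r) \<otimes>\<^bsub>grp_H m\<^esub> inv\<^bsub>grp_H m\<^esub> (h \<otimes>\<^bsub>grp_H m\<^esub> \<tau> s) = u"
      unfolding u(2) using U_closed[OF u(1)] h c by (simp add: H.m_assoc del: H.inv_mult_group)
    then show "(h \<otimes>\<^bsub>grp_H m\<^esub> \<tau> r) \<otimes>\<^bsub>grp_H m\<^esub> inv\<^bsub>grp_H m\<^esub> (h \<otimes>\<^bsub>grp_H m\<^esub> \<tau> s) \<in> sub_U v m" using u(1) by simp
  next
    let ?u = "(h \<otimes>\<^bsub>grp_H m\<^esub> \<tau> r) \<otimes>\<^bsub>grp_H m\<^esub> inv\<^bsub>grp_H m\<^esub> (h \<otimes>\<^bsub>grp_H m\<^esub> \<tau> s)"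
    assume u: "?u \<in> sub_U v m"
    have "?u \<otimes>\<^bsub>grp_H m\<^esub> (h \<otimes>\<^bsub>grp_H m\<^esub> \<tau> s) \<in> sub_U v m #>\<^bsub>grp_H m\<^esub> (h \<otimes>\<^bsub>grp_H m\<^esub> \<tau> s)" by (rule H.r_coset_memI[OF u])
    also have "?u \<otimes>\<^bsub>grp_H m\<^esub> (h \<otimes>\<^bsub>grp_H m\<^esub> \<tau> s) = h \<otimes>\<^bsub>grp_H m\<^esub> \<tau> r"
      using h c by (simp only: H.m_assoc H.m_closed H.inv_closed H.l_inv H.r_one)
    finally have "h \<otimes>\<^bsub>grp_H m\<^esub> \<tau> r \<in> sub_U v m #>\<^bsub>grp_H m\<^esub> (h \<otimes>\<^bsub>grp_H m\<^esub> \<tau> s)" .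
    then show "sub_U v m #>\<^bsub>grp_H m\<^esub> (h \<otimes>\<^bsub>grp_H m\<^esub> \<tau> r) = sub_U v m #>\<^bsub>grp_H m\<^esub> (h \<otimes>\<^bsub>grp_H m\<^esub> \<tau> s)"
      using h c H.r_coset_self[OF subgroup_U, of "h \<otimes>\<^bsub>grp_H m\<^esub> \<tau> r"]
      by (intro H.r_cosets_disjoint[OF subgroup_U]) auto
  qed
  also have "(h \<otimes>\<^bsub>grp_H m\<^esub> \<tau> r) \<otimes>\<^bsub>grp_H m\<^esub> inv\<^bsub>grp_H m\<^esub> (h \<otimes>\<^bsub>grp_H m\<^esub> \<tau> s) =
      h \<otimes>\<^bsub>grp_H m\<^esub> \<tau> (r * inverse s) \<otimes>\<^bsub>grp_H m\<^esub> inv\<^bsub>grp_H m\<^esub> h"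
    unfolding H.inv_mult_group[OF h c(2)] ti \<tau>_mult[symmetric] using h c \<tau>_carrier[of "inverse s"] nz by (simp add: H.m_assoc)
  also have "\<dots> \<in> sub_U v m \<longleftrightarrow> (r * inverse s - 1) \<cdot>\<^sub>m pr (fst (snd h)) \<in> M 0 m m"
    by (rule conj_\<tau>[OF h units_mult[OF r units_inverse[OF s]]])
  finally show ?thesis .
qed

text \<open>The inverse of \<open>h1\<close> has at most one denominator w, and hence so does
  \<open>pr h1\<close>, which off the fixed part is not integral. Multiplying it by r/s - 1
  therefore gives an integral matrix exactly when r and s agree modulo w, and the orbit has one
  coset for each of the q - 1 unit residues.\<close>

lemma measure_block:
  assumes "h \<in> A k - fixd k"
  shows "H.nice (block h)" "measure \<mu> (block h) = of_nat (q - 1) * measure \<mu> (sub_U v m)"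
proof -
  have h: "h \<in> carrier (grp_H m)" using assms A_carrier by blast
  obtain a h1 h2 where he: "h = (a, h1, h2)" by (cases h)
  have hc: "(a, h1, h2) \<in> carrier (grp_H m)" using h he by simp
  then have c: "h1 \<in> carrier (GL m)" "h1 \<in> carrier_mat m m" "det h1 \<noteq> 0" by (auto simp: carrier_grp_H carrier_GL)
  have Ah: "(a, h1, h2) \<in> A k" using assms he by simp
  note * = A_iff[OF hc, THEN iffD1, OF Ah]
  have p0: "pr h1 \<notin> M 0 m m" using assms by (simp add: he fixd_def)
  have p1: "pr h1 \<in> M (- 1) m m" unfolding pr_def using M_mult0(1)[OF M_mult0(1)[OF _ P_M]] * by blast
  have coset_eq: "sub_U v m #>\<^bsub>grp_H m\<^esub> (h \<otimes>\<^bsub>grp_H m\<^esub> \<tau> r) = sub_U v m #>\<^bsub>grp_H m\<^esub> (h \<otimes>\<^bsub>grp_H m\<^esub> \<tau> s) \<longleftrightarrow> r - s \<in> I 1"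
    if r: "r \<in> int_units v" and s: "s \<in> int_units v" for r s
  proof -
    have nz: "s \<noteq> 0" "v s = 0" using s by (auto simp: int_units_iff)
    have e: "r * inverse s - 1 = inverse s * (r - s)" using nz by (simp add: field_simps)
    have e1: "r * inverse s - 1 \<in> I 1 \<longleftrightarrow> r - s \<in> I 1" unfolding e using nz by (simp add: I_scale val_inverse)
    have "(r * inverse s - 1) \<cdot>\<^sub>m pr h1 \<in> M 0 m m \<longleftrightarrow> r * inverse s - 1 \<in> I 1"
    proof
      assume x: "r * inverse s - 1 \<in> I 1"
      show "(r * inverse s - 1) \<cdot>\<^sub>m pr h1 \<in> M 0 m m" using M_smult[OF p1 x] by simp
    next
      assume x: "(r * inverse s - 1) \<cdot>\<^sub>m pr h1 \<in> M 0 m m"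
      show "r * inverse s - 1 \<in> I 1"
      proof (rule I0_not_unit)
        have "inverse s \<in> I 0" "r \<in> I 0" using nz r by (auto simp: I_iff_val val_inverse int_units_iff)
        then show "r * inverse s - 1 \<in> I 0" by (intro I_diff I_mult0) auto
        show "r * inverse s - 1 \<notin> int_units v"
        proof
          assume "r * inverse s - 1 \<in> int_units v"
          then have "pr h1 \<in> M 0 m m" using x by (simp add: M_smult_iff int_units_iff)
          with p0 show False by simp
        qed
      qed
    qed
    then show ?thesis using coset_\<tau>_eq_iff[OF h r s] e1 by (simp add: he)
  qed
  let ?C = "(\<lambda>r. sub_U v m #>\<^bsub>grp_H m\<^esub> (h \<otimes>\<^bsub>grp_H m\<^esub> \<tau> r)) ` res_unit_reps"
  note R = res_unit_reps
  have tc: "\<tau> r \<in> carrier (grp_H m)" if "r \<in> int_units v" for r using that \<tau>_carrier by (simp add: int_units_iff)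
  have un: "\<Union>?C = block h"
  proof
    show "\<Union>?C \<subseteq> block h" unfolding block_def r_coset_def using R(3) by blast
    show "block h \<subseteq> \<Union>?C"
    proof
      fix x assume "x \<in> block h"
      then obtain u r where x: "x = u \<otimes>\<^bsub>grp_H m\<^esub> (h \<otimes>\<^bsub>grp_H m\<^esub> \<tau> r)" "u \<in> sub_U v m" "r \<in> int_units v"
        unfolding block_def by blast
      obtain s where s: "s \<in> res_unit_reps" "r - s \<in> I 1" using R(4)[OF x(3)] by blast
      have "x \<in> sub_U v m #>\<^bsub>grp_H m\<^esub> (h \<otimes>\<^bsub>grp_H m\<^esub> \<tau> r)" unfolding x(1) by (rule H.r_coset_memI[OF x(2)])
      then show "x \<in> \<Union>?C" using coset_eq[of r s] x(3) s R(3) by blast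
    qed
  qed
  have mem: "\<exists>r\<in>int_units v. C = sub_U v m #>\<^bsub>grp_H m\<^esub> (h \<otimes>\<^bsub>grp_H m\<^esub> \<tau> r)" if "C \<in> ?C" for C
    using that R(3) by blast
  have n: "H.nice C" "C \<noteq> {}" "measure \<mu> C = measure \<mu> (sub_U v m)" if "C \<in> ?C" for C
  proof -
    obtain r where r: "r \<in> int_units v" "C = sub_U v m #>\<^bsub>grp_H m\<^esub> (h \<otimes>\<^bsub>grp_H m\<^esub> \<tau> r)" using mem[OF \<open>C \<in> ?C\<close>] by blast
    have gc: "h \<otimes>\<^bsub>grp_H m\<^esub> \<tau> r \<in> carrier (grp_H m)" using h tc[OF r(1)] by simp
    show "H.nice C" unfolding r(2) by (rule H.nice_r_coset[OF nice_U gc])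
    show "C \<noteq> {}" unfolding r(2) using H.r_coset_self[OF subgroup_U gc] by blast
    show "measure \<mu> C = measure \<mu> (sub_U v m)" unfolding r(2) using H.measure_r_coset[OF nice_U gc] unimodular[OF gc] by simp
  qed
  have d: "C = C'" if C: "C \<in> ?C" "C' \<in> ?C" and ne: "C \<inter> C' \<noteq> {}" for C C'
  proof -
    obtain r s where rs: "r \<in> int_units v" "C = sub_U v m #>\<^bsub>grp_H m\<^esub> (h \<otimes>\<^bsub>grp_H m\<^esub> \<tau> r)" "s \<in> int_units v" "C' = sub_U v m #>\<^bsub>grp_H m\<^esub> (h \<otimes>\<^bsub>grp_H m\<^esub> \<tau> s)"
      using mem[OF C(1)] mem[OF C(2)] by blast
    have c2: "h \<otimes>\<^bsub>grp_H m\<^esub> \<tau> r \<in> carrier (grp_H m)" "h \<otimes>\<^bsub>grp_H m\<^esub> \<tau> s \<in> carrier (grp_H m)" using h tc rs by auto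
    show ?thesis unfolding rs(2,4) by (rule H.r_cosets_disjoint[OF subgroup_U c2]) (use ne rs(2,4) in simp)
  qed
  show nb: "H.nice (block h)"
    unfolding un[symmetric] using H.nice_UN[of ?C "\<lambda>x. x"] R(1) n(1) by simp
  have "card ?C = q - 1"
  proof -
    have "inj_on (\<lambda>r. sub_U v m #>\<^bsub>grp_H m\<^esub> (h \<otimes>\<^bsub>grp_H m\<^esub> \<tau> r)) res_unit_reps"
    proof (rule inj_onI)
      fix r s assume rs: "r \<in> res_unit_reps" "s \<in> res_unit_reps"
        "sub_U v m #>\<^bsub>grp_H m\<^esub> (h \<otimes>\<^bsub>grp_H m\<^esub> \<tau> r) = sub_U v m #>\<^bsub>grp_H m\<^esub> (h \<otimes>\<^bsub>grp_H m\<^esub> \<tau> s)"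
      then have "r - s \<in> I 1" using coset_eq[of r s] R(3) by blast
      then show "r = s" using rs(1,2) res_reps_eq by (auto simp: res_unit_reps_def)
    qed
    then show ?thesis using R(2) by (simp add: card_image)
  qed
  then show "measure \<mu> (block h) = of_nat (q - 1) * measure \<mu> (sub_U v m)"
    using H.measure_blocks(2)[OF nb un n(1,2) d n(3)] by simp
qed

lemma ex_measure_nonfixed: "\<exists>b. measure \<mu> (A k - fixd k) = of_nat ((q - 1) * b) * measure \<mu> (sub_U v m)"
proof -
  let ?C = "block ` (A k - fixd k)"
  have c: "h \<in> carrier (grp_H m)" if "h \<in> A k - fixd k" for h using that A_carrier by blast
  have un: "\<Union>?C = A k - fixd k"
  proof
    show "\<Union>?C \<subseteq> A k - fixd k"
    proof
      fix x assume "x \<in> \<Union>?C"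
      then obtain h where h: "h \<in> A k - fixd k" "x \<in> block h" by blast
      then show "x \<in> A k - fixd k" using left_invariant(4) nonfixed_\<tau> unfolding block_def by blast
    qed
    show "A k - fixd k \<subseteq> \<Union>?C" using block_self c by blast
  qed
  have "measure \<mu> (A k - fixd k) = of_nat (card ?C) * (of_nat (q - 1) * measure \<mu> (sub_U v m))"
  proof (rule H.measure_blocks(2)[OF nice_parts(4) un])
    fix T assume "T \<in> ?C"
    then obtain h where h: "h \<in> A k - fixd k" "T = block h" by blast
    show "H.nice T" "measure \<mu> T = of_nat (q - 1) * measure \<mu> (sub_U v m)" using measure_block[OF h(1)] h(2) by simp_all
    show "T \<noteq> {}" using block_self[OF c[OF h(1)]] h(2) by blast
  next
    fix T T' assume "T \<in> ?C" "T' \<in> ?C" and ne: "T \<inter> T' \<noteq> {}"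
    then obtain h h' where h: "h \<in> A k - fixd k" "T = block h" "h' \<in> A k - fixd k" "T' = block h'" by blast
    obtain x where x: "x \<in> block h" "x \<in> block h'" using ne h by blast
    show "T = T'" using block_eq[OF c[OF h(1)] x(1)] block_eq[OF c[OF h(3)] x(2)] h by simp
  qed
  then show ?thesis by (intro exI[of _ "card ?C"]) (simp add: mult_ac)
qed

text \<open>The set \<open>A k\<close> splits into \<open>yes k\<close>, the rest of
  \<open>fixd k\<close>, which has the measure of \<open>yes (Suc k)\<close>, and the nonfixed part,
  which consists of blocks. Dividing by the measure of U turns measures into counts.\<close>

lemma cosets_N_decomp:
  obtains y b :: "nat \<Rightarrow> nat" where "y 0 = 0" "y (Suc (2 * m)) = 0" "\<And>k. cosets_N k = y k + y (Suc k) + (q - 1) * b k"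
proof -
  define y where "y k = card ((\<lambda>h. sub_U v m #>\<^bsub>grp_H m\<^esub> h) ` yes k)" for k
  obtain b where b: "\<And>k. measure \<mu> (A k - fixd k) = of_nat ((q - 1) * b k) * measure \<mu> (sub_U v m)"
    using ex_measure_nonfixed by metis
  have yes_A: "yes k \<subseteq> A k" for k by (auto simp: yes_def fixd_def)
  have my: "measure \<mu> (yes k) = of_nat (y k) * measure \<mu> (sub_U v m)" for k
    unfolding y_def by (rule ex_count[OF yes_A left_invariant(2)])
  \<comment> \<open>The upper boundary term vanishes because \<open>A k\<close> is empty beyond
    \<open>2 * m\<close>; the lower one is \<open>yes_0\<close>.\<close>
  have "yes (Suc (2 * m)) = {}" using yes_A A_le by fastforce
  then have y: "y 0 = 0" "y (Suc (2 * m)) = 0" using yes_0 by (simp_all add: y_def)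
  have pU: "measure \<mu> (sub_U v m) > 0" by (rule measure_pos[OF subgroup_U nice_U])
  have "cosets_N k = y k + y (Suc k) + (q - 1) * b k" for k
  proof -
    have fin: "emeasure \<mu> S \<noteq> \<infinity>" "S \<in> sets \<mu>" if "H.nice S" for S using that H.nice_emeasure H.nice_sets by auto
    have "measure \<mu> (A k) = measure \<mu> (fixd k) + measure \<mu> (A k - fixd k)"
    proof -
      have "measure \<mu> (A k - fixd k) = measure \<mu> (A k) - measure \<mu> (fixd k)"
        using fin nice_A nice_parts by (intro measure_Diff) (auto simp: fixd_def)
      then show ?thesis by simp
    qed
    moreover have "measure \<mu> (fixd k - yes k) = measure \<mu> (fixd k) - measure \<mu> (yes k)"
      using fin nice_A nice_parts by (intro measure_Diff) (auto simp: yes_def)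
    ultimately have "of_nat (cosets_N k) * measure \<mu> (sub_U v m) = of_nat (y k + y (Suc k) + (q - 1) * b k) * measure \<mu> (sub_U v m)"
      using measure_no[of k] my[of k] my[of "Suc k"] b[of k] measure_A(2)[of k] by (simp add: algebra_simps)
    then show ?thesis using pU by (simp only: mult_cancel_right of_nat_eq_iff) simp
  qed
  with y show ?thesis by (rule that)
qed

section \<open>The subgroup of the stabilizer on which nu is congruent to 1, and its index\<close>

definition V :: "('f \<times> 'f mat \<times> 'f mat) set" where
  "V = {h \<in> H0. nu h \<in> sub_D v w}"

lemma nu_mult: "g \<in> carrier (grp_H m) \<Longrightarrow> h \<in> carrier (grp_H m) \<Longrightarrow> nu (g \<otimes>\<^bsub>grp_H m\<^esub> h) = nu g * nu h"
  using iota_t_mult[of g m h] by (cases "iota m g"; cases "iota m h") (simp add: iota_t_def)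

lemma nu_one: "nu \<one>\<^bsub>grp_H m\<^esub> = 1"
  by (simp add: nu_def grp_H_def mult_group_def)

lemma nu_inv:
  fixes h :: "'f \<times> 'f mat \<times> 'f mat"
  assumes "h \<in> carrier (grp_H m)"
  shows "nu h * nu (inv\<^bsub>grp_H m\<^esub> h) = 1"
  using nu_mult[OF assms H.inv_closed[OF assms]] by (simp only: H.r_inv[OF assms] nu_one)

lemma nu_unit: "h \<in> H0 \<Longrightarrow> nu h \<in> int_units v"
proof -
  assume "h \<in> H0"
  then have "iota_t m h \<in> sub_Kt v m" using iota_U H0_sub_U by blast
  then show ?thesis by (simp add: iota_t_def sub_Kt_def)
qed

lemma nu_\<tau>: "nu (\<tau> r) = inverse r"
  by (simp add: nu_def \<tau>_def det_E inverse_eq_divide)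

lemma subgroup_V: "subgroup V (grp_H m)"
proof (rule H.subgroupI)
  note c = H0_carrier
  show "V \<subseteq> carrier (grp_H m)" using c by (auto simp: V_def)
  have "\<one>\<^bsub>grp_H m\<^esub> \<in> V" using subgroup.one_closed[OF subgroup_H0] by (simp add: V_def nu_one sub_D_iff)
  then show "V \<noteq> {}" by blast
  show "inv\<^bsub>grp_H m\<^esub> h \<in> V" if "h \<in> V" for h
  proof -
    have h: "h \<in> H0" "h \<in> carrier (grp_H m)" "nu h - 1 \<in> I 1" using that c by (auto simp: V_def sub_D_iff)
    have "nu h * (1 - nu (inv\<^bsub>grp_H m\<^esub> h)) \<in> I 1" using h(3) nu_inv[OF h(2)] by (simp add: right_diff_distrib)
    then have "1 - nu (inv\<^bsub>grp_H m\<^esub> h) \<in> I 1" using nu_unit[OF h(1)] by (simp add: I_scale int_units_iff)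
    then show ?thesis using subgroup.m_inv_closed[OF subgroup_H0 h(1)] by (simp add: V_def sub_D_iff I_diff_commute)
  qed
  show "g \<otimes>\<^bsub>grp_H m\<^esub> h \<in> V" if "g \<in> V" "h \<in> V" for g h
  proof -
    have g: "g \<in> H0" "g \<in> carrier (grp_H m)" "nu g - 1 \<in> I 1" using that(1) c by (auto simp: V_def sub_D_iff)
    have h: "h \<in> H0" "h \<in> carrier (grp_H m)" "nu h - 1 \<in> I 1" using that(2) c by (auto simp: V_def sub_D_iff)
    have "nu g * (nu h - 1) \<in> I 1" using nu_unit[OF g(1)] h(3) by (simp add: I_scale int_units_iff)
    then have "nu g * (nu h - 1) + (nu g - 1) \<in> I 1" using g(3) by (rule I_add)
    then show ?thesis using subgroup.m_closed[OF subgroup_H0 g(1) h(1)] nu_mult[OF g(2) h(2)]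
      by (simp add: V_def sub_D_iff algebra_simps)
  qed
qed

lemma nice_V: "H.nice V"
proof (rule H.nice_subset[OF nice_H0])
  let ?W = "(mult_U 0 \<times> GL_U m 0 \<times> GL_U m 0) \<inter> H0"
  show "V \<subseteq> H0" by (auto simp: V_def)
  show "H.nice ?W" by (rule H.nice_Int[OF H.nice_U nice_H0])
  show "\<one>\<^bsub>grp_H m\<^esub> \<in> ?W" using subgroup.one_closed[OF subgroup_H0] subgroup.one_closed[OF H.U_subgroup[of 0]] by simp
  show "g \<otimes>\<^bsub>grp_H m\<^esub> h \<in> V" if gV: "g \<in> V" and hW: "h \<in> ?W" for g h
  proof -
    obtain a h1 h2 where h: "h = (a, h1, h2)" "h1 \<in> GL_U m 0" "h2 \<in> GL_U m 0" using hW by auto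
    note d1 = GL_int_D[OF GL_U_int[OF h(2)]] and d2 = GL_int_D[OF GL_U_int[OF h(3)]]
    have D1: "det h1 - 1 \<in> I 1" using det_congruent[OF d1(3), of "1\<^sub>m m" 1] h(2) by (simp add: GL_U_def)
    have D2: "det h2 - 1 \<in> I 1" using det_congruent[OF d2(3), of "1\<^sub>m m" 1] h(3) by (simp add: GL_U_def)
    have "det h1 * (nu h - 1) = (det h2 - 1) - (det h1 - 1)" using d1(2) by (simp add: h(1) nu_def field_simps)
    then have "det h1 * (nu h - 1) \<in> I 1" using I_diff[OF D2 D1] by simp
    then have "nu h - 1 \<in> I 1" using d1(2,6) by (simp add: I_scale)
    then have "h \<in> V" using hW by (simp add: V_def sub_D_iff)
    then show ?thesis by (rule subgroup.m_closed[OF subgroup_V gV])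
  qed
qed

text \<open>On the torus, \<open>nu (\<tau> r)\<close> is the inverse of r, so nu takes every unit
  residue on \<open>H0\<close>. The elements \<open>\<tau> r\<close> with r a unit digit hence
  represent all left cosets of V in \<open>H0\<close>.\<close>

lemma measure_H0_V: "measure \<mu> H0 = of_nat (q - 1) * measure \<mu> V"
proof -
  note R = res_unit_reps
  have Vc: "V \<subseteq> H0" by (auto simp: V_def)
  have "(\<lambda>g. g <#\<^bsub>grp_H m\<^esub> V) ` H0 = (\<lambda>r. \<tau> r <#\<^bsub>grp_H m\<^esub> V) ` res_unit_reps"
    (is "?L = ?R")
  proof
    show "?R \<subseteq> ?L" using R(3) \<tau>_H0 by auto
    show "?L \<subseteq> ?R"
    proof
      fix C assume "C \<in> ?L"
      then obtain g where g: "g \<in> H0" "C = g <#\<^bsub>grp_H m\<^esub> V" by blast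
      have gc: "g \<in> carrier (grp_H m)" using g(1) H0_carrier by blast
      obtain r where r: "r \<in> res_unit_reps" "inverse (nu g) - r \<in> I 1"
        using R(4)[OF units_inverse[OF nu_unit[OF g(1)]]] by blast
      have r': "r \<in> int_units v" "r \<noteq> 0" using r(1) R(3) by (auto simp: int_units_iff)
      have ti: "inv\<^bsub>grp_H m\<^esub> (\<tau> r) \<in> H0" by (rule subgroup.m_inv_closed[OF subgroup_H0 \<tau>_H0[OF r'(1)]])
      have tn: "nu (inv\<^bsub>grp_H m\<^esub> (\<tau> r)) = r"
        using nu_inv[OF \<tau>_carrier[OF r'(2)]] r'(2) by (simp add: nu_\<tau> field_simps)
      have "nu g * (inverse (nu g) - r) \<in> I 1" using r(2) nu_unit[OF g(1)] by (simp add: I_scale int_units_iff)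
      then have "1 - r * nu g \<in> I 1" using nu_unit[OF g(1)] by (simp add: right_diff_distrib int_units_iff mult.commute)
      then have "inv\<^bsub>grp_H m\<^esub> (\<tau> r) \<otimes>\<^bsub>grp_H m\<^esub> g \<in> V"
        using subgroup.m_closed[OF subgroup_H0 ti g(1)] nu_mult[OF H.inv_closed[OF \<tau>_carrier[OF r'(2)]] gc] tn
        by (simp add: V_def sub_D_iff I_diff_commute)
      then have "\<tau> r <#\<^bsub>grp_H m\<^esub> V = g <#\<^bsub>grp_H m\<^esub> V"
        using H.l_coset_eq_iff[OF subgroup_V \<tau>_carrier[OF r'(2)] gc] H.l_coset_mem_iff[OF subgroup_V \<tau>_carrier[OF r'(2)] gc] by blast
      then show "C \<in> ?R" using g(2) r(1) by auto
    qed
  qed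
  moreover have "inj_on (\<lambda>r. \<tau> r <#\<^bsub>grp_H m\<^esub> V) res_unit_reps"
  proof (rule inj_onI)
    fix r s assume rs: "r \<in> res_unit_reps" "s \<in> res_unit_reps" "\<tau> r <#\<^bsub>grp_H m\<^esub> V = \<tau> s <#\<^bsub>grp_H m\<^esub> V"
    have u: "r \<noteq> 0" "s \<noteq> 0" "v r = 0" "v s = 0" using rs(1,2) R(3) by (auto simp: int_units_iff)
    have "\<tau> s \<in> \<tau> r <#\<^bsub>grp_H m\<^esub> V"
      unfolding rs(3) by (rule H.l_coset_self[OF subgroup_V \<tau>_carrier[OF u(2)]])
    then obtain g where g: "g \<in> V" "\<tau> s = \<tau> r \<otimes>\<^bsub>grp_H m\<^esub> g" unfolding l_coset_def by blast
    have "inverse s = inverse r * nu g"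
      using nu_mult[OF \<tau>_carrier[OF u(1)], of g] g(1) Vc H0_carrier unfolding g(2)[symmetric] nu_\<tau> by blast
    then have "s * (nu g - 1) = r - s" using u by (simp add: field_simps)
    moreover have "s * (nu g - 1) \<in> I 1" using g(1) u by (simp add: V_def sub_D_iff I_scale)
    ultimately have "r - s \<in> I 1" by simp
    then show "r = s" using rs(1,2) res_reps_eq by (auto simp: res_unit_reps_def)
  qed
  ultimately have "card ((\<lambda>g. g <#\<^bsub>grp_H m\<^esub> V) ` H0) = q - 1" using R(2) by (simp add: card_image)
  moreover have "g \<otimes>\<^bsub>grp_H m\<^esub> h \<in> H0" if "g \<in> H0" "h \<in> V" for g h
    using subgroup.m_closed[OF subgroup_H0 that(1)] that(2) Vc by blast
  ultimately show ?thesis using H.measure_l_cosets(2)[OF subgroup_V nice_V nice_H0] by simp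
qed

end

section \<open>Orbit sums and base points\<close>

text \<open>The geometric sum for natural exponents; for negative ones, x^(-1) - 1 is itself x - 1
  times an element of R.\<close>

lemma ex_power_diff:
  assumes R: "is_subring R" and x: "(x :: 'a::field) \<in> R" "inverse x \<in> R" "x \<noteq> 0"
  shows "\<exists>u\<in>R. x powi z - 1 = (x - 1) * u"
proof -
  have nat: "\<exists>u\<in>R. y ^ n - 1 = (y - 1) * u" if y: "y \<in> R" for y :: 'a and n
  proof (induction n)
    case 0
    show ?case by (rule bexI[OF _ subring_zero[OF R]]) simp
  next
    case (Suc n)
    then obtain u where u: "u \<in> R" "y ^ n - 1 = (y - 1) * u" by blast
    have "y ^ Suc n - 1 = y * (y ^ n - 1) + (y - 1)" by (simp add: algebra_simps)
    also have "\<dots> = (y - 1) * (y * u + 1)" unfolding u(2) by (simp add: algebra_simps)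
    finally show ?case using subring_add[OF R subring_mult[OF R y u(1)] subring_one[OF R]] by blast
  qed
  show ?thesis
  proof (cases "z \<ge> 0")
    case True
    then show ?thesis using nat[OF x(1)] by (simp add: power_int_def)
  next
    case False
    obtain u where u: "u \<in> R" "inverse x ^ nat (- z) - 1 = (inverse x - 1) * u" using nat[OF x(2)] by blast
    have "inverse x - 1 = (x - 1) * (- inverse x)" using x(3) by (simp add: field_simps)
    then have "x powi z - 1 = (x - 1) * (- inverse x * u)" using False u(2) by (simp add: power_int_def)
    then show ?thesis using subring_mult[OF R subring_uminus[OF R x(2)] u(1)] by blast
  qed
qed

lemma sum_alternating_telescope:
  "(\<Sum>k\<le>n. (-1) ^ k * of_nat (y k + y (Suc k))) = (of_nat (y 0) + (-1) ^ n * of_nat (y (Suc n)) :: 'a::comm_ring_1)"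
  by (induction n) (auto simp: algebra_simps)

lemma card_image_eq:
  assumes "\<And>x y. x \<in> S \<Longrightarrow> y \<in> S \<Longrightarrow> f x = f y \<longleftrightarrow> g x = g y"
  shows "card (f ` S) = card (g ` S)"
proof -
  let ?r = "\<lambda>C. SOME x. x \<in> S \<and> f x = C"
  have r: "?r (f x) \<in> S \<and> f (?r (f x)) = f x" if "x \<in> S" for x
    by (rule someI[of "\<lambda>z. z \<in> S \<and> f z = f x" x]) (use that in simp)
  have e: "g (?r (f x)) = g x" if "x \<in> S" for x using r[OF that] assms[of "?r (f x)" x] that by blast
  have "bij_betw (\<lambda>C. g (?r C)) (f ` S) (g ` S)"
  proof (rule bij_betw_imageI)
    show "inj_on (\<lambda>C. g (?r C)) (f ` S)" by (rule inj_onI) (use e assms in auto)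
    show "(\<lambda>C. g (?r C)) ` f ` S = g ` S" using e by (auto simp: image_image)
  qed
  then show ?thesis by (rule bij_betw_same_card)
qed

context local_field_unif
begin

definition hecke_coeff :: "nat \<Rightarrow> int \<Rightarrow> nat \<Rightarrow> 'p::field_char_0" where
  "hecke_coeff m c k = of_rat (hecke_num m c k)"

text \<open>Both q and its inverse lie in \<open>\<O>\<close>, so every power of q is 1 modulo q - 1
  there, whatever the exponent; only the sign survives.\<close>

lemma hecke_coeff:
  fixes \<O> :: "'p::field_char_0 set"
  assumes R: "is_subring \<O>" and Z: "Z_q_inv v \<subseteq> \<O>"
  obtains u where "u \<in> \<O>" "hecke_coeff m c k = (-1) ^ k + of_nat (q - 1) * u"
proof -
  have Q: "(of_nat q :: 'p) \<in> \<O>" by (rule subring_of_nat[OF R])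
  have "inverse (of_nat q) \<in> (Z_q_inv v :: 'p set)" unfolding Z_q_inv_def using subring_gen_superset by blast
  then have Qi: "inverse (of_nat q :: 'p) \<in> \<O>" using Z by blast
  have Q0: "(of_nat q :: 'p) \<noteq> 0" using q_ge_2 by simp
  obtain u where u: "u \<in> \<O>" "(of_nat q :: 'p) powi (- (int k * (c + 2 * int m - int k) div 2)) - 1 = (of_nat q - 1) * u"
    using ex_power_diff[OF R Q Qi Q0] by blast
  have "hecke_coeff m c k = (-1) ^ k * (of_nat q :: 'p) powi (- (int k * (c + 2 * int m - int k) div 2))"
    by (simp add: hecke_coeff_def hecke_num_def of_rat_mult of_rat_power of_rat_power_int)
  also have "(of_nat q :: 'p) powi (- (int k * (c + 2 * int m - int k) div 2)) = 1 + (of_nat q - 1) * u"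
    using u(2) by (simp only: diff_eq_eq add.commute)
  also have "(-1) ^ k * (1 + (of_nat q - 1) * u) = (-1) ^ k + of_nat (q - 1) * ((-1) ^ k * u)" using q_ge_2 by (simp add: of_nat_diff algebra_simps)
  finally show ?thesis
    using that[of "(-1) ^ k * u"] subring_mult[OF R subring_power[OF R subring_uminus[OF R subring_one[OF R]]] u(1)] by blast
qed

end

context orbit
begin

lemma orbit_sum:
  fixes \<O> :: "'p::field_char_0 set"
  assumes R: "is_subring \<O>" and Z: "Z_q_inv v \<subseteq> \<O>"
  obtains V x where "compact_open_subgroup (grp_H m) (top_H v m) V"
    "iota_t m ` V \<subseteq> y0 <#\<^bsub>grp_Gt m\<^esub> (sub_Lt v w m #>\<^bsub>grp_Gt m\<^esub> inv\<^bsub>grp_Gt m\<^esub> y0)"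
    "x \<in> \<O>" "(\<Sum>k\<le>2 * m. hecke_coeff m c k * of_nat (cosets_M k)) = gen_index \<mu> (sub_U v m) V * x"
proof (cases "\<exists>i<m. xs i = 0")
  case False
  have "compact_open_subgroup (grp_H m) (top_H v m) H0" by (rule H.compact_open_nice[OF nice_H0 subgroup_H0])
  moreover have "iota_t m ` H0 \<subseteq> y0 <#\<^bsub>grp_Gt m\<^esub> (sub_Lt v w m #>\<^bsub>grp_Gt m\<^esub> inv\<^bsub>grp_Gt m\<^esub> y0)"
  proof
    fix g assume "g \<in> iota_t m ` H0"
    then obtain a h1 h2 where h: "(a, h1, h2) \<in> H0" "g = iota_t m (a, h1, h2)" by auto
    show "g \<in> y0 <#\<^bsub>grp_Gt m\<^esub> (sub_Lt v w m #>\<^bsub>grp_Gt m\<^esub> inv\<^bsub>grp_Gt m\<^esub> y0)"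
      unfolding h(2) using stab_conj[OF h(1)] nu_in_D[OF _ h(1)] False by auto
  qed
  moreover have "(\<Sum>k\<le>2 * m. hecke_coeff m c k * of_nat (cosets_N k)) \<in> \<O>"
  proof (rule subring_sum[OF R])
    fix k
    obtain u where u: "u \<in> \<O>" "hecke_coeff m c k = (-1) ^ k + of_nat (q - 1) * u" using hecke_coeff[OF R Z] by blast
    show "hecke_coeff m c k * of_nat (cosets_N k) \<in> \<O>"
      unfolding u(2) by (intro subring_mult[OF R] subring_add[OF R] subring_of_nat[OF R] subring_power[OF R] subring_uminus[OF R] subring_one[OF R] u(1))
  qed
  moreover have "(\<Sum>k\<le>2 * m. hecke_coeff m c k * of_nat (cosets_M k)) =
      (gen_index \<mu> (sub_U v m) H0 :: 'p) * (\<Sum>k\<le>2 * m. hecke_coeff m c k * of_nat (cosets_N k))"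
  proof -
    have "(of_nat (cosets_M k) :: 'p) = gen_index \<mu> (sub_U v m) H0 * of_nat (cosets_N k)" for k
      using cosets_M_eq[OF subgroup_H0 nice_H0, of 1 k, where ?'p = 'p] by simp
    then show ?thesis by (simp add: sum_distrib_left mult_ac)
  qed
  ultimately show ?thesis by (rule that)
next
  case True
  then obtain i where i: "i < m" "xs i = 0" by blast
  interpret torus_orbit v w m xs t0 \<mu> i by unfold_locales (fact i)+
  have 1: "compact_open_subgroup (grp_H m) (top_H v m) V" by (rule H.compact_open_nice[OF nice_V subgroup_V])
  have 2: "iota_t m ` V \<subseteq> y0 <#\<^bsub>grp_Gt m\<^esub> (sub_Lt v w m #>\<^bsub>grp_Gt m\<^esub> inv\<^bsub>grp_Gt m\<^esub> y0)"
    using stab_conj by (auto simp: V_def nu_def)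
  obtain y b :: "nat \<Rightarrow> nat" where y: "y 0 = 0" "y (Suc (2 * m)) = 0"
    and N: "\<And>k. cosets_N k = y k + y (Suc k) + (q - 1) * b k"
    by (rule cosets_N_decomp) blast
  obtain u :: "nat \<Rightarrow> 'p" where u: "\<And>k. u k \<in> \<O>" "\<And>k. hecke_coeff m c k = (-1) ^ k + of_nat (q - 1) * u k"
  proof -
    have "\<forall>k. \<exists>u\<in>\<O>. hecke_coeff m c k = (-1) ^ k + of_nat (q - 1) * u" using hecke_coeff[OF R Z] by blast
    then show ?thesis using that by metis
  qed
  \<comment> \<open>The quotient by q - 1: the free torus orbits \<open>b k\<close> with their sign,
    and the excess \<open>u k\<close> of the Hecke coefficient over its sign.\<close>
  define x where "x = (\<Sum>k\<le>2 * m. (-1) ^ k * of_nat (b k) + u k * of_nat (cosets_N k))"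
  have 3: "x \<in> \<O>"
    unfolding x_def
    by (intro subring_sum[OF R] subring_mult[OF R] subring_add[OF R] subring_of_nat[OF R] subring_power[OF R] subring_uminus[OF R] subring_one[OF R] u(1))
  have "(\<Sum>k\<le>2 * m. hecke_coeff m c k * of_nat (cosets_N k)) =
      (\<Sum>k\<le>2 * m. (-1) ^ k * of_nat (y k + y (Suc k)) + of_nat (q - 1) * ((-1) ^ k * of_nat (b k) + u k * of_nat (cosets_N k)))"
  proof (rule sum.cong[OF refl])
    fix k
    have "(of_nat (cosets_N k) :: 'p) = of_nat (y k + y (Suc k)) + of_nat (q - 1) * of_nat (b k)"
      unfolding N by simp
    then have "(-1) ^ k * (of_nat (cosets_N k) :: 'p) = (-1) ^ k * of_nat (y k + y (Suc k)) + of_nat (q - 1) * ((-1) ^ k * of_nat (b k))"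
      by (simp add: algebra_simps del: of_nat_add)
    then show "hecke_coeff m c k * of_nat (cosets_N k) =
        (-1) ^ k * of_nat (y k + y (Suc k)) + of_nat (q - 1) * ((-1) ^ k * of_nat (b k) + u k * of_nat (cosets_N k))"
      unfolding u(2) by (simp add: distrib_left distrib_right mult.assoc del: of_nat_add)
  qed
  \<comment> \<open>The contribution of the fixed cosets telescopes to its two boundary terms, which
    are zero.\<close>
  also have "\<dots> = of_nat (q - 1) * x"
    by (subst sum.distrib) (simp add: sum_alternating_telescope x_def sum_distrib_left y del: of_nat_add)
  finally have s: "(\<Sum>k\<le>2 * m. hecke_coeff m c k * of_nat (cosets_N k)) = of_nat (q - 1) * x" .
  have "(\<Sum>k\<le>2 * m. hecke_coeff m c k * of_nat (cosets_M k)) * of_nat (q - 1) =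
      (\<Sum>k\<le>2 * m. hecke_coeff m c k * (of_nat (cosets_M k) * of_nat (q - 1)))"
    by (simp add: sum_distrib_right mult.assoc)
  also have "\<dots> = (\<Sum>k\<le>2 * m. hecke_coeff m c k * (gen_index \<mu> (sub_U v m) V * of_nat (cosets_N k)))"
    unfolding cosets_M_eq[OF subgroup_V nice_V measure_H0_V] ..
  also have "\<dots> = gen_index \<mu> (sub_U v m) V * (\<Sum>k\<le>2 * m. hecke_coeff m c k * of_nat (cosets_N k))"
    by (simp add: sum_distrib_left mult_ac)
  also have "\<dots> = (gen_index \<mu> (sub_U v m) V * x) * of_nat (q - 1)"
    unfolding s by (simp add: mult_ac)
  \<comment> \<open>The factor q - 1 is the index of V in \<open>H0\<close> on the left and the
    divisor of the alternating sum on the right; it is nonzero in characteristic zero and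
    cancels.\<close>
  finally have "(\<Sum>k\<le>2 * m. hecke_coeff m c k * of_nat (cosets_M k)) = gen_index \<mu> (sub_U v m) V * x"
    using q_ge_2 by (simp del: of_nat_diff add: of_nat_eq_0_iff)
  with 1 2 3 show ?thesis by (rule that)
qed

text \<open>Two translates of \<open>y0\<close> lie in the same coset exactly when the group
  elements differ by the stabilizer, so the orbit part in the support corresponds to left cosets of
  \<open>H0\<close>.\<close>

lemma card_orbit_cosets:
  "card ((\<lambda>h. (iota_t m h \<otimes>\<^bsub>grp_Gt m\<^esub> y0) <#\<^bsub>grp_Gt m\<^esub> sub_Kt v m) ` A k) = cosets_M k"
  unfolding cosets_M_def
proof (rule card_image_eq)
  fix h h' assume "h \<in> A k" "h' \<in> A k"
  then have c: "h \<in> carrier (grp_H m)" "h' \<in> carrier (grp_H m)" using A_carrier by auto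
  have i: "iota_t m h \<in> carrier (grp_Gt m)" "iota_t m h' \<in> carrier (grp_Gt m)" using c iota_t_carrier by auto
  have e: "inv\<^bsub>grp_Gt m\<^esub> (iota_t m h \<otimes>\<^bsub>grp_Gt m\<^esub> y0) \<otimes>\<^bsub>grp_Gt m\<^esub> (iota_t m h' \<otimes>\<^bsub>grp_Gt m\<^esub> y0) =
      inv\<^bsub>grp_Gt m\<^esub> y0 \<otimes>\<^bsub>grp_Gt m\<^esub> iota_t m (inv\<^bsub>grp_H m\<^esub> h \<otimes>\<^bsub>grp_H m\<^esub> h') \<otimes>\<^bsub>grp_Gt m\<^esub> y0"
    using c i y0_carrier by (simp add: Gt.inv_mult_group Gt.m_assoc)
  have "(iota_t m h \<otimes>\<^bsub>grp_Gt m\<^esub> y0) <#\<^bsub>grp_Gt m\<^esub> sub_Kt v m = (iota_t m h' \<otimes>\<^bsub>grp_Gt m\<^esub> y0) <#\<^bsub>grp_Gt m\<^esub> sub_Kt v m \<longleftrightarrow>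
      inv\<^bsub>grp_Gt m\<^esub> (iota_t m h \<otimes>\<^bsub>grp_Gt m\<^esub> y0) \<otimes>\<^bsub>grp_Gt m\<^esub> (iota_t m h' \<otimes>\<^bsub>grp_Gt m\<^esub> y0) \<in> sub_Kt v m"
    using i y0_carrier by (simp only: Gt.l_coset_eq_iff[OF subgroup_sub_Kt] Gt.l_coset_mem_iff[OF subgroup_sub_Kt] Gt.m_closed)
  also have "\<dots> \<longleftrightarrow> inv\<^bsub>grp_H m\<^esub> h \<otimes>\<^bsub>grp_H m\<^esub> h' \<in> H0"
    unfolding e H0_def using c by simp
  also have "\<dots> \<longleftrightarrow> h <#\<^bsub>grp_H m\<^esub> H0 = h' <#\<^bsub>grp_H m\<^esub> H0"
    using c by (simp only: H.l_coset_eq_iff[OF subgroup_H0] H.l_coset_mem_iff[OF subgroup_H0])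
  finally show "(iota_t m h \<otimes>\<^bsub>grp_Gt m\<^esub> y0) <#\<^bsub>grp_Gt m\<^esub> sub_Kt v m = (iota_t m h' \<otimes>\<^bsub>grp_Gt m\<^esub> y0) <#\<^bsub>grp_Gt m\<^esub> sub_Kt v m \<longleftrightarrow>
      h <#\<^bsub>grp_H m\<^esub> H0 = h' <#\<^bsub>grp_H m\<^esub> H0" .
qed

end

section \<open>Base points for the H-orbits\<close>

context local_field_unif
begin

definition base_points :: "nat \<Rightarrow> (('f \<times> 'f mat) \<times> 'f) set" where
  "base_points m = {((1, tri m (1\<^sub>m m) (mat_diag m xs) (1\<^sub>m m)), t) | xs t. t \<noteq> 0 \<and> (\<forall>i<m. xs i = 0 \<or> v (xs i) < 0)}"

lemma base_points_carrier: "base_points m \<subseteq> carrier (grp_Gt m)"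
  by (auto simp: base_points_def carrier_grp_Gt carrier_GL det_tri)

text \<open>After the Iwasawa decomposition the matrix is block triangular with blocks A, B, D, and
  H removes the diagonal blocks, leaving \<open>Z = minv A * B\<close>. Integral P and Q can be
  applied to Z, one side from H compensated by the compact group, so Z may be taken
  diagonal.\<close>

lemma ex_base_point:
  assumes "y \<in> carrier (grp_Gt m)"
  obtains h y0 \<kappa> where "h \<in> carrier (grp_H m)" "y0 \<in> base_points m" "\<kappa> \<in> sub_Kt v m"
    "y = iota_t m h \<otimes>\<^bsub>grp_Gt m\<^esub> y0 \<otimes>\<^bsub>grp_Gt m\<^esub> \<kappa>"
proof -
  obtain a g t where y: "y = ((a, g), t)" "a \<noteq> 0" "g \<in> carrier_mat (2 * m) (2 * m)" "det g \<noteq> 0" "t \<noteq> 0"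
    using assms by (cases y) (auto simp: carrier_grp_Gt carrier_GL)
  obtain k where k: "k \<in> GL_int v (2 * m)" "upper_triangular (g * k)" using iwasawa[of g "2 * m"] y(3,4) by (auto simp: carrier_GL)
  note kd = GL_int_D[OF k(1)]
  have bc: "g * k \<in> carrier_mat (2 * m) (2 * m)" using y kd by simp
  obtain A B D where b: "g * k = tri m A B D" "A \<in> carrier_mat m m" "B \<in> carrier_mat m m" "D \<in> carrier_mat m m"
    using tri_of_upper[OF bc k(2)] by (meson mat_carrier)
  have db: "det A \<noteq> 0" "det D \<noteq> 0"
    using y(3,4) kd det_mult[OF y(3) kd(1)] det_tri[OF b(2-4)] b(1) by auto
  define Z where "Z = minv A * B"
  have Z: "Z \<in> carrier_mat m m" "A * Z = B"
    using mat_cancel_left(2)[OF b(2) db(1) b(3)] minv(1)[OF b(2) db(1)] b(3) by (auto simp: Z_def)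
  obtain P Q d where PQ: "P \<in> GL_int v m" "Q \<in> GL_int v m" "P * Z * Q = mat_diag m d"
    using cartan[OF Z(1)] by blast
  note P = GL_int_D[OF PQ(1)] and Q = GL_int_D[OF PQ(2)]
  note Pi = minv[OF P(1,2)] and Qi = minv[OF Q(1,2)]
  \<comment> \<open>Integral diagonal entries are moved into the compact factor as
    \<open>ys\<close>; what stays is zero or not integral, as base points demand.\<close>
  define xs where "xs i = (if d i \<in> I 0 then 0 else d i)" for i
  define ys where "ys i = d i - xs i" for i
  have xs: "\<forall>i<m. xs i = 0 \<or> v (xs i) < 0" by (auto simp: xs_def frac_ideal_def)
  have ys: "mat_diag m ys \<in> M 0 m m" by (rule MI) (auto simp: mat_diag_def ys_def xs_def)
  have dxy: "mat_diag m ys + mat_diag m xs = mat_diag m d" by (intro eq_matI) (auto simp: mat_diag_def ys_def)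
  \<comment> \<open>These witnesses solve the block equation: the diagonal blocks cancel P and Q,
    and the upper right block becomes A Z = B. The T component is divided by \<open>nu h\<close>
    because the embedding of h multiplies by it, and \<open>\<kappa>\<close> also undoes the Iwasawa
    factor k.\<close>
  define h where "h = (a, A * minv P, D * Q)"
  define y0 where "y0 = ((1 :: 'f, tri m (1\<^sub>m m) (mat_diag m xs) (1\<^sub>m m)), t / nu h)"
  define \<kappa> where "\<kappa> = ((1 :: 'f, tri m P (mat_diag m ys * minv Q) (minv Q) * minv k), 1 :: 'f)"
  have hc: "h \<in> carrier (grp_H m)"
    using y(2) b db P Q Pi Qi by (simp add: h_def carrier_grp_H carrier_GL det_mult[of _ m])
  then have nu: "nu h \<noteq> 0" using iota_t_carrier[OF hc] by (cases "iota m h") (simp add: iota_t_def carrier_grp_Gt)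
  have "y0 \<in> base_points m" unfolding base_points_def y0_def using xs y(5) nu by auto
  moreover have "tri m P (mat_diag m ys * minv Q) (minv Q) \<in> GL_int v (2 * m)"
    using PQ GL_int_minv[OF PQ(2)] P Q M_mult0(1)[OF ys Q(4)] by (subst tri_GL_int) auto
  then have "\<kappa> \<in> sub_Kt v m"
    using GL_int_mult GL_int_minv[OF k(1)] by (simp add: \<kappa>_def sub_Kt_def sub_K_iff int_units_iff)
  moreover have "y = iota_t m h \<otimes>\<^bsub>grp_Gt m\<^esub> y0 \<otimes>\<^bsub>grp_Gt m\<^esub> \<kappa>"
  proof -
    let ?AP = "A * minv P" and ?DQ = "D * Q" and ?x = "mat_diag m xs"
    have c: "?AP \<in> carrier_mat m m" "?DQ \<in> carrier_mat m m" using b P Q Pi by auto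
    have e1: "tri m ?AP (0\<^sub>m m m) ?DQ * tri m (1\<^sub>m m) ?x (1\<^sub>m m) = tri m ?AP (?AP * ?x) ?DQ"
      using c by (subst tri_mult) (auto simp: left_mult_zero_mat[of _ m m] right_mult_one_mat[OF c(1)] right_mult_one_mat[OF c(2)])
    have "?AP * (mat_diag m ys * minv Q) + ?AP * ?x * minv Q = ?AP * ((mat_diag m ys + ?x) * minv Q)"
      using c Qi by (simp add: add_mult_distrib_mat[of _ m m] mult_add_distrib_mat[of ?AP m m "mat_diag m ys * minv Q" m "?x * minv Q"] assoc_mult_mat[of ?AP m m _ m _ m])
    also have "(mat_diag m ys + ?x) * minv Q = P * Z"
      unfolding dxy PQ(3)[symmetric] using mat_cancel_right(1)[OF Q(1,2), of "P * Z" m] P Z by simp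
    also have "?AP * (P * Z) = B"
      using mat_cancel_left(1)[OF P(1,2) Z(1)] Z b Pi P by (simp add: assoc_mult_mat[of A m m _ m _ m])
    finally have e2: "?AP * (mat_diag m ys * minv Q) + ?AP * ?x * minv Q = B" .
    have e3: "?AP * P = A" "?DQ * minv Q = D"
      using mat_cancel_right(2)[OF P(1,2) b(2)] mat_cancel_right(1)[OF Q(1,2) b(4)] by simp_all
    have "tri m ?AP (?AP * ?x) ?DQ * tri m P (mat_diag m ys * minv Q) (minv Q) = g * k"
      using c P Qi e2 e3 b(1) by (subst tri_mult) auto
    moreover have "tri m ?AP (?AP * ?x) ?DQ * (tri m P (mat_diag m ys * minv Q) (minv Q) * minv k) =
        tri m ?AP (?AP * ?x) ?DQ * tri m P (mat_diag m ys * minv Q) (minv Q) * minv k"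
      using c P Qi kd by (intro assoc_mult_mat[symmetric, of _ "2 * m" "2 * m" _ "2 * m" _ "2 * m"]) auto
    moreover have "g * k * minv k = g" by (rule mat_cancel_right(1)[OF kd(1,2) y(3)])
    moreover have "iota_t m h = ((a, tri m ?AP (0\<^sub>m m m) ?DQ), nu h)"
      unfolding h_def iota_t_alt by (simp add: nu_def)
    ultimately show ?thesis
      using nu by (simp add: y(1) y0_def \<kappa>_def e1)
  qed
  ultimately show ?thesis using that hc by blast
qed

end

section \<open>Coinvariants\<close>

locale hecke_cosets = local_field_unif v w for v :: "'f::field_char_0 \<Rightarrow> int" and w +
  fixes m :: nat
begin

sublocale H: group "grp_H m" by (rule group_grp_H)

sublocale Gt: td_group "grp_Gt m" "top_Gt v m" "\<lambda>N. (mult_U N \<times> GL_U (2 * m) N) \<times> mult_U N"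
    "\<lambda>N. (mult_B N \<times> GL_B (2 * m) N) \<times> mult_B N"
  by (rule td_group_Gt)

sublocale \<iota>: group_hom "grp_H m" "grp_Gt m" "iota_t m"
  by (rule iota_t_group_hom)

abbreviation Kt_coset :: "('f \<times> 'f mat) \<times> 'f \<Rightarrow> (('f \<times> 'f mat) \<times> 'f) set" where
  "Kt_coset y \<equiv> y <#\<^bsub>grp_Gt m\<^esub> sub_Kt v m"

lemma nice_sub_Kt: "Gt.nice (sub_Kt v m)"
  using Gt.nice_B0 by (simp add: sub_Kt_alt)

lemma sub_Kt_carrier: "sub_Kt v m \<subseteq> carrier (grp_Gt m)"
  by (rule subgroup.subset[OF subgroup_sub_Kt])

lemma supp_Gt_carrier: "supp_Gt m k \<subseteq> carrier (grp_Gt m)"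
  using supp_G_carrier by (auto simp: supp_Gt_def grp_Gt_def mult_group_def)

lemma supp_Gt_right: "y \<in> supp_Gt m k \<Longrightarrow> a \<in> sub_Kt v m \<Longrightarrow> y \<otimes>\<^bsub>grp_Gt m\<^esub> a \<in> supp_Gt m k"
  using supp_G_biinvariant(2) by (auto simp: supp_Gt_def sub_Kt_def int_units_iff val_mult)

lemma nice_supp_Gt: "Gt.nice (supp_Gt m k)"
proof (rule Gt.nice_invariantI[OF nice_sub_Kt subgroup.one_closed[OF subgroup_sub_Kt] supp_Gt_carrier _ supp_Gt_right])
  show "supp_Gt m k \<subseteq> (mult_B (Suc k) \<times> GL_B (2 * m) (Suc k)) \<times> mult_B (Suc k)"
  proof
    fix x assume "x \<in> supp_Gt m k"
    then obtain a g t where x: "x = ((a, g), t)" "a \<noteq> 0" "v a = int k" "t \<noteq> 0" "v t = - int k"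
      "g \<in> carrier (GL (2 * m))" "g \<in> M 0 (2 * m) (2 * m)" "minv g \<in> M (-1) (2 * m) (2 * m)"
      by (auto simp: supp_Gt_def supp_G_def supp_GL_def)
    then show "x \<in> (mult_B (Suc k) \<times> GL_B (2 * m) (Suc k)) \<times> mult_B (Suc k)"
      using M_mono[of "- int (Suc k)" 0 g] M_mono[of "- int (Suc k)" "-1" "minv g"]
      by (auto simp: mult_B_def GL_B_def)
  qed
qed

section \<open>The Hecke operator as a finite combination of coset indicators\<close>

definition support :: "(('f \<times> 'f mat) \<times> 'f) set" where
  "support = (\<Union>k\<le>2 * m. supp_Gt m k)"

definition cosets :: "(('f \<times> 'f mat) \<times> 'f) set set" where
  "cosets = Kt_coset ` support"

lemma support_carrier: "support \<subseteq> carrier (grp_Gt m)"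
  using supp_Gt_carrier by (auto simp: support_def)

lemma finite_cosets: "finite cosets"
  unfolding cosets_def support_def
  by (intro Gt.finite_cosets_compact[OF Gt.nice_compact subgroup_sub_Kt nice_sub_Kt] Gt.nice_UN nice_supp_Gt) auto

lemma Kt_coset_eqI: "y \<in> carrier (grp_Gt m) \<Longrightarrow> x \<in> Kt_coset y \<Longrightarrow> Kt_coset x = Kt_coset y"
  using Gt.l_repr_independence[OF _ _ subgroup_sub_Kt] by metis

lemma Kt_coset_subset_supp: "y \<in> carrier (grp_Gt m) \<Longrightarrow> Kt_coset y \<subseteq> supp_Gt m k \<longleftrightarrow> y \<in> supp_Gt m k"
  using Gt.l_coset_self[OF subgroup_sub_Kt, of y] supp_Gt_right[of y k] unfolding l_coset_def by blast

lemma Kt_coset_translate: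
  "g \<in> carrier (grp_Gt m) \<Longrightarrow> y \<in> carrier (grp_Gt m) \<Longrightarrow> Kt_coset (g \<otimes>\<^bsub>grp_Gt m\<^esub> y) = g <#\<^bsub>grp_Gt m\<^esub> Kt_coset y"
  by (rule Gt.lcos_m_assoc[OF sub_Kt_carrier, symmetric])

lemma Kt_coset_right_iff:
  assumes "y \<in> carrier (grp_Gt m)" "g \<in> carrier (grp_Gt m)" "k \<in> sub_Kt v m"
  shows "g \<otimes>\<^bsub>grp_Gt m\<^esub> k \<in> Kt_coset y \<longleftrightarrow> g \<in> Kt_coset y"
proof -
  have kc: "k \<in> carrier (grp_Gt m)" using assms(3) sub_Kt_carrier by blast
  have "Kt_coset (g \<otimes>\<^bsub>grp_Gt m\<^esub> k) = Kt_coset g"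
    by (rule Kt_coset_eqI[OF assms(2) Gt.l_coset_memI[OF assms(3)]])
  then show ?thesis
    using Gt.l_coset_eq_iff[OF subgroup_sub_Kt assms(1,2)]
      Gt.l_coset_eq_iff[OF subgroup_sub_Kt assms(1) Gt.m_closed[OF assms(2) kc]] by simp
qed

text \<open>The value of the Hecke operator on a coset. Each support is a union of cosets, and at
  most one k contributes since k is minus the valuation of the T component.\<close>

definition coset_value :: "int \<Rightarrow> (('f \<times> 'f mat) \<times> 'f) set \<Rightarrow> 'p::field_char_0" where
  "coset_value c C = (\<Sum>k\<le>2 * m. if C \<subseteq> supp_Gt m k then hecke_coeff m c k else 0)"

lemma hecke_tilde_sum:
  assumes "odd c"
  shows "(hecke_tilde v w m c :: _ \<Rightarrow> 'p::field_char_0) = (\<lambda>x. \<Sum>C\<in>cosets. coset_value c C * indicator C x)"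
proof
  fix x
  have mem: "x \<in> C \<longleftrightarrow> C = Kt_coset x" if x: "x \<in> carrier (grp_Gt m)" and C: "C \<in> cosets" for C
  proof -
    obtain y where y: "y \<in> support" "C = Kt_coset y" using C by (auto simp: cosets_def)
    then show ?thesis using Gt.l_coset_eq_iff[OF subgroup_sub_Kt _ x, of y] support_carrier by blast
  qed
  show "hecke_tilde v w m c x = (\<Sum>C\<in>cosets. (coset_value c C :: 'p) * indicator C x)"
  proof (cases "x \<in> support")
    case True
    then have xc: "x \<in> carrier (grp_Gt m)" using support_carrier by blast
    have "(\<Sum>C\<in>cosets. (coset_value c C :: 'p) * indicator C x) = (\<Sum>C\<in>cosets. if C = Kt_coset x then coset_value c C else 0)"
      by (rule sum.cong[OF refl]) (auto simp: mem[OF xc] indicator_def)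
    also have "\<dots> = coset_value c (Kt_coset x)" using finite_cosets True by (simp add: cosets_def)
    finally show ?thesis
      unfolding hecke_tilde_eq[OF assms] coset_value_def Kt_coset_subset_supp[OF xc] hecke_coeff_def by simp
  next
    case False
    have "x \<notin> C" if C: "C \<in> cosets" for C
    proof
      assume x: "x \<in> C"
      obtain y k where y: "y \<in> supp_Gt m k" "k \<le> 2 * m" "C = Kt_coset y" using C unfolding cosets_def support_def by blast
      then have "x \<in> support" using x Kt_coset_subset_supp[of y k] supp_Gt_carrier unfolding support_def by blast
      with False show False by simp
    qed
    then have "(\<Sum>C\<in>cosets. (coset_value c C :: 'p) * indicator C x) = 0" by (intro sum.neutral) simp
    then show ?thesis unfolding hecke_tilde_eq[OF assms] using False by (auto simp: support_def intro!: sum.neutral)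
  qed
qed

section \<open>Test functions and their classes in the coinvariants\<close>

lemma test_functionsI:
  fixes f :: "('f \<times> 'f mat) \<times> 'f \<Rightarrow> 'p::field_char_0"
  assumes f: "\<And>g. g \<notin> T \<Longrightarrow> f g = 0" and T: "Gt.nice T"
    and inv: "\<And>g k. g \<in> carrier (grp_Gt m) \<Longrightarrow> k \<in> sub_Kt v m \<Longrightarrow> f (g \<otimes>\<^bsub>grp_Gt m\<^esub> k) = f g"
  shows "f \<in> test_functions v m"
proof -
  note Tc = Gt.nice_carrier[OF T]
  have "Gt.nice {g \<in> carrier (grp_Gt m). f g \<noteq> 0}"
    by (rule Gt.nice_subset[OF T _ nice_sub_Kt subgroup.one_closed[OF subgroup_sub_Kt]])
      (use f inv sub_Kt_carrier in auto)
  then have "compactly_supported (top_Gt v m) f" by (rule Gt.nice_compactly_supported) simp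
  moreover have "f g = 0" if "g \<notin> carrier (grp_Gt m)" for g using that f Tc by blast
  ultimately show ?thesis using inv unfolding test_functions_def by blast
qed

lemma sum_indicator_test_function:
  assumes A: "finite A" and \<rho>: "\<And>a. a \<in> A \<Longrightarrow> \<rho> a \<in> carrier (grp_Gt m)"
  shows "(\<lambda>x. \<Sum>a\<in>A. (f a :: 'p::field_char_0) * indicator (Kt_coset (\<rho> a)) x) \<in> test_functions v m"
proof (rule test_functionsI)
  show "Gt.nice (\<Union>a\<in>A. Kt_coset (\<rho> a))" by (rule Gt.nice_UN[OF A Gt.nice_l_coset[OF nice_sub_Kt \<rho>]])
  show "(\<Sum>a\<in>A. f a * indicator (Kt_coset (\<rho> a)) g) = 0" if "g \<notin> (\<Union>a\<in>A. Kt_coset (\<rho> a))" for g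
    using that by (intro sum.neutral) auto
  show "(\<Sum>a\<in>A. f a * indicator (Kt_coset (\<rho> a)) (g \<otimes>\<^bsub>grp_Gt m\<^esub> k)) = (\<Sum>a\<in>A. f a * indicator (Kt_coset (\<rho> a)) g)"
    if "g \<in> carrier (grp_Gt m)" "k \<in> sub_Kt v m" for g k
    by (rule sum.cong[OF refl]) (simp add: indicator_def Kt_coset_right_iff[OF \<rho> that])
qed

lemma indicator_test_function:
  "y \<in> carrier (grp_Gt m) \<Longrightarrow> (indicator (Kt_coset y) :: _ \<Rightarrow> 'p::field_char_0) \<in> test_functions v m"
  using sum_indicator_test_function[of "{()}" "\<lambda>_. y" "\<lambda>_. 1 :: 'p"] by simp

lemma H_act_indicator:
  assumes h: "h \<in> carrier (grp_H m)" and y: "y \<in> carrier (grp_Gt m)"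
  shows "H_act m h (indicator (Kt_coset y)) = indicator (Kt_coset (iota_t m h \<otimes>\<^bsub>grp_Gt m\<^esub> y))"
proof
  fix g
  have i: "iota_t m h \<in> carrier (grp_Gt m)" using h by simp
  have iy: "iota_t m h \<otimes>\<^bsub>grp_Gt m\<^esub> y \<in> carrier (grp_Gt m)" using i y by simp
  show "H_act m h (indicator (Kt_coset y)) g = indicator (Kt_coset (iota_t m h \<otimes>\<^bsub>grp_Gt m\<^esub> y)) g"
  proof (cases "g \<in> carrier (grp_Gt m)")
    case True
    have "inv\<^bsub>grp_Gt m\<^esub> (iota_t m h) \<otimes>\<^bsub>grp_Gt m\<^esub> g \<in> Kt_coset y \<longleftrightarrow> g \<in> Kt_coset (iota_t m h \<otimes>\<^bsub>grp_Gt m\<^esub> y)"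
      using i y iy True
      by (simp add: Gt.l_coset_mem_iff[OF subgroup_sub_Kt] Gt.inv_mult_group Gt.m_assoc del: \<iota>.hom_inv)
    then show ?thesis using True by (simp add: H_act_def indicator_def del: \<iota>.hom_inv)
  next
    case False
    then have "g \<notin> Kt_coset (iota_t m h \<otimes>\<^bsub>grp_Gt m\<^esub> y)"
      using Gt.l_coset_subset_G[OF sub_Kt_carrier iy] by blast
    then show ?thesis using False by (simp add: H_act_def)
  qed
qed

lemma coinvariant_class_eqI:
  fixes \<xi> \<eta> :: "('f \<times> 'f mat) \<times> 'f \<Rightarrow> 'p::field_char_0"
  assumes "\<xi> - \<eta> \<in> coinvariant_kernel v m"
  shows "coinvariant_class v m \<xi> = coinvariant_class v m \<eta>"
proof -
  interpret vector_space "fun_scale :: 'p \<Rightarrow> (('f \<times> 'f mat) \<times> 'f \<Rightarrow> 'p) \<Rightarrow> _" by (rule vector_space_fun_scale)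
  have "\<zeta> - \<xi> \<in> coinvariant_kernel v m \<longleftrightarrow> \<zeta> - \<eta> \<in> coinvariant_kernel v m" for \<zeta> :: "('f \<times> 'f mat) \<times> 'f \<Rightarrow> 'p"
  proof
    assume "\<zeta> - \<xi> \<in> coinvariant_kernel v m"
    from span_add[OF this[unfolded coinvariant_kernel_def] assms[unfolded coinvariant_kernel_def]]
    show "\<zeta> - \<eta> \<in> coinvariant_kernel v m" unfolding coinvariant_kernel_def by (simp add: algebra_simps)
  next
    assume "\<zeta> - \<eta> \<in> coinvariant_kernel v m"
    from span_diff[OF this[unfolded coinvariant_kernel_def] assms[unfolded coinvariant_kernel_def]]
    show "\<zeta> - \<xi> \<in> coinvariant_kernel v m" unfolding coinvariant_kernel_def by (simp add: algebra_simps)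
  qed
  then show ?thesis by (simp add: coinvariant_class_def)
qed

lemma sum_translates_kernel:
  fixes f :: "'i \<Rightarrow> 'p::field_char_0"
  assumes "finite A" "\<And>a. a \<in> A \<Longrightarrow> \<rho> a \<in> carrier (grp_Gt m)" "\<And>a. a \<in> A \<Longrightarrow> h a \<in> carrier (grp_H m)"
  shows "(\<lambda>x. \<Sum>a\<in>A. f a * indicator (Kt_coset (\<rho> a)) x) -
    (\<lambda>x. \<Sum>a\<in>A. f a * indicator (Kt_coset (iota_t m (h a) \<otimes>\<^bsub>grp_Gt m\<^esub> \<rho> a)) x) \<in> coinvariant_kernel v m"
proof -
  interpret vector_space "fun_scale :: 'p \<Rightarrow> (('f \<times> 'f mat) \<times> 'f \<Rightarrow> 'p) \<Rightarrow> _" by (rule vector_space_fun_scale)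
  let ?\<xi> = "\<lambda>a. indicator (Kt_coset (\<rho> a)) :: _ \<Rightarrow> 'p"
  \<comment> \<open>The minus sign turns the generator "translate minus original" into the
    difference "original minus translate" of the statement.\<close>
  let ?F = "\<lambda>a x. - f a * (H_act m (h a) (?\<xi> a) - ?\<xi> a) x"
  have F: "?F a \<in> coinvariant_kernel v m" if "a \<in> A" for a
    unfolding coinvariant_kernel_def
    by (rule span_scale, rule span_base) (use indicator_test_function assms that in blast)
  have "(\<lambda>x. \<Sum>a\<in>B. ?F a x) \<in> coinvariant_kernel v m" if "B \<subseteq> A" for B
    using finite_subset[OF that assms(1)] that
  proof (induction B rule: finite_induct)
    case empty
    have "(\<lambda>x. 0 :: 'p) = (0 :: ('f \<times> 'f mat) \<times> 'f \<Rightarrow> 'p)" by (simp add: zero_fun_def)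
    then show ?case unfolding coinvariant_kernel_def using span_zero by simp
  next
    case (insert b B)
    have "?F b + (\<lambda>x. \<Sum>a\<in>B. ?F a x) \<in> coinvariant_kernel v m"
      using F insert unfolding coinvariant_kernel_def by (intro span_add) auto
    also have "?F b + (\<lambda>x. \<Sum>a\<in>B. ?F a x) = (\<lambda>x. \<Sum>a\<in>insert b B. ?F a x)"
      using insert by (simp add: plus_fun_def)
    finally show ?case .
  qed
  then have "(\<lambda>x. \<Sum>a\<in>A. ?F a x) \<in> coinvariant_kernel v m" by blast
  also have "(\<lambda>x. \<Sum>a\<in>A. ?F a x) = (\<lambda>x. \<Sum>a\<in>A. f a * indicator (Kt_coset (\<rho> a)) x) -
    (\<lambda>x. \<Sum>a\<in>A. f a * indicator (Kt_coset (iota_t m (h a) \<otimes>\<^bsub>grp_Gt m\<^esub> \<rho> a)) x)"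
  proof
    fix x
    have "?F a x = f a * indicator (Kt_coset (\<rho> a)) x - f a * indicator (Kt_coset (iota_t m (h a) \<otimes>\<^bsub>grp_Gt m\<^esub> \<rho> a)) x"
      if "a \<in> A" for a
      unfolding H_act_indicator[OF assms(3)[OF that] assms(2)[OF that]] by (simp add: algebra_simps)
    then show "(\<Sum>a\<in>A. ?F a x) = ((\<lambda>x. \<Sum>a\<in>A. f a * indicator (Kt_coset (\<rho> a)) x) -
        (\<lambda>x. \<Sum>a\<in>A. f a * indicator (Kt_coset (iota_t m (h a) \<otimes>\<^bsub>grp_Gt m\<^esub> \<rho> a)) x)) x"
      by (simp add: sum_subtractf)
  qed
  finally show ?thesis .
qed

text \<open>The choice operator is applied to the set of all base points of an orbit. This set is
  the same for all cosets of the orbit, so they are all moved to the same point, where their values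
  can be added.\<close>

definition bases :: "(('f \<times> 'f mat) \<times> 'f) set \<Rightarrow> (('f \<times> 'f mat) \<times> 'f) set" where
  "bases C = {y0 \<in> base_points m. \<exists>h\<in>carrier (grp_H m). C = Kt_coset (iota_t m h \<otimes>\<^bsub>grp_Gt m\<^esub> y0)}"

text \<open>Depends only on the \<open>H\<close>-orbit of the coset (\<open>bases_eq\<close>).\<close>

definition base :: "(('f \<times> 'f mat) \<times> 'f) set \<Rightarrow> ('f \<times> 'f mat) \<times> 'f" where
  "base C = (SOME y0. y0 \<in> bases C)"

lemma base_in_bases:
  assumes "C \<in> cosets"
  shows "base C \<in> bases C"
proof -
  obtain y where y: "y \<in> carrier (grp_Gt m)" "C = Kt_coset y" using assms support_carrier by (auto simp: cosets_def)
  obtain h y0 \<kappa> where h: "h \<in> carrier (grp_H m)" "y0 \<in> base_points m" "\<kappa> \<in> sub_Kt v m"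
    "y = iota_t m h \<otimes>\<^bsub>grp_Gt m\<^esub> y0 \<otimes>\<^bsub>grp_Gt m\<^esub> \<kappa>"
    by (rule ex_base_point[OF y(1)])
  have "iota_t m h \<otimes>\<^bsub>grp_Gt m\<^esub> y0 \<in> carrier (grp_Gt m)"
    using Gt.m_closed[OF \<iota>.hom_closed[OF h(1)]] h(2) base_points_carrier by blast
  then have "C = Kt_coset (iota_t m h \<otimes>\<^bsub>grp_Gt m\<^esub> y0)"
    unfolding y(2) by (rule Kt_coset_eqI) (unfold h(4), rule Gt.l_coset_memI[OF h(3)])
  then have "y0 \<in> bases C" using h by (auto simp: bases_def)
  then show ?thesis unfolding base_def by (rule someI)
qed

lemma bases_carrier: "y0 \<in> bases C \<Longrightarrow> y0 \<in> carrier (grp_Gt m)"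
  using base_points_carrier by (auto simp: bases_def)

lemma bases_mono:
  assumes h: "h \<in> carrier (grp_H m)" "h' \<in> carrier (grp_H m)" and y: "y \<in> carrier (grp_Gt m)"
  shows "bases (Kt_coset (iota_t m h \<otimes>\<^bsub>grp_Gt m\<^esub> y)) \<subseteq> bases (Kt_coset (iota_t m h' \<otimes>\<^bsub>grp_Gt m\<^esub> y))"
proof
  fix z assume z: "z \<in> bases (Kt_coset (iota_t m h \<otimes>\<^bsub>grp_Gt m\<^esub> y))"
  then obtain g where g: "g \<in> carrier (grp_H m)" "Kt_coset (iota_t m h \<otimes>\<^bsub>grp_Gt m\<^esub> y) = Kt_coset (iota_t m g \<otimes>\<^bsub>grp_Gt m\<^esub> z)"
    by (auto simp: bases_def)
  have zc: "z \<in> carrier (grp_Gt m)" using z by (rule bases_carrier)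
  let ?d = "h' \<otimes>\<^bsub>grp_H m\<^esub> inv\<^bsub>grp_H m\<^esub> h"
  have d: "?d \<in> carrier (grp_H m)" using h by simp
  note i = \<iota>.hom_closed[OF d] \<iota>.hom_closed[OF h(1)] \<iota>.hom_closed[OF h(2)] \<iota>.hom_closed[OF g(1)]
  have "iota_t m h' \<otimes>\<^bsub>grp_Gt m\<^esub> y = iota_t m (?d \<otimes>\<^bsub>grp_H m\<^esub> h) \<otimes>\<^bsub>grp_Gt m\<^esub> y"
    using h by (simp only: H.m_assoc H.inv_closed H.l_inv H.r_one)
  also have "\<dots> = iota_t m ?d \<otimes>\<^bsub>grp_Gt m\<^esub> (iota_t m h \<otimes>\<^bsub>grp_Gt m\<^esub> y)"
    unfolding \<iota>.hom_mult[OF d h(1)] by (rule Gt.m_assoc[OF i(1,2) y])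
  finally have "Kt_coset (iota_t m h' \<otimes>\<^bsub>grp_Gt m\<^esub> y) = iota_t m ?d <#\<^bsub>grp_Gt m\<^esub> Kt_coset (iota_t m h \<otimes>\<^bsub>grp_Gt m\<^esub> y)"
    using Kt_coset_translate[OF i(1) Gt.m_closed[OF i(2) y]] by simp
  also have "\<dots> = Kt_coset (iota_t m ?d \<otimes>\<^bsub>grp_Gt m\<^esub> (iota_t m g \<otimes>\<^bsub>grp_Gt m\<^esub> z))"
    unfolding g(2) by (rule Kt_coset_translate[OF i(1) Gt.m_closed[OF i(4) zc], symmetric])
  also have "iota_t m ?d \<otimes>\<^bsub>grp_Gt m\<^esub> (iota_t m g \<otimes>\<^bsub>grp_Gt m\<^esub> z) = iota_t m (?d \<otimes>\<^bsub>grp_H m\<^esub> g) \<otimes>\<^bsub>grp_Gt m\<^esub> z"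
    unfolding \<iota>.hom_mult[OF d g(1)] by (rule Gt.m_assoc[OF i(1,4) zc, symmetric])
  finally show "z \<in> bases (Kt_coset (iota_t m h' \<otimes>\<^bsub>grp_Gt m\<^esub> y))"
    using z H.m_closed[OF d g(1)] unfolding bases_def by blast
qed

lemma bases_eq:
  assumes "h \<in> carrier (grp_H m)" "h' \<in> carrier (grp_H m)" "y \<in> carrier (grp_Gt m)"
  shows "bases (Kt_coset (iota_t m h \<otimes>\<^bsub>grp_Gt m\<^esub> y)) = bases (Kt_coset (iota_t m h' \<otimes>\<^bsub>grp_Gt m\<^esub> y))"
  using bases_mono[OF assms] bases_mono[OF assms(2,1,3)] by (rule subset_antisym)

text \<open>Determines which terms of the zeta element are nonzero at g: those of the whole orbit of
  C. A coset whose base point lies over g shares the orbit, and conversely cosets in one orbit share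
  their base point.\<close>

lemma cosets_over_base:
  assumes C: "C \<in> cosets" and g: "g \<in> Kt_coset (base C)"
  shows "C' \<in> cosets \<and> g \<in> Kt_coset (base C') \<longleftrightarrow>
    C' \<in> cosets \<and> (\<exists>h\<in>carrier (grp_H m). C' = Kt_coset (iota_t m h \<otimes>\<^bsub>grp_Gt m\<^esub> base C))"
proof (rule conj_cong[OF refl])
  assume C': "C' \<in> cosets"
  note b = base_in_bases[OF C] and b' = base_in_bases[OF C']
  note bc = bases_carrier[OF b] and bc' = bases_carrier[OF b']
  obtain h h' where h: "h \<in> carrier (grp_H m)" "C = Kt_coset (iota_t m h \<otimes>\<^bsub>grp_Gt m\<^esub> base C)"
    and h': "h' \<in> carrier (grp_H m)" "C' = Kt_coset (iota_t m h' \<otimes>\<^bsub>grp_Gt m\<^esub> base C')"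
    using b b' unfolding bases_def by blast
  show "g \<in> Kt_coset (base C') \<longleftrightarrow> (\<exists>h\<in>carrier (grp_H m). C' = Kt_coset (iota_t m h \<otimes>\<^bsub>grp_Gt m\<^esub> base C))"
  proof
    assume g': "g \<in> Kt_coset (base C')"
    have "Kt_coset (base C') = Kt_coset (base C)" using Kt_coset_eqI[OF bc g] Kt_coset_eqI[OF bc' g'] by simp
    then have "Kt_coset (iota_t m h' \<otimes>\<^bsub>grp_Gt m\<^esub> base C') = Kt_coset (iota_t m h' \<otimes>\<^bsub>grp_Gt m\<^esub> base C)"
      unfolding Kt_coset_translate[OF \<iota>.hom_closed[OF h'(1)] bc'] Kt_coset_translate[OF \<iota>.hom_closed[OF h'(1)] bc] by simp
    then show "\<exists>h\<in>carrier (grp_H m). C' = Kt_coset (iota_t m h \<otimes>\<^bsub>grp_Gt m\<^esub> base C)" using h' by blast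
  next
    assume "\<exists>h\<in>carrier (grp_H m). C' = Kt_coset (iota_t m h \<otimes>\<^bsub>grp_Gt m\<^esub> base C)"
    then obtain k where k: "k \<in> carrier (grp_H m)" "C' = Kt_coset (iota_t m k \<otimes>\<^bsub>grp_Gt m\<^esub> base C)" by blast
    have "bases C' = bases C" using bases_eq[OF k(1) h(1) bc] h(2) k(2) by simp
    then have "base C' = base C" by (simp add: base_def)
    then show "g \<in> Kt_coset (base C')" using g by simp
  qed
qed

text \<open>T is commutative, so conjugation leaves the last component unchanged: the group with D
  is normalized by the group with C.\<close>

lemma conj_sub_Lt:
  assumes "\<kappa> \<in> sub_Kt v m" "l \<in> sub_Lt v w m"
  shows "inv\<^bsub>grp_Gt m\<^esub> \<kappa> \<otimes>\<^bsub>grp_Gt m\<^esub> l \<otimes>\<^bsub>grp_Gt m\<^esub> \<kappa> \<in> sub_Lt v w m"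
proof -
  obtain x t where l: "l = (x, t)" "x \<in> sub_K v m" "t \<in> sub_D v w" using assms(2) by (auto simp: sub_Lt_def)
  have "t \<in> int_units v" using l(3) unit_congruent[of 1 t] by (simp add: sub_D_iff int_units_iff)
  then have "l \<in> sub_Kt v m" using l by (simp add: sub_Kt_def)
  then have "inv\<^bsub>grp_Gt m\<^esub> \<kappa> \<otimes>\<^bsub>grp_Gt m\<^esub> l \<otimes>\<^bsub>grp_Gt m\<^esub> \<kappa> \<in> sub_Kt v m"
    using assms(1) subgroup_sub_Kt by (intro subgroup.m_closed[OF subgroup_sub_Kt] subgroup.m_inv_closed[OF subgroup_sub_Kt])
  moreover have "snd (inv\<^bsub>grp_Gt m\<^esub> \<kappa> \<otimes>\<^bsub>grp_Gt m\<^esub> l \<otimes>\<^bsub>grp_Gt m\<^esub> \<kappa>) = t"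
  proof -
    obtain a k s where k: "\<kappa> = ((a, k), s)" by (metis prod.exhaust)
    have "((a, k), s) \<in> carrier (grp_Gt m)" using assms(1) sub_Kt_carrier k by blast
    then show ?thesis by (simp add: k l(1) inv_grp_Gt carrier_grp_Gt)
  qed
  ultimately show ?thesis
    using l(3) by (cases "inv\<^bsub>grp_Gt m\<^esub> \<kappa> \<otimes>\<^bsub>grp_Gt m\<^esub> l \<otimes>\<^bsub>grp_Gt m\<^esub> \<kappa>") (simp add: sub_Kt_def sub_Lt_def)
qed

text \<open>Write g as y times an element of the larger compact group; by \<open>conj_sub_Lt\<close>
  that factor normalizes the smaller group. A subgroup V found at a base point is therefore
  admissible on its entire coset.\<close>

lemma stabilizer_mono:
  assumes y: "y \<in> carrier (grp_Gt m)" and g: "g \<in> Kt_coset y"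
  shows "y <#\<^bsub>grp_Gt m\<^esub> (sub_Lt v w m #>\<^bsub>grp_Gt m\<^esub> inv\<^bsub>grp_Gt m\<^esub> y) \<subseteq> g <#\<^bsub>grp_Gt m\<^esub> (sub_Lt v w m #>\<^bsub>grp_Gt m\<^esub> inv\<^bsub>grp_Gt m\<^esub> g)"
proof
  fix z assume "z \<in> y <#\<^bsub>grp_Gt m\<^esub> (sub_Lt v w m #>\<^bsub>grp_Gt m\<^esub> inv\<^bsub>grp_Gt m\<^esub> y)"
  then obtain l where l: "l \<in> sub_Lt v w m" "z = y \<otimes>\<^bsub>grp_Gt m\<^esub> (l \<otimes>\<^bsub>grp_Gt m\<^esub> inv\<^bsub>grp_Gt m\<^esub> y)"
    by (auto simp: l_coset_def r_coset_def)
  obtain \<kappa> where k: "\<kappa> \<in> sub_Kt v m" "g = y \<otimes>\<^bsub>grp_Gt m\<^esub> \<kappa>" using g by (auto simp: l_coset_def)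
  have kc: "\<kappa> \<in> carrier (grp_Gt m)" using k sub_Kt_carrier by blast
  have lc: "l \<in> carrier (grp_Gt m)"
  proof -
    obtain x t where x: "l = (x, t)" "x \<in> sub_K v m" "t \<in> sub_D v w" using l(1) by (auto simp: sub_Lt_def)
    have "t \<in> int_units v" using x(3) unit_congruent[of 1 t] by (simp add: sub_D_iff int_units_iff)
    then have "l \<in> sub_Kt v m" using x by (simp add: sub_Kt_def)
    then show ?thesis using sub_Kt_carrier by blast
  qed
  have "g \<otimes>\<^bsub>grp_Gt m\<^esub> ((inv\<^bsub>grp_Gt m\<^esub> \<kappa> \<otimes>\<^bsub>grp_Gt m\<^esub> l \<otimes>\<^bsub>grp_Gt m\<^esub> \<kappa>) \<otimes>\<^bsub>grp_Gt m\<^esub> inv\<^bsub>grp_Gt m\<^esub> g) =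
      y \<otimes>\<^bsub>grp_Gt m\<^esub> ((\<kappa> \<otimes>\<^bsub>grp_Gt m\<^esub> inv\<^bsub>grp_Gt m\<^esub> \<kappa>) \<otimes>\<^bsub>grp_Gt m\<^esub> (l \<otimes>\<^bsub>grp_Gt m\<^esub> ((\<kappa> \<otimes>\<^bsub>grp_Gt m\<^esub> inv\<^bsub>grp_Gt m\<^esub> \<kappa>) \<otimes>\<^bsub>grp_Gt m\<^esub> inv\<^bsub>grp_Gt m\<^esub> y)))"
    unfolding k(2) Gt.inv_mult_group[OF y kc] using y kc lc by (simp only: Gt.m_assoc Gt.m_closed Gt.inv_closed)
  also have "\<dots> = z" unfolding l(2) using y kc lc by simp
  finally have "z = g \<otimes>\<^bsub>grp_Gt m\<^esub> ((inv\<^bsub>grp_Gt m\<^esub> \<kappa> \<otimes>\<^bsub>grp_Gt m\<^esub> l \<otimes>\<^bsub>grp_Gt m\<^esub> \<kappa>) \<otimes>\<^bsub>grp_Gt m\<^esub> inv\<^bsub>grp_Gt m\<^esub> g)" ..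
  then show "z \<in> g <#\<^bsub>grp_Gt m\<^esub> (sub_Lt v w m #>\<^bsub>grp_Gt m\<^esub> inv\<^bsub>grp_Gt m\<^esub> g)"
    using Gt.l_coset_memI[OF Gt.r_coset_memI[OF conj_sub_Lt[OF k(1) l(1)]]] by simp
qed

theorem ex_zeta_element:
  fixes \<O> :: "'p::field_char_0 set"
  assumes R: "is_subring \<O>" and Z: "Z_q_inv v \<subseteq> \<O>" and \<mu>: "haar_measure (grp_H m) (top_H v m) \<mu>" and c: "odd c"
  shows "\<exists>\<zeta>. zeta_element v m \<mu> \<O> (1 :: 'p) (hecke_tilde v w m c) (sub_Lt v w m) \<zeta>"
proof -
  have bc: "base C \<in> carrier (grp_Gt m)" if "C \<in> cosets" for C using bases_carrier[OF base_in_bases[OF that]] .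
  have "\<forall>C\<in>cosets. \<exists>h. h \<in> carrier (grp_H m) \<and> Kt_coset (iota_t m h \<otimes>\<^bsub>grp_Gt m\<^esub> base C) = C"
  proof
    fix C assume "C \<in> cosets"
    from base_in_bases[OF this] show "\<exists>h. h \<in> carrier (grp_H m) \<and> Kt_coset (iota_t m h \<otimes>\<^bsub>grp_Gt m\<^esub> base C) = C"
      unfolding bases_def by blast
  qed
  from bchoice[OF this] obtain h where h: "\<And>C. C \<in> cosets \<Longrightarrow> h C \<in> carrier (grp_H m)"
    "\<And>C. C \<in> cosets \<Longrightarrow> Kt_coset (iota_t m (h C) \<otimes>\<^bsub>grp_Gt m\<^esub> base C) = C"
    by blast
  \<comment> \<open>Each coset indicator of the Hecke operator is replaced by the indicator at its
    base point, with the same coefficient.\<close>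
  define \<zeta> where "\<zeta> = (\<lambda>x. \<Sum>C\<in>cosets. (coset_value c C :: 'p) * indicator (Kt_coset (base C)) x)"
  have "\<zeta> \<in> test_functions v m"
    unfolding \<zeta>_def by (rule sum_indicator_test_function[OF finite_cosets bc])
  moreover have "\<zeta> - hecke_tilde v w m c \<in> coinvariant_kernel v m"
  proof -
    have e: "hecke_tilde v w m c = (\<lambda>x. \<Sum>C\<in>cosets. (coset_value c C :: 'p) * indicator (Kt_coset (iota_t m (h C) \<otimes>\<^bsub>grp_Gt m\<^esub> base C)) x)"
      unfolding hecke_tilde_sum[OF c] by (intro ext sum.cong refl) (simp add: h(2))
    show ?thesis
      unfolding e \<zeta>_def by (rule sum_translates_kernel[OF finite_cosets bc h(1)])
  qed
  then have "coinvariant_class v m \<zeta> = coinvariant_class v m (\<lambda>g. hecke_tilde v w m c g * 1)"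
    using coinvariant_class_eqI by simp
  moreover have "\<exists>r V x. (\<forall>i<r::nat. compact_open_subgroup (grp_H m) (top_H v m) (V i) \<and>
      iota_t m ` V i \<subseteq> g <#\<^bsub>grp_Gt m\<^esub> (sub_Lt v w m #>\<^bsub>grp_Gt m\<^esub> inv\<^bsub>grp_Gt m\<^esub> g) \<and> x i \<in> \<O>) \<and>
      \<zeta> g = (\<Sum>i<r. gen_index \<mu> (sub_U v m) (V i) * x i)" if "g \<in> carrier (grp_Gt m)" for g
  proof (cases "\<exists>C\<in>cosets. g \<in> Kt_coset (base C)")
    case False
    then have "\<zeta> g = 0" unfolding \<zeta>_def by (intro sum.neutral) auto
    \<comment> \<open>Away from the base cosets the value is 0, written as the empty sum.\<close>
    then show ?thesis by (intro exI[of _ 0]) simp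
  next
    case True
    then obtain C where C: "C \<in> cosets" "g \<in> Kt_coset (base C)" by blast
    have "base C \<in> base_points m" using base_in_bases[OF C(1)] unfolding bases_def by blast
    then obtain xs t where b: "base C = ((1, tri m (1\<^sub>m m) (mat_diag m xs) (1\<^sub>m m)), t)" "t \<noteq> 0" "\<forall>i<m. xs i = 0 \<or> v (xs i) < 0"
      unfolding base_points_def by blast
    interpret o: orbit v w m xs t \<mu>
      by unfold_locales (use b \<mu> in auto)
    have y0: "o.y0 = base C" by (simp add: o.y0_def o.X_def b(1))
    let ?D = "{C' \<in> cosets. g \<in> Kt_coset (base C')}"
    \<comment> \<open>Among the cosets lying over g, those in the k-th support are the translates of
      the base point by \<open>A k\<close>; this reduces the value at g to the counts
      \<open>cosets_M\<close>.\<close>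
    have D: "{C' \<in> ?D. C' \<subseteq> supp_Gt m k} = (\<lambda>h. Kt_coset (iota_t m h \<otimes>\<^bsub>grp_Gt m\<^esub> base C)) ` o.A k" if "k \<le> 2 * m" for k
    proof -
      have ic: "iota_t m h \<otimes>\<^bsub>grp_Gt m\<^esub> base C \<in> carrier (grp_Gt m)" if "h \<in> carrier (grp_H m)" for h
        using bc[OF C(1)] that by simp
      have iff: "C' \<in> ?D \<longleftrightarrow> C' \<in> cosets \<and> (\<exists>h\<in>carrier (grp_H m). C' = Kt_coset (iota_t m h \<otimes>\<^bsub>grp_Gt m\<^esub> base C))" for C'
        using cosets_over_base[OF C, of C'] by simp
      show ?thesis
      proof (intro subset_antisym subsetI)
        fix C' assume "C' \<in> {C' \<in> ?D. C' \<subseteq> supp_Gt m k}"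
        then have C': "C' \<in> ?D" "C' \<subseteq> supp_Gt m k" by simp_all
        obtain h where h: "h \<in> carrier (grp_H m)" "C' = Kt_coset (iota_t m h \<otimes>\<^bsub>grp_Gt m\<^esub> base C)"
          using C'(1) unfolding iff by blast
        have "h \<in> o.A k" using Kt_coset_subset_supp[OF ic[OF h(1)], of k] C'(2) h by (simp add: o.A_def y0)
        then show "C' \<in> (\<lambda>h. Kt_coset (iota_t m h \<otimes>\<^bsub>grp_Gt m\<^esub> base C)) ` o.A k" unfolding h(2) by (rule imageI)
      next
        fix C' assume "C' \<in> (\<lambda>h. Kt_coset (iota_t m h \<otimes>\<^bsub>grp_Gt m\<^esub> base C)) ` o.A k"
        then obtain h where h: "h \<in> carrier (grp_H m)" "iota_t m h \<otimes>\<^bsub>grp_Gt m\<^esub> base C \<in> supp_Gt m k"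
          "C' = Kt_coset (iota_t m h \<otimes>\<^bsub>grp_Gt m\<^esub> base C)"
          unfolding o.A_def y0 by blast
        have "C' \<in> cosets" unfolding cosets_def support_def h(3) using h(2) that by blast
        then have "C' \<in> ?D" unfolding iff using h(1,3) by blast
        moreover have "C' \<subseteq> supp_Gt m k" using Kt_coset_subset_supp[OF ic[OF h(1)], of k] h(2,3) by simp
        ultimately show "C' \<in> {C' \<in> ?D. C' \<subseteq> supp_Gt m k}" by simp
      qed
    qed
    have "\<zeta> g = (\<Sum>C'\<in>?D. coset_value c C')"
      unfolding \<zeta>_def sum.inter_filter[OF finite_cosets] by (rule sum.cong[OF refl]) (simp add: indicator_def)
    also have "\<dots> = (\<Sum>k\<le>2 * m. \<Sum>C'\<in>?D. if C' \<subseteq> supp_Gt m k then hecke_coeff m c k else 0)"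
      unfolding coset_value_def by (rule sum.swap)
    also have "\<dots> = (\<Sum>k\<le>2 * m. hecke_coeff m c k * of_nat (o.cosets_M k))"
    proof (rule sum.cong[OF refl])
      fix k assume "k \<in> {..2 * m}"
      then have "card {C' \<in> ?D. C' \<subseteq> supp_Gt m k} = o.cosets_M k"
        using D[of k] o.card_orbit_cosets[of k] unfolding y0 by simp
      moreover have "(\<Sum>C'\<in>?D. if C' \<subseteq> supp_Gt m k then hecke_coeff m c k else (0 :: 'p)) = (\<Sum>C'\<in>{C' \<in> ?D. C' \<subseteq> supp_Gt m k}. hecke_coeff m c k)"
        using finite_cosets by (intro sum.inter_filter[symmetric]) simp
      ultimately show "(\<Sum>C'\<in>?D. if C' \<subseteq> supp_Gt m k then hecke_coeff m c k else (0 :: 'p)) = hecke_coeff m c k * of_nat (o.cosets_M k)"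
        by (simp only: sum_constant mult.commute)
    qed
    finally have z: "\<zeta> g = (\<Sum>k\<le>2 * m. hecke_coeff m c k * of_nat (o.cosets_M k))" .
    obtain V x where V': "compact_open_subgroup (grp_H m) (top_H v m) V"
      "iota_t m ` V \<subseteq> o.y0 <#\<^bsub>grp_Gt m\<^esub> (sub_Lt v w m #>\<^bsub>grp_Gt m\<^esub> inv\<^bsub>grp_Gt m\<^esub> o.y0)"
      "x \<in> \<O>" "(\<Sum>k\<le>2 * m. hecke_coeff m c k * of_nat (o.cosets_M k)) = gen_index \<mu> (sub_U v m) V * x"
      by (rule o.orbit_sum[OF R Z, of c])
    note V = V'[unfolded y0, folded z]
    have "iota_t m ` V \<subseteq> g <#\<^bsub>grp_Gt m\<^esub> (sub_Lt v w m #>\<^bsub>grp_Gt m\<^esub> inv\<^bsub>grp_Gt m\<^esub> g)"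
      using V(2) stabilizer_mono[OF bc[OF C(1)] C(2)] by (rule subset_trans)
    then show ?thesis
      using V by (intro exI[of _ 1] exI[of _ "\<lambda>_. V"] exI[of _ "\<lambda>_. x"]) simp
  qed
  ultimately show ?thesis unfolding zeta_element_def by blast
qed

end

theorem theorem7p6p2:
  fixes v :: "'f::field_char_0 \<Rightarrow> int" and w :: 'f and m :: nat
    and \<O> :: "'p::field_char_0 set"
    and \<mu>\<^sub>H :: "('f \<times> 'f mat \<times> 'f mat) measure"
  assumes "local_field v"
    and "uniformizer v w"
    and "m \<ge> 1"
    and "is_subring \<O>" and "Z_q_inv v \<subseteq> \<O>"
    and "haar_measure (grp_H m) (top_H v m) \<mu>\<^sub>H"
  shows "\<forall>c::int. odd c \<longrightarrow>
    (\<exists>\<zeta>. zeta_element v m \<mu>\<^sub>H \<O> (1::'p) (hecke_tilde v w m c) (sub_Lt v w m) \<zeta>)"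
proof (intro allI impI)
  fix c :: int assume c: "odd c"
  interpret local_field v by fact
  interpret hecke_cosets v w m by unfold_locales fact
  show "\<exists>\<zeta>. zeta_element v m \<mu>\<^sub>H \<O> (1::'p) (hecke_tilde v w m c) (sub_Lt v w m) \<zeta>"
    by (rule ex_zeta_element[OF assms(4-6) c])
qed

end
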